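(* Let $X$ be a smooth algebraic variety over $\mathbb{C}$. The complex of coherent sheaves over $S^3X$ $$\mathbb{I}_3^\bullet:\qquad 0\to\mathcal{O}_{S^3X}\xrightarrow{\;r\;}{w_2}_*(\mathcal{O}_{X\times X})\xrightarrow{\;D\;}{w_3}_*(\Omega^1_X)\to0,$$ where $r$ is the restriction and $D$ is given locally by $D(a\otimes b)=2a\,db-b\,da$, is a (right) resolution of the sheaf of invariants $(\mathcal{I}_{\Delta_3})^{\mathfrak{S}_3}$; that is, the sequence $$0\to(\mathcal{I}_{\Delta_3})^{\mathfrak{S}_3}\to\mathcal{O}_{S^3X}\xrightarrow{r}{w_2}_*(\mathcal{O}_{X\times X})\xrightarrow{D}{w_3}_*(\Omega^1_X)\to0$$ is exact.
   Context: $S^3X=X^3/\mathfrak{S}_3$ with quotient map $\pi:X^3\to S^3X$. The big diagonal $\Delta_3\subset X^3$ is the scheme-theoretic union of the pairwise diagonals, $\mathcal{I}_{\Delta_3}=\mathcal{I}_{\Delta_{12}}\cap\mathcal{I}_{\Delta_{13}}\cap\mathcal{I}_{\Delta_{23}}$, and $(\mathcal{I}_{\Delta_3})^{\mathfrak{S}_3}$ denotes $(\pi_*\mathcal{I}_{\Delta_3})^{\mathfrak{S}_3}$, an ideal sheaf of $\mathcal{O}_{S^3X}$. The maps are $w_2:X\times X\to S^3X$, $(x,y)\mapsto 2x+y$, and $w_3:X\to S^3X$, $x\mapsto3x$. The restriction $r$ is the pull-back of functions along $w_2$. "Locally" means over affine open sets of the form $S^3U$, with $U=\mathrm{Spec}\,A\subseteq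 X$ affine open, where sections of ${w_2}_*(\mathcal{O}_{X\times X})$ are $A\otimes_{\mathbb{C}}A$ and sections of ${w_3}_*(\Omega^1_X)$ are $\Omega^1_A$. *)

theory Defs
  imports "HOL-Analysis.Abstract_Topology" "HOL-Algebra.QuotRing" "HOL-Algebra.Ring_Divisibility"
    "HOL-Algebra.Module" "HOL-Library.Multiset" Complex_Main
begin

section \<open>Spaces with functions\<close>

text \<open>
  Varieties over \<open>\<complex>\<close> are taken in the classical sense (Serre): a space of closed points together
  with its sheaf of regular complex-valued functions. A section over an open set \<open>U\<close> is a function
  in \<open>extensional U\<close>, so that sections are equal iff they agree on \<open>U\<close>. The value of \<open>reg X U\<close>
  is only meaningful for open \<open>U\<close>.
\<close>

record 'a fspace =
  zariski :: "'a topology"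
  reg :: "'a set \<Rightarrow> ('a \<Rightarrow> complex) set"

abbreviation points :: "'a fspace \<Rightarrow> 'a set" where
  "points X \<equiv> topspace (zariski X)"

abbreviation openX :: "'a fspace \<Rightarrow> 'a set \<Rightarrow> bool" where
  "openX X U \<equiv> openin (zariski X) U"

definition preim :: "('a \<Rightarrow> 'b) \<Rightarrow> 'a fspace \<Rightarrow> 'b set \<Rightarrow> 'a set" where
  "preim \<phi> X V = {x \<in> points X. \<phi> x \<in> V}"

definition pullback :: "('a \<Rightarrow> 'b) \<Rightarrow> 'a fspace \<Rightarrow> 'b set \<Rightarrow> ('b \<Rightarrow> complex) \<Rightarrow> 'a \<Rightarrow> complex" where
  "pullback \<phi> X V f = (\<lambda>x\<in>preim \<phi> X V. f (\<phi> x))"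

definition sheaf_of_functions :: "'a fspace \<Rightarrow> bool" where
  "sheaf_of_functions X \<longleftrightarrow>
     (\<forall>U. openX X U \<longrightarrow>
        reg X U \<subseteq> extensional U \<and>
        (\<forall>c. (\<lambda>x\<in>U. c) \<in> reg X U) \<and>
        (\<forall>f\<in>reg X U. \<forall>g\<in>reg X U.
           (\<lambda>x\<in>U. f x + g x) \<in> reg X U \<and> (\<lambda>x\<in>U. f x * g x) \<in> reg X U) \<and>
        (\<forall>f\<in>reg X U. \<forall>W. openX X W \<and> W \<subseteq> U \<longrightarrow> restrict f W \<in> reg X W) \<and>
        (\<forall>f\<in>extensional U.
           (\<forall>x\<in>U. \<exists>W. openX X W \<and> x \<in> W \<and> W \<subseteq> U \<and> restrict f W \<in> reg X W) \<longrightarrow> f \<in> reg X U))"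

text \<open>
  The space with functions determined by charts \<open>(U, A)\<close>, where \<open>A\<close> is an algebra of functions on
  \<open>U\<close>: the non-vanishing loci of the elements of the algebras \<open>A\<close> form a basis of the topology, and
  regular functions are locally quotients of elements of \<open>A\<close>.
\<close>

definition fraction_space :: "('a set \<times> ('a \<Rightarrow> complex) set) set \<Rightarrow> 'a fspace" where
  "fraction_space \<A> =
     (let T = topology_generated_by {{x \<in> U. h x \<noteq> 0} | U A h. (U, A) \<in> \<A> \<and> h \<in> A}
      in \<lparr>zariski = T,
          reg = (\<lambda>W. {f \<in> extensional W. \<forall>x\<in>W. \<exists>(U, A)\<in>\<A>. \<exists>g\<in>A. \<exists>h\<in>A. \<exists>N.
                   openin T N \<and> x \<in> N \<and> N \<subseteq> W \<inter> U \<and> (\<forall>y\<in>N. h y \<noteq> 0 \<and> f y = g y / h y)})\<rparr>)"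

definition open_subspace :: "'a fspace \<Rightarrow> 'a set \<Rightarrow> 'a fspace" where
  "open_subspace X U = \<lparr>zariski = subtopology (zariski X) U, reg = reg X\<rparr>"

definition fspace_iso :: "'a fspace \<Rightarrow> 'b fspace \<Rightarrow> ('a \<Rightarrow> 'b) \<Rightarrow> bool" where
  "fspace_iso X Y \<phi> \<longleftrightarrow>
     homeomorphic_map (zariski X) (zariski Y) \<phi> \<and>
     (\<forall>V. openX Y V \<longrightarrow>
        (\<forall>f\<in>extensional V. f \<in> reg Y V \<longleftrightarrow> pullback \<phi> X V f \<in> reg X (preim \<phi> X V)))"


section \<open>Smooth varieties over the complex numbers\<close>

definition affine_space :: "nat \<Rightarrow> (nat \<Rightarrow> complex) set" where
  "affine_space n = {..<n} \<rightarrow>\<^sub>E UNIV"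

inductive_set polyfun :: "nat \<Rightarrow> ((nat \<Rightarrow> complex) \<Rightarrow> complex) set" for n where
  const: "(\<lambda>v. c) \<in> polyfun n"
| coord: "i < n \<Longrightarrow> (\<lambda>v. v i) \<in> polyfun n"
| add: "p \<in> polyfun n \<Longrightarrow> q \<in> polyfun n \<Longrightarrow> (\<lambda>v. p v + q v) \<in> polyfun n"
| mult: "p \<in> polyfun n \<Longrightarrow> q \<in> polyfun n \<Longrightarrow> (\<lambda>v. p v * q v) \<in> polyfun n"

definition algebraic_set :: "nat \<Rightarrow> (nat \<Rightarrow> complex) set \<Rightarrow> bool" where
  "algebraic_set n Z \<longleftrightarrow>
     (\<exists>P \<subseteq> polyfun n. Z = {v \<in> affine_space n. \<forall>p\<in>P. p v = 0})"

definition affine_variety :: "nat \<Rightarrow> (nat \<Rightarrow> complex) set \<Rightarrow> (nat \<Rightarrow> complex) fspace" where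
  "affine_variety n Z = fraction_space {(Z, polyfun n)}"

definition affine_open :: "'a fspace \<Rightarrow> 'a set \<Rightarrow> bool" where
  "affine_open X U \<longleftrightarrow>
     openX X U \<and>
     (\<exists>n Z \<phi>. algebraic_set n Z \<and> fspace_iso (open_subspace X U) (affine_variety n Z) \<phi>)"

definition tensors :: "'a fspace \<Rightarrow> 'b fspace \<Rightarrow> 'a set \<Rightarrow> 'b set \<Rightarrow> ('a \<times> 'b \<Rightarrow> complex) set" where
  "tensors X Y U V =
     {(\<lambda>(x, y). \<Sum>i<n. f i x * g i y) | (n::nat) f g. \<forall>i<n. f i \<in> reg X U \<and> g i \<in> reg Y V}"

definition prod_space :: "'a fspace \<Rightarrow> 'b fspace \<Rightarrow> ('a \<times> 'b) fspace" (infixr \<open>\<times>\<^sub>f\<close> 80) where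
  "X \<times>\<^sub>f Y = fraction_space {(U \<times> V, tensors X Y U V) | U V. openX X U \<and> openX Y V}"

text \<open>A germ at \<open>x\<close> is the set of all functions that agree with a given one near \<open>x\<close>.\<close>

definition germ :: "'a fspace \<Rightarrow> 'a \<Rightarrow> ('a \<Rightarrow> complex) \<Rightarrow> ('a \<Rightarrow> complex) set" where
  "germ X x f = {g. \<exists>W. openX X W \<and> x \<in> W \<and> (\<forall>y\<in>W. g y = f y)}"

definition stalk :: "'a fspace \<Rightarrow> 'a \<Rightarrow> ('a \<Rightarrow> complex) set ring" where
  "stalk X x =
     \<lparr>carrier = {germ X x f | f U. openX X U \<and> x \<in> U \<and> f \<in> reg X U},
      monoid.mult = (\<lambda>G H. \<Union>f\<in>G. \<Union>g\<in>H. germ X x (\<lambda>y. f y * g y)),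
      one = germ X x (\<lambda>y. 1),
      zero = germ X x (\<lambda>y. 0),
      add = (\<lambda>G H. \<Union>f\<in>G. \<Union>g\<in>H. germ X x (\<lambda>y. f y + g y))\<rparr>"

definition prime_chain :: "('r, 'm) ring_scheme \<Rightarrow> nat \<Rightarrow> bool" where
  "prime_chain R d \<longleftrightarrow>
     (\<exists>P. (\<forall>i\<le>d. primeideal (P i) R) \<and> (\<forall>i<d. P i \<subset> P (Suc i)))"

definition has_krull_dim :: "('r, 'm) ring_scheme \<Rightarrow> nat \<Rightarrow> bool" where
  "has_krull_dim R d \<longleftrightarrow> prime_chain R d \<and> \<not> prime_chain R (Suc d)"

definition regular_local_ring :: "('r, 'm) ring_scheme \<Rightarrow> bool" where
  "regular_local_ring R \<longleftrightarrow>
     cring R \<and> noetherian_ring R \<and>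
     (\<exists>\<mm> d S. {I. maximalideal I R} = {\<mm>} \<and> has_krull_dim R d \<and>
        S \<subseteq> carrier R \<and> finite S \<and> card S = d \<and> \<mm> = genideal R S)"

text \<open>
  Varieties are reduced and separated of finite type, but not assumed irreducible. Over \<open>\<complex>\<close>,
  smoothness is regularity of all local rings.
\<close>

definition variety :: "'a fspace \<Rightarrow> bool" where
  "variety X \<longleftrightarrow>
     sheaf_of_functions X \<and>
     (\<exists>\<U>. finite \<U> \<and> (\<forall>U\<in>\<U>. affine_open X U) \<and> \<Union>\<U> = points X) \<and>
     closedin (zariski (X \<times>\<^sub>f X)) {(x, x) | x. x \<in> points X}"

definition smooth_variety :: "'a fspace \<Rightarrow> bool" where
  "smooth_variety X \<longleftrightarrow> variety X \<and> (\<forall>x\<in>points X. regular_local_ring (stalk X x))"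


section \<open>Sheaves of modules\<close>

record ('p, 'r, 's) mod_sheaf =
  sec :: "'p set \<Rightarrow> ('r, 's) module"
  restr :: "'p set \<Rightarrow> 's \<Rightarrow> 's"

definition structure_sheaf ::
  "'a fspace \<Rightarrow> ('a, 'a \<Rightarrow> complex, 'a \<Rightarrow> complex) mod_sheaf" (\<open>\<O>\<close>) where
  "\<O> X =
     \<lparr>sec = (\<lambda>U. \<lparr>carrier = reg X U,
                  monoid.mult = (\<lambda>f g. \<lambda>x\<in>U. f x * g x),
                  one = (\<lambda>x\<in>U. 1),
                  zero = (\<lambda>x\<in>U. 0),
                  add = (\<lambda>f g. \<lambda>x\<in>U. f x + g x),
                  smult = (\<lambda>f g. \<lambda>x\<in>U. f x * g x)\<rparr>),
      restr = (\<lambda>V f. restrict f V)\<rparr>"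

definition module_sheaf :: "'a fspace \<Rightarrow> ('a, 'a \<Rightarrow> complex, 's) mod_sheaf \<Rightarrow> bool" where
  "module_sheaf S F \<longleftrightarrow>
     (\<forall>V. openX S V \<longrightarrow> module (sec (\<O> S) V) (sec F V)) \<and>
     (\<forall>V W. openX S V \<and> openX S W \<and> V \<subseteq> W \<longrightarrow>
        (\<forall>s\<in>carrier (sec F W).
           restr F V s \<in> carrier (sec F V) \<and>
           (\<forall>t\<in>carrier (sec F W).
              restr F V (s \<oplus>\<^bsub>sec F W\<^esub> t) = restr F V s \<oplus>\<^bsub>sec F V\<^esub> restr F V t) \<and>
           (\<forall>f\<in>reg S W.
              restr F V (f \<odot>\<^bsub>sec F W\<^esub> s) = restrict f V \<odot>\<^bsub>sec F V\<^esub> restr F V s) \<and>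
           (\<forall>U. openX S U \<and> U \<subseteq> V \<longrightarrow> restr F U (restr F V s) = restr F U s))) \<and>
     (\<forall>V. openX S V \<longrightarrow> (\<forall>s\<in>carrier (sec F V). restr F V s = s)) \<and>
     (\<forall>\<V> \<sigma>. (\<forall>V\<in>\<V>. openX S V \<and> \<sigma> V \<in> carrier (sec F V)) \<and>
             (\<forall>V\<in>\<V>. \<forall>W\<in>\<V>. restr F (V \<inter> W) (\<sigma> V) = restr F (V \<inter> W) (\<sigma> W)) \<longrightarrow>
        (\<exists>!s. s \<in> carrier (sec F (\<Union>\<V>)) \<and> (\<forall>V\<in>\<V>. restr F V s = \<sigma> V)))"

definition sheaf_hom ::
  "'a fspace \<Rightarrow> ('a, 'a \<Rightarrow> complex, 's) mod_sheaf \<Rightarrow> ('a, 'a \<Rightarrow> complex, 't) mod_sheaf \<Rightarrow>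
     ('a set \<Rightarrow> 's \<Rightarrow> 't) \<Rightarrow> bool" where
  "sheaf_hom S F G \<phi> \<longleftrightarrow>
     (\<forall>V. openX S V \<longrightarrow>
        (\<forall>s\<in>carrier (sec F V).
           \<phi> V s \<in> carrier (sec G V) \<and>
           (\<forall>t\<in>carrier (sec F V). \<phi> V (s \<oplus>\<^bsub>sec F V\<^esub> t) = \<phi> V s \<oplus>\<^bsub>sec G V\<^esub> \<phi> V t) \<and>
           (\<forall>f\<in>reg S V. \<phi> V (f \<odot>\<^bsub>sec F V\<^esub> s) = f \<odot>\<^bsub>sec G V\<^esub> \<phi> V s) \<and>
           (\<forall>W. openX S W \<and> W \<subseteq> V \<longrightarrow> \<phi> W (restr F W s) = restr G W (\<phi> V s))))"

definition sheaf_injective ::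
  "'a fspace \<Rightarrow> ('a, 'a \<Rightarrow> complex, 's) mod_sheaf \<Rightarrow> ('a set \<Rightarrow> 's \<Rightarrow> 't) \<Rightarrow> bool" where
  "sheaf_injective S F \<phi> \<longleftrightarrow> (\<forall>V. openX S V \<longrightarrow> inj_on (\<phi> V) (carrier (sec F V)))"

text \<open>A section lies in the image sheaf iff it lifts locally.\<close>

definition in_image ::
  "'a fspace \<Rightarrow> ('a, 'a \<Rightarrow> complex, 's) mod_sheaf \<Rightarrow> ('a, 'a \<Rightarrow> complex, 't) mod_sheaf \<Rightarrow>
     ('a set \<Rightarrow> 's \<Rightarrow> 't) \<Rightarrow> 'a set \<Rightarrow> 't \<Rightarrow> bool" where
  "in_image S F G \<phi> V t \<longleftrightarrow>
     (\<forall>p\<in>V. \<exists>W. openX S W \<and> p \<in> W \<and> W \<subseteq> V \<and>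
        (\<exists>s\<in>carrier (sec F W). \<phi> W s = restr G W t))"

definition sheaf_surjective ::
  "'a fspace \<Rightarrow> ('a, 'a \<Rightarrow> complex, 's) mod_sheaf \<Rightarrow> ('a, 'a \<Rightarrow> complex, 't) mod_sheaf \<Rightarrow>
     ('a set \<Rightarrow> 's \<Rightarrow> 't) \<Rightarrow> bool" where
  "sheaf_surjective S F G \<phi> \<longleftrightarrow>
     (\<forall>V. openX S V \<longrightarrow> (\<forall>t\<in>carrier (sec G V). in_image S F G \<phi> V t))"

definition sheaf_exact ::
  "'a fspace \<Rightarrow> ('a, 'a \<Rightarrow> complex, 's) mod_sheaf \<Rightarrow> ('a, 'a \<Rightarrow> complex, 't) mod_sheaf \<Rightarrow>
     ('a, 'a \<Rightarrow> complex, 'u) mod_sheaf \<Rightarrow>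
     ('a set \<Rightarrow> 's \<Rightarrow> 't) \<Rightarrow> ('a set \<Rightarrow> 't \<Rightarrow> 'u) \<Rightarrow> bool" where
  "sheaf_exact S F G H \<phi> \<psi> \<longleftrightarrow>
     (\<forall>V. openX S V \<longrightarrow>
        (\<forall>t\<in>carrier (sec G V). \<psi> V t = \<zero>\<^bsub>sec H V\<^esub> \<longleftrightarrow> in_image S F G \<phi> V t))"

text \<open>The sequence \<open>0 \<rightarrow> I \<rightarrow> F \<rightarrow> G \<rightarrow> H \<rightarrow> 0\<close>, with maps \<open>\<iota>\<close>, \<open>\<phi>\<close>, \<open>\<psi>\<close>, is an exact sequence of
  sheaves of modules.\<close>

definition exact_sequence ::
  "'a fspace \<Rightarrow> ('a, 'a \<Rightarrow> complex, 'i) mod_sheaf \<Rightarrow> ('a, 'a \<Rightarrow> complex, 's) mod_sheaf \<Rightarrow>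
     ('a, 'a \<Rightarrow> complex, 't) mod_sheaf \<Rightarrow> ('a, 'a \<Rightarrow> complex, 'u) mod_sheaf \<Rightarrow>
     ('a set \<Rightarrow> 'i \<Rightarrow> 's) \<Rightarrow> ('a set \<Rightarrow> 's \<Rightarrow> 't) \<Rightarrow> ('a set \<Rightarrow> 't \<Rightarrow> 'u) \<Rightarrow> bool" where
  "exact_sequence S I F G H \<iota> \<phi> \<psi> \<longleftrightarrow>
     module_sheaf S I \<and> module_sheaf S F \<and> module_sheaf S G \<and> module_sheaf S H \<and>
     sheaf_hom S I F \<iota> \<and> sheaf_hom S F G \<phi> \<and> sheaf_hom S G H \<psi> \<and>
     sheaf_injective S I \<iota> \<and>
     sheaf_exact S I F G \<iota> \<phi> \<and>
     sheaf_exact S F G H \<phi> \<psi> \<and>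
     sheaf_surjective S G H \<psi>"

definition pushforward ::
  "('a \<Rightarrow> 'b) \<Rightarrow> 'a fspace \<Rightarrow> ('a, 'a \<Rightarrow> complex, 's) mod_sheaf \<Rightarrow> ('b, 'b \<Rightarrow> complex, 's) mod_sheaf"
where
  "pushforward \<phi> Y F =
     \<lparr>sec = (\<lambda>V. let M = sec F (preim \<phi> Y V) in
               \<lparr>carrier = carrier M, monoid.mult = monoid.mult M, one = one M,
                zero = zero M, add = add M,
                smult = (\<lambda>f s. smult M (pullback \<phi> Y V f) s)\<rparr>),
      restr = (\<lambda>V. restr F (preim \<phi> Y V))\<rparr>"


section \<open>Kaehler differentials\<close>

text \<open>
  For a commutative ring \<open>R\<close> and a subring of constants \<open>K\<close>, the module of differentials is the
  free \<open>R\<close>-module on symbols \<open>d b\<close> (\<open>b \<in> carrier R\<close>; elements are finitely supported functions)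
  modulo additivity, the Leibniz rule and \<open>d c = 0\<close> for \<open>c \<in> K\<close>.
\<close>

definition diff_free :: "('r, 'm) ring_scheme \<Rightarrow> ('r, 'r \<Rightarrow> 'r) module" where
  "diff_free R =
     \<lparr>carrier = {m \<in> carrier R \<rightarrow>\<^sub>E carrier R. finite {b \<in> carrier R. m b \<noteq> \<zero>\<^bsub>R\<^esub>}},
      monoid.mult = undefined, one = undefined,
      zero = (\<lambda>b\<in>carrier R. \<zero>\<^bsub>R\<^esub>),
      add = (\<lambda>m n. \<lambda>b\<in>carrier R. m b \<oplus>\<^bsub>R\<^esub> n b),
      smult = (\<lambda>a m. \<lambda>b\<in>carrier R. a \<otimes>\<^bsub>R\<^esub> m b)\<rparr>"

definition diff_symbol :: "('r, 'm) ring_scheme \<Rightarrow> 'r \<Rightarrow> 'r \<Rightarrow> 'r" where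
  "diff_symbol R b = (\<lambda>c\<in>carrier R. if c = b then \<one>\<^bsub>R\<^esub> else \<zero>\<^bsub>R\<^esub>)"

definition diff_relations :: "('r, 'm) ring_scheme \<Rightarrow> 'r set \<Rightarrow> ('r \<Rightarrow> 'r) set" where
  "diff_relations R K =
     (let F = diff_free R; \<delta> = diff_symbol R in
        {\<delta> (a \<oplus>\<^bsub>R\<^esub> b) \<ominus>\<^bsub>F\<^esub> (\<delta> a \<oplus>\<^bsub>F\<^esub> \<delta> b) | a b. a \<in> carrier R \<and> b \<in> carrier R} \<union>
        {\<delta> (a \<otimes>\<^bsub>R\<^esub> b) \<ominus>\<^bsub>F\<^esub> (a \<odot>\<^bsub>F\<^esub> \<delta> b \<oplus>\<^bsub>F\<^esub> b \<odot>\<^bsub>F\<^esub> \<delta> a) | a b. a \<in> carrier R \<and> b \<in> carrier R} \<union>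
        \<delta> ` K)"

definition diff_kernel :: "('r, 'm) ring_scheme \<Rightarrow> 'r set \<Rightarrow> ('r \<Rightarrow> 'r) set" where
  "diff_kernel R K = \<Inter>{N. submodule N R (diff_free R) \<and> diff_relations R K \<subseteq> N}"

definition kaehler :: "('r, 'm) ring_scheme \<Rightarrow> 'r set \<Rightarrow> ('r, ('r \<Rightarrow> 'r) set) module" where
  "kaehler R K =
     (let F = diff_free R; N = diff_kernel R K in
        \<lparr>carrier = A_RCOSETS F N,
         monoid.mult = undefined, one = undefined,
         zero = N,
         add = set_add F,
         smult = (\<lambda>a C. \<Union>m\<in>C. a_r_coset F N (a \<odot>\<^bsub>F\<^esub> m))\<rparr>)"

definition univ_deriv :: "('r, 'm) ring_scheme \<Rightarrow> 'r set \<Rightarrow> 'r \<Rightarrow> ('r \<Rightarrow> 'r) set" where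
  "univ_deriv R K b = a_r_coset (diff_free R) (diff_kernel R K) (diff_symbol R b)"

type_synonym 'a cotangent = "(('a \<Rightarrow> complex) set \<Rightarrow> ('a \<Rightarrow> complex) set) set"

definition const_germs :: "'a fspace \<Rightarrow> 'a \<Rightarrow> ('a \<Rightarrow> complex) set set" where
  "const_germs X x = {germ X x (\<lambda>y. c) | c. True}"

definition Omega_stalk :: "'a fspace \<Rightarrow> 'a \<Rightarrow> (('a \<Rightarrow> complex) set, 'a cotangent) module" where
  "Omega_stalk X x = kaehler (stalk X x) (const_germs X x)"

text \<open>The germ of \<open>a db\<close> at \<open>x\<close>.\<close>

definition form_germ :: "'a fspace \<Rightarrow> ('a \<Rightarrow> complex) \<Rightarrow> ('a \<Rightarrow> complex) \<Rightarrow> 'a \<Rightarrow> 'a cotangent" where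
  "form_germ X a b x =
     germ X x a \<odot>\<^bsub>Omega_stalk X x\<^esub> univ_deriv (stalk X x) (const_germs X x) (germ X x b)"

text \<open>
  \<open>\<Omega>\<^sup>1\<close> as the sheaf whose sections are the families of elements of the stalks (the differentials
  of the local rings) that are locally given by finite sums \<open>\<Sum> a\<^sub>i db\<^sub>i\<close> with regular \<open>a\<^sub>i, b\<^sub>i\<close>.
\<close>

definition Omega :: "'a fspace \<Rightarrow> ('a, 'a \<Rightarrow> complex, 'a \<Rightarrow> 'a cotangent) mod_sheaf" where
  "Omega X =
     \<lparr>sec = (\<lambda>U.
        \<lparr>carrier = {\<omega> \<in> (\<Pi>\<^sub>E x\<in>U. carrier (Omega_stalk X x)).
            \<forall>x\<in>U. \<exists>W. openX X W \<and> x \<in> W \<and> W \<subseteq> U \<and>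
              (\<exists>(n::nat) a b. (\<forall>i<n. a i \<in> reg X W \<and> b i \<in> reg X W) \<and>
                 (\<forall>y\<in>W. \<omega> y = (\<Oplus>\<^bsub>Omega_stalk X y\<^esub>i\<in>{..<n}. form_germ X (a i) (b i) y)))},
         monoid.mult = undefined, one = undefined,
         zero = (\<lambda>x\<in>U. \<zero>\<^bsub>Omega_stalk X x\<^esub>),
         add = (\<lambda>\<omega> \<eta>. \<lambda>x\<in>U. \<omega> x \<oplus>\<^bsub>Omega_stalk X x\<^esub> \<eta> x),
         smult = (\<lambda>f \<omega>. \<lambda>x\<in>U. germ X x f \<odot>\<^bsub>Omega_stalk X x\<^esub> \<omega> x)\<rparr>),
      restr = (\<lambda>V \<omega>. restrict \<omega> V)\<rparr>"


section \<open>The symmetric cube\<close>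

definition quotient_fspace :: "'a fspace \<Rightarrow> ('a \<Rightarrow> 'b) \<Rightarrow> 'b fspace" where
  "quotient_fspace Y q =
     \<lparr>zariski = topology (\<lambda>V. V \<subseteq> q ` points Y \<and> openX Y (preim q Y V)),
      reg = (\<lambda>V. {f \<in> extensional V. pullback q Y V f \<in> reg Y (preim q Y V)})\<rparr>"

lemma openX_quotient_fspace:
  "openX (quotient_fspace Y q) V \<longleftrightarrow> V \<subseteq> q ` points Y \<and> openX Y (preim q Y V)"
proof -
  have 1: "preim q Y (S \<inter> T) = preim q Y S \<inter> preim q Y T" for S T
    by (auto simp: preim_def)
  have 2: "preim q Y (\<Union>\<K>) = \<Union>(preim q Y ` \<K>)" for \<K>
    by (auto simp: preim_def)
  have "istopology (\<lambda>V. V \<subseteq> q ` points Y \<and> openX Y (preim q Y V))"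
    unfolding istopology_def by (auto simp: 1 2)
  then show ?thesis
    by (simp add: quotient_fspace_def topology_inverse')
qed

text \<open>
  \<open>S\<^sup>3X = X\<^sup>3/\<SS>\<^sub>3\<close>: the orbit of \<open>(x, y, z)\<close> is the multiset \<open>{#x, y, z#}\<close>, i.e. the zero-cycle
  \<open>x + y + z\<close>. The functions on \<open>V\<close> are the \<open>\<SS>\<^sub>3\<close>-invariant regular functions on \<open>\<pi>\<^sup>-\<^sup>1(V)\<close>,
  an invariant function being written uniquely as \<open>f \<circ> \<pi>\<close> and represented by \<open>f\<close>.
\<close>

definition cycle3 :: "'a \<times> 'a \<times> 'a \<Rightarrow> 'a multiset" where
  "cycle3 = (\<lambda>(x, y, z). {#x, y, z#})"

definition cube :: "'a fspace \<Rightarrow> ('a \<times> 'a \<times> 'a) fspace" where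
  "cube X = X \<times>\<^sub>f X \<times>\<^sub>f X"

definition sym3 :: "'a fspace \<Rightarrow> 'a multiset fspace" where
  "sym3 X = quotient_fspace (cube X) cycle3"

definition sym3_set :: "'a set \<Rightarrow> 'a multiset set" where
  "sym3_set U = {M. size M = 3 \<and> set_mset M \<subseteq> U}"

definition w2 :: "'a \<times> 'a \<Rightarrow> 'a multiset" where
  "w2 = (\<lambda>(x, y). {#x, x, y#})"

definition w3 :: "'a \<Rightarrow> 'a multiset" where
  "w3 x = {#x, x, x#}"

text \<open>The pairwise diagonals are reduced, so their ideals consist of the functions vanishing on them.\<close>

definition vanishing_ideal :: "'a fspace \<Rightarrow> 'a set \<Rightarrow> 'a set \<Rightarrow> ('a \<Rightarrow> complex) set" where
  "vanishing_ideal Y C W = {h \<in> reg Y W. \<forall>p\<in>W \<inter> C. h p = 0}"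

definition big_diagonal_ideal ::
  "'a fspace \<Rightarrow> ('a \<times> 'a \<times> 'a) set \<Rightarrow> ('a \<times> 'a \<times> 'a \<Rightarrow> complex) set" where
  "big_diagonal_ideal X W =
     vanishing_ideal (cube X) {(x, y, z). x = y} W \<inter>
     vanishing_ideal (cube X) {(x, y, z). x = z} W \<inter>
     vanishing_ideal (cube X) {(x, y, z). y = z} W"

text \<open>
  The sheaf \<open>(\<pi>\<^sub>*I)\<^sup>\<SS>\<^sup>3\<close> of invariants of the ideal \<open>I\<close> of the big diagonal, as an ideal sheaf of
  \<open>\<O> (sym3 X)\<close>: again an invariant section \<open>f \<circ> \<pi>\<close> of \<open>I\<close> is represented by \<open>f\<close>.
\<close>

definition invariant_ideal ::
  "'a fspace \<Rightarrow> ('a multiset, 'a multiset \<Rightarrow> complex, 'a multiset \<Rightarrow> complex) mod_sheaf" where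
  "invariant_ideal X =
     \<lparr>sec = (\<lambda>V. (sec (\<O> (sym3 X)) V)
                \<lparr>carrier := {f \<in> reg (sym3 X) V.
                    pullback cycle3 (cube X) V f \<in> big_diagonal_ideal X (preim cycle3 (cube X) V)}\<rparr>),
      restr = restr (\<O> (sym3 X))\<rparr>"

definition w2_pushforward ::
  "'a fspace \<Rightarrow> ('a multiset, 'a multiset \<Rightarrow> complex, 'a \<times> 'a \<Rightarrow> complex) mod_sheaf" where
  "w2_pushforward X = pushforward w2 (X \<times>\<^sub>f X) (\<O> (X \<times>\<^sub>f X))"

definition w3_pushforward ::
  "'a fspace \<Rightarrow> ('a multiset, 'a multiset \<Rightarrow> complex, 'a \<Rightarrow> 'a cotangent) mod_sheaf" where
  "w3_pushforward X = pushforward w3 X (Omega X)"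

definition restriction_map ::
  "'a fspace \<Rightarrow> 'a multiset set \<Rightarrow> ('a multiset \<Rightarrow> complex) \<Rightarrow> 'a \<times> 'a \<Rightarrow> complex" where
  "restriction_map X V f = pullback w2 (X \<times>\<^sub>f X) V f"

text \<open>
  \<open>D\<close> is the morphism of sheaves of modules given by \<open>a \<otimes> b \<mapsto> 2a db - b da\<close> over every \<open>S\<^sup>3U\<close>
  with \<open>U\<close> affine; here \<open>w\<^sub>2\<^sup>-\<^sup>1(S\<^sup>3U) = U \<times> U\<close> and \<open>w\<^sub>3\<^sup>-\<^sup>1(S\<^sup>3U) = U\<close>.
\<close>

definition locally_given_D ::
  "'a fspace \<Rightarrow> ('a multiset set \<Rightarrow> ('a \<times> 'a \<Rightarrow> complex) \<Rightarrow> 'a \<Rightarrow> 'a cotangent) \<Rightarrow> bool" where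
  "locally_given_D X D \<longleftrightarrow>
     sheaf_hom (sym3 X) (w2_pushforward X) (w3_pushforward X) D \<and>
     (\<forall>U. affine_open X U \<longrightarrow> (\<forall>a\<in>reg X U. \<forall>b\<in>reg X U.
        D (sym3_set U) (\<lambda>(x, y)\<in>U \<times> U. a x * b y) =
        (\<lambda>x\<in>U. form_germ X (\<lambda>y. 2 * a y) b x \<ominus>\<^bsub>Omega_stalk X x\<^esub> form_germ X b a x)))"

end

theory Submission
  imports Defs "HOL-Library.Function_Algebras"
begin

text \<open>Exactness is checked at stalks. The maps \<open>a \<mapsto> (a, - da)\<close> and \<open>b \<mapsto> (b, 2 db)\<close> into the square-zero
  extension of \<open>O\<close> by \<open>\<Omega>\<^sup>1\<close> combine to a ring homomorphism on tensors \<open>a \<otimes> b\<close> whose second component is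
  \<open>D\<close>. Tensors embed into the functions on \<open>X \<times> X\<close> and functions that do not vanish on the diagonal
  become units, so \<open>D\<close> extends uniquely to fractions, that is, to all functions near the diagonal.

  Near \<open>3x\<close> the cokernel of \<open>r\<close> is identified with \<open>\<Omega>\<^sup>1\<close>: the assignment \<open>a db \<mapsto> (a \<otimes> b - ab \<otimes> 1) / 3\<close>
  is well defined modulo restrictions of symmetric functions and inverse to \<open>D\<close>. Near \<open>2x + y\<close> with
  \<open>x \<noteq> y\<close> the sheaf of differentials vanishes, and \<open>r\<close> is surjective: choose \<open>a\<close> with \<open>a(x) \<noteq> a(y)\<close> and
  symmetrize functions multiplied by \<open>(a(u) - a(v))\<^sup>2\<close>. A symmetric function restricts to zero along \<open>w2\<close>
  iff it vanishes on the big diagonal.\<close>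

text \<open>\<open>D\<close> kills restrictions of symmetric functions because the symmetrization of
  a \<otimes> b \<otimes> c restricts to a multiple of ab \<otimes> c + ac \<otimes> b + bc
  \<otimes> a, and the forms 2ab dc - c d(ab), 2ac db - b d(ac), 2bc da - a d(bc) add up to zero.
  The third comes from D(a \<otimes> b - ab \<otimes> 1) = 2a db - b da + d(ab) = 3a db. The
  obstacle is that a function on X \<times> X is only locally a fraction of tensors, on
  neighbourhoods that need not be products, and that its denominator is not symmetric. Denominators
  are therefore cleared: identities h t = g are made to hold on a whole product U \<times> U by
  putting into both sides a factor that vanishes where the fraction is not controlled, and h is
  replaced by a symmetric multiple, over which \<open>D\<close> is linear. The same reduction shows
  that every \<open>D\<close> with the prescribed values on tensors is the one constructed here.
  That any three points lie in a common affine open set supplies the functions that separate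
  them.\<close>

definition fun_alg :: "('a \<Rightarrow> complex) set \<Rightarrow> bool" where
  "fun_alg F \<longleftrightarrow> (\<forall>c. (\<lambda>x. c) \<in> F) \<and>
     (\<forall>f\<in>F. \<forall>g\<in>F. (\<lambda>x. f x + g x) \<in> F \<and> (\<lambda>x. f x * g x) \<in> F)"

lemma fun_algD:
  assumes "fun_alg F"
  shows fun_alg_const: "(\<lambda>x. c) \<in> F"
    and fun_alg_add: "f \<in> F \<Longrightarrow> g \<in> F \<Longrightarrow> (\<lambda>x. f x + g x) \<in> F"
    and fun_alg_mult: "f \<in> F \<Longrightarrow> g \<in> F \<Longrightarrow> (\<lambda>x. f x * g x) \<in> F"
  using assms by (auto simp: fun_alg_def)

lemma fun_alg_scale: "fun_alg F \<Longrightarrow> f \<in> F \<Longrightarrow> (\<lambda>x. c * f x) \<in> F"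
  using fun_alg_mult[of F "\<lambda>x. c" f] fun_alg_const[of F c] by simp

lemma fun_alg_uminus: "fun_alg F \<Longrightarrow> f \<in> F \<Longrightarrow> (\<lambda>x. - f x) \<in> F"
  using fun_alg_scale[of F f "-1"] by simp

lemma fun_alg_diff: "fun_alg F \<Longrightarrow> f \<in> F \<Longrightarrow> g \<in> F \<Longrightarrow> (\<lambda>x. f x - g x) \<in> F"
  using fun_alg_add[of F f "\<lambda>x. - g x"] fun_alg_uminus[of F g] by simp

text \<open>Tensors are handled through lists of pairs because \<open>D\<close> is first computed on
  such a representative and only afterwards seen to depend on the function \<open>eval2 ts\<close>
  alone.\<close>

definition eval2 :: "(('a \<Rightarrow> complex) \<times> ('b \<Rightarrow> complex)) list \<Rightarrow> 'a \<times> 'b \<Rightarrow> complex" where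
  "eval2 ts = (\<lambda>(x, y). \<Sum>(a, b)\<leftarrow>ts. a x * b y)"

lemma eval2_simps [simp]:
  "eval2 [] (x, y) = 0"
  "eval2 ((a, b) # ts) (x, y) = a x * b y + eval2 ts (x, y)"
  "eval2 (ts @ us) (x, y) = eval2 ts (x, y) + eval2 us (x, y)"
  by (auto simp: eval2_def)

text \<open>A product on representatives: maps defined on lists can be shown multiplicative before
  they are known to depend only on the represented function.\<close>

definition mul2 :: "(('a \<Rightarrow> complex) \<times> ('b \<Rightarrow> complex)) list \<Rightarrow>
    (('a \<Rightarrow> complex) \<times> ('b \<Rightarrow> complex)) list \<Rightarrow> (('a \<Rightarrow> complex) \<times> ('b \<Rightarrow> complex)) list" where
  "mul2 ts us = concat (map (\<lambda>(a, b). map (\<lambda>(c, d). (\<lambda>x. a x * c x, \<lambda>y. b y * d y)) us) ts)"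

lemma eval2_mul2_single:
  "eval2 (map (\<lambda>(c, d). (\<lambda>x. a x * c x, \<lambda>y. b y * d y)) us) (x, y) = a x * b y * eval2 us (x, y)"
  by (induction us) (auto simp: algebra_simps)

lemma eval2_mul2: "eval2 (mul2 ts us) (x, y) = eval2 ts (x, y) * eval2 us (x, y)"
  by (induction ts) (auto simp: mul2_def eval2_mul2_single algebra_simps)

definition ten2 :: "('a \<Rightarrow> complex) set \<Rightarrow> ('b \<Rightarrow> complex) set \<Rightarrow> ('a \<times> 'b \<Rightarrow> complex) set" where
  "ten2 F G = {eval2 ts | ts. set ts \<subseteq> F \<times> G}"

lemma ten2_single: "a \<in> F \<Longrightarrow> b \<in> G \<Longrightarrow> (\<lambda>(x, y). a x * b y) \<in> ten2 F G"
  unfolding ten2_def by (auto intro!: exI[of _ "[(a, b)]"])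

lemma ten2_fst: "fun_alg G \<Longrightarrow> a \<in> F \<Longrightarrow> (\<lambda>(x, y). a x) \<in> ten2 F G"
  using ten2_single[of a F "\<lambda>y. 1" G] fun_alg_const[of G 1] by simp

lemma ten2_snd: "fun_alg F \<Longrightarrow> b \<in> G \<Longrightarrow> (\<lambda>(x, y). b y) \<in> ten2 F G"
  using ten2_single[of "\<lambda>x. 1" F b G] fun_alg_const[of F 1] by simp

lemma ten2_fun_alg:
  assumes "fun_alg F" "fun_alg G"
  shows "fun_alg (ten2 F G)"
  unfolding fun_alg_def
proof (intro conjI allI ballI)
  fix c
  show "(\<lambda>x. c) \<in> ten2 F G"
    using ten2_single[OF fun_alg_const[OF assms(1), of c] fun_alg_const[OF assms(2), of 1]]
    by (simp add: case_prod_unfold)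
next
  fix f g assume "f \<in> ten2 F G" "g \<in> ten2 F G"
  then obtain ts us where ts: "f = eval2 ts" "g = eval2 us" "set ts \<subseteq> F \<times> G" "set us \<subseteq> F \<times> G"
    unfolding ten2_def by blast
  have 1: "(\<lambda>p. f p + g p) = eval2 (ts @ us)" "set (ts @ us) \<subseteq> F \<times> G" using ts by auto
  show "(\<lambda>p. f p + g p) \<in> ten2 F G" unfolding ten2_def using 1 by blast
  have 2: "(\<lambda>p. f p * g p) = eval2 (mul2 ts us)" using ts by (auto simp: eval2_mul2)
  have 3: "set (mul2 ts us) \<subseteq> F \<times> G"
  proof
    fix t assume "t \<in> set (mul2 ts us)"
    then obtain a b c d where t: "(a, b) \<in> set ts" "(c, d) \<in> set us" "t = (\<lambda>x. a x * c x, \<lambda>y. b y * d y)"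
      by (auto simp: mul2_def)
    then have "a \<in> F" "b \<in> G" "c \<in> F" "d \<in> G" using ts by auto
    then have "(\<lambda>x. a x * c x) \<in> F" "(\<lambda>y. b y * d y) \<in> G"
      by (simp_all add: fun_alg_mult[OF assms(1)] fun_alg_mult[OF assms(2)])
    then show "t \<in> F \<times> G" using t by simp
  qed
  show "(\<lambda>p. f p * g p) \<in> ten2 F G" unfolding ten2_def using 2 3 by blast
qed

text \<open>Reduces a statement that is closed under sums to elementary tensors, without choosing a
  list.\<close>

lemma ten2_induct [consumes 1, case_names zero add]:
  assumes "f \<in> ten2 F G"
    and "P (\<lambda>p. 0)"
    and "\<And>a b g. a \<in> F \<Longrightarrow> b \<in> G \<Longrightarrow> g \<in> ten2 F G \<Longrightarrow> P g \<Longrightarrow> P (\<lambda>(x, y). a x * b y + g (x, y))"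
  shows "P f"
proof -
  obtain ts where ts: "f = eval2 ts" "set ts \<subseteq> F \<times> G" using assms(1) unfolding ten2_def by blast
  have "P (eval2 ts)" using ts(2)
  proof (induction ts)
    case Nil
    have "eval2 [] = (\<lambda>p::'a \<times> 'b. 0)" by auto
    then show ?case using assms(2) by metis
  next
    case (Cons t ts)
    obtain a b where t: "t = (a, b)" by (cases t)
    have "eval2 (t # ts) = (\<lambda>(x, y). a x * b y + eval2 ts (x, y))" by (auto simp: t)
    moreover have "eval2 ts \<in> ten2 F G" using Cons unfolding ten2_def by auto
    ultimately show ?case using assms(3)[of a b "eval2 ts"] Cons t by auto
  qed
  then show ?thesis using ts by simp
qed

text \<open>Only the values on the chart matter. The algebra of a chart may consist of functions
  with fixed junk values outside \<open>U\<close>, as \<open>tensors\<close> does, and is then not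
  closed under the pointwise operations; its saturation is.\<close>

definition agreeing :: "'a set \<Rightarrow> ('a \<Rightarrow> complex) set \<Rightarrow> ('a \<Rightarrow> complex) set" where
  "agreeing U A = {f. \<exists>h\<in>A. \<forall>x\<in>U. f x = h x}"

lemma agreeing_superset: "A \<subseteq> agreeing U A"
proof
  fix f assume "f \<in> A"
  then show "f \<in> agreeing U A" unfolding agreeing_def by (intro CollectI bexI[of _ f]) auto
qed

lemma fun_alg_agreeing: "fun_alg A \<Longrightarrow> fun_alg (agreeing U A)"
  unfolding fun_alg_def[of "agreeing U A"]
proof (intro conjI allI ballI)
  assume A: "fun_alg A"
  fix c show "(\<lambda>x. c) \<in> agreeing U A"
    unfolding agreeing_def mem_Collect_eq by (rule bexI[OF _ fun_alg_const[OF A, of c]]) simp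
next
  assume A: "fun_alg A"
  fix f g assume "f \<in> agreeing U A" "g \<in> agreeing U A"
  then obtain f' g' where fg: "f' \<in> A" "g' \<in> A" "\<forall>x\<in>U. f x = f' x" "\<forall>x\<in>U. g x = g' x"
    unfolding agreeing_def by blast
  show "(\<lambda>x. f x + g x) \<in> agreeing U A" unfolding agreeing_def mem_Collect_eq
    by (rule bexI[OF _ fun_alg_add[OF A fg(1,2)]]) (use fg in auto)
  show "(\<lambda>x. f x * g x) \<in> agreeing U A" unfolding agreeing_def mem_Collect_eq
    by (rule bexI[OF _ fun_alg_mult[OF A fg(1,2)]]) (use fg in auto)
qed

section \<open>Spaces of functions\<close>

lemma sheaf_of_functionsD:
  assumes "sheaf_of_functions X" "openX X U"
  shows reg_extensional: "f \<in> reg X U \<Longrightarrow> f \<in> extensional U"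
    and reg_const: "(\<lambda>x\<in>U. c) \<in> reg X U"
    and reg_add: "f \<in> reg X U \<Longrightarrow> g \<in> reg X U \<Longrightarrow> (\<lambda>x\<in>U. f x + g x) \<in> reg X U"
    and reg_mult: "f \<in> reg X U \<Longrightarrow> g \<in> reg X U \<Longrightarrow> (\<lambda>x\<in>U. f x * g x) \<in> reg X U"
    and reg_restrict: "f \<in> reg X U \<Longrightarrow> openX X W \<Longrightarrow> W \<subseteq> U \<Longrightarrow> restrict f W \<in> reg X W"
    and reg_local: "f \<in> extensional U \<Longrightarrow>
      (\<And>x. x \<in> U \<Longrightarrow> \<exists>W. openX X W \<and> x \<in> W \<and> W \<subseteq> U \<and> restrict f W \<in> reg X W) \<Longrightarrow> f \<in> reg X U"
proof -
  have *: "reg X U \<subseteq> extensional U \<and>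
        (\<forall>c. (\<lambda>x\<in>U. c) \<in> reg X U) \<and>
        (\<forall>f\<in>reg X U. \<forall>g\<in>reg X U.
           (\<lambda>x\<in>U. f x + g x) \<in> reg X U \<and> (\<lambda>x\<in>U. f x * g x) \<in> reg X U) \<and>
        (\<forall>f\<in>reg X U. \<forall>W. openX X W \<and> W \<subseteq> U \<longrightarrow> restrict f W \<in> reg X W) \<and>
        (\<forall>f\<in>extensional U.
           (\<forall>x\<in>U. \<exists>W. openX X W \<and> x \<in> W \<and> W \<subseteq> U \<and> restrict f W \<in> reg X W) \<longrightarrow> f \<in> reg X U)"
    using assms unfolding sheaf_of_functions_def by simp
  show "f \<in> extensional U" if "f \<in> reg X U"
    using *[THEN conjunct1] that by (rule subsetD)
  show "(\<lambda>x\<in>U. c) \<in> reg X U"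
    by (rule *[THEN conjunct2, THEN conjunct1, rule_format])
  show "(\<lambda>x\<in>U. f x + g x) \<in> reg X U" if "f \<in> reg X U" "g \<in> reg X U"
    using *[THEN conjunct2, THEN conjunct2, THEN conjunct1] that by simp
  show "(\<lambda>x\<in>U. f x * g x) \<in> reg X U" if "f \<in> reg X U" "g \<in> reg X U"
    using *[THEN conjunct2, THEN conjunct2, THEN conjunct1] that by simp
  show "restrict f W \<in> reg X W" if "f \<in> reg X U" "openX X W" "W \<subseteq> U"
    using *[THEN conjunct2, THEN conjunct2, THEN conjunct2, THEN conjunct1] that by simp
  show "f \<in> reg X U" if "f \<in> extensional U"
      "\<And>x. x \<in> U \<Longrightarrow> \<exists>W. openX X W \<and> x \<in> W \<and> W \<subseteq> U \<and> restrict f W \<in> reg X W"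
    using *[THEN conjunct2, THEN conjunct2, THEN conjunct2, THEN conjunct2] that by simp
qed

text \<open>Functions on the whole type whose restriction to \<open>U\<close> is regular; unlike \<^const>\<open>reg\<close>, this set
  is closed under the pointwise operations of HOL.\<close>

definition regs :: "'a fspace \<Rightarrow> 'a set \<Rightarrow> ('a \<Rightarrow> complex) set" where
  "regs X U = {f. restrict f U \<in> reg X U}"

lemma reg_regs:
  assumes "sheaf_of_functions X" "openX X U"
  shows "f \<in> reg X U \<longleftrightarrow> f \<in> extensional U \<and> f \<in> regs X U"
proof
  assume f: "f \<in> reg X U"
  then have "f \<in> extensional U" using reg_extensional assms by blast
  moreover from this have "restrict f U = f" by (rule extensional_restrict)
  ultimately show "f \<in> extensional U \<and> f \<in> regs X U" using f by (simp add: regs_def)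
next
  assume "f \<in> extensional U \<and> f \<in> regs X U"
  then show "f \<in> reg X U" using extensional_restrict[of f U] by (auto simp: regs_def)
qed

lemma restrict_reg_iff: "restrict f U \<in> reg X U \<longleftrightarrow> f \<in> regs X U"
  by (simp add: regs_def)

lemma regs_cong: "f \<in> regs X U \<Longrightarrow> (\<And>x. x \<in> U \<Longrightarrow> f x = g x) \<Longrightarrow> g \<in> regs X U"
  unfolding regs_def using restrict_ext[of U f g] by simp

lemma fun_alg_regs:
  assumes "sheaf_of_functions X" "openX X U"
  shows "fun_alg (regs X U)"
  unfolding fun_alg_def
proof (intro conjI allI ballI)
  fix c show "(\<lambda>x. c) \<in> regs X U" using reg_const[OF assms] by (simp add: regs_def)
next
  fix f g assume fg: "f \<in> regs X U" "g \<in> regs X U"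
  have "(\<lambda>x\<in>U. restrict f U x + restrict g U x) = restrict (\<lambda>x. f x + g x) U"
    by (intro ext) (simp add: restrict_def)
  with reg_add[OF assms, of "restrict f U" "restrict g U"] fg
  show "(\<lambda>x. f x + g x) \<in> regs X U" unfolding regs_def by simp
  have "(\<lambda>x\<in>U. restrict f U x * restrict g U x) = restrict (\<lambda>x. f x * g x) U"
    by (intro ext) (simp add: restrict_def)
  with reg_mult[OF assms, of "restrict f U" "restrict g U"] fg
  show "(\<lambda>x. f x * g x) \<in> regs X U" unfolding regs_def by simp
qed

lemma regs_subset:
  assumes "sheaf_of_functions X" "openX X U" "openX X W" "W \<subseteq> U" "f \<in> regs X U"
  shows "f \<in> regs X W"
proof -
  have "restrict (restrict f U) W \<in> reg X W" using reg_restrict assms unfolding regs_def by blast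
  moreover have "restrict (restrict f U) W = restrict f W" using assms(4) by (intro ext) (auto simp: restrict_def)
  ultimately show ?thesis by (simp add: regs_def)
qed

lemma regs_local:
  assumes "sheaf_of_functions X" "openX X U"
    and "\<And>x. x \<in> U \<Longrightarrow> \<exists>W. openX X W \<and> x \<in> W \<and> f \<in> regs X W"
  shows "f \<in> regs X U"
  unfolding regs_def mem_Collect_eq
proof (rule reg_local[OF assms(1,2)])
  fix x assume x: "x \<in> U"
  then obtain W where W: "openX X W" "x \<in> W" "f \<in> regs X W" using assms(3) by blast
  have o: "openX X (W \<inter> U)" using W assms(2) by auto
  have "f \<in> regs X (W \<inter> U)" by (rule regs_subset[OF assms(1) W(1) o _ W(3)]) auto
  moreover have "restrict (restrict f U) (W \<inter> U) = restrict f (W \<inter> U)" by (auto simp: restrict_def)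
  ultimately show "\<exists>W. openX X W \<and> x \<in> W \<and> W \<subseteq> U \<and> restrict (restrict f U) W \<in> reg X W"
    using o x W(2) by (intro exI[of _ "W \<inter> U"]) (auto simp: regs_def)
qed simp

text \<open>These two properties say that a function with a non-zero value stays non-zero nearby and
  is invertible there, so that its germ is a unit. \<open>sheaf_of_functions\<close> does not give
  them, since it does not relate values to the topology.\<close>

definition function_space :: "'a fspace \<Rightarrow> bool" where
  "function_space X \<longleftrightarrow> sheaf_of_functions X \<and>
     (\<forall>U f. openX X U \<and> f \<in> regs X U \<longrightarrow>
        openX X {x \<in> U. f x \<noteq> 0} \<and> (\<lambda>x. 1 / f x) \<in> regs X {x \<in> U. f x \<noteq> 0})"

lemma function_spaceD:
  assumes "function_space X"
  shows function_space_sheaf: "sheaf_of_functions X"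
    and function_space_open: "openX X U \<Longrightarrow> f \<in> regs X U \<Longrightarrow> openX X {x \<in> U. f x \<noteq> 0}"
    and function_space_inverse: "openX X U \<Longrightarrow> f \<in> regs X U \<Longrightarrow> (\<lambda>x. 1 / f x) \<in> regs X {x \<in> U. f x \<noteq> 0}"
  using assms by (auto simp: function_space_def)

lemma regs_divide:
  assumes X: "function_space X" and U: "openX X U" and f: "f \<in> regs X U" and g: "g \<in> regs X U"
    and W: "openX X W" "W \<subseteq> U" "\<And>x. x \<in> W \<Longrightarrow> g x \<noteq> 0"
  shows "(\<lambda>x. f x / g x) \<in> regs X W"
proof -
  note S = function_space_sheaf[OF X]
  have "(\<lambda>x. 1 / g x) \<in> regs X W"
    by (rule regs_subset[OF S function_space_open[OF X U g] W(1) _ function_space_inverse[OF X U g]])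
       (use W in auto)
  from fun_alg_mult[OF fun_alg_regs[OF S W(1)] regs_subset[OF S U W(1,2) f] this]
  show ?thesis by simp
qed

section \<open>Spaces given by charts, with fractions as regular functions\<close>

definition chart_system :: "('a set \<times> ('a \<Rightarrow> complex) set) set \<Rightarrow> bool" where
  "chart_system \<A> \<longleftrightarrow>
     (\<forall>(U, A)\<in>\<A>. fun_alg (agreeing U A)) \<and>
     (\<forall>(U, A)\<in>\<A>. \<forall>(V, B)\<in>\<A>. \<exists>C. (U \<inter> V, C) \<in> \<A> \<and> A \<union> B \<subseteq> agreeing (U \<inter> V) C)"

context
  fixes \<A> :: "('a set \<times> ('a \<Rightarrow> complex) set) set"
  assumes charts: "chart_system \<A>"
begin

lemma charts_alg: "(U, A) \<in> \<A> \<Longrightarrow> fun_alg (agreeing U A)"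
  using charts by (auto simp: chart_system_def)

text \<open>Functions from different charts can be compared on one chart. This makes the
  non-vanishing loci a basis of the topology and gives any two fractions at a point a common
  chart.\<close>

lemma charts_Int:
  assumes "(U, A) \<in> \<A>" "(V, B) \<in> \<A>"
  obtains C where "(U \<inter> V, C) \<in> \<A>" "agreeing U A \<subseteq> agreeing (U \<inter> V) C" "agreeing V B \<subseteq> agreeing (U \<inter> V) C"
proof -
  obtain C where C: "(U \<inter> V, C) \<in> \<A>" "A \<union> B \<subseteq> agreeing (U \<inter> V) C"
    using charts assms by (fastforce simp: chart_system_def)
  have "agreeing U A \<subseteq> agreeing (U \<inter> V) C" "agreeing V B \<subseteq> agreeing (U \<inter> V) C"
    using C(2) unfolding agreeing_def by fastforce+
  then show ?thesis using that C by blast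
qed

lemma zariski_fraction_space:
  "zariski (fraction_space \<A>) =
     topology_generated_by {{x \<in> U. h x \<noteq> 0} | U A h. (U, A) \<in> \<A> \<and> h \<in> A}"
  by (simp add: fraction_space_def Let_def)

lemma openX_basic:
  assumes "(U, A) \<in> \<A>" "h \<in> agreeing U A"
  shows "openX (fraction_space \<A>) {x \<in> U. h x \<noteq> 0}"
proof -
  obtain k where k: "k \<in> A" "\<And>x. x \<in> U \<Longrightarrow> h x = k x" using assms by (auto simp: agreeing_def)
  have "{x \<in> U. h x \<noteq> 0} = {x \<in> U. k x \<noteq> 0}" using k by auto
  then show ?thesis unfolding zariski_fraction_space
    using assms k by (auto intro!: topology_generated_by_Basis)
qed

text \<open>The non-vanishing loci of k and l meet in that of k l over the intersection of the
  charts, so finite intersections of basic sets are again basic.\<close>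

lemma openX_fraction_space:
  "openX (fraction_space \<A>) N \<longleftrightarrow>
     (\<forall>x\<in>N. \<exists>U A k. (U, A) \<in> \<A> \<and> k \<in> agreeing U A \<and> x \<in> U \<and> k x \<noteq> 0 \<and> {y \<in> U. k y \<noteq> 0} \<subseteq> N)"
    (is "?L \<longleftrightarrow> ?R N")
proof
  assume ?L
  then have "generate_topology_on {{x \<in> U. h x \<noteq> 0} | U A h. (U, A) \<in> \<A> \<and> h \<in> A} N"
    unfolding zariski_fraction_space by (rule openin_topology_generated_by)
  then show "?R N"
  proof induction
    case Empty then show ?case by simp
  next
    case (Int a b)
    show ?case
    proof
      fix x assume x: "x \<in> a \<inter> b"
      obtain U A k where 1: "(U, A) \<in> \<A>" "k \<in> agreeing U A" "x \<in> U" "k x \<noteq> 0" "{y \<in> U. k y \<noteq> 0} \<subseteq> a"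
        using Int x by blast
      obtain V B l where 2: "(V, B) \<in> \<A>" "l \<in> agreeing V B" "x \<in> V" "l x \<noteq> 0" "{y \<in> V. l y \<noteq> 0} \<subseteq> b"
        using Int x by blast
      obtain C where C: "(U \<inter> V, C) \<in> \<A>" "agreeing U A \<subseteq> agreeing (U \<inter> V) C" "agreeing V B \<subseteq> agreeing (U \<inter> V) C"
        using charts_Int[OF 1(1) 2(1)] by blast
      have "(\<lambda>x. k x * l x) \<in> agreeing (U \<inter> V) C"
        by (rule fun_alg_mult[OF charts_alg[OF C(1)]]) (use 1 2 C in auto)
      then show "\<exists>U A k. (U, A) \<in> \<A> \<and> k \<in> agreeing U A \<and> x \<in> U \<and> k x \<noteq> 0 \<and> {y \<in> U. k y \<noteq> 0} \<subseteq> a \<inter> b"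
        using C 1 2 by (intro exI[of _ "U \<inter> V"] exI[of _ C] exI[of _ "\<lambda>x. k x * l x"]) auto
    qed
  next
    case (UN K) then show ?case by (meson UnionE Union_upper order_trans)
  next
    case (Basis s)
    then obtain U A h where "s = {x \<in> U. h x \<noteq> 0}" "(U, A) \<in> \<A>" "h \<in> A" by blast
    then show ?case using agreeing_superset[of A U] by auto
  qed
next
  assume R: "?R N"
  show ?L
  proof (subst openin_subopen, intro ballI)
    fix x assume "x \<in> N"
    then obtain U A k where "(U, A) \<in> \<A>" "k \<in> agreeing U A" "x \<in> U" "k x \<noteq> 0" "{y \<in> U. k y \<noteq> 0} \<subseteq> N"
      using R by blast
    then show "\<exists>T. openX (fraction_space \<A>) T \<and> x \<in> T \<and> T \<subseteq> N"
      using openX_basic[of U A k] by blast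
  qed
qed

lemma openX_chart: "(U, A) \<in> \<A> \<Longrightarrow> openX (fraction_space \<A>) U"
  using openX_basic[of U A "\<lambda>x. 1"] fun_alg_const[OF charts_alg] by simp

lemma points_fraction_space: "points (fraction_space \<A>) = \<Union>(fst ` \<A>)"
proof
  show "points (fraction_space \<A>) \<subseteq> \<Union>(fst ` \<A>)"
    using openin_topspace[of "zariski (fraction_space \<A>)"]
    unfolding openX_fraction_space by force
  show "\<Union>(fst ` \<A>) \<subseteq> points (fraction_space \<A>)"
    using openX_chart openin_subset by fastforce
qed

text \<open>The neighbourhood \<open>N\<close> of the definition disappears into the denominator: if
  the non-vanishing locus of k lies in \<open>N\<close>, then numerator and denominator multiplied
  by k form a fraction that is valid wherever its denominator is non-zero.\<close>

lemma regs_fraction_space: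
  "f \<in> regs (fraction_space \<A>) W \<longleftrightarrow>
     (\<forall>x\<in>W. \<exists>U A g h. (U, A) \<in> \<A> \<and> g \<in> agreeing U A \<and> h \<in> agreeing U A \<and> x \<in> U \<and> h x \<noteq> 0 \<and>
        (\<forall>y\<in>U. h y \<noteq> 0 \<longrightarrow> y \<in> W \<and> f y = g y / h y))"
  (is "_ \<longleftrightarrow> ?R")
proof
  assume f: "f \<in> regs (fraction_space \<A>) W"
  show ?R
  proof
    fix x assume x: "x \<in> W"
    have "\<exists>(U, A)\<in>\<A>. \<exists>g\<in>A. \<exists>h\<in>A. \<exists>N. openX (fraction_space \<A>) N \<and> x \<in> N \<and> N \<subseteq> W \<inter> U \<and>
             (\<forall>y\<in>N. h y \<noteq> 0 \<and> restrict f W y = g y / h y)"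
      using f x unfolding regs_def zariski_fraction_space
      by (simp add: fraction_space_def Let_def)
    then obtain U A g h N where 1: "(U, A) \<in> \<A>" "g \<in> A" "h \<in> A" "openX (fraction_space \<A>) N" "x \<in> N"
        "N \<subseteq> W \<inter> U" "\<And>y. y \<in> N \<Longrightarrow> h y \<noteq> 0 \<and> restrict f W y = g y / h y" by blast
    obtain V B k where 2: "(V, B) \<in> \<A>" "k \<in> agreeing V B" "x \<in> V" "k x \<noteq> 0" "{y \<in> V. k y \<noteq> 0} \<subseteq> N"
      using 1(4,5) unfolding openX_fraction_space by blast
    obtain C where C: "(U \<inter> V, C) \<in> \<A>" "agreeing U A \<subseteq> agreeing (U \<inter> V) C" "agreeing V B \<subseteq> agreeing (U \<inter> V) C"
      using charts_Int[OF 1(1) 2(1)] by blast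
    have gh: "g \<in> agreeing (U \<inter> V) C" "h \<in> agreeing (U \<inter> V) C" "k \<in> agreeing (U \<inter> V) C"
      using C 1 2 agreeing_superset[of A U] by auto
    have m: "(\<lambda>x. g x * k x) \<in> agreeing (U \<inter> V) C" "(\<lambda>x. h x * k x) \<in> agreeing (U \<inter> V) C"
      by (rule fun_alg_mult[OF charts_alg[OF C(1)]]; use gh in simp)+
    have "x \<in> U \<inter> V" "h x * k x \<noteq> 0" using 1 2 by auto
    moreover have "y \<in> W \<and> f y = g y * k y / (h y * k y)" if "y \<in> U \<inter> V" "h y * k y \<noteq> 0" for y
    proof -
      have "y \<in> N" using that 2 by auto
      then show ?thesis using 1(6) 1(7)[of y] that by auto
    qed
    ultimately show "\<exists>U A g h. (U, A) \<in> \<A> \<and> g \<in> agreeing U A \<and> h \<in> agreeing U A \<and> x \<in> U \<and> h x \<noteq> 0 \<and>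
        (\<forall>y\<in>U. h y \<noteq> 0 \<longrightarrow> y \<in> W \<and> f y = g y / h y)"
      using C m by blast
  qed
next
  assume R: ?R
  have "\<exists>(U, A)\<in>\<A>. \<exists>g\<in>A. \<exists>h\<in>A. \<exists>N. openX (fraction_space \<A>) N \<and> x \<in> N \<and> N \<subseteq> W \<inter> U \<and>
             (\<forall>y\<in>N. h y \<noteq> 0 \<and> restrict f W y = g y / h y)" if x: "x \<in> W" for x
  proof -
    obtain U A g h where 1: "(U, A) \<in> \<A>" "g \<in> agreeing U A" "h \<in> agreeing U A" "x \<in> U" "h x \<noteq> 0"
        "\<forall>y\<in>U. h y \<noteq> 0 \<longrightarrow> y \<in> W \<and> f y = g y / h y" using R x by blast
    obtain g' h' where 2: "g' \<in> A" "h' \<in> A" "\<And>y. y \<in> U \<Longrightarrow> g y = g' y \<and> h y = h' y"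
      using 1(2,3) unfolding agreeing_def by auto
    have "\<forall>y\<in>{y \<in> U. h y \<noteq> 0}. h' y \<noteq> 0 \<and> restrict f W y = g' y / h' y"
      using 1(6) 2(3) by auto
    moreover have "openX (fraction_space \<A>) {y \<in> U. h y \<noteq> 0}" "x \<in> {y \<in> U. h y \<noteq> 0}"
      "{y \<in> U. h y \<noteq> 0} \<subseteq> W \<inter> U"
      using 1 openX_basic[OF 1(1,3)] by auto
    ultimately have "\<exists>N. openX (fraction_space \<A>) N \<and> x \<in> N \<and> N \<subseteq> W \<inter> U \<and>
             (\<forall>y\<in>N. h' y \<noteq> 0 \<and> restrict f W y = g' y / h' y)" by blast
    with 2(1,2) have "\<exists>g\<in>A. \<exists>h\<in>A. \<exists>N. openX (fraction_space \<A>) N \<and> x \<in> N \<and> N \<subseteq> W \<inter> U \<and>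
             (\<forall>y\<in>N. h y \<noteq> 0 \<and> restrict f W y = g y / h y)" by blast
    then show ?thesis by (intro bexI[OF _ 1(1)]) (unfold prod.case)
  qed
  then show "f \<in> regs (fraction_space \<A>) W"
    unfolding regs_def zariski_fraction_space
    by (simp add: fraction_space_def Let_def)
qed

lemma reg_fraction_space_extensional: "f \<in> reg (fraction_space \<A>) W \<Longrightarrow> f \<in> extensional W"
  by (simp add: fraction_space_def Let_def)

lemma agreeing_regs: "(U, A) \<in> \<A> \<Longrightarrow> h \<in> agreeing U A \<Longrightarrow> h \<in> regs (fraction_space \<A>) U"
  unfolding regs_fraction_space
  by (intro ballI exI[of _ U] exI[of _ A] exI[of _ h] exI[of _ "\<lambda>x. 1"])
     (auto intro: fun_alg_const[OF charts_alg])

lemma common_fraction: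
  assumes "f \<in> regs (fraction_space \<A>) W" "f' \<in> regs (fraction_space \<A>) W" "x \<in> W"
  obtains U A g h g' h' where "(U, A) \<in> \<A>" "g \<in> agreeing U A" "h \<in> agreeing U A" "g' \<in> agreeing U A" "h' \<in> agreeing U A"
    "x \<in> U" "h x \<noteq> 0" "h' x \<noteq> 0" "\<And>y. y \<in> U \<Longrightarrow> h y \<noteq> 0 \<Longrightarrow> y \<in> W \<and> f y = g y / h y"
    "\<And>y. y \<in> U \<Longrightarrow> h' y \<noteq> 0 \<Longrightarrow> y \<in> W \<and> f' y = g' y / h' y"
proof -
  obtain U A g h where 1: "(U, A) \<in> \<A>" "g \<in> agreeing U A" "h \<in> agreeing U A" "x \<in> U" "h x \<noteq> 0"
        "\<forall>y\<in>U. h y \<noteq> 0 \<longrightarrow> y \<in> W \<and> f y = g y / h y"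
    using assms(1,3) unfolding regs_fraction_space by blast
  obtain V B g' h' where 2: "(V, B) \<in> \<A>" "g' \<in> agreeing V B" "h' \<in> agreeing V B" "x \<in> V" "h' x \<noteq> 0"
        "\<forall>y\<in>V. h' y \<noteq> 0 \<longrightarrow> y \<in> W \<and> f' y = g' y / h' y"
    using assms(2,3) unfolding regs_fraction_space by blast
  obtain C where C: "(U \<inter> V, C) \<in> \<A>" "agreeing U A \<subseteq> agreeing (U \<inter> V) C" "agreeing V B \<subseteq> agreeing (U \<inter> V) C"
    using charts_Int[OF 1(1) 2(1)] by blast
  show ?thesis by (rule that[of "U \<inter> V" C g h g' h']) (use 1 2 C in auto)
qed

lemma function_space_fraction_space: "function_space (fraction_space \<A>)"
proof -
  let ?S = "fraction_space \<A>"
  have restr: "f \<in> regs ?S W" if f: "f \<in> regs ?S U" and W: "openX ?S W" "W \<subseteq> U" for f U W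
    unfolding regs_fraction_space
  proof
    fix x assume x: "x \<in> W"
    obtain U' A g h where 1: "(U', A) \<in> \<A>" "g \<in> agreeing U' A" "h \<in> agreeing U' A" "x \<in> U'" "h x \<noteq> 0"
        "\<forall>y\<in>U'. h y \<noteq> 0 \<longrightarrow> y \<in> U \<and> f y = g y / h y"
      using f x W(2) unfolding regs_fraction_space by blast
    obtain V B k where 2: "(V, B) \<in> \<A>" "k \<in> agreeing V B" "x \<in> V" "k x \<noteq> 0" "{y \<in> V. k y \<noteq> 0} \<subseteq> W"
      using x W(1) unfolding openX_fraction_space by blast
    obtain C where C: "(U' \<inter> V, C) \<in> \<A>" "agreeing U' A \<subseteq> agreeing (U' \<inter> V) C" "agreeing V B \<subseteq> agreeing (U' \<inter> V) C"
      using charts_Int[OF 1(1) 2(1)] by blast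
    have m: "(\<lambda>x. g x * k x) \<in> agreeing (U' \<inter> V) C" "(\<lambda>x. h x * k x) \<in> agreeing (U' \<inter> V) C"
      by (rule fun_alg_mult[OF charts_alg[OF C(1)]]; use 1 2 C in blast)+
    show "\<exists>U A g h. (U, A) \<in> \<A> \<and> g \<in> agreeing U A \<and> h \<in> agreeing U A \<and> x \<in> U \<and> h x \<noteq> 0 \<and>
        (\<forall>y\<in>U. h y \<noteq> 0 \<longrightarrow> y \<in> W \<and> f y = g y / h y)"
      by (intro exI[of _ "U' \<inter> V"] exI[of _ C] exI[of _ "\<lambda>x. g x * k x"] exI[of _ "\<lambda>x. h x * k x"])
         (use 1 2 C m in auto)
  qed
  have sh: "sheaf_of_functions ?S"
    unfolding sheaf_of_functions_def
  proof (intro allI impI conjI ballI)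
    fix U assume U: "openX ?S U"
    have U': "\<exists>V A. (V, A) \<in> \<A> \<and> x \<in> V" if "x \<in> U" for x
      using U that unfolding openX_fraction_space by blast
    show "reg ?S U \<subseteq> extensional U" using reg_fraction_space_extensional by blast
    fix c
    have const: "(\<lambda>x. c) \<in> regs ?S (points ?S)" for c :: complex
      unfolding regs_fraction_space points_fraction_space
    proof
      fix x assume "x \<in> \<Union>(fst ` \<A>)"
      then obtain V A where V: "(V, A) \<in> \<A>" "x \<in> V" by auto
      then show "\<exists>U A g h. (U, A) \<in> \<A> \<and> g \<in> agreeing U A \<and> h \<in> agreeing U A \<and> x \<in> U \<and> h x \<noteq> 0 \<and>
        (\<forall>y\<in>U. h y \<noteq> 0 \<longrightarrow> y \<in> \<Union>(fst ` \<A>) \<and> c = g y / h y)"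
        by (intro exI[of _ V] exI[of _ A] exI[of _ "\<lambda>x. c"] exI[of _ "\<lambda>x. 1"])
           (auto intro: fun_alg_const[OF charts_alg] rev_bexI)
    qed
    show "(\<lambda>x\<in>U. c) \<in> reg ?S U"
      using restr[OF const U openin_subset[OF U]] by (simp add: regs_def)
  next
    fix U f g assume U: "openX ?S U" and fg: "f \<in> reg ?S U" "g \<in> reg ?S U"
    then have fg': "f \<in> regs ?S U" "g \<in> regs ?S U"
      using reg_fraction_space_extensional by (auto simp: regs_def extensional_restrict)
    have "(\<lambda>x. f x + g x) \<in> regs ?S U \<and> (\<lambda>x. f x * g x) \<in> regs ?S U"
    proof (unfold regs_fraction_space, intro conjI; intro ballI)
      fix x assume x: "x \<in> U"
      obtain V A g1 h1 g2 h2 where 1: "(V, A) \<in> \<A>" "g1 \<in> agreeing V A" "h1 \<in> agreeing V A" "g2 \<in> agreeing V A" "h2 \<in> agreeing V A"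
        "x \<in> V" "h1 x \<noteq> 0" "h2 x \<noteq> 0" "\<And>y. y \<in> V \<Longrightarrow> h1 y \<noteq> 0 \<Longrightarrow> y \<in> U \<and> f y = g1 y / h1 y"
        "\<And>y. y \<in> V \<Longrightarrow> h2 y \<noteq> 0 \<Longrightarrow> y \<in> U \<and> g y = g2 y / h2 y"
        by (rule common_fraction[OF fg' x], rule that) assumption+
      note m = fun_alg_mult[OF charts_alg[OF 1(1)]] and a = fun_alg_add[OF charts_alg[OF 1(1)]]
      have 2: "(\<lambda>x. g1 x * h2 x + g2 x * h1 x) \<in> agreeing V A" "(\<lambda>x. g1 x * g2 x) \<in> agreeing V A"
        "(\<lambda>x. h1 x * h2 x) \<in> agreeing V A"
        by (rule a m; (rule m)?; use 1 in simp)+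
      show "\<exists>U' A k h. (U', A) \<in> \<A> \<and> k \<in> agreeing U' A \<and> h \<in> agreeing U' A \<and> x \<in> U' \<and> h x \<noteq> 0 \<and>
        (\<forall>y\<in>U'. h y \<noteq> 0 \<longrightarrow> y \<in> U \<and> f y + g y = k y / h y)"
        by (intro exI[of _ V] exI[of _ A] exI[of _ "\<lambda>x. g1 x * h2 x + g2 x * h1 x"] exI[of _ "\<lambda>x. h1 x * h2 x"])
           (use 1 2 in \<open>auto simp: field_simps\<close>)
      show "\<exists>U' A k h. (U', A) \<in> \<A> \<and> k \<in> agreeing U' A \<and> h \<in> agreeing U' A \<and> x \<in> U' \<and> h x \<noteq> 0 \<and>
        (\<forall>y\<in>U'. h y \<noteq> 0 \<longrightarrow> y \<in> U \<and> f y * g y = k y / h y)"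
        by (intro exI[of _ V] exI[of _ A] exI[of _ "\<lambda>x. g1 x * g2 x"] exI[of _ "\<lambda>x. h1 x * h2 x"])
           (use 1 2 in \<open>auto simp: field_simps\<close>)
    qed
    then show "(\<lambda>x\<in>U. f x + g x) \<in> reg ?S U" "(\<lambda>x\<in>U. f x * g x) \<in> reg ?S U"
      by (auto simp: regs_def)
  next
    fix U f W assume "openX ?S U" "f \<in> reg ?S U" "openX ?S W \<and> W \<subseteq> U"
    then show "restrict f W \<in> reg ?S W"
      using restr[of f U W] reg_fraction_space_extensional by (auto simp: regs_def extensional_restrict)
  next
    fix U f assume U: "openX ?S U" and f: "f \<in> extensional U"
      and l: "\<forall>x\<in>U. \<exists>W. openX ?S W \<and> x \<in> W \<and> W \<subseteq> U \<and> restrict f W \<in> reg ?S W"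
    have "f \<in> regs ?S U"
      unfolding regs_fraction_space
    proof
      fix x assume "x \<in> U"
      then obtain W where W: "openX ?S W" "x \<in> W" "W \<subseteq> U" "f \<in> regs ?S W"
        using l by (auto simp: regs_def)
      then obtain V A g h where "(V, A) \<in> \<A>" "g \<in> agreeing V A" "h \<in> agreeing V A" "x \<in> V" "h x \<noteq> 0"
        "\<forall>y\<in>V. h y \<noteq> 0 \<longrightarrow> y \<in> W \<and> f y = g y / h y"
        unfolding regs_fraction_space by blast
      then show "\<exists>V A g h. (V, A) \<in> \<A> \<and> g \<in> agreeing V A \<and> h \<in> agreeing V A \<and> x \<in> V \<and> h x \<noteq> 0 \<and>
        (\<forall>y\<in>V. h y \<noteq> 0 \<longrightarrow> y \<in> U \<and> f y = g y / h y)" using W(3) by blast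
    qed
    then show "f \<in> reg ?S U" using f by (simp add: regs_def extensional_restrict)
  qed
  have inv: "openX ?S {x \<in> U. f x \<noteq> 0} \<and> (\<lambda>x. 1 / f x) \<in> regs ?S {x \<in> U. f x \<noteq> 0}"
    if U: "openX ?S U" and f: "f \<in> regs ?S U" for U f
  proof -
    have *: "\<exists>V A g h. (V, A) \<in> \<A> \<and> g \<in> agreeing V A \<and> h \<in> agreeing V A \<and> x \<in> V \<and> h x * g x \<noteq> 0 \<and>
        (\<forall>y\<in>V. h y * g y \<noteq> 0 \<longrightarrow> y \<in> U \<and> f y \<noteq> 0 \<and> 1 / f y = h y / g y)"
      if x: "x \<in> U" "f x \<noteq> 0" for x
    proof -
      obtain V A g h where "(V, A) \<in> \<A>" "g \<in> agreeing V A" "h \<in> agreeing V A" "x \<in> V" "h x \<noteq> 0"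
        "\<forall>y\<in>V. h y \<noteq> 0 \<longrightarrow> y \<in> U \<and> f y = g y / h y"
        using f x unfolding regs_fraction_space by blast
      then show ?thesis using x(2) by (intro exI[of _ V] exI[of _ A] exI[of _ g] exI[of _ h]) auto
    qed
    have "openX ?S {x \<in> U. f x \<noteq> 0}"
      unfolding openX_fraction_space
    proof
      fix x assume "x \<in> {x \<in> U. f x \<noteq> 0}"
      then obtain V A g h where 1: "(V, A) \<in> \<A>" "g \<in> agreeing V A" "h \<in> agreeing V A" "x \<in> V" "h x * g x \<noteq> 0"
        "\<forall>y\<in>V. h y * g y \<noteq> 0 \<longrightarrow> y \<in> U \<and> f y \<noteq> 0 \<and> 1 / f y = h y / g y" using * by blast
      then have "(\<lambda>x. h x * g x) \<in> agreeing V A" by (intro fun_alg_mult[OF charts_alg])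
      then show "\<exists>V A k. (V, A) \<in> \<A> \<and> k \<in> agreeing V A \<and> x \<in> V \<and> k x \<noteq> 0 \<and> {y \<in> V. k y \<noteq> 0} \<subseteq> {x \<in> U. f x \<noteq> 0}"
        using 1 by blast
    qed
    moreover have "(\<lambda>x. 1 / f x) \<in> regs ?S {x \<in> U. f x \<noteq> 0}"
      unfolding regs_fraction_space
    proof
      fix x assume "x \<in> {x \<in> U. f x \<noteq> 0}"
      then obtain V A g h where 1: "(V, A) \<in> \<A>" "g \<in> agreeing V A" "h \<in> agreeing V A" "x \<in> V" "h x * g x \<noteq> 0"
        "\<forall>y\<in>V. h y * g y \<noteq> 0 \<longrightarrow> y \<in> U \<and> f y \<noteq> 0 \<and> 1 / f y = h y / g y" using * by blast
      \<comment> \<open>The inverse of g / h is written as h h / (h g), because h / g would be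
        controlled only where h is non-zero as well.\<close>
      have 2: "(\<lambda>x. h x * h x) \<in> agreeing V A" "(\<lambda>x. h x * g x) \<in> agreeing V A"
        using 1 by (auto intro: fun_alg_mult[OF charts_alg])
      show "\<exists>V A k l. (V, A) \<in> \<A> \<and> k \<in> agreeing V A \<and> l \<in> agreeing V A \<and> x \<in> V \<and> l x \<noteq> 0 \<and>
        (\<forall>y\<in>V. l y \<noteq> 0 \<longrightarrow> y \<in> {x \<in> U. f x \<noteq> 0} \<and> 1 / f y = k y / l y)"
        by (intro exI[of _ V] exI[of _ A] exI[of _ "\<lambda>x. h x * h x"] exI[of _ "\<lambda>x. h x * g x"])
           (use 1 2 in auto)
    qed
    ultimately show ?thesis ..
  qed
  show ?thesis using sh inv by (auto simp: function_space_def)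
qed

end

section \<open>Products of spaces with functions\<close>

lemma ten2_mono: "F \<subseteq> F' \<Longrightarrow> G \<subseteq> G' \<Longrightarrow> ten2 F G \<subseteq> ten2 F' G'"
  unfolding ten2_def by blast

lemma eval2_nth: "eval2 ts (x, y) = (\<Sum>i<length ts. fst (ts ! i) x * snd (ts ! i) y)"
  by (simp add: eval2_def sum_list_sum_nth case_prod_unfold atLeast0LessThan)

lemma tensors_subset_ten2:
  assumes "sheaf_of_functions X" "sheaf_of_functions Y" "openX X U" "openX Y V"
  shows "tensors X Y U V \<subseteq> ten2 (regs X U) (regs Y V)"
proof
  fix t assume "t \<in> tensors X Y U V"
  then obtain n f g where t: "t = (\<lambda>(x, y). \<Sum>i<(n::nat). f i x * g i y)"
    "\<forall>i<n. f i \<in> reg X U \<and> g i \<in> reg Y V" unfolding tensors_def by blast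
  have "t = eval2 (map (\<lambda>i. (f i, g i)) [0..<n])"
    by (intro ext) (auto simp: t eval2_nth)
  moreover have "set (map (\<lambda>i. (f i, g i)) [0..<n]) \<subseteq> regs X U \<times> regs Y V"
    using t(2) assms by (auto simp: reg_regs)
  ultimately show "t \<in> ten2 (regs X U) (regs Y V)" unfolding ten2_def by blast
qed

text \<open>Replaces sections, which are extensional, by functions on the whole type, so that
  \<open>ten2\<close> and its closure properties apply to product charts.\<close>

lemma agreeing_tensors:
  assumes "sheaf_of_functions X" "sheaf_of_functions Y" "openX X U" "openX Y V"
  shows "agreeing (U \<times> V) (tensors X Y U V) = agreeing (U \<times> V) (ten2 (regs X U) (regs Y V))"
proof
  show "agreeing (U \<times> V) (tensors X Y U V) \<subseteq> agreeing (U \<times> V) (ten2 (regs X U) (regs Y V))"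
    using tensors_subset_ten2[OF assms] unfolding agreeing_def by blast
  show "agreeing (U \<times> V) (ten2 (regs X U) (regs Y V)) \<subseteq> agreeing (U \<times> V) (tensors X Y U V)"
  proof
    fix k assume "k \<in> agreeing (U \<times> V) (ten2 (regs X U) (regs Y V))"
    then obtain ts where ts: "\<forall>p\<in>U \<times> V. k p = eval2 ts p" "set ts \<subseteq> regs X U \<times> regs Y V"
      unfolding agreeing_def ten2_def by blast
    let ?f = "\<lambda>i. restrict (fst (ts ! i)) U" and ?g = "\<lambda>i. restrict (snd (ts ! i)) V"
    let ?t = "\<lambda>(x, y). \<Sum>i<length ts. ?f i x * ?g i y"
    have "ts ! i \<in> regs X U \<times> regs Y V" if "i < length ts" for i
      using ts(2) that nth_mem by blast
    then have "\<forall>i<length ts. ?f i \<in> reg X U \<and> ?g i \<in> reg Y V"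
      by (auto simp: restrict_reg_iff mem_Times_iff)
    then have "?t \<in> tensors X Y U V" unfolding tensors_def
      by (intro CollectI exI[of _ "length ts"] exI[of _ ?f] exI[of _ ?g] conjI refl)
    moreover have "\<forall>p\<in>U \<times> V. k p = ?t p" using ts(1) by (auto simp: eval2_nth)
    ultimately show "k \<in> agreeing (U \<times> V) (tensors X Y U V)"
      unfolding agreeing_def by blast
  qed
qed

definition prod_charts :: "'a fspace \<Rightarrow> 'b fspace \<Rightarrow> (('a \<times> 'b) set \<times> ('a \<times> 'b \<Rightarrow> complex) set) set" where
  "prod_charts X Y = {(U \<times> V, tensors X Y U V) | U V. openX X U \<and> openX Y V}"

lemma prod_space_charts: "X \<times>\<^sub>f Y = fraction_space (prod_charts X Y)"
  by (simp add: prod_space_def prod_charts_def)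

context
  fixes X :: "'a fspace" and Y :: "'b fspace"
  assumes X: "sheaf_of_functions X" and Y: "sheaf_of_functions Y"
begin

lemma chart_system_prod: "chart_system (prod_charts X Y)"
  unfolding chart_system_def
proof (intro conjI ballI, goal_cases)
  case (1 c)
  then obtain U V where c: "c = (U \<times> V, tensors X Y U V)" "openX X U" "openX Y V"
    unfolding prod_charts_def by blast
  then show ?case
    by (simp add: agreeing_tensors[OF X Y] fun_alg_agreeing ten2_fun_alg fun_alg_regs X Y)
next
  case (2 c)
  then obtain U V where c: "c = (U \<times> V, tensors X Y U V)" "openX X U" "openX Y V"
    unfolding prod_charts_def by blast
  have "case c' of (V', B) \<Rightarrow> \<exists>C. (U \<times> V \<inter> V', C) \<in> prod_charts X Y \<and>
      tensors X Y U V \<union> B \<subseteq> agreeing (U \<times> V \<inter> V') C" if c'': "c' \<in> prod_charts X Y" for c'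
  proof -
  obtain U' V' where c': "c' = (U' \<times> V', tensors X Y U' V')" "openX X U'" "openX Y V'"
    using c'' unfolding prod_charts_def by blast
  have o: "openX X (U \<inter> U')" "openX Y (V \<inter> V')" using c c' by auto
  let ?C = "tensors X Y (U \<inter> U') (V \<inter> V')"
  have "tensors X Y U V \<union> tensors X Y U' V' \<subseteq> ten2 (regs X (U \<inter> U')) (regs Y (V \<inter> V'))"
  proof (rule Un_least)
    show "tensors X Y U V \<subseteq> ten2 (regs X (U \<inter> U')) (regs Y (V \<inter> V'))"
      by (rule order_trans[OF tensors_subset_ten2[OF X Y c(2,3)] ten2_mono])
         (auto intro: regs_subset[OF X c(2) o(1)] regs_subset[OF Y c(3) o(2)])
    show "tensors X Y U' V' \<subseteq> ten2 (regs X (U \<inter> U')) (regs Y (V \<inter> V'))"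
      by (rule order_trans[OF tensors_subset_ten2[OF X Y c'(2,3)] ten2_mono])
         (auto intro: regs_subset[OF X c'(2) o(1)] regs_subset[OF Y c'(3) o(2)])
  qed
  also have "\<dots> \<subseteq> agreeing ((U \<inter> U') \<times> (V \<inter> V')) ?C"
    unfolding agreeing_tensors[OF X Y o] by (rule agreeing_superset)
  finally have "tensors X Y U V \<union> tensors X Y U' V' \<subseteq> agreeing ((U \<inter> U') \<times> (V \<inter> V')) ?C" .
  moreover have "((U \<inter> U') \<times> (V \<inter> V'), ?C) \<in> prod_charts X Y"
    unfolding prod_charts_def using o by blast
  ultimately show ?thesis
    unfolding c'(1) by (auto simp: Times_Int_Times)
  qed
  then show ?case unfolding c(1) by simp
qed

lemma function_space_prod: "function_space (X \<times>\<^sub>f Y)"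
  unfolding prod_space_charts by (rule function_space_fraction_space[OF chart_system_prod])

lemma points_prod: "points (X \<times>\<^sub>f Y) = points X \<times> points Y"
proof -
  have "\<Union>(fst ` prod_charts X Y) = points X \<times> points Y"
  proof
    show "\<Union>(fst ` prod_charts X Y) \<subseteq> points X \<times> points Y"
    proof
      fix p assume "p \<in> \<Union>(fst ` prod_charts X Y)"
      then obtain U V where "openX X U" "openX Y V" "p \<in> U \<times> V"
        unfolding prod_charts_def by auto
      then show "p \<in> points X \<times> points Y"
        using openin_subset[of "zariski X" U] openin_subset[of "zariski Y" V] by auto
    qed
    have "(points X \<times> points Y, tensors X Y (points X) (points Y)) \<in> prod_charts X Y"
      unfolding prod_charts_def using openin_topspace by blast
    then show "points X \<times> points Y \<subseteq> \<Union>(fst ` prod_charts X Y)" by force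
  qed
  then show ?thesis
    unfolding prod_space_charts by (simp add: points_fraction_space[OF chart_system_prod])
qed

lemma openX_prod_Times:
  assumes "openX X U" "openX Y V"
  shows "openX (X \<times>\<^sub>f Y) (U \<times> V)"
proof -
  have "(U \<times> V, tensors X Y U V) \<in> prod_charts X Y" using assms unfolding prod_charts_def by blast
  then show ?thesis unfolding prod_space_charts by (rule openX_chart[OF chart_system_prod])
qed

text \<open>The Zariski topology of a product is in general finer than the product topology, so a
  neighbourhood is only known to contain the non-vanishing locus of a tensor inside some
  \<open>U \<times> V\<close>.\<close>

lemma openX_prod_nhd:
  assumes "openX (X \<times>\<^sub>f Y) N" "(x, y) \<in> N"
  obtains U V k where "openX X U" "openX Y V" "x \<in> U" "y \<in> V" "k \<in> ten2 (regs X U) (regs Y V)"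
    "k (x, y) \<noteq> 0" "\<And>u v. u \<in> U \<Longrightarrow> v \<in> V \<Longrightarrow> k (u, v) \<noteq> 0 \<Longrightarrow> (u, v) \<in> N"
proof -
  obtain U' A k where 1: "(U', A) \<in> prod_charts X Y" "k \<in> agreeing U' A" "(x, y) \<in> U'" "k (x, y) \<noteq> 0"
    "{p \<in> U'. k p \<noteq> 0} \<subseteq> N"
    using assms unfolding prod_space_charts openX_fraction_space[OF chart_system_prod] by blast
  obtain U V where 2: "U' = U \<times> V" "A = tensors X Y U V" "openX X U" "openX Y V"
    using 1(1) unfolding prod_charts_def by blast
  obtain l where l: "l \<in> ten2 (regs X U) (regs Y V)" "\<forall>p\<in>U \<times> V. k p = l p"
    using 1(2) unfolding 2 agreeing_tensors[OF X Y 2(3,4)] unfolding agreeing_def by blast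
  show ?thesis by (rule that[of U V l]) (use 1 2 l in auto)
qed

lemma regs_prod_fraction:
  assumes "f \<in> regs (X \<times>\<^sub>f Y) W" "(x, y) \<in> W"
  obtains U V g h where "openX X U" "openX Y V" "x \<in> U" "y \<in> V" "g \<in> ten2 (regs X U) (regs Y V)"
    "h \<in> ten2 (regs X U) (regs Y V)" "h (x, y) \<noteq> 0"
    "\<And>u v. u \<in> U \<Longrightarrow> v \<in> V \<Longrightarrow> h (u, v) \<noteq> 0 \<Longrightarrow> (u, v) \<in> W \<and> f (u, v) = g (u, v) / h (u, v)"
proof -
  obtain U' A g h where 1: "(U', A) \<in> prod_charts X Y" "g \<in> agreeing U' A" "h \<in> agreeing U' A"
    "(x, y) \<in> U'" "h (x, y) \<noteq> 0" "\<forall>y\<in>U'. h y \<noteq> 0 \<longrightarrow> y \<in> W \<and> f y = g y / h y"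
    using assms unfolding prod_space_charts regs_fraction_space[OF chart_system_prod] by blast
  obtain U V where 2: "U' = U \<times> V" "A = tensors X Y U V" "openX X U" "openX Y V"
    using 1(1) unfolding prod_charts_def by blast
  obtain g' where g: "g' \<in> ten2 (regs X U) (regs Y V)" "\<forall>p\<in>U \<times> V. g p = g' p"
    using 1(2) unfolding 2 agreeing_tensors[OF X Y 2(3,4)] unfolding agreeing_def by blast
  obtain h' where h: "h' \<in> ten2 (regs X U) (regs Y V)" "\<forall>p\<in>U \<times> V. h p = h' p"
    using 1(3) unfolding 2 agreeing_tensors[OF X Y 2(3,4)] unfolding agreeing_def by blast
  show ?thesis by (rule that[of U V g' h']) (use 1 2 g h in auto)
qed

lemma ten2_regs:
  assumes "openX X U" "openX Y V" "k \<in> ten2 (regs X U) (regs Y V)"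
  shows "k \<in> regs (X \<times>\<^sub>f Y) (U \<times> V)"
proof -
  have "(U \<times> V, tensors X Y U V) \<in> prod_charts X Y" using assms unfolding prod_charts_def by blast
  moreover have "k \<in> agreeing (U \<times> V) (tensors X Y U V)"
    unfolding agreeing_tensors[OF X Y assms(1,2)] using agreeing_superset assms(3) by blast
  ultimately show ?thesis unfolding prod_space_charts by (rule agreeing_regs[OF chart_system_prod])
qed

end

section \<open>Morphisms and the universal property of products\<close>

definition morphism :: "'a fspace \<Rightarrow> 'b fspace \<Rightarrow> ('a \<Rightarrow> 'b) \<Rightarrow> bool" where
  "morphism Z Y \<phi> \<longleftrightarrow> \<phi> ` points Z \<subseteq> points Y \<and>
     (\<forall>V. openX Y V \<longrightarrow> openX Z (preim \<phi> Z V) \<and>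
        (\<forall>f\<in>regs Y V. (\<lambda>z. f (\<phi> z)) \<in> regs Z (preim \<phi> Z V)))"

lemma morphismD:
  assumes "morphism Z Y \<phi>"
  shows morphism_points: "z \<in> points Z \<Longrightarrow> \<phi> z \<in> points Y"
    and morphism_open: "openX Y V \<Longrightarrow> openX Z (preim \<phi> Z V)"
    and morphism_regs: "openX Y V \<Longrightarrow> f \<in> regs Y V \<Longrightarrow> (\<lambda>z. f (\<phi> z)) \<in> regs Z (preim \<phi> Z V)"
  using assms by (auto simp: morphism_def)

lemma pullback_restrict: "pullback \<phi> Z V (restrict f V) = restrict (\<lambda>z. f (\<phi> z)) (preim \<phi> Z V)"
  by (intro ext) (simp add: pullback_def restrict_def preim_def)

lemma pullback_eq: "pullback \<phi> Z V f = restrict (\<lambda>z. f (\<phi> z)) (preim \<phi> Z V)"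
  by (simp add: pullback_def)

lemma preim_Int: "preim \<phi> Z (V \<inter> W) = preim \<phi> Z V \<inter> preim \<phi> Z W"
  by (auto simp: preim_def)

lemma preim_mono: "V \<subseteq> W \<Longrightarrow> preim \<phi> Z V \<subseteq> preim \<phi> Z W"
  by (auto simp: preim_def)

lemma preim_Union: "preim \<phi> Z (\<Union>\<V>) = \<Union>(preim \<phi> Z ` \<V>)"
  by (auto simp: preim_def)

lemma morphism_regs_subset:
  assumes "sheaf_of_functions Z" "morphism Z Y \<phi>" "openX Y V" "f \<in> regs Y V" "openX Z W"
    "\<And>z. z \<in> W \<Longrightarrow> \<phi> z \<in> V"
  shows "(\<lambda>z. f (\<phi> z)) \<in> regs Z W"
  by (rule regs_subset[OF assms(1) morphism_open[OF assms(2,3)] assms(5) _ morphism_regs[OF assms(2-4)]])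
     (use assms(5,6) openin_subset in \<open>fastforce simp: preim_def\<close>)

lemma morphism_comp:
  assumes "morphism Z Y \<phi>" "morphism Y S \<psi>"
  shows "morphism Z S (\<lambda>z. \<psi> (\<phi> z))"
proof -
  have *: "preim (\<lambda>z. \<psi> (\<phi> z)) Z V = preim \<phi> Z (preim \<psi> Y V)" for V
    using morphism_points[OF assms(1)] by (auto simp: preim_def)
  show ?thesis
    unfolding morphism_def *
    using morphism_points[OF assms(1)] morphism_points[OF assms(2)]
      morphism_open[OF assms(2)] morphism_open[OF assms(1)]
      morphism_regs[OF assms(1) morphism_open[OF assms(2)] morphism_regs[OF assms(2)]]
    by auto
qed

lemma morphism_id: "morphism Z Z (\<lambda>z. z)"
proof -
  have "preim (\<lambda>z. z) Z V = V" if "openX Z V" for V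
    using openin_subset[OF that] by (auto simp: preim_def)
  then show ?thesis by (auto simp: morphism_def)
qed

context
  fixes X :: "'a fspace" and Y :: "'b fspace"
  assumes X: "sheaf_of_functions X" and Y: "sheaf_of_functions Y"
begin

lemma morphism_fst: "morphism (X \<times>\<^sub>f Y) X fst"
  unfolding morphism_def
proof (intro conjI allI impI ballI)
  show "fst ` points (X \<times>\<^sub>f Y) \<subseteq> points X" by (auto simp: points_prod[OF X Y])
  fix U assume U: "openX X U"
  have *: "preim fst (X \<times>\<^sub>f Y) U = U \<times> points Y"
    using openin_subset[OF U] by (auto simp: preim_def points_prod[OF X Y])
  show "openX (X \<times>\<^sub>f Y) (preim fst (X \<times>\<^sub>f Y) U)"
    unfolding * by (rule openX_prod_Times[OF X Y U openin_topspace])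
  fix f assume f: "f \<in> regs X U"
  have "(\<lambda>(x, y). f x) \<in> ten2 (regs X U) (regs Y (points Y))"
    by (rule ten2_fst[OF fun_alg_regs[OF Y openin_topspace] f])
  from ten2_regs[OF X Y U openin_topspace this]
  show "(\<lambda>z. f (fst z)) \<in> regs (X \<times>\<^sub>f Y) (preim fst (X \<times>\<^sub>f Y) U)"
    unfolding * by (simp add: case_prod_unfold)
qed

lemma morphism_snd: "morphism (X \<times>\<^sub>f Y) Y snd"
  unfolding morphism_def
proof (intro conjI allI impI ballI)
  show "snd ` points (X \<times>\<^sub>f Y) \<subseteq> points Y" by (auto simp: points_prod[OF X Y])
  fix U assume U: "openX Y U"
  have *: "preim snd (X \<times>\<^sub>f Y) U = points X \<times> U"
    using openin_subset[OF U] by (auto simp: preim_def points_prod[OF X Y])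
  show "openX (X \<times>\<^sub>f Y) (preim snd (X \<times>\<^sub>f Y) U)"
    unfolding * by (rule openX_prod_Times[OF X Y openin_topspace U])
  fix f assume f: "f \<in> regs Y U"
  have "(\<lambda>(x, y). f y) \<in> ten2 (regs X (points X)) (regs Y U)"
    by (rule ten2_snd[OF fun_alg_regs[OF X openin_topspace] f])
  from ten2_regs[OF X Y openin_topspace U this]
  show "(\<lambda>z. f (snd z)) \<in> regs (X \<times>\<^sub>f Y) (preim snd (X \<times>\<^sub>f Y) U)"
    unfolding * by (simp add: case_prod_unfold)
qed

text \<open>A tensor pulls back to a sum of products of regular functions. Open sets and regular
  functions of the product are described by non-vanishing loci and quotients of tensors, and on
  \<open>Z\<close> these make sense because it is a function space.\<close>

lemma morphism_Pair:
  assumes Z: "function_space Z" and \<phi>: "morphism Z X \<phi>" and \<psi>: "morphism Z Y \<psi>"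
  shows "morphism Z (X \<times>\<^sub>f Y) (\<lambda>z. (\<phi> z, \<psi> z))"
proof -
  note S = function_space_sheaf[OF Z]
  let ?p = "\<lambda>z. (\<phi> z, \<psi> z)"
  have ten: "openX Z {z \<in> points Z. \<phi> z \<in> U \<and> \<psi> z \<in> V} \<and>
      (\<lambda>z. k (\<phi> z, \<psi> z)) \<in> regs Z {z \<in> points Z. \<phi> z \<in> U \<and> \<psi> z \<in> V}"
    if U: "openX X U" and V: "openX Y V" and k: "k \<in> ten2 (regs X U) (regs Y V)" for U V k
  proof -
    let ?N = "{z \<in> points Z. \<phi> z \<in> U \<and> \<psi> z \<in> V}"
    have N: "openX Z ?N"
    proof -
      have "?N = preim \<phi> Z U \<inter> preim \<psi> Z V" by (auto simp: preim_def)
      then show ?thesis using morphism_open[OF \<phi> U] morphism_open[OF \<psi> V] by auto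
    qed
    note A = fun_alg_regs[OF S N]
    have "(\<lambda>z. k (\<phi> z, \<psi> z)) \<in> regs Z ?N" using k
    proof (induction rule: ten2_induct)
      case zero
      show ?case by (rule fun_alg_const[OF A])
    next
      case (add a b g)
      have "(\<lambda>z. a (\<phi> z)) \<in> regs Z ?N" "(\<lambda>z. b (\<psi> z)) \<in> regs Z ?N"
        by (rule morphism_regs_subset[OF S \<phi> U add(1) N], simp)
           (rule morphism_regs_subset[OF S \<psi> V add(2) N], simp)
      from fun_alg_add[OF A fun_alg_mult[OF A this] add(4)] show ?case by simp
    qed
    then show ?thesis using N by blast
  qed
  have op: "openX Z (preim ?p Z W)" if W: "openX (X \<times>\<^sub>f Y) W" for W
  proof (subst openin_subopen, intro ballI)
    fix z assume z: "z \<in> preim ?p Z W"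
    then have "(\<phi> z, \<psi> z) \<in> W" "z \<in> points Z" by (auto simp: preim_def)
    obtain U V k where k: "openX X U" "openX Y V" "\<phi> z \<in> U" "\<psi> z \<in> V" "k \<in> ten2 (regs X U) (regs Y V)"
      "k (\<phi> z, \<psi> z) \<noteq> 0" "\<And>u v. u \<in> U \<Longrightarrow> v \<in> V \<Longrightarrow> k (u, v) \<noteq> 0 \<Longrightarrow> (u, v) \<in> W"
      using openX_prod_nhd[OF X Y W \<open>(\<phi> z, \<psi> z) \<in> W\<close>] by blast
    note t = ten[OF k(1,2,5)]
    have "openX Z {z \<in> {z \<in> points Z. \<phi> z \<in> U \<and> \<psi> z \<in> V}. k (\<phi> z, \<psi> z) \<noteq> 0}"
      by (rule function_space_open[OF Z t[THEN conjunct1] t[THEN conjunct2]])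
    moreover have "z \<in> {z \<in> {z \<in> points Z. \<phi> z \<in> U \<and> \<psi> z \<in> V}. k (\<phi> z, \<psi> z) \<noteq> 0}"
      using k \<open>z \<in> points Z\<close> by auto
    moreover have "{z \<in> {z \<in> points Z. \<phi> z \<in> U \<and> \<psi> z \<in> V}. k (\<phi> z, \<psi> z) \<noteq> 0} \<subseteq> preim ?p Z W"
      using k(7) by (auto simp: preim_def)
    ultimately show "\<exists>T. openX Z T \<and> z \<in> T \<and> T \<subseteq> preim ?p Z W" by blast
  qed
  have "(\<lambda>z. f (\<phi> z, \<psi> z)) \<in> regs Z (preim ?p Z W)"
    if W: "openX (X \<times>\<^sub>f Y) W" and f: "f \<in> regs (X \<times>\<^sub>f Y) W" for W f
  proof (rule regs_local[OF S op[OF W]])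
    fix z assume z: "z \<in> preim ?p Z W"
    then have "(\<phi> z, \<psi> z) \<in> W" "z \<in> points Z" by (auto simp: preim_def)
    obtain U V g h where k: "openX X U" "openX Y V" "\<phi> z \<in> U" "\<psi> z \<in> V" "g \<in> ten2 (regs X U) (regs Y V)"
      "h \<in> ten2 (regs X U) (regs Y V)" "h (\<phi> z, \<psi> z) \<noteq> 0"
      "\<And>u v. u \<in> U \<Longrightarrow> v \<in> V \<Longrightarrow> h (u, v) \<noteq> 0 \<Longrightarrow> (u, v) \<in> W \<and> f (u, v) = g (u, v) / h (u, v)"
      using regs_prod_fraction[OF X Y f \<open>(\<phi> z, \<psi> z) \<in> W\<close>] by blast
    let ?N = "{z \<in> points Z. \<phi> z \<in> U \<and> \<psi> z \<in> V}"
    let ?M = "{z \<in> ?N. h (\<phi> z, \<psi> z) \<noteq> 0}"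
    note tg = ten[OF k(1,2,5)] and th = ten[OF k(1,2,6)]
    have M: "openX Z ?M"
      by (rule function_space_open[OF Z th[THEN conjunct1] th[THEN conjunct2]])
    have "(\<lambda>z. g (\<phi> z, \<psi> z) / h (\<phi> z, \<psi> z)) \<in> regs Z ?M"
      by (rule regs_divide[OF Z tg[THEN conjunct1] tg[THEN conjunct2] th[THEN conjunct2] M]) auto
    then have "(\<lambda>z. f (\<phi> z, \<psi> z)) \<in> regs Z ?M"
      by (rule regs_cong) (use k(8) in auto)
    then show "\<exists>W. openX Z W \<and> z \<in> W \<and> (\<lambda>z. f (\<phi> z, \<psi> z)) \<in> regs Z W"
      using M k \<open>z \<in> points Z\<close> by (intro exI[of _ ?M]) auto
  qed
  moreover have "?p ` points Z \<subseteq> points (X \<times>\<^sub>f Y)"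
    using morphism_points[OF \<phi>] morphism_points[OF \<psi>] by (auto simp: points_prod[OF X Y])
  ultimately show ?thesis using op unfolding morphism_def by blast
qed

end

section \<open>Quotient spaces\<close>

lemma points_quotient: "points (quotient_fspace Y q) = q ` points Y"
proof -
  have "openX (quotient_fspace Y q) (q ` points Y)"
    unfolding openX_quotient_fspace
  proof
    have "preim q Y (q ` points Y) = points Y" by (auto simp: preim_def)
    then show "openX Y (preim q Y (q ` points Y))" by simp
  qed simp
  then show ?thesis
    by (metis openX_quotient_fspace openin_subset openin_topspace subset_antisym)
qed

lemma regs_quotient: "f \<in> regs (quotient_fspace Y q) V \<longleftrightarrow> (\<lambda>y. f (q y)) \<in> regs Y (preim q Y V)"
  by (simp add: regs_def quotient_fspace_def pullback_restrict)

lemma morphism_quotient: "morphism Y (quotient_fspace Y q) q"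
  by (simp add: morphism_def points_quotient openX_quotient_fspace regs_quotient)

text \<open>Openness and regularity downstairs are defined by pullback, and the non-vanishing locus
  of f pulls back to that of its composite with q.\<close>

lemma function_space_quotient:
  assumes Y: "function_space Y"
  shows "function_space (quotient_fspace Y q)"
proof -
  let ?S = "quotient_fspace Y q"
  note S = function_space_sheaf[OF Y]
  have rr: "g \<in> reg ?S V \<longleftrightarrow> g \<in> extensional V \<and> g \<in> regs ?S V" for g V
  proof
    assume g: "g \<in> reg ?S V"
    then have "g \<in> extensional V" by (simp add: quotient_fspace_def)
    then show "g \<in> extensional V \<and> g \<in> regs ?S V" using g by (simp add: regs_def extensional_restrict)
  next
    assume "g \<in> extensional V \<and> g \<in> regs ?S V"
    then show "g \<in> reg ?S V" using extensional_restrict[of g V] by (auto simp: regs_def)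
  qed
  have o: "openX Y (preim q Y V)" if "openX ?S V" for V
    using that by (simp add: openX_quotient_fspace)
  note A = fun_alg_regs[OF S o]
  have sh: "sheaf_of_functions ?S"
    unfolding sheaf_of_functions_def
  proof (intro allI impI conjI ballI)
    fix U assume U: "openX ?S U"
    show "reg ?S U \<subseteq> extensional U" using rr by blast
    fix c
    show "(\<lambda>x\<in>U. c) \<in> reg ?S U"
      unfolding restrict_reg_iff regs_quotient by (rule fun_alg_const[OF A[OF U]])
  next
    fix U f g assume U: "openX ?S U" and fg: "f \<in> reg ?S U" "g \<in> reg ?S U"
    then have fg': "(\<lambda>y. f (q y)) \<in> regs Y (preim q Y U)" "(\<lambda>y. g (q y)) \<in> regs Y (preim q Y U)"
      by (simp_all add: rr regs_quotient)
    show "(\<lambda>x\<in>U. f x + g x) \<in> reg ?S U"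
      unfolding restrict_reg_iff regs_quotient by (rule fun_alg_add[OF A[OF U] fg'])
    show "(\<lambda>x\<in>U. f x * g x) \<in> reg ?S U"
      unfolding restrict_reg_iff regs_quotient by (rule fun_alg_mult[OF A[OF U] fg'])
  next
    fix U f W assume U: "openX ?S U" and f: "f \<in> reg ?S U" and W: "openX ?S W \<and> W \<subseteq> U"
    then have "(\<lambda>y. f (q y)) \<in> regs Y (preim q Y U)" by (simp add: rr regs_quotient)
    then show "restrict f W \<in> reg ?S W"
      unfolding restrict_reg_iff regs_quotient
      by (rule regs_subset[OF S o[OF U] o[OF W[THEN conjunct1]] preim_mono[OF W[THEN conjunct2]]])
  next
    fix U f assume U: "openX ?S U" and f: "f \<in> extensional U"
      and l: "\<forall>x\<in>U. \<exists>W. openX ?S W \<and> x \<in> W \<and> W \<subseteq> U \<and> restrict f W \<in> reg ?S W"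
    have "f \<in> regs ?S U"
      unfolding regs_quotient
    proof (rule regs_local[OF S o[OF U]])
      fix y assume y: "y \<in> preim q Y U"
      then have "q y \<in> U" by (simp add: preim_def)
      then obtain W where W: "openX ?S W" "q y \<in> W" "f \<in> regs ?S W"
        using l by (auto simp: restrict_reg_iff)
      then show "\<exists>W. openX Y W \<and> y \<in> W \<and> (\<lambda>y. f (q y)) \<in> regs Y W"
        using o[OF W(1)] y by (intro exI[of _ "preim q Y W"]) (auto simp: preim_def regs_quotient)
    qed
    then show "f \<in> reg ?S U" using f by (simp add: rr)
  qed
  have "openX ?S {x \<in> U. f x \<noteq> 0} \<and> (\<lambda>x. 1 / f x) \<in> regs ?S {x \<in> U. f x \<noteq> 0}"
    if U: "openX ?S U" and f: "f \<in> regs ?S U" for U f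
  proof -
    have *: "preim q Y {x \<in> U. f x \<noteq> 0} = {y \<in> preim q Y U. f (q y) \<noteq> 0}" by (auto simp: preim_def)
    have f': "(\<lambda>y. f (q y)) \<in> regs Y (preim q Y U)" using f by (simp add: regs_quotient)
    show ?thesis
      unfolding openX_quotient_fspace regs_quotient *
      using function_space_open[OF Y o[OF U] f'] function_space_inverse[OF Y o[OF U] f'] U
      by (auto simp: openX_quotient_fspace)
  qed
  then show ?thesis using sh by (auto simp: function_space_def)
qed

section \<open>Sheaves of modules\<close>

lemma sec_structure_sheaf [simp]:
  "carrier (sec (\<O> S) V) = reg S V"
  "f \<otimes>\<^bsub>sec (\<O> S) V\<^esub> g = (\<lambda>x\<in>V. f x * g x)"
  "\<one>\<^bsub>sec (\<O> S) V\<^esub> = (\<lambda>x\<in>V. 1)"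
  "\<zero>\<^bsub>sec (\<O> S) V\<^esub> = (\<lambda>x\<in>V. 0)"
  "f \<oplus>\<^bsub>sec (\<O> S) V\<^esub> g = (\<lambda>x\<in>V. f x + g x)"
  "f \<odot>\<^bsub>sec (\<O> S) V\<^esub> g = (\<lambda>x\<in>V. f x * g x)"
  "restr (\<O> S) V f = restrict f V"
  by (simp_all add: structure_sheaf_def)

lemma restrict_ext_eq:
  "g \<in> extensional V \<Longrightarrow> (\<And>x. x \<in> V \<Longrightarrow> f x = g x) \<Longrightarrow> restrict f V = g"
  by (intro ext) (simp add: restrict_def extensional_def)

lemma abelian_group_functions:
  assumes C: "C \<subseteq> extensional V" "(\<lambda>x\<in>V. 0) \<in> C"
    and add: "\<And>f g. f \<in> C \<Longrightarrow> g \<in> C \<Longrightarrow> (\<lambda>x\<in>V. f x + g x) \<in> C"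
    and neg: "\<And>f. f \<in> C \<Longrightarrow> (\<lambda>x\<in>V. - f x) \<in> C"
  shows "abelian_group ((sec (\<O> S) V)\<lparr>carrier := C\<rparr>)"
proof (rule abelian_groupI, goal_cases)
  case (1 x y) then show ?case using add by simp
next
  case 2 then show ?case using C by simp
next
  case (3 x y z) then show ?case by (simp add: algebra_simps cong: restrict_cong)
next
  case (4 x y) then show ?case by (simp add: add.commute)
next
  case (5 x) then show ?case using C(1) by (auto intro!: restrict_ext_eq)
next
  case (6 x)
  show ?case
    by (rule bexI[of _ "\<lambda>v\<in>V. - x v"]) (use 6 neg in \<open>auto cong: restrict_cong\<close>)
qed

lemma cring_sections:
  assumes S: "sheaf_of_functions S" and V: "openX S V"
  shows "cring (sec (\<O> S) V)"
proof -
  have "(\<lambda>x\<in>V. - f x) \<in> reg S V" if "f \<in> reg S V" for f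
    using reg_mult[OF S V reg_const[OF S V, of "-1"] that] by (simp cong: restrict_cong)
  then have "abelian_group ((sec (\<O> S) V)\<lparr>carrier := reg S V\<rparr>)"
    using reg_extensional[OF S V] reg_const[OF S V] reg_add[OF S V]
    by (intro abelian_group_functions) auto
  moreover have "(sec (\<O> S) V)\<lparr>carrier := reg S V\<rparr> = sec (\<O> S) V" by (simp add: structure_sheaf_def)
  ultimately have a: "abelian_group (sec (\<O> S) V)" by simp
  show ?thesis
  proof (rule cringI[OF a comm_monoidI], goal_cases)
    case (1 x y) then show ?case using reg_mult[OF S V] by simp
  next
    case 2 then show ?case using reg_const[OF S V] by simp
  next
    case (3 x y z) then show ?case by (simp add: algebra_simps cong: restrict_cong)
  next
    case (4 x) then show ?case using reg_extensional[OF S V] by (auto intro!: restrict_ext_eq)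
  next
    case (5 x y) then show ?case by (simp add: mult.commute)
  next
    case (6 x y z) then show ?case by (simp add: algebra_simps cong: restrict_cong)
  qed
qed

lemma module_functions:
  assumes S: "sheaf_of_functions S" and V: "openX S V"
    and C: "C \<subseteq> extensional V" "(\<lambda>x\<in>V. 0) \<in> C"
    and add: "\<And>f g. f \<in> C \<Longrightarrow> g \<in> C \<Longrightarrow> (\<lambda>x\<in>V. f x + g x) \<in> C"
    and smult: "\<And>f g. f \<in> reg S V \<Longrightarrow> g \<in> C \<Longrightarrow> (\<lambda>x\<in>V. f x * g x) \<in> C"
  shows "module (sec (\<O> S) V) ((sec (\<O> S) V)\<lparr>carrier := C\<rparr>)"
proof (rule moduleI[OF cring_sections[OF S V] abelian_group_functions[OF C add]], goal_cases)
  case (3 f)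
  then show ?case using smult[OF reg_const[OF S V, of "-1"]] by (simp cong: restrict_cong)
next
  case (4 a x) then show ?case using smult by simp
next
  case (5 a b x) then show ?case by (simp add: algebra_simps cong: restrict_cong)
next
  case (6 a x y) then show ?case by (simp add: algebra_simps cong: restrict_cong)
next
  case (7 a b x) then show ?case by (simp add: algebra_simps cong: restrict_cong)
next
  case (8 x) then show ?case using C(1) by (auto intro!: restrict_ext_eq)
qed

text \<open>Sections of all sheaves occurring here are extensional functions, with values in the
  complex numbers or in stalks of differentials, so one gluing argument serves them all.\<close>

lemma glue_functions:
  assumes ext: "\<And>V. V \<in> \<V> \<Longrightarrow> \<sigma> V \<in> extensional V"
    and compat: "\<And>V W. V \<in> \<V> \<Longrightarrow> W \<in> \<V> \<Longrightarrow> restrict (\<sigma> V) (V \<inter> W) = restrict (\<sigma> W) (V \<inter> W)"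
  obtains s where "s \<in> extensional (\<Union>\<V>)" "\<And>V. V \<in> \<V> \<Longrightarrow> restrict s V = \<sigma> V"
proof -
  define c where "c x = (SOME V. V \<in> \<V> \<and> x \<in> V)" for x
  have c: "c x \<in> \<V>" "x \<in> c x" if "x \<in> V" "V \<in> \<V>" for x V
    using someI[of "\<lambda>V. V \<in> \<V> \<and> x \<in> V" V] that unfolding c_def by auto
  let ?s = "\<lambda>x\<in>\<Union>\<V>. \<sigma> (c x) x"
  have "restrict ?s V = \<sigma> V" if V: "V \<in> \<V>" for V
  proof (rule restrict_ext_eq[OF ext[OF V]])
    fix x assume x: "x \<in> V"
    have "restrict (\<sigma> (c x)) (c x \<inter> V) x = restrict (\<sigma> V) (c x \<inter> V) x"
      using compat[OF c(1)[OF x V] V] by simp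
    then have "\<sigma> (c x) x = \<sigma> V x" using x c(2)[OF x V] by simp
    then show "?s x = \<sigma> V x" using x V by auto
  qed
  then show ?thesis by (intro that[of ?s]) auto
qed

lemma glue_unique:
  assumes "s \<in> extensional (\<Union>\<V>)" "t \<in> extensional (\<Union>\<V>)"
    and "\<And>V. V \<in> \<V> \<Longrightarrow> restrict s V = restrict t V"
  shows "s = t"
proof (rule extensionalityI[OF assms(1,2)])
  fix x assume "x \<in> \<Union>\<V>"
  then obtain V where "V \<in> \<V>" "x \<in> V" by blast
  then show "s x = t x" using assms(3)[of V] by (metis restrict_apply')
qed

text \<open>Serves both for the structure sheaf and for the ideal of the big diagonal. In the
  hypothesis \<open>local\<close> the function is already regular: gluing in the structure sheaf
  comes first, membership in \<open>C\<close> second.\<close>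

lemma module_sheaf_functions:
  fixes S :: "'a fspace" and C :: "'a set \<Rightarrow> ('a \<Rightarrow> complex) set"
  assumes S: "sheaf_of_functions S"
    and C: "\<And>V. openX S V \<Longrightarrow> C V \<subseteq> reg S V" "\<And>V. openX S V \<Longrightarrow> (\<lambda>x\<in>V. 0) \<in> C V"
    and add: "\<And>V f g. openX S V \<Longrightarrow> f \<in> C V \<Longrightarrow> g \<in> C V \<Longrightarrow> (\<lambda>x\<in>V. f x + g x) \<in> C V"
    and smult: "\<And>V f g. openX S V \<Longrightarrow> f \<in> reg S V \<Longrightarrow> g \<in> C V \<Longrightarrow> (\<lambda>x\<in>V. f x * g x) \<in> C V"
    and restr: "\<And>V W f. openX S V \<Longrightarrow> openX S W \<Longrightarrow> W \<subseteq> V \<Longrightarrow> f \<in> C V \<Longrightarrow> restrict f W \<in> C W"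
    and local: "\<And>V f. openX S V \<Longrightarrow> f \<in> reg S V \<Longrightarrow>
      (\<And>x. x \<in> V \<Longrightarrow> \<exists>W. openX S W \<and> x \<in> W \<and> W \<subseteq> V \<and> restrict f W \<in> C W) \<Longrightarrow> f \<in> C V"
  shows "module_sheaf S \<lparr>sec = (\<lambda>V. (sec (\<O> S) V)\<lparr>carrier := C V\<rparr>), restr = restr (\<O> S)\<rparr>"
proof -
  have Cext: "f \<in> extensional V" if "openX S V" "f \<in> C V" for V f
    using C(1) reg_extensional[OF S] that by blast
  have glue: "\<exists>!s. s \<in> C (\<Union>\<V>) \<and> (\<forall>V\<in>\<V>. restrict s V = \<sigma> V)"
    if 1: "\<forall>V\<in>\<V>. openX S V \<and> \<sigma> V \<in> C V"
      and 2: "\<forall>V\<in>\<V>. \<forall>W\<in>\<V>. restrict (\<sigma> V) (V \<inter> W) = restrict (\<sigma> W) (V \<inter> W)" for \<V> \<sigma>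
  proof -
    have o: "openX S (\<Union>\<V>)" using 1 by auto
    obtain s where s: "s \<in> extensional (\<Union>\<V>)" "\<And>V. V \<in> \<V> \<Longrightarrow> restrict s V = \<sigma> V"
      by (rule glue_functions[of \<V> \<sigma>]) (use 1 2 Cext in auto)
    have cov: "\<exists>W. openX S W \<and> x \<in> W \<and> W \<subseteq> \<Union>\<V> \<and> restrict s W \<in> C W" if "x \<in> \<Union>\<V>" for x
      using that 1 s(2) by (metis Union_iff Union_upper)
    have "s \<in> reg S (\<Union>\<V>)"
    proof (rule reg_local[OF S o s(1)])
      fix x assume "x \<in> \<Union>\<V>"
      then obtain W where W: "openX S W" "x \<in> W" "W \<subseteq> \<Union>\<V>" "restrict s W \<in> C W" using cov by metis
      then show "\<exists>W. openX S W \<and> x \<in> W \<and> W \<subseteq> \<Union>\<V> \<and> restrict s W \<in> reg S W"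
        using C(1)[OF W(1)] by auto
    qed
    then have "s \<in> C (\<Union>\<V>)" by (rule local[OF o _ cov])
    then show ?thesis
    proof (intro ex1I[of _ s] conjI ballI)
      fix t assume t: "t \<in> C (\<Union>\<V>) \<and> (\<forall>V\<in>\<V>. restrict t V = \<sigma> V)"
      show "t = s" by (rule glue_unique[OF Cext[OF o] s(1)]) (use t s(2) in auto)
    qed (use s(2) in auto)
  qed
  have rr: "restrict (restrict f V) U = restrict f U" if "U \<subseteq> V" for f :: "'a \<Rightarrow> complex" and U V
    using that by (intro ext) (auto simp: restrict_def)
  show ?thesis
    unfolding module_sheaf_def
  proof (intro conjI allI impI ballI, goal_cases)
    case (1 V)
    then show ?case using module_functions[OF S 1, of "C V"] Cext C(2) add smult by auto
  next
    case (2 V W s) then show ?case using restr[of W V s] by simp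
  next
    case (3 V W s t) then show ?case by (auto intro!: ext)
  next
    case (4 V W s f) then show ?case by (auto intro!: ext)
  next
    case (5 V W s U) then show ?case using rr by simp
  next
    case (6 V s) then show ?case using extensional_restrict[OF Cext] by simp
  next
    case (7 \<V> \<sigma>)
    then have "\<forall>V\<in>\<V>. openX S V \<and> \<sigma> V \<in> C V"
      "\<forall>V\<in>\<V>. \<forall>W\<in>\<V>. restrict (\<sigma> V) (V \<inter> W) = restrict (\<sigma> W) (V \<inter> W)" by auto
    from glue[OF this] show ?case by simp
  qed
qed

lemma module_sheaf_structure:
  assumes S: "sheaf_of_functions S"
  shows "module_sheaf S (\<O> S)"
proof -
  have "module_sheaf S \<lparr>sec = (\<lambda>V. (sec (\<O> S) V)\<lparr>carrier := reg S V\<rparr>), restr = restr (\<O> S)\<rparr>"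
    using reg_const[OF S] reg_add[OF S] reg_mult[OF S] reg_restrict[OF S]
    by (intro module_sheaf_functions[OF S]) auto
  moreover have "\<lparr>sec = (\<lambda>V. (sec (\<O> S) V)\<lparr>carrier := reg S V\<rparr>), restr = restr (\<O> S)\<rparr> = \<O> S"
    by (simp add: structure_sheaf_def)
  ultimately show ?thesis by simp
qed

lemma module_sheafD:
  assumes "module_sheaf S F"
  shows module_sheaf_module: "openX S V \<Longrightarrow> module (sec (\<O> S) V) (sec F V)"
    and module_sheaf_restr: "openX S V \<Longrightarrow> openX S W \<Longrightarrow> V \<subseteq> W \<Longrightarrow> s \<in> carrier (sec F W) \<Longrightarrow>
      restr F V s \<in> carrier (sec F V)"
    and module_sheaf_restr_add: "openX S V \<Longrightarrow> openX S W \<Longrightarrow> V \<subseteq> W \<Longrightarrow> s \<in> carrier (sec F W) \<Longrightarrow>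
      t \<in> carrier (sec F W) \<Longrightarrow>
      restr F V (s \<oplus>\<^bsub>sec F W\<^esub> t) = restr F V s \<oplus>\<^bsub>sec F V\<^esub> restr F V t"
    and module_sheaf_restr_smult: "openX S V \<Longrightarrow> openX S W \<Longrightarrow> V \<subseteq> W \<Longrightarrow> s \<in> carrier (sec F W) \<Longrightarrow>
      f \<in> reg S W \<Longrightarrow> restr F V (f \<odot>\<^bsub>sec F W\<^esub> s) = restrict f V \<odot>\<^bsub>sec F V\<^esub> restr F V s"
    and module_sheaf_restr_restr: "openX S V \<Longrightarrow> openX S W \<Longrightarrow> V \<subseteq> W \<Longrightarrow> s \<in> carrier (sec F W) \<Longrightarrow>
      openX S U \<Longrightarrow> U \<subseteq> V \<Longrightarrow> restr F U (restr F V s) = restr F U s"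
    and module_sheaf_restr_id: "openX S V \<Longrightarrow> s \<in> carrier (sec F V) \<Longrightarrow> restr F V s = s"
    and module_sheaf_glue: "(\<And>V. V \<in> \<V> \<Longrightarrow> openX S V \<and> \<sigma> V \<in> carrier (sec F V)) \<Longrightarrow>
      (\<And>V W. V \<in> \<V> \<Longrightarrow> W \<in> \<V> \<Longrightarrow> restr F (V \<inter> W) (\<sigma> V) = restr F (V \<inter> W) (\<sigma> W)) \<Longrightarrow>
      \<exists>!s. s \<in> carrier (sec F (\<Union>\<V>)) \<and> (\<forall>V\<in>\<V>. restr F V s = \<sigma> V)"
proof -
  note a = assms[unfolded module_sheaf_def]
  note 1 = a[THEN conjunct1, rule_format] and 2 = a[THEN conjunct2, THEN conjunct1, rule_format, OF conjI, OF _ conjI]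
    and 3 = a[THEN conjunct2, THEN conjunct2, THEN conjunct1, rule_format]
    and 4 = a[THEN conjunct2, THEN conjunct2, THEN conjunct2, THEN spec, THEN spec, THEN mp, OF conjI]
  show "openX S V \<Longrightarrow> module (sec (\<O> S) V) (sec F V)" by (rule 1)
  show "openX S V \<Longrightarrow> openX S W \<Longrightarrow> V \<subseteq> W \<Longrightarrow> s \<in> carrier (sec F W) \<Longrightarrow>
      restr F V s \<in> carrier (sec F V)" using 2 by simp
  show "openX S V \<Longrightarrow> openX S W \<Longrightarrow> V \<subseteq> W \<Longrightarrow> s \<in> carrier (sec F W) \<Longrightarrow>
      t \<in> carrier (sec F W) \<Longrightarrow>
      restr F V (s \<oplus>\<^bsub>sec F W\<^esub> t) = restr F V s \<oplus>\<^bsub>sec F V\<^esub> restr F V t" using 2 by simp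
  show "openX S V \<Longrightarrow> openX S W \<Longrightarrow> V \<subseteq> W \<Longrightarrow> s \<in> carrier (sec F W) \<Longrightarrow>
      f \<in> reg S W \<Longrightarrow> restr F V (f \<odot>\<^bsub>sec F W\<^esub> s) = restrict f V \<odot>\<^bsub>sec F V\<^esub> restr F V s" using 2 by simp
  show "openX S V \<Longrightarrow> openX S W \<Longrightarrow> V \<subseteq> W \<Longrightarrow> s \<in> carrier (sec F W) \<Longrightarrow>
      openX S U \<Longrightarrow> U \<subseteq> V \<Longrightarrow> restr F U (restr F V s) = restr F U s" using 2 by simp
  show "openX S V \<Longrightarrow> s \<in> carrier (sec F V) \<Longrightarrow> restr F V s = s" using 3 by simp
  show "(\<And>V. V \<in> \<V> \<Longrightarrow> openX S V \<and> \<sigma> V \<in> carrier (sec F V)) \<Longrightarrow>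
      (\<And>V W. V \<in> \<V> \<Longrightarrow> W \<in> \<V> \<Longrightarrow> restr F (V \<inter> W) (\<sigma> V) = restr F (V \<inter> W) (\<sigma> W)) \<Longrightarrow>
      \<exists>!s. s \<in> carrier (sec F (\<Union>\<V>)) \<and> (\<forall>V\<in>\<V>. restr F V s = \<sigma> V)" by (rule 4; blast)
qed

lemma pushforward_simps [simp]:
  "carrier (sec (pushforward \<phi> Y F) V) = carrier (sec F (preim \<phi> Y V))"
  "\<zero>\<^bsub>sec (pushforward \<phi> Y F) V\<^esub> = \<zero>\<^bsub>sec F (preim \<phi> Y V)\<^esub>"
  "s \<oplus>\<^bsub>sec (pushforward \<phi> Y F) V\<^esub> t = s \<oplus>\<^bsub>sec F (preim \<phi> Y V)\<^esub> t"
  "f \<odot>\<^bsub>sec (pushforward \<phi> Y F) V\<^esub> s = pullback \<phi> Y V f \<odot>\<^bsub>sec F (preim \<phi> Y V)\<^esub> s"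
  "restr (pushforward \<phi> Y F) V = restr F (preim \<phi> Y V)"
  by (simp_all add: pushforward_def Let_def)

lemma pullback_reg:
  assumes "sheaf_of_functions S" "morphism Y S \<phi>" "openX S V" "f \<in> reg S V"
  shows "pullback \<phi> Y V f \<in> reg Y (preim \<phi> Y V)"
  using morphism_regs[OF assms(2,3)] assms(4)
  by (simp add: pullback_eq restrict_reg_iff reg_regs[OF assms(1,3)])

lemma pullback_arith:
  "pullback \<phi> Y V (\<lambda>x\<in>V. f x + g x) = (\<lambda>x\<in>preim \<phi> Y V. pullback \<phi> Y V f x + pullback \<phi> Y V g x)"
  "pullback \<phi> Y V (\<lambda>x\<in>V. f x * g x) = (\<lambda>x\<in>preim \<phi> Y V. pullback \<phi> Y V f x * pullback \<phi> Y V g x)"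
  "pullback \<phi> Y V (\<lambda>x\<in>V. c) = (\<lambda>x\<in>preim \<phi> Y V. c)"
  by (intro ext, simp add: pullback_def preim_def restrict_def)+

lemma pullback_restrict_subset:
  "W \<subseteq> V \<Longrightarrow> pullback \<phi> Y W (restrict f W) = restrict (pullback \<phi> Y V f) (preim \<phi> Y W)"
  by (intro ext) (auto simp: pullback_def preim_def restrict_def)

lemma module_sheaf_pushforward:
  assumes S: "sheaf_of_functions S" and \<phi>: "morphism Y S \<phi>" and F: "module_sheaf Y F"
  shows "module_sheaf S (pushforward \<phi> Y F)"
proof -
  let ?P = "preim \<phi> Y"
  note o = morphism_open[OF \<phi>] and r = pullback_reg[OF S \<phi>]
  have glue: "\<exists>!s. s \<in> carrier (sec F (?P (\<Union>\<V>))) \<and> (\<forall>V\<in>\<V>. restr F (?P V) s = \<sigma> V)"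
    if 1: "\<forall>V\<in>\<V>. openX S V \<and> \<sigma> V \<in> carrier (sec F (?P V))"
      and 2: "\<forall>V\<in>\<V>. \<forall>W\<in>\<V>. restr F (?P (V \<inter> W)) (\<sigma> V) = restr F (?P (V \<inter> W)) (\<sigma> W)" for \<V> \<sigma>
  proof -
    \<comment> \<open>Upstairs the family must be indexed by preimages, and different
      \<open>V\<close> may have the same preimage. Compatibility makes their sections equal, so any
      choice will do.\<close>
    define \<tau> where "\<tau> U = \<sigma> (SOME V. V \<in> \<V> \<and> ?P V = U)" for U
    have \<tau>: "\<tau> (?P V) = \<sigma> V" if V: "V \<in> \<V>" for V
    proof -
      define V' where "V' = (SOME V'. V' \<in> \<V> \<and> ?P V' = ?P V)"
      have V': "V' \<in> \<V>" "?P V' = ?P V"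
        using someI[of "\<lambda>V'. V' \<in> \<V> \<and> ?P V' = ?P V" V] V unfolding V'_def by auto
      have "restr F (?P V) (\<sigma> V') = restr F (?P V) (\<sigma> V)"
        using 2[rule_format, OF V'(1) V] V'(2) by (simp add: preim_Int)
      moreover have "restr F (?P V) (\<sigma> V) = \<sigma> V"
        using module_sheaf_restr_id[OF F o] 1 V by blast
      moreover have "restr F (?P V') (\<sigma> V') = \<sigma> V'"
        using module_sheaf_restr_id[OF F o] 1 V'(1) by blast
      ultimately show ?thesis unfolding \<tau>_def V'_def[symmetric] V'(2) by simp
    qed
    have "\<exists>!s. s \<in> carrier (sec F (\<Union>(?P ` \<V>))) \<and> (\<forall>U\<in>?P ` \<V>. restr F U s = \<tau> U)"
    proof (rule module_sheaf_glue[OF F])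
      show "openX Y U \<and> \<tau> U \<in> carrier (sec F U)" if "U \<in> ?P ` \<V>" for U
        using that 1 o \<tau> by auto
      show "restr F (U \<inter> U') (\<tau> U) = restr F (U \<inter> U') (\<tau> U')" if "U \<in> ?P ` \<V>" "U' \<in> ?P ` \<V>" for U U'
        using that 2 \<tau> by (auto simp: preim_Int)
    qed
    then show ?thesis by (simp add: preim_Union \<tau>)
  qed
  show ?thesis
    unfolding module_sheaf_def
  proof (intro conjI allI impI ballI, goal_cases)
    case (1 V)
    interpret M: module "sec (\<O> Y) (?P V)" "sec F (?P V)"
      by (rule module_sheaf_module[OF F o[OF 1]])
    have a: "abelian_group (sec (pushforward \<phi> Y F) V)"
      by (rule abelian_groupI)
         (auto simp: M.a_ac intro!: bexI[of _ "\<ominus>\<^bsub>sec F (?P V)\<^esub> _"] M.l_neg)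
    show ?case
      by (rule moduleI[OF cring_sections[OF S 1] a])
         (use r[OF 1] M.smult_l_distr M.smult_r_distr M.smult_assoc1 M.smult_one M.smult_closed in
           \<open>auto simp: pullback_arith\<close>)
  next
    case (2 V W s) then show ?case using module_sheaf_restr[OF F o[of V] o[of W] preim_mono] by simp
  next
    case (3 V W s t) then show ?case using module_sheaf_restr_add[OF F o[of V] o[of W] preim_mono] by simp
  next
    case (4 V W s f)
    then show ?case using module_sheaf_restr_smult[OF F o[of V] o[of W] preim_mono] r[of W]
      by (simp add: pullback_restrict_subset[of V W])
  next
    case (5 V W s U) then show ?case using module_sheaf_restr_restr[OF F o[of V] o[of W] preim_mono _ o[of U] preim_mono] by simp
  next
    case (6 V s) then show ?case using module_sheaf_restr_id[OF F o] by simp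
  next
    case (7 \<V> \<sigma>)
    then show ?case using glue[of \<V> \<sigma>, OF 7[THEN conjunct1, simplified] 7[THEN conjunct2, simplified]] by simp
  qed
qed

lemma sheaf_hom_pullback:
  assumes S: "sheaf_of_functions S" and \<phi>: "morphism Y S \<phi>"
  shows "sheaf_hom S (\<O> S) (pushforward \<phi> Y (\<O> Y)) (pullback \<phi> Y)"
  unfolding sheaf_hom_def
  using pullback_reg[OF S \<phi>] by (auto simp: pullback_arith pullback_restrict_subset)

lemma perm3_iff:
  "{#a, b, c#} = {#x, y, z#} \<longleftrightarrow>
     (a, b, c) \<in> {(x, y, z), (x, z, y), (y, x, z), (y, z, x), (z, x, y), (z, y, x)}"
  by (auto simp: add_eq_conv_ex)

section \<open>Kaehler differentials\<close>

lemma diff_free_simps [simp]: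
  "carrier (diff_free R) = {m \<in> carrier R \<rightarrow>\<^sub>E carrier R. finite {b \<in> carrier R. m b \<noteq> \<zero>\<^bsub>R\<^esub>}}"
  "\<zero>\<^bsub>diff_free R\<^esub> = (\<lambda>b\<in>carrier R. \<zero>\<^bsub>R\<^esub>)"
  "m \<oplus>\<^bsub>diff_free R\<^esub> n = (\<lambda>b\<in>carrier R. m b \<oplus>\<^bsub>R\<^esub> n b)"
  "a \<odot>\<^bsub>diff_free R\<^esub> m = (\<lambda>b\<in>carrier R. a \<otimes>\<^bsub>R\<^esub> m b)"
  by (simp_all add: diff_free_def)

context cring
begin

lemma module_diff_free: "module R (diff_free R)"
proof -
  have fin: "finite {b \<in> carrier R. f b \<noteq> \<zero>}"
    if "finite {b \<in> carrier R. m b \<noteq> \<zero>}" "finite {b \<in> carrier R. n b \<noteq> \<zero>}"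
      "\<And>b. b \<in> carrier R \<Longrightarrow> m b = \<zero> \<Longrightarrow> n b = \<zero> \<Longrightarrow> f b = \<zero>" for f m n
    by (rule finite_subset[OF _ finite_UnI[OF that(1,2)]]) (use that(3) in auto)
  have mem: "m b \<in> carrier R" if "m \<in> carrier R \<rightarrow>\<^sub>E carrier R" "b \<in> carrier R" for m b
    using that by blast
  have eq: "(\<lambda>b\<in>carrier R. f b) = m"
    if "m \<in> carrier R \<rightarrow>\<^sub>E carrier R" "\<And>b. b \<in> carrier R \<Longrightarrow> f b = m b" for f m
    using that by (intro ext) (auto simp: PiE_def extensional_def)
  show ?thesis
  proof (rule moduleI[OF is_cring abelian_groupI], goal_cases)
    case (1 m n)
    then show ?case using fin[of m n "\<lambda>b\<in>carrier R. m b \<oplus> n b"] mem by auto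
  next
    case 2 then show ?case by auto
  next
    case (3 x y z) then show ?case by (auto intro!: restrict_ext simp: a_assoc mem)
  next
    case (4 x y) then show ?case by (auto intro!: restrict_ext simp: a_comm mem)
  next
    case (5 x) then show ?case by (auto intro!: eq simp: mem)
  next
    case (6 x)
    have "(\<lambda>b\<in>carrier R. \<ominus> x b) \<in> carrier (diff_free R)"
      using 6 fin[of x x "\<lambda>b\<in>carrier R. \<ominus> x b"] mem by auto
    moreover have "(\<lambda>b\<in>carrier R. \<ominus> x b) \<oplus>\<^bsub>diff_free R\<^esub> x = \<zero>\<^bsub>diff_free R\<^esub>"
      using 6 by (auto intro!: restrict_ext simp: l_neg mem)
    ultimately show ?case by blast
  next
    case (7 a m) then show ?case using fin[of m m "\<lambda>b\<in>carrier R. a \<otimes> m b"] mem by auto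
  next
    case (8 a b x) then show ?case by (auto intro!: restrict_ext simp: l_distr mem)
  next
    case (9 a x y) then show ?case by (auto intro!: restrict_ext simp: r_distr mem)
  next
    case (10 a b x) then show ?case by (auto intro!: restrict_ext simp: m_assoc mem)
  next
    case (11 x) then show ?case by (auto intro!: eq simp: mem)
  qed
qed

lemma diff_symbol_closed: "b \<in> carrier R \<Longrightarrow> diff_symbol R b \<in> carrier (diff_free R)"
  by (auto simp: diff_symbol_def)

end

locale differentials = cring R for R (structure) +
  fixes K
  assumes K: "K \<subseteq> carrier R"
begin

abbreviation "F \<equiv> diff_free R"
abbreviation "N \<equiv> diff_kernel R K"
abbreviation "\<delta> \<equiv> diff_symbol R"
abbreviation "\<Omega> \<equiv> kaehler R K"
abbreviation "d \<equiv> univ_deriv R K"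

sublocale F: module R F by (rule module_diff_free)

declare diff_free_simps [simp del]

lemma diff_relations_closed: "diff_relations R K \<subseteq> carrier F"
  using diff_symbol_closed K unfolding diff_relations_def Let_def
  by (auto intro!: F.minus_closed F.add.m_closed F.smult_closed)

lemma submodule_diff_kernel: "submodule N R F"
proof -
  let ?S = "{N. submodule N R F \<and> diff_relations R K \<subseteq> N}"
  have c: "carrier F \<in> ?S" using F.carrier_is_submodule diff_relations_closed by blast
  show ?thesis
    unfolding diff_kernel_def
  proof (rule F.submoduleI)
    show "\<Inter>?S \<subseteq> carrier F" using c by blast
    show "\<zero>\<^bsub>F\<^esub> \<in> \<Inter>?S"
      using subgroup.one_closed[OF submodule.axioms(1)] by fastforce
    show "\<ominus>\<^bsub>F\<^esub> a \<in> \<Inter>?S" if "a \<in> \<Inter>?S" for a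
      using that F.submoduleE(3) by blast
    show "a \<oplus>\<^bsub>F\<^esub> b \<in> \<Inter>?S" if "a \<in> \<Inter>?S" "b \<in> \<Inter>?S" for a b
      using that F.submoduleE(5) by blast
    show "a \<odot>\<^bsub>F\<^esub> b \<in> \<Inter>?S" if "a \<in> carrier R" "b \<in> \<Inter>?S" for a b
      using that F.submoduleE(4) by blast
  qed
qed

lemma diff_relations_kernel: "diff_relations R K \<subseteq> N"
  unfolding diff_kernel_def by blast

sublocale N: abelian_subgroup N F
  by (intro abelian_subgroupI3 additive_subgroupI submodule.axioms(1)[OF submodule_diff_kernel]
      F.abelian_group_axioms)

definition cls :: "('a \<Rightarrow> 'a) \<Rightarrow> ('a \<Rightarrow> 'a) set" where
  "cls m = N +>\<^bsub>F\<^esub> m"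

lemma cls_eqI:
  assumes "m \<in> carrier F" "n \<in> carrier F" "m \<ominus>\<^bsub>F\<^esub> n \<in> N"
  shows "cls m = cls n"
proof -
  have "m \<in> N +>\<^bsub>F\<^esub> n"
    using assms by (intro N.a_rcos_module_rev) (simp_all add: a_minus_def)
  then show ?thesis unfolding cls_def using N.a_repr_independence' assms(2) by blast
qed

lemma cls_eqD:
  assumes "m \<in> carrier F" "n \<in> carrier F" "cls m = cls n"
  shows "m \<ominus>\<^bsub>F\<^esub> n \<in> N"
  using N.a_rcos_module_imp[OF assms(2), of m] N.a_rcos_self[OF assms(1)] assms(3)
  by (simp add: cls_def a_minus_def)

lemma carrier_kaehler: "carrier \<Omega> = cls ` carrier F"
  by (auto simp: kaehler_def Let_def A_RCOSETS_def' cls_def)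

lemma zero_kaehler: "\<zero>\<^bsub>\<Omega>\<^esub> = cls \<zero>\<^bsub>F\<^esub>"
  by (simp add: kaehler_def Let_def cls_def F.a_coset_add_zero N.a_subset)

lemma add_kaehler: "m \<in> carrier F \<Longrightarrow> n \<in> carrier F \<Longrightarrow> cls m \<oplus>\<^bsub>\<Omega>\<^esub> cls n = cls (m \<oplus>\<^bsub>F\<^esub> n)"
  by (simp add: kaehler_def Let_def cls_def N.a_rcos_sum)

text \<open>The union in \<open>kaehler\<close> runs over a coset whose members have congruent
  multiples, the kernel being a submodule; hence all its terms coincide.\<close>

lemma smult_kaehler:
  assumes a: "a \<in> carrier R" and m: "m \<in> carrier F"
  shows "a \<odot>\<^bsub>\<Omega>\<^esub> cls m = cls (a \<odot>\<^bsub>F\<^esub> m)"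
proof -
  have "cls (a \<odot>\<^bsub>F\<^esub> m') = cls (a \<odot>\<^bsub>F\<^esub> m)" if m': "m' \<in> cls m" for m'
  proof -
    have c: "m' \<in> carrier F"
      using m' F.a_r_coset_subset_G[OF N.a_subset m] by (auto simp: cls_def)
    have "m' \<oplus>\<^bsub>F\<^esub> \<ominus>\<^bsub>F\<^esub> m \<in> N" using N.a_rcos_module_imp[OF m] m' by (simp add: cls_def)
    then have "a \<odot>\<^bsub>F\<^esub> (m' \<oplus>\<^bsub>F\<^esub> \<ominus>\<^bsub>F\<^esub> m) \<in> N" by (rule F.submoduleE(4)[OF submodule_diff_kernel a])
    then have "a \<odot>\<^bsub>F\<^esub> m' \<ominus>\<^bsub>F\<^esub> a \<odot>\<^bsub>F\<^esub> m \<in> N"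
      using a m c by (simp add: a_minus_def F.smult_r_distr F.smult_r_minus)
    then show ?thesis using a m c by (intro cls_eqI) auto
  qed
  moreover have "m \<in> cls m" using N.a_rcos_self[OF m] by (simp add: cls_def)
  ultimately have "(\<Union>m'\<in>cls m. cls (a \<odot>\<^bsub>F\<^esub> m')) = cls (a \<odot>\<^bsub>F\<^esub> m)" by blast
  then show ?thesis by (simp add: kaehler_def Let_def cls_def)
qed

lemma module_kaehler: "module R \<Omega>"
proof (rule moduleI[OF is_cring abelian_groupI], goal_cases)
  case (6 x)
  then obtain m where m: "m \<in> carrier F" "x = cls m" by (auto simp: carrier_kaehler)
  then show ?case
    by (auto simp: carrier_kaehler zero_kaehler add_kaehler F.l_neg intro!: bexI[of _ "\<ominus>\<^bsub>F\<^esub> m"])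
qed (auto simp: carrier_kaehler zero_kaehler add_kaehler smult_kaehler F.a_ac F.smult_l_distr
      F.smult_r_distr F.smult_assoc1 F.smult_one)

sublocale \<Omega>: module R \<Omega> by (rule module_kaehler)

lemma univ_deriv_cls: "d b = cls (\<delta> b)"
  by (simp add: univ_deriv_def cls_def)

lemma univ_deriv_closed [simp]: "b \<in> carrier R \<Longrightarrow> d b \<in> carrier \<Omega>"
  by (simp add: univ_deriv_cls carrier_kaehler diff_symbol_closed)

lemma univ_deriv_add:
  assumes "a \<in> carrier R" "b \<in> carrier R"
  shows "d (a \<oplus> b) = d a \<oplus>\<^bsub>\<Omega>\<^esub> d b"
proof -
  have "\<delta> (a \<oplus> b) \<ominus>\<^bsub>F\<^esub> (\<delta> a \<oplus>\<^bsub>F\<^esub> \<delta> b) \<in> N"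
    using diff_relations_kernel assms unfolding diff_relations_def Let_def by blast
  then show ?thesis
    using assms by (simp add: univ_deriv_cls add_kaehler diff_symbol_closed cls_eqI)
qed

lemma univ_deriv_mult:
  assumes "a \<in> carrier R" "b \<in> carrier R"
  shows "d (a \<otimes> b) = a \<odot>\<^bsub>\<Omega>\<^esub> d b \<oplus>\<^bsub>\<Omega>\<^esub> b \<odot>\<^bsub>\<Omega>\<^esub> d a"
proof -
  have "\<delta> (a \<otimes> b) \<ominus>\<^bsub>F\<^esub> (a \<odot>\<^bsub>F\<^esub> \<delta> b \<oplus>\<^bsub>F\<^esub> b \<odot>\<^bsub>F\<^esub> \<delta> a) \<in> N"
    using diff_relations_kernel assms unfolding diff_relations_def Let_def by blast
  then show ?thesis
    using assms by (simp add: univ_deriv_cls add_kaehler smult_kaehler diff_symbol_closed cls_eqI)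
qed

lemma univ_deriv_const:
  assumes "k \<in> K"
  shows "d k = \<zero>\<^bsub>\<Omega>\<^esub>"
proof -
  have k: "k \<in> carrier R" using assms K by blast
  have "\<delta> k \<in> N"
    using diff_relations_kernel assms unfolding diff_relations_def Let_def by blast
  then have "\<delta> k \<ominus>\<^bsub>F\<^esub> \<zero>\<^bsub>F\<^esub> \<in> N" using k by (simp add: a_minus_def diff_symbol_closed)
  then show ?thesis using k by (simp add: univ_deriv_cls zero_kaehler diff_symbol_closed cls_eqI)
qed

text \<open>The universal property in the form needed below: a biadditive map into an abelian group
  modulo a subgroup \<open>Z\<close> which satisfies the Leibniz rule modulo \<open>Z\<close>.\<close>

context
  fixes \<phi> :: "'a \<Rightarrow> 'a \<Rightarrow> 'e::ab_group_add" and Z :: "'e set"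
  assumes Z0: "0 \<in> Z" and Zdiff: "\<And>x y. x \<in> Z \<Longrightarrow> y \<in> Z \<Longrightarrow> x - y \<in> Z"
    and addl: "\<And>a a' b. a \<in> carrier R \<Longrightarrow> a' \<in> carrier R \<Longrightarrow> b \<in> carrier R \<Longrightarrow>
      \<phi> (a \<oplus> a') b - (\<phi> a b + \<phi> a' b) \<in> Z"
    and addr: "\<And>a b b'. a \<in> carrier R \<Longrightarrow> b \<in> carrier R \<Longrightarrow> b' \<in> carrier R \<Longrightarrow>
      \<phi> a (b \<oplus> b') - (\<phi> a b + \<phi> a b') \<in> Z"
    and leib: "\<And>a b c. a \<in> carrier R \<Longrightarrow> b \<in> carrier R \<Longrightarrow> c \<in> carrier R \<Longrightarrow>
      \<phi> a (b \<otimes> c) - (\<phi> (a \<otimes> b) c + \<phi> (a \<otimes> c) b) \<in> Z"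
    and const_Z: "\<And>a k. a \<in> carrier R \<Longrightarrow> k \<in> K \<Longrightarrow> \<phi> a k \<in> Z"
begin

lemma Zadd: "x \<in> Z \<Longrightarrow> y \<in> Z \<Longrightarrow> x + y \<in> Z"
  using Zdiff[of x "0 - y"] Zdiff[OF Z0, of y] by simp

lemma Zminus: "x \<in> Z \<Longrightarrow> - x \<in> Z"
  using Zdiff[OF Z0, of x] by simp

lemma Zsum: "finite T \<Longrightarrow> (\<And>x. x \<in> T \<Longrightarrow> f x \<in> Z) \<Longrightarrow> sum f T \<in> Z"
  by (induction T rule: finite_induct) (auto simp: Z0 Zadd)

lemma phi_zero: "b \<in> carrier R \<Longrightarrow> \<phi> \<zero> b \<in> Z"
  using addl[of \<zero> \<zero> b] Zminus by fastforce

text \<open>The linear extension of \<phi> to the free module, known only up to \<open>Z\<close>. It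
  is a relation with a free choice of the finite set \<open>T\<close>: a zero coefficient is sent
  into \<open>Z\<close> but not necessarily to 0, so enlarging the support changes the sum by an
  element of \<open>Z\<close>.\<close>

definition val :: "('a \<Rightarrow> 'a) \<Rightarrow> 'e \<Rightarrow> bool" where
  "val m e \<longleftrightarrow> (\<exists>T. finite T \<and> T \<subseteq> carrier R \<and> (\<forall>b\<in>carrier R - T. m b = \<zero>) \<and>
     (\<Sum>b\<in>T. \<phi> (m b) b) - e \<in> Z)"

lemma val_enlarge:
  assumes m: "finite T" "T \<subseteq> carrier R" "\<forall>b\<in>carrier R - T. m b = \<zero>" "(\<Sum>b\<in>T. \<phi> (m b) b) - e \<in> Z"
    and T': "finite T'" "T \<subseteq> T'" "T' \<subseteq> carrier R"
  shows "(\<Sum>b\<in>T'. \<phi> (m b) b) - e \<in> Z"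
proof -
  have s: "(\<Sum>b\<in>T' - T. \<phi> (m b) b) \<in> Z" 
  proof (rule Zsum)
    fix b assume "b \<in> T' - T"
    then have "m b = \<zero>" "b \<in> carrier R" using m(3) T'(3) by blast+
    then show "\<phi> (m b) b \<in> Z" by (simp add: phi_zero)
  qed (use T' in simp)
  have "(\<Sum>b\<in>T'. \<phi> (m b) b) = (\<Sum>b\<in>T' - T. \<phi> (m b) b) + (\<Sum>b\<in>T. \<phi> (m b) b)"
    using T' by (intro sum.subset_diff) auto
  then show ?thesis using Zadd[OF s m(4)] by (simp add: algebra_simps)
qed

lemma val_unique:
  assumes "val m e" "val m e'"
  shows "e - e' \<in> Z"
proof -
  obtain T where T: "finite T" "T \<subseteq> carrier R" "\<forall>b\<in>carrier R - T. m b = \<zero>" "(\<Sum>b\<in>T. \<phi> (m b) b) - e \<in> Z"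
    using assms(1) unfolding val_def by blast
  obtain U where U: "finite U" "U \<subseteq> carrier R" "\<forall>b\<in>carrier R - U. m b = \<zero>" "(\<Sum>b\<in>U. \<phi> (m b) b) - e' \<in> Z"
    using assms(2) unfolding val_def by blast
  have "(\<Sum>b\<in>T \<union> U. \<phi> (m b) b) - e \<in> Z" "(\<Sum>b\<in>T \<union> U. \<phi> (m b) b) - e' \<in> Z"
    using val_enlarge[OF T, of "T \<union> U"] val_enlarge[OF U, of "T \<union> U"] T U by auto
  from Zdiff[OF this(2,1)] show ?thesis by simp
qed

lemma val_cong:
  assumes "val m e" "e - e' \<in> Z"
  shows "val m e'"
proof -
  obtain T where T: "finite T" "T \<subseteq> carrier R" "\<forall>b\<in>carrier R - T. m b = \<zero>" "(\<Sum>b\<in>T. \<phi> (m b) b) - e \<in> Z"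
    using assms(1) unfolding val_def by blast
  have "(\<Sum>b\<in>T. \<phi> (m b) b) - e' \<in> Z" using Zadd[OF T(4) assms(2)] by simp
  then show ?thesis unfolding val_def using T by blast
qed

lemma val_add:
  assumes mn: "m \<in> carrier F" "n \<in> carrier F" and "val m e" "val n f"
  shows "val (m \<oplus>\<^bsub>F\<^esub> n) (e + f)"
proof -
  obtain T where T: "finite T" "T \<subseteq> carrier R" "\<forall>b\<in>carrier R - T. m b = \<zero>" "(\<Sum>b\<in>T. \<phi> (m b) b) - e \<in> Z"
    using assms(3) unfolding val_def by blast
  obtain U where U: "finite U" "U \<subseteq> carrier R" "\<forall>b\<in>carrier R - U. n b = \<zero>" "(\<Sum>b\<in>U. \<phi> (n b) b) - f \<in> Z"
    using assms(4) unfolding val_def by blast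
  have c: "m b \<in> carrier R" "n b \<in> carrier R" if "b \<in> carrier R" for b
    using mn that by (auto simp: diff_free_simps)
  have 1: "(\<Sum>b\<in>T \<union> U. \<phi> (m b) b) - e \<in> Z" "(\<Sum>b\<in>T \<union> U. \<phi> (n b) b) - f \<in> Z"
    using val_enlarge[OF T, of "T \<union> U"] val_enlarge[OF U, of "T \<union> U"] T U by auto
  have "(\<Sum>b\<in>T \<union> U. \<phi> ((m \<oplus>\<^bsub>F\<^esub> n) b) b - (\<phi> (m b) b + \<phi> (n b) b)) \<in> Z"
    using T U c by (intro Zsum) (auto simp: diff_free_simps intro!: addl)
  from Zadd[OF this Zadd[OF 1]]
  have "(\<Sum>b\<in>T \<union> U. \<phi> ((m \<oplus>\<^bsub>F\<^esub> n) b) b) - (e + f) \<in> Z"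
    by (simp add: sum.distrib sum_subtractf algebra_simps)
  moreover have "\<forall>b\<in>carrier R - (T \<union> U). (m \<oplus>\<^bsub>F\<^esub> n) b = \<zero>"
    using T U by (auto simp: diff_free_simps)
  ultimately show ?thesis unfolding val_def using T U by (intro exI[of _ "T \<union> U"]) auto
qed

lemma val_zero: "val \<zero>\<^bsub>F\<^esub> 0"
  unfolding val_def by (intro exI[of _ "{}"]) (auto simp: diff_free_simps Z0)

lemma val_total:
  assumes "m \<in> carrier F"
  shows "val m (\<Sum>b | b \<in> carrier R \<and> m b \<noteq> \<zero>. \<phi> (m b) b)"
  unfolding val_def
  by (rule exI[of _ "{b \<in> carrier R. m b \<noteq> \<zero>}"]) (use assms in \<open>auto simp: diff_free_simps Z0\<close>)

text \<open>Nothing is assumed about \<phi> and negation; but any value of -m, added to e, is a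
  value of zero and hence lies in \<open>Z\<close>.\<close>

lemma val_minus:
  assumes "m \<in> carrier F" "val m e"
  shows "val (\<ominus>\<^bsub>F\<^esub> m) (- e)"
proof -
  obtain f where f: "val (\<ominus>\<^bsub>F\<^esub> m) f" using val_total assms(1) by blast
  have "val (\<ominus>\<^bsub>F\<^esub> m \<oplus>\<^bsub>F\<^esub> m) (f + e)" by (rule val_add) (use assms f in auto)
  then have "val \<zero>\<^bsub>F\<^esub> (f + e)" using assms(1) by (simp add: F.l_neg)
  from val_unique[OF this val_zero] show ?thesis by (intro val_cong[OF f]) simp
qed

lemma val_diff:
  assumes "m \<in> carrier F" "n \<in> carrier F" "val m e" "val n f"
  shows "val (m \<ominus>\<^bsub>F\<^esub> n) (e - f)"
  using val_add[OF assms(1) _ assms(3) val_minus[OF assms(2,4)]] assms by (simp add: a_minus_def)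

lemma val_single:
  assumes "a \<in> carrier R" "b \<in> carrier R"
  shows "val (a \<odot>\<^bsub>F\<^esub> \<delta> b) (\<phi> a b)"
  unfolding val_def
  by (rule exI[of _ "{b}"]) (use assms in \<open>auto simp: diff_free_simps diff_symbol_def Z0\<close>)

text \<open>The kernel is the least submodule containing the relations, so it is enough to exhibit a
  submodule on which the value 0 occurs. Requiring this of all multiples of m makes the set closed
  under scalars, although \<open>'e\<close> carries no action of the ring.\<close>

lemma val_kernel:
  assumes "m \<in> N"
  shows "val m 0"
proof -
  let ?P = "{m \<in> carrier F. \<forall>r\<in>carrier R. val (r \<odot>\<^bsub>F\<^esub> m) 0}"
  have "submodule ?P R F"
  proof (rule F.submoduleI)
    show "\<zero>\<^bsub>F\<^esub> \<in> ?P" using val_zero by simp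
    show "\<ominus>\<^bsub>F\<^esub> m \<in> ?P" if "m \<in> ?P" for m
      using that val_minus[of "_ \<odot>\<^bsub>F\<^esub> m" 0] by (auto simp: F.smult_r_minus)
    show "m \<oplus>\<^bsub>F\<^esub> n \<in> ?P" if "m \<in> ?P" "n \<in> ?P" for m n
      using that val_add[of "_ \<odot>\<^bsub>F\<^esub> m" "_ \<odot>\<^bsub>F\<^esub> n" 0 0] by (auto simp: F.smult_r_distr)
    show "a \<odot>\<^bsub>F\<^esub> m \<in> ?P" if "a \<in> carrier R" "m \<in> ?P" for a m
      using that by (auto simp flip: F.smult_assoc1)
  qed auto
  moreover have "diff_relations R K \<subseteq> ?P"
  proof
    fix m assume m: "m \<in> diff_relations R K"
    then have mc: "m \<in> carrier F" using diff_relations_closed by blast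
    have "val (r \<odot>\<^bsub>F\<^esub> m) 0" if r: "r \<in> carrier R" for r
    proof -
      consider (add) a b where "m = \<delta> (a \<oplus> b) \<ominus>\<^bsub>F\<^esub> (\<delta> a \<oplus>\<^bsub>F\<^esub> \<delta> b)" "a \<in> carrier R" "b \<in> carrier R"
        | (mult) a b where "m = \<delta> (a \<otimes> b) \<ominus>\<^bsub>F\<^esub> (a \<odot>\<^bsub>F\<^esub> \<delta> b \<oplus>\<^bsub>F\<^esub> b \<odot>\<^bsub>F\<^esub> \<delta> a)" "a \<in> carrier R" "b \<in> carrier R"
        | (const) k where "m = \<delta> k" "k \<in> K"
        using m unfolding diff_relations_def Let_def by blast
      then show ?thesis
      proof cases
        case add
        have "val (r \<odot>\<^bsub>F\<^esub> \<delta> (a \<oplus> b) \<ominus>\<^bsub>F\<^esub> (r \<odot>\<^bsub>F\<^esub> \<delta> a \<oplus>\<^bsub>F\<^esub> r \<odot>\<^bsub>F\<^esub> \<delta> b)) (\<phi> r (a \<oplus> b) - (\<phi> r a + \<phi> r b))"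
          using add r by (intro val_diff val_add val_single) (auto intro: diff_symbol_closed)
        moreover have "r \<odot>\<^bsub>F\<^esub> \<delta> (a \<oplus> b) \<ominus>\<^bsub>F\<^esub> (r \<odot>\<^bsub>F\<^esub> \<delta> a \<oplus>\<^bsub>F\<^esub> r \<odot>\<^bsub>F\<^esub> \<delta> b) = r \<odot>\<^bsub>F\<^esub> m"
          using add r by (simp add: a_minus_def F.smult_r_distr F.smult_r_minus diff_symbol_closed)
        ultimately show ?thesis using addr[OF r add(2,3)] by (auto intro: val_cong)
      next
        case mult
        have "val (r \<odot>\<^bsub>F\<^esub> \<delta> (a \<otimes> b) \<ominus>\<^bsub>F\<^esub> ((r \<otimes> a) \<odot>\<^bsub>F\<^esub> \<delta> b \<oplus>\<^bsub>F\<^esub> (r \<otimes> b) \<odot>\<^bsub>F\<^esub> \<delta> a))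
           (\<phi> r (a \<otimes> b) - (\<phi> (r \<otimes> a) b + \<phi> (r \<otimes> b) a))"
          using mult r by (intro val_diff val_add val_single) (auto intro: diff_symbol_closed)
        moreover have "r \<odot>\<^bsub>F\<^esub> \<delta> (a \<otimes> b) \<ominus>\<^bsub>F\<^esub> ((r \<otimes> a) \<odot>\<^bsub>F\<^esub> \<delta> b \<oplus>\<^bsub>F\<^esub> (r \<otimes> b) \<odot>\<^bsub>F\<^esub> \<delta> a) = r \<odot>\<^bsub>F\<^esub> m"
          using mult r
          by (simp add: a_minus_def F.smult_r_distr F.smult_r_minus diff_symbol_closed F.smult_assoc1)
        ultimately show ?thesis using leib[OF r mult(2,3)] by (auto intro: val_cong)
      next
        case const
        then have "k \<in> carrier R" using K by blast
        from val_single[OF r this] const show ?thesis using const_Z[OF r const(2)] by (auto intro: val_cong)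
      qed
    qed
    then show "m \<in> ?P" using mc by blast
  qed
  ultimately have "N \<subseteq> ?P" unfolding diff_kernel_def by blast
  then have m: "m \<in> carrier F" "\<forall>r\<in>carrier R. val (r \<odot>\<^bsub>F\<^esub> m) 0" using assms by blast+
  then show ?thesis using m(2)[rule_format, of \<one>] by (simp add: F.smult_one)
qed

text \<open>This is how a relation between differentials is exploited: it forces the corresponding
  sum of values of \<phi> into \<open>Z\<close>. Later \<phi> is the candidate inverse of
  \<open>D\<close>, up to a factor, and \<open>Z\<close> consists of restrictions of symmetric
  functions.\<close>

lemma kaehler_sum_zero:
  assumes ts: "set ts \<subseteq> carrier R \<times> carrier R"
    and zero: "foldr (\<lambda>(a, b) \<omega>. a \<odot>\<^bsub>\<Omega>\<^esub> d b \<oplus>\<^bsub>\<Omega>\<^esub> \<omega>) ts \<zero>\<^bsub>\<Omega>\<^esub> = \<zero>\<^bsub>\<Omega>\<^esub>"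
  shows "(\<Sum>(a, b)\<leftarrow>ts. \<phi> a b) \<in> Z"
proof -
  define m where "m = foldr (\<lambda>(a, b) \<omega>. a \<odot>\<^bsub>F\<^esub> \<delta> b \<oplus>\<^bsub>F\<^esub> \<omega>) ts \<zero>\<^bsub>F\<^esub>"
  have "m \<in> carrier F \<and> cls m = foldr (\<lambda>(a, b) \<omega>. a \<odot>\<^bsub>\<Omega>\<^esub> d b \<oplus>\<^bsub>\<Omega>\<^esub> \<omega>) ts \<zero>\<^bsub>\<Omega>\<^esub> \<and>
      val m (\<Sum>(a, b)\<leftarrow>ts. \<phi> a b)"
    using ts unfolding m_def
  proof (induction ts)
    case Nil
    then show ?case by (simp add: zero_kaehler val_zero)
  next
    case (Cons t ts)
    obtain a b where t: "t = (a, b)" by (cases t)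
    let ?n = "foldr (\<lambda>(a, b) \<omega>. a \<odot>\<^bsub>F\<^esub> \<delta> b \<oplus>\<^bsub>F\<^esub> \<omega>) ts \<zero>\<^bsub>F\<^esub>"
    have ab: "a \<in> carrier R" "b \<in> carrier R" and IH: "?n \<in> carrier F"
      "cls ?n = foldr (\<lambda>(a, b) \<omega>. a \<odot>\<^bsub>\<Omega>\<^esub> d b \<oplus>\<^bsub>\<Omega>\<^esub> \<omega>) ts \<zero>\<^bsub>\<Omega>\<^esub>" "val ?n (\<Sum>(a, b)\<leftarrow>ts. \<phi> a b)"
      using Cons t by auto
    have s: "a \<odot>\<^bsub>F\<^esub> \<delta> b \<in> carrier F" using ab by (simp add: diff_symbol_closed)
    show ?case
      using s IH(1) IH(2)[symmetric] val_add[OF s IH(1) val_single[OF ab] IH(3)] ab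
      by (simp add: t univ_deriv_cls smult_kaehler add_kaehler diff_symbol_closed)
  qed
  then have m: "m \<in> carrier F" "cls m = cls \<zero>\<^bsub>F\<^esub>" "val m (\<Sum>(a, b)\<leftarrow>ts. \<phi> a b)"
    using zero by (simp_all add: zero_kaehler)
  have "m \<ominus>\<^bsub>F\<^esub> \<zero>\<^bsub>F\<^esub> \<in> N" by (rule cls_eqD) (use m in auto)
  moreover have "\<ominus>\<^bsub>F\<^esub> \<zero>\<^bsub>F\<^esub> = \<zero>\<^bsub>F\<^esub>" by (rule F.minus_equality) auto
  ultimately have "m \<in> N" using m(1) by (simp add: a_minus_def)
  from val_unique[OF m(3) val_kernel[OF this]] show ?thesis by simp
qed

end

end

section \<open>Germs of functions and differential forms\<close>

text \<open>Representatives instead of classes: they form an algebra under the pointwise operations,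
  and \<open>germ X x\<close> maps them onto the local ring.\<close>

definition germs_at :: "'a fspace \<Rightarrow> 'a \<Rightarrow> ('a \<Rightarrow> complex) set" where
  "germs_at X x = {f. \<exists>U. openX X U \<and> x \<in> U \<and> f \<in> regs X U}"

lemma germs_atI: "openX X U \<Longrightarrow> x \<in> U \<Longrightarrow> f \<in> regs X U \<Longrightarrow> f \<in> germs_at X x"
  unfolding germs_at_def by blast

lemma fun_alg_germs_at:
  assumes X: "sheaf_of_functions X" and x: "x \<in> points X"
  shows "fun_alg (germs_at X x)"
  unfolding fun_alg_def
proof (intro conjI allI ballI)
  fix c show "(\<lambda>x. c) \<in> germs_at X x"
    by (rule germs_atI[OF openin_topspace x fun_alg_const[OF fun_alg_regs[OF X openin_topspace]]])
next
  fix f g assume "f \<in> germs_at X x" "g \<in> germs_at X x"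
  then obtain U V where UV: "openX X U" "x \<in> U" "f \<in> regs X U" "openX X V" "x \<in> V" "g \<in> regs X V"
    unfolding germs_at_def by blast
  have o: "openX X (U \<inter> V)" using UV by auto
  have fg: "f \<in> regs X (U \<inter> V)" "g \<in> regs X (U \<inter> V)"
    using regs_subset[OF X UV(1) o _ UV(3)] regs_subset[OF X UV(4) o _ UV(6)] by auto
  show "(\<lambda>x. f x + g x) \<in> germs_at X x"
    by (rule germs_atI[OF o _ fun_alg_add[OF fun_alg_regs[OF X o] fg]]) (use UV in simp)
  show "(\<lambda>x. f x * g x) \<in> germs_at X x"
    by (rule germs_atI[OF o _ fun_alg_mult[OF fun_alg_regs[OF X o] fg]]) (use UV in simp)
qed

lemma germ_self: "x \<in> points X \<Longrightarrow> f \<in> germ X x f"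
  unfolding germ_def using openin_topspace by blast

lemma germ_eqI:
  assumes W: "openX X W" "x \<in> W" and eq: "\<And>y. y \<in> W \<Longrightarrow> f y = g y"
  shows "germ X x f = germ X x g"
proof -
  have "h \<in> germ X x g" if h: "h \<in> germ X x f" and eq: "\<And>y. y \<in> W \<Longrightarrow> f y = g y" for f g h
  proof -
    obtain U where U: "openX X U" "x \<in> U" "\<forall>y\<in>U. h y = f y" using h unfolding germ_def by blast
    have "openX X (U \<inter> W)" using U W by auto
    then show ?thesis unfolding germ_def
      using U W eq by (intro CollectI exI[of _ "U \<inter> W"]) auto
  qed
  from this[of _ f g] this[of _ g f] show ?thesis using eq by fastforce
qed

lemma germ_eqD:
  assumes "x \<in> points X" "germ X x f = germ X x g"
  obtains W where "openX X W" "x \<in> W" "\<And>y. y \<in> W \<Longrightarrow> f y = g y"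
proof -
  have "f \<in> germ X x g" using germ_self[OF assms(1), of f] assms(2) by simp
  then show ?thesis unfolding germ_def using that by blast
qed

text \<open>The operations of the stalk are unions over all representatives; when the operation
  respects equality near x, all members of such a union are equal and it collapses.\<close>

lemma germ_UN:
  assumes x: "x \<in> points X" and op: "\<And>f' g' W. openX X W \<Longrightarrow> x \<in> W \<Longrightarrow> (\<And>y. y \<in> W \<Longrightarrow> f' y = f y) \<Longrightarrow>
      (\<And>y. y \<in> W \<Longrightarrow> g' y = g y) \<Longrightarrow> P f' g' = P f g"
  shows "(\<Union>f'\<in>germ X x f. \<Union>g'\<in>germ X x g. P f' g') = P f g"
proof -
  have "P f' g' = P f g" if f': "f' \<in> germ X x f" and g': "g' \<in> germ X x g" for f' g'
  proof -
    obtain U V where "openX X U" "x \<in> U" "\<forall>y\<in>U. f' y = f y" "openX X V" "x \<in> V" "\<forall>y\<in>V. g' y = g y"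
      using f' g' unfolding germ_def by blast
    then show ?thesis by (intro op[of "U \<inter> V"]) auto
  qed
  then show ?thesis using germ_self[OF x, of f] germ_self[OF x, of g] by blast
qed

lemma stalk_simps:
  assumes x: "x \<in> points X"
  shows "germ X x f \<otimes>\<^bsub>stalk X x\<^esub> germ X x g = germ X x (\<lambda>y. f y * g y)"
    and "germ X x f \<oplus>\<^bsub>stalk X x\<^esub> germ X x g = germ X x (\<lambda>y. f y + g y)"
    and "\<one>\<^bsub>stalk X x\<^esub> = germ X x (\<lambda>y. 1)"
    and "\<zero>\<^bsub>stalk X x\<^esub> = germ X x (\<lambda>y. 0)"
proof -
  show "germ X x f \<otimes>\<^bsub>stalk X x\<^esub> germ X x g = germ X x (\<lambda>y. f y * g y)"
    unfolding stalk_def by (simp, rule germ_UN[OF x]) (rule germ_eqI, auto)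
  show "germ X x f \<oplus>\<^bsub>stalk X x\<^esub> germ X x g = germ X x (\<lambda>y. f y + g y)"
    unfolding stalk_def by (simp, rule germ_UN[OF x]) (rule germ_eqI, auto)
qed (simp_all add: stalk_def)

lemma carrier_stalk:
  assumes X: "sheaf_of_functions X"
  shows "carrier (stalk X x) = germ X x ` germs_at X x"
proof
  show "carrier (stalk X x) \<subseteq> germ X x ` germs_at X x"
    unfolding stalk_def germs_at_def using reg_regs[OF X] by fastforce
  show "germ X x ` germs_at X x \<subseteq> carrier (stalk X x)"
  proof
    fix G assume "G \<in> germ X x ` germs_at X x"
    then obtain f U where f: "G = germ X x f" "openX X U" "x \<in> U" "f \<in> regs X U"
      unfolding germs_at_def by blast
    have "germ X x f = germ X x (restrict f U)" using f by (intro germ_eqI[of X U]) auto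
    then show "G \<in> carrier (stalk X x)"
      unfolding stalk_def using f by (auto simp: regs_def)
  qed
qed

lemma cring_stalk:
  assumes X: "sheaf_of_functions X" and x: "x \<in> points X"
  shows "cring (stalk X x)"
proof -
  note A = fun_alg_germs_at[OF X x]
  note [simp] = stalk_simps[OF x] carrier_stalk[OF X]
  have a: "abelian_group (stalk X x)"
  proof (rule abelian_groupI, goal_cases)
    case (6 G)
    then obtain f where f: "f \<in> germs_at X x" "G = germ X x f" by auto
    have "germ X x (\<lambda>y. - f y) \<oplus>\<^bsub>stalk X x\<^esub> G = \<zero>\<^bsub>stalk X x\<^esub>" using f by simp
    then show ?case using fun_alg_uminus[OF A f(1)] by auto
  qed (auto simp: fun_alg_add[OF A] fun_alg_const[OF A] algebra_simps)
  show ?thesis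
    by (rule cringI[OF a comm_monoidI])
       (auto simp: fun_alg_mult[OF A] fun_alg_const[OF A] algebra_simps)
qed

definition dgerm :: "'a fspace \<Rightarrow> 'a \<Rightarrow> ('a \<Rightarrow> complex) \<Rightarrow> 'a cotangent" where
  "dgerm X x f = univ_deriv (stalk X x) (const_germs X x) (germ X x f)"

context
  fixes X :: "'a fspace" and x :: 'a
  assumes X: "sheaf_of_functions X" and x: "x \<in> points X"
begin

lemma germ_closed: "f \<in> germs_at X x \<Longrightarrow> germ X x f \<in> carrier (stalk X x)"
  by (simp add: carrier_stalk[OF X])

lemma differentials_stalk: "differentials (stalk X x) (const_germs X x)"
proof -
  interpret cring "stalk X x" by (rule cring_stalk[OF X x])
  show ?thesis
    by unfold_locales
       (auto simp: const_germs_def intro!: germ_closed fun_alg_const[OF fun_alg_germs_at[OF X x]])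
qed

interpretation D: differentials "stalk X x" "const_germs X x"
  rewrites "kaehler (stalk X x) (const_germs X x) = Omega_stalk X x"
  by (rule differentials_stalk) (simp add: Omega_stalk_def)

lemma module_Omega_stalk: "module (stalk X x) (Omega_stalk X x)"
  by (rule D.module_kaehler)

lemma form_germ_eq: "form_germ X a b x = germ X x a \<odot>\<^bsub>Omega_stalk X x\<^esub> dgerm X x b"
  by (simp add: form_germ_def dgerm_def)

lemma dgerm_closed: "f \<in> germs_at X x \<Longrightarrow> dgerm X x f \<in> carrier (Omega_stalk X x)"
  unfolding dgerm_def by (rule D.univ_deriv_closed[OF germ_closed])

lemma dgerm_add:
  "f \<in> germs_at X x \<Longrightarrow> g \<in> germs_at X x \<Longrightarrow>
    dgerm X x (\<lambda>y. f y + g y) = dgerm X x f \<oplus>\<^bsub>Omega_stalk X x\<^esub> dgerm X x g"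
  unfolding dgerm_def using D.univ_deriv_add[OF germ_closed germ_closed] by (simp add: stalk_simps[OF x])

lemma dgerm_mult:
  "f \<in> germs_at X x \<Longrightarrow> g \<in> germs_at X x \<Longrightarrow>
    dgerm X x (\<lambda>y. f y * g y) = germ X x f \<odot>\<^bsub>Omega_stalk X x\<^esub> dgerm X x g \<oplus>\<^bsub>Omega_stalk X x\<^esub>
      germ X x g \<odot>\<^bsub>Omega_stalk X x\<^esub> dgerm X x f"
  unfolding dgerm_def using D.univ_deriv_mult[OF germ_closed germ_closed] by (simp add: stalk_simps[OF x])

lemma dgerm_const: "dgerm X x (\<lambda>y. c) = \<zero>\<^bsub>Omega_stalk X x\<^esub>"
  unfolding dgerm_def by (rule D.univ_deriv_const) (auto simp: const_germs_def)

lemma form_germ_closed: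
  "a \<in> germs_at X x \<Longrightarrow> b \<in> germs_at X x \<Longrightarrow> form_germ X a b x \<in> carrier (Omega_stalk X x)"
  unfolding form_germ_eq by (rule D.\<Omega>.smult_closed[OF germ_closed dgerm_closed])

end

lemma form_germ_cong:
  assumes "germ X x a = germ X x a'" "germ X x b = germ X x b'"
  shows "form_germ X a b x = form_germ X a' b' x"
  using assms by (simp add: form_germ_def)

text \<open>Sums of terms a db over the same kind of list that represents tensors.
  \<open>carrier_Omega\<close> brings the sections of \<open>Omega\<close> into this form.\<close>

definition forms :: "'a fspace \<Rightarrow> 'a \<Rightarrow> (('a \<Rightarrow> complex) \<times> ('a \<Rightarrow> complex)) list \<Rightarrow> 'a cotangent" where
  "forms X x ts = foldr (\<lambda>(a, b) \<omega>. form_germ X a b x \<oplus>\<^bsub>Omega_stalk X x\<^esub> \<omega>) ts \<zero>\<^bsub>Omega_stalk X x\<^esub>"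

lemma forms_simps [simp]:
  "forms X x [] = \<zero>\<^bsub>Omega_stalk X x\<^esub>"
  "forms X x ((a, b) # ts) = form_germ X a b x \<oplus>\<^bsub>Omega_stalk X x\<^esub> forms X x ts"
  by (simp_all add: forms_def)

context
  fixes X :: "'a fspace" and x :: 'a
  assumes X: "sheaf_of_functions X" and x: "x \<in> points X"
begin

interpretation M: module "stalk X x" "Omega_stalk X x"
  by (rule module_Omega_stalk[OF X x])

lemmas form_germ_closed_at_x = form_germ_closed[OF X x]

lemma forms_closed: "set ts \<subseteq> germs_at X x \<times> germs_at X x \<Longrightarrow> forms X x ts \<in> carrier (Omega_stalk X x)"
  by (induction ts) (auto simp: form_germ_closed_at_x)

lemma forms_append:
  "set ts \<subseteq> germs_at X x \<times> germs_at X x \<Longrightarrow> set us \<subseteq> germs_at X x \<times> germs_at X x \<Longrightarrow>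
   forms X x (ts @ us) = forms X x ts \<oplus>\<^bsub>Omega_stalk X x\<^esub> forms X x us"
  by (induction ts) (auto simp: form_germ_closed_at_x forms_closed M.M.a_ac)

lemma forms_smult:
  "f \<in> germs_at X x \<Longrightarrow> set ts \<subseteq> germs_at X x \<times> germs_at X x \<Longrightarrow>
   forms X x (map (\<lambda>(a, b). (\<lambda>y. f y * a y, b)) ts) = germ X x f \<odot>\<^bsub>Omega_stalk X x\<^esub> forms X x ts"
proof (induction ts)
  case Nil then show ?case by (simp add: germ_closed[OF X x])
next
  case (Cons t ts)
  obtain a b where t: "t = (a, b)" by (cases t)
  have ab: "a \<in> germs_at X x" "b \<in> germs_at X x" using Cons t by auto
  have "form_germ X (\<lambda>y. f y * a y) b x = germ X x f \<odot>\<^bsub>Omega_stalk X x\<^esub> form_germ X a b x"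
    unfolding form_germ_eq[OF X x] stalk_simps(1)[OF x, symmetric]
    by (rule M.smult_assoc1) (use ab Cons in \<open>auto intro!: germ_closed[OF X x] dgerm_closed[OF X x]\<close>)
  then show ?case
    using Cons ab by (simp add: t M.smult_r_distr germ_closed[OF X x] form_germ_closed_at_x forms_closed)
qed

lemma finsum_forms:
  "(\<forall>i<n. a i \<in> germs_at X x \<and> b i \<in> germs_at X x) \<Longrightarrow>
   (\<Oplus>\<^bsub>Omega_stalk X x\<^esub>i\<in>{..<n}. form_germ X (a i) (b i) x) = forms X x (map (\<lambda>i. (a i, b i)) [0..<n])"
proof (induction n)
  case 0 then show ?case by simp
next
  case (Suc n)
  have 1: "set (map (\<lambda>i. (a i, b i)) [0..<n]) \<subseteq> germs_at X x \<times> germs_at X x" using Suc.prems by auto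
  have "(\<Oplus>\<^bsub>Omega_stalk X x\<^esub>i\<in>{..<Suc n}. form_germ X (a i) (b i) x) =
     form_germ X (a n) (b n) x \<oplus>\<^bsub>Omega_stalk X x\<^esub> (\<Oplus>\<^bsub>Omega_stalk X x\<^esub>i\<in>{..<n}. form_germ X (a i) (b i) x)"
    unfolding lessThan_Suc using Suc.prems by (subst M.M.finsum_insert) (auto simp: form_germ_closed_at_x)
  then show ?case
    using Suc 1 forms_append[OF 1, of "[(a n, b n)]"] by (simp add: form_germ_closed_at_x forms_closed M.M.a_ac)
qed

end

lemma carrier_Omega:
  assumes X: "sheaf_of_functions X" and U: "openX X U"
  shows "carrier (sec (Omega X) U) = {\<omega> \<in> (\<Pi>\<^sub>E x\<in>U. carrier (Omega_stalk X x)).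
     \<forall>x\<in>U. \<exists>W ts. openX X W \<and> x \<in> W \<and> W \<subseteq> U \<and> set ts \<subseteq> regs X W \<times> regs X W \<and>
       (\<forall>y\<in>W. \<omega> y = forms X y ts)}"
proof -
  have *: "(\<exists>(n::nat) a b. (\<forall>i<n. a i \<in> reg X W \<and> b i \<in> reg X W) \<and>
             (\<forall>y\<in>W. \<omega> y = (\<Oplus>\<^bsub>Omega_stalk X y\<^esub>i\<in>{..<n}. form_germ X (a i) (b i) y))) \<longleftrightarrow>
      (\<exists>ts. set ts \<subseteq> regs X W \<times> regs X W \<and> (\<forall>y\<in>W. \<omega> y = forms X y ts))" (is "?L \<longleftrightarrow> ?R")
    if W: "openX X W" for W and \<omega> :: "'a \<Rightarrow> 'a cotangent"
  proof
    assume ?L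
    then obtain n :: nat and a b where 1: "\<forall>i<n. a i \<in> reg X W \<and> b i \<in> reg X W"
      "\<forall>y\<in>W. \<omega> y = (\<Oplus>\<^bsub>Omega_stalk X y\<^esub>i\<in>{..<n}. form_germ X (a i) (b i) y)" by blast
    then have r: "\<forall>i<n. a i \<in> regs X W \<and> b i \<in> regs X W" using reg_regs[OF X W] by blast
    have "\<omega> y = forms X y (map (\<lambda>i. (a i, b i)) [0..<n])" if y: "y \<in> W" for y
    proof -
      have "y \<in> points X" using y openin_subset[OF W] by blast
      then show ?thesis using 1(2) y r germs_atI[OF W y] by (simp add: finsum_forms[OF X])
    qed
    moreover have "set (map (\<lambda>i. (a i, b i)) [0..<n]) \<subseteq> regs X W \<times> regs X W" using r by auto
    ultimately show ?R by blast
  next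
    assume ?R
    then obtain ts where ts: "set ts \<subseteq> regs X W \<times> regs X W" "\<forall>y\<in>W. \<omega> y = forms X y ts" by blast
    let ?a = "\<lambda>i. restrict (fst (ts ! i)) W" and ?b = "\<lambda>i. restrict (snd (ts ! i)) W"
    have nth: "ts ! i \<in> regs X W \<times> regs X W" if "i < length ts" for i
      using ts(1) nth_mem[OF that] by blast
    have r: "\<forall>i<length ts. ?a i \<in> reg X W \<and> ?b i \<in> reg X W"
      using nth by (auto simp: restrict_reg_iff mem_Times_iff)
    have "\<omega> y = (\<Oplus>\<^bsub>Omega_stalk X y\<^esub>i\<in>{..<length ts}. form_germ X (?a i) (?b i) y)" if y: "y \<in> W" for y
    proof -
      have py: "y \<in> points X" using y openin_subset[OF W] by blast
      have fc: "form_germ X (restrict a W) (restrict b W) y = form_germ X a b y" for a b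
        by (rule form_germ_cong; rule germ_eqI[OF W y]) auto
      have "(\<Oplus>\<^bsub>Omega_stalk X y\<^esub>i\<in>{..<length ts}. form_germ X (?a i) (?b i) y) =
          forms X y (map (\<lambda>i. (?a i, ?b i)) [0..<length ts])"
        by (rule finsum_forms[OF X py]) (use r reg_regs[OF X W] germs_atI[OF W y] in blast)
      also have "map (\<lambda>i. (?a i, ?b i)) [0..<length ts] = map (\<lambda>(a, b). (restrict a W, restrict b W)) ts"
        by (intro nth_equalityI) (auto simp: case_prod_unfold)
      also have "forms X y (map (\<lambda>(a, b). (restrict a W, restrict b W)) us) = forms X y us" for us
        by (induction us) (simp_all only: list.map forms_simps fc split: prod.split, simp_all)
      finally show ?thesis unfolding ts(2)[rule_format, OF y] by (rule sym)
    qed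
    then show ?L using r
      by (intro exI[of _ "length ts"] exI[of _ ?a] exI[of _ ?b] conjI ballI)
  qed
  show ?thesis unfolding Omega_def by (simp add: * cong: conj_cong)
qed

lemma sec_Omega [simp]:
  "\<zero>\<^bsub>sec (Omega X) U\<^esub> = (\<lambda>x\<in>U. \<zero>\<^bsub>Omega_stalk X x\<^esub>)"
  "\<omega> \<oplus>\<^bsub>sec (Omega X) U\<^esub> \<eta> = (\<lambda>x\<in>U. \<omega> x \<oplus>\<^bsub>Omega_stalk X x\<^esub> \<eta> x)"
  "f \<odot>\<^bsub>sec (Omega X) U\<^esub> \<omega> = (\<lambda>x\<in>U. germ X x f \<odot>\<^bsub>Omega_stalk X x\<^esub> \<omega> x)"
  "restr (Omega X) V \<omega> = restrict \<omega> V"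
  by (simp_all add: Omega_def)

context
  fixes X :: "'a fspace"
  assumes X: "sheaf_of_functions X"
begin

text \<open>Spares \<open>W \<subseteq> U\<close> and membership in the stalks: the first is
  achieved by intersecting, the second holds because a sum of forms lies in the stalk.\<close>

lemma Omega_secI:
  assumes "openX X U" "\<omega> \<in> extensional U"
    "\<And>x. x \<in> U \<Longrightarrow> \<exists>W ts. openX X W \<and> x \<in> W \<and> set ts \<subseteq> regs X W \<times> regs X W \<and> (\<forall>y\<in>W. \<omega> y = forms X y ts)"
  shows "\<omega> \<in> carrier (sec (Omega X) U)"
  unfolding carrier_Omega[OF X assms(1)]
proof (intro CollectI conjI ballI PiE_I)
  fix x assume x: "x \<in> U"
  from assms(3)[OF x] obtain W ts
    where W: "openX X W" "x \<in> W" "set ts \<subseteq> regs X W \<times> regs X W" "\<forall>y\<in>W. \<omega> y = forms X y ts"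
    by (elim exE conjE)
  have "set ts \<subseteq> germs_at X x \<times> germs_at X x" using W(3) germs_atI[OF W(1,2)] by blast
  then show "\<omega> x \<in> carrier (Omega_stalk X x)"
    using W forms_closed[OF X, of x ts] openin_subset[OF W(1)] by auto
  have o: "openX X (W \<inter> U)" using W assms(1) by auto
  have "set ts \<subseteq> regs X (W \<inter> U) \<times> regs X (W \<inter> U)" using W(3) regs_subset[OF X W(1) o] by blast
  then show "\<exists>W ts. openX X W \<and> x \<in> W \<and> W \<subseteq> U \<and> set ts \<subseteq> regs X W \<times> regs X W \<and> (\<forall>y\<in>W. \<omega> y = forms X y ts)"
    using o W x by (intro exI[of _ "W \<inter> U"] exI[of _ ts]) auto
qed (use assms(2) in \<open>simp add: extensional_def\<close>)

lemma Omega_secD: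
  assumes "openX X U" "\<omega> \<in> carrier (sec (Omega X) U)"
  shows "\<omega> \<in> extensional U" "x \<in> U \<Longrightarrow> \<omega> x \<in> carrier (Omega_stalk X x)"
    "x \<in> U \<Longrightarrow> \<exists>W ts. openX X W \<and> x \<in> W \<and> W \<subseteq> U \<and> set ts \<subseteq> regs X W \<times> regs X W \<and> (\<forall>y\<in>W. \<omega> y = forms X y ts)"
  using assms(2) unfolding carrier_Omega[OF X assms(1)] by (auto simp: PiE_def)

lemma germ_smult_section:
  assumes U: "openX X U" and f: "f \<in> regs X U" and \<omega>: "\<omega> \<in> carrier (sec (Omega X) U)"
  shows "(\<lambda>x\<in>U. germ X x f \<odot>\<^bsub>Omega_stalk X x\<^esub> \<omega> x) \<in> carrier (sec (Omega X) U)"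
proof (rule Omega_secI[OF U])
  fix x assume x: "x \<in> U"
  obtain W ts where W: "openX X W" "x \<in> W" "W \<subseteq> U" "set ts \<subseteq> regs X W \<times> regs X W" "\<forall>y\<in>W. \<omega> y = forms X y ts"
    using Omega_secD(3)[OF U \<omega> x] by (elim exE conjE)
  have f': "f \<in> regs X W" using regs_subset[OF X U W(1,3) f] .
  have "germ X y f \<odot>\<^bsub>Omega_stalk X y\<^esub> \<omega> y = forms X y (map (\<lambda>(a, b). (\<lambda>y. f y * a y, b)) ts)" if y: "y \<in> W" for y
  proof -
    have "y \<in> points X" using y openin_subset[OF W(1)] by blast
    moreover have "set ts \<subseteq> germs_at X y \<times> germs_at X y" "f \<in> germs_at X y"
      using W(4) f' germs_atI[OF W(1) y] by blast+
    ultimately show ?thesis using W(5) y by (simp add: forms_smult[OF X])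
  qed
  moreover have "set (map (\<lambda>(a, b). (\<lambda>y. f y * a y, b)) ts) \<subseteq> regs X W \<times> regs X W"
    using W(4) fun_alg_mult[OF fun_alg_regs[OF X W(1)] f'] by fastforce
  ultimately show "\<exists>W ts. openX X W \<and> x \<in> W \<and> set ts \<subseteq> regs X W \<times> regs X W \<and>
     (\<forall>y\<in>W. (\<lambda>x\<in>U. germ X x f \<odot>\<^bsub>Omega_stalk X x\<^esub> \<omega> x) y = forms X y ts)"
    using W by (intro exI[of _ W] exI[of _ "map (\<lambda>(a, b). (\<lambda>y. f y * a y, b)) ts"]) auto
qed simp

lemma add_section:
  assumes U: "openX X U" and \<omega>: "\<omega> \<in> carrier (sec (Omega X) U)" and \<eta>: "\<eta> \<in> carrier (sec (Omega X) U)"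
  shows "(\<lambda>x\<in>U. \<omega> x \<oplus>\<^bsub>Omega_stalk X x\<^esub> \<eta> x) \<in> carrier (sec (Omega X) U)"
proof (rule Omega_secI[OF U])
  fix x assume x: "x \<in> U"
  obtain W ts where W: "openX X W" "x \<in> W" "W \<subseteq> U" "set ts \<subseteq> regs X W \<times> regs X W" "\<forall>y\<in>W. \<omega> y = forms X y ts"
    using Omega_secD(3)[OF U \<omega> x] by (elim exE conjE)
  obtain V us where V: "openX X V" "x \<in> V" "V \<subseteq> U" "set us \<subseteq> regs X V \<times> regs X V" "\<forall>y\<in>V. \<eta> y = forms X y us"
    using Omega_secD(3)[OF U \<eta> x] by (elim exE conjE)
  have o: "openX X (W \<inter> V)" using W V by auto
  have sub: "set ts \<subseteq> regs X (W \<inter> V) \<times> regs X (W \<inter> V)" "set us \<subseteq> regs X (W \<inter> V) \<times> regs X (W \<inter> V)"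
    using W(4) V(4) regs_subset[OF X W(1) o] regs_subset[OF X V(1) o] by blast+
  have "\<omega> y \<oplus>\<^bsub>Omega_stalk X y\<^esub> \<eta> y = forms X y (ts @ us)" if y: "y \<in> W \<inter> V" for y
  proof -
    have "y \<in> points X" using y openin_subset[OF W(1)] by blast
    moreover have "set ts \<subseteq> germs_at X y \<times> germs_at X y" "set us \<subseteq> germs_at X y \<times> germs_at X y"
      using sub germs_atI[OF o y] by blast+
    ultimately show ?thesis using W(5) V(5) y by (simp add: forms_append[OF X])
  qed
  then show "\<exists>W ts. openX X W \<and> x \<in> W \<and> set ts \<subseteq> regs X W \<times> regs X W \<and>
     (\<forall>y\<in>W. (\<lambda>x\<in>U. \<omega> x \<oplus>\<^bsub>Omega_stalk X x\<^esub> \<eta> x) y = forms X y ts)"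
    using W V o sub by (intro exI[of _ "W \<inter> V"] exI[of _ "ts @ us"]) auto
qed simp

lemma module_Omega_sec:
  assumes U: "openX X U"
  shows "module (sec (\<O> X) U) (sec (Omega X) U)"
proof -
  have M: "module (stalk X x) (Omega_stalk X x)" if "x \<in> U" for x
    using module_Omega_stalk[OF X] that openin_subset[OF U] by blast
  note G = module.axioms(2)[OF M]
  note c = Omega_secD(2)[OF U]
  have gc: "germ X x f \<in> carrier (stalk X x)" if "f \<in> reg X U" "x \<in> U" for f x
  proof -
    have "f \<in> germs_at X x" using that reg_regs[OF X U] germs_atI[OF U] by blast
    moreover have "x \<in> points X" using that openin_subset[OF U] by blast
    ultimately show ?thesis by (intro germ_closed[OF X])
  qed
  have px: "x \<in> points X" if "x \<in> U" for x using that openin_subset[OF U] by blast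
  have ge: "germ X x (\<lambda>x\<in>U. f x) = germ X x f" if "x \<in> U" for f x
    by (rule germ_eqI[OF U that]) auto
  have reg: "f \<in> regs X U" if "f \<in> reg X U" for f using that reg_regs[OF X U] by blast
  show ?thesis
  proof (rule moduleI[OF cring_sections[OF X U] abelian_groupI], goal_cases)
    case (1 x y) then show ?case using add_section[OF U] by simp
  next
    case 2
    show ?case
      by (simp, rule Omega_secI[OF U])
         (auto intro!: exI[of _ U] exI[of _ "[]"] simp: U)
  next
    case (3 x y z)
    then show ?case using abelian_monoid.a_assoc[OF abelian_group.axioms(1)[OF G]] c
      by (auto intro!: restrict_ext)
  next
    case (4 x y)
    then show ?case using abelian_monoid.a_comm[OF abelian_group.axioms(1)[OF G]] c
      by (auto intro!: restrict_ext)
  next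
    case (5 x)
    then show ?case using abelian_monoid.l_zero[OF abelian_group.axioms(1)[OF G]] c Omega_secD(1)[OF U]
      by (auto intro!: restrict_ext_eq)
  next
    case (6 \<omega>)
    \<comment> \<open>Negation is multiplication by -1, for which closure under scalars is already
      available.\<close>
    let ?f = "\<lambda>x. -1 :: complex"
    have f: "?f \<in> regs X U" by (rule fun_alg_const[OF fun_alg_regs[OF X U]])
    let ?n = "\<lambda>x\<in>U. germ X x ?f \<odot>\<^bsub>Omega_stalk X x\<^esub> \<omega> x"
    have "?n \<oplus>\<^bsub>sec (Omega X) U\<^esub> \<omega> = \<zero>\<^bsub>sec (Omega X) U\<^esub>"
    proof (unfold sec_Omega, rule restrict_ext)
      fix x assume x: "x \<in> U"
      interpret module "stalk X x" "Omega_stalk X x" by (rule M[OF x])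
      have g1: "germ X x (\<lambda>x. c) \<in> carrier (stalk X x)" for c :: complex
        by (rule germ_closed[OF X px[OF x] fun_alg_const[OF fun_alg_germs_at[OF X px[OF x]]]])
      have "germ X x ?f \<odot>\<^bsub>Omega_stalk X x\<^esub> \<omega> x \<oplus>\<^bsub>Omega_stalk X x\<^esub> \<omega> x =
         (germ X x ?f \<oplus>\<^bsub>stalk X x\<^esub> \<one>\<^bsub>stalk X x\<^esub>) \<odot>\<^bsub>Omega_stalk X x\<^esub> \<omega> x"
        using c[OF 6 x] g1 by (subst smult_l_distr) auto
      also have "germ X x ?f \<oplus>\<^bsub>stalk X x\<^esub> \<one>\<^bsub>stalk X x\<^esub> = \<zero>\<^bsub>stalk X x\<^esub>"
        by (simp add: stalk_simps[OF px[OF x]])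
      finally show "?n x \<oplus>\<^bsub>Omega_stalk X x\<^esub> \<omega> x = \<zero>\<^bsub>Omega_stalk X x\<^esub>" using c[OF 6 x] x by simp
    qed
    then show ?case using germ_smult_section[OF U f 6] by blast
  next
    case (7 a x) then show ?case using germ_smult_section[OF U reg] by simp
  next
    case (8 a b \<omega>)
    then show ?case
      using module.smult_l_distr[OF M gc gc c]
      by (auto intro!: restrict_ext simp: ge stalk_simps(2)[OF px, symmetric])
  next
    case (9 a \<omega> \<eta>)
    then show ?case using module.smult_r_distr[OF M gc c c] by (auto intro!: restrict_ext)
  next
    case (10 a b \<omega>)
    then show ?case
      using module.smult_assoc1[OF M gc gc c]
      by (auto intro!: restrict_ext simp: ge stalk_simps(1)[OF px, symmetric])
  next
    case (11 \<omega>)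
    then show ?case using module.smult_one[OF M c] Omega_secD(1)[OF U]
      by (auto intro!: restrict_ext_eq simp: ge stalk_simps(3)[OF px, symmetric])
  qed
qed

lemma Omega_restr:
  assumes "openX X V" "openX X W" "V \<subseteq> W" "\<omega> \<in> carrier (sec (Omega X) W)"
  shows "restrict \<omega> V \<in> carrier (sec (Omega X) V)"
proof (rule Omega_secI[OF assms(1)])
  fix x assume x: "x \<in> V"
  obtain U ts where U: "openX X U" "x \<in> U" "set ts \<subseteq> regs X U \<times> regs X U" "\<forall>y\<in>U. \<omega> y = forms X y ts"
    using Omega_secD(3)[OF assms(2,4) subsetD[OF assms(3) x]] by (elim exE conjE)
  have o: "openX X (U \<inter> V)" using U assms by auto
  have "set ts \<subseteq> regs X (U \<inter> V) \<times> regs X (U \<inter> V)" using U(3) regs_subset[OF X U(1) o] by blast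
  then show "\<exists>W ts. openX X W \<and> x \<in> W \<and> set ts \<subseteq> regs X W \<times> regs X W \<and> (\<forall>y\<in>W. restrict \<omega> V y = forms X y ts)"
    using o U x by (intro exI[of _ "U \<inter> V"] exI[of _ ts]) auto
qed simp

lemma module_sheaf_Omega: "module_sheaf X (Omega X)"
  unfolding module_sheaf_def
proof (intro conjI allI impI ballI, goal_cases)
  case (1 V) then show ?case by (rule module_Omega_sec)
next
  case (2 V W s) then show ?case using Omega_restr[of V W s] by simp
next
  case (3 V W s t) then show ?case by (intro ext) (simp add: restrict_def subset_iff)
next
  case (4 V W s f)
  have "germ X x (restrict f V) = germ X x f" if "x \<in> V" for x
    using 4 that by (intro germ_eqI[of X V]) auto
  then show ?case using 4(1) by (intro ext) (simp add: restrict_def[of "\<lambda>x. germ X x _ \<odot>\<^bsub>_\<^esub> _"] restrict_def[of s] subset_iff)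
next
  case (5 V W s U) then show ?case by (intro ext) (simp add: restrict_def subset_iff)
next
  case (6 V s) then show ?case using Omega_secD(1)[OF 6] extensional_restrict by auto
next
  case (7 \<V> \<sigma>)
  then have 1: "\<And>V. V \<in> \<V> \<Longrightarrow> openX X V" "\<And>V. V \<in> \<V> \<Longrightarrow> \<sigma> V \<in> carrier (sec (Omega X) V)"
    and 2: "\<And>V W. V \<in> \<V> \<Longrightarrow> W \<in> \<V> \<Longrightarrow> restrict (\<sigma> V) (V \<inter> W) = restrict (\<sigma> W) (V \<inter> W)" by auto
  have o: "openX X (\<Union>\<V>)" using 1 by auto
  obtain s where s: "s \<in> extensional (\<Union>\<V>)" "\<And>V. V \<in> \<V> \<Longrightarrow> restrict s V = \<sigma> V"
    by (rule glue_functions[of \<V> \<sigma>]) (use 1 2 Omega_secD(1) in auto)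
  have "s \<in> carrier (sec (Omega X) (\<Union>\<V>))"
  proof (rule Omega_secI[OF o s(1)])
    fix x assume "x \<in> \<Union>\<V>"
    then obtain V where V: "V \<in> \<V>" "x \<in> V" by blast
    obtain W ts where W: "openX X W" "x \<in> W" "W \<subseteq> V" "set ts \<subseteq> regs X W \<times> regs X W" "\<forall>y\<in>W. \<sigma> V y = forms X y ts"
      using Omega_secD(3)[OF 1(1)[OF V(1)] 1(2)[OF V(1)] V(2)] by (elim exE conjE)
    have "s y = \<sigma> V y" if "y \<in> W" for y using s(2)[OF V(1)] that W(3) by (metis restrict_apply' subsetD)
    then show "\<exists>W ts. openX X W \<and> x \<in> W \<and> set ts \<subseteq> regs X W \<times> regs X W \<and> (\<forall>y\<in>W. s y = forms X y ts)"
      using W by auto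
  qed
  then show ?case
  proof (intro ex1I[of _ s])
    fix t assume t: "t \<in> carrier (sec (Omega X) (\<Union>\<V>)) \<and> (\<forall>V\<in>\<V>. restr (Omega X) V t = \<sigma> V)"
    show "t = s" by (rule glue_unique[OF _ s(1)]) (use t s(2) Omega_secD(1)[OF o] in auto)
  qed (use s(2) in auto)
qed

end

section \<open>Tensors with values in a square-zero extension\<close>

text \<open>The square-zero extension of \<open>R\<close> by \<open>M\<close>: a derivation of \<open>R\<close> into \<open>M\<close> is a section of it.\<close>

definition triv_ext :: "('r, 'x) ring_scheme \<Rightarrow> ('r, 'm, 'y) module_scheme \<Rightarrow> ('r \<times> 'm) ring" where
  "triv_ext R M = \<lparr>carrier = carrier R \<times> carrier M,
     monoid.mult = (\<lambda>(a, m) (b, n). (a \<otimes>\<^bsub>R\<^esub> b, a \<odot>\<^bsub>M\<^esub> n \<oplus>\<^bsub>M\<^esub> b \<odot>\<^bsub>M\<^esub> m)),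
     one = (\<one>\<^bsub>R\<^esub>, \<zero>\<^bsub>M\<^esub>), zero = (\<zero>\<^bsub>R\<^esub>, \<zero>\<^bsub>M\<^esub>),
     add = (\<lambda>(a, m) (b, n). (a \<oplus>\<^bsub>R\<^esub> b, m \<oplus>\<^bsub>M\<^esub> n))\<rparr>"

lemma triv_ext_simps [simp]:
  "carrier (triv_ext R M) = carrier R \<times> carrier M"
  "(a, m) \<otimes>\<^bsub>triv_ext R M\<^esub> (b, n) = (a \<otimes>\<^bsub>R\<^esub> b, a \<odot>\<^bsub>M\<^esub> n \<oplus>\<^bsub>M\<^esub> b \<odot>\<^bsub>M\<^esub> m)"
  "(a, m) \<oplus>\<^bsub>triv_ext R M\<^esub> (b, n) = (a \<oplus>\<^bsub>R\<^esub> b, m \<oplus>\<^bsub>M\<^esub> n)"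
  "\<one>\<^bsub>triv_ext R M\<^esub> = (\<one>\<^bsub>R\<^esub>, \<zero>\<^bsub>M\<^esub>)"
  "\<zero>\<^bsub>triv_ext R M\<^esub> = (\<zero>\<^bsub>R\<^esub>, \<zero>\<^bsub>M\<^esub>)"
  by (simp_all add: triv_ext_def)

context module
begin

lemma cring_triv_ext: "cring (triv_ext R M)"
proof (rule cringI[OF abelian_groupI comm_monoidI], goal_cases)
  case (6 x)
  then show ?case
    by (cases x) (auto intro!: bexI[of _ "\<ominus>\<^bsub>R\<^esub> fst x"] bexI[of _ "\<ominus>\<^bsub>M\<^esub> snd x"] simp: R.l_neg M.l_neg)
next
  case (9 x y z)
  then show ?case
    by (auto simp: R.m_assoc smult_r_distr M.a_assoc)
       (simp add: smult_assoc1[symmetric] R.m_comm)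
next
  case (12 x y z)
  then show ?case by (auto simp: R.l_distr smult_l_distr smult_r_distr M.a_ac)
qed (auto simp: R.a_ac M.a_ac R.m_comm)

lemma triv_ext_Units:
  assumes "a \<in> Units R" "m \<in> carrier M"
  shows "(a, m) \<in> Units (triv_ext R M)"
proof -
  let ?b = "inv\<^bsub>R\<^esub> a"
  have a: "a \<in> carrier R" "?b \<in> carrier R" "a \<otimes> ?b = \<one>" "?b \<otimes> a = \<one>" using assms(1) by auto
  \<comment> \<open>The inverse of (a, m) is (b, - b b m) with b inverse to a: \<open>M\<close> has
    square zero, so the geometric series stops after its linear term.\<close>
  let ?n = "\<ominus>\<^bsub>M\<^esub> ((?b \<otimes> ?b) \<odot>\<^bsub>M\<^esub> m)"
  have "a \<odot>\<^bsub>M\<^esub> ?n = \<ominus>\<^bsub>M\<^esub> (?b \<odot>\<^bsub>M\<^esub> m)"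
    using a assms(2) by (simp add: smult_r_minus smult_assoc1[symmetric] R.m_assoc[symmetric])
  then have "(a, m) \<otimes>\<^bsub>triv_ext R M\<^esub> (?b, ?n) = \<one>\<^bsub>triv_ext R M\<^esub>"
    using a assms(2) by (simp add: M.l_neg)
  moreover from this have "(?b, ?n) \<otimes>\<^bsub>triv_ext R M\<^esub> (a, m) = \<one>\<^bsub>triv_ext R M\<^esub>"
    using a assms(2) by (subst comm_monoid.m_comm[OF cring.axioms(2)[OF cring_triv_ext]]) auto
  ultimately show ?thesis
    unfolding Units_def using a assms(2) by (intro CollectI conjI bexI[of _ "(?b, ?n)"]) auto
qed

end

text \<open>A ring homomorphism from the local ring at \<open>x\<close> to \<open>E\<close>, written
  on representatives; the condition on equal germs lets it pass to the quotient.\<close>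

definition germ_hom :: "'a fspace \<Rightarrow> 'a \<Rightarrow> ('e, 'y) ring_scheme \<Rightarrow> (('a \<Rightarrow> complex) \<Rightarrow> 'e) \<Rightarrow> bool" where
  "germ_hom X x E \<psi> \<longleftrightarrow>
     (\<forall>f\<in>germs_at X x. \<psi> f \<in> carrier E \<and> (\<forall>g\<in>germs_at X x.
        \<psi> (\<lambda>y. f y + g y) = \<psi> f \<oplus>\<^bsub>E\<^esub> \<psi> g \<and> \<psi> (\<lambda>y. f y * g y) = \<psi> f \<otimes>\<^bsub>E\<^esub> \<psi> g \<and>
        (germ X x f = germ X x g \<longrightarrow> \<psi> f = \<psi> g))) \<and> \<psi> (\<lambda>y. 1) = \<one>\<^bsub>E\<^esub>"

lemma germ_homD:
  assumes "germ_hom X x E \<psi>"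
  shows germ_hom_closed: "f \<in> germs_at X x \<Longrightarrow> \<psi> f \<in> carrier E"
    and germ_hom_add: "f \<in> germs_at X x \<Longrightarrow> g \<in> germs_at X x \<Longrightarrow> \<psi> (\<lambda>y. f y + g y) = \<psi> f \<oplus>\<^bsub>E\<^esub> \<psi> g"
    and germ_hom_mult: "f \<in> germs_at X x \<Longrightarrow> g \<in> germs_at X x \<Longrightarrow> \<psi> (\<lambda>y. f y * g y) = \<psi> f \<otimes>\<^bsub>E\<^esub> \<psi> g"
    and germ_hom_cong: "f \<in> germs_at X x \<Longrightarrow> g \<in> germs_at X x \<Longrightarrow> germ X x f = germ X x g \<Longrightarrow> \<psi> f = \<psi> g"
    and germ_hom_one: "\<psi> (\<lambda>y. 1) = \<one>\<^bsub>E\<^esub>"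
proof -
  note a = assms[unfolded germ_hom_def]
  note b = a[THEN conjunct1, THEN bspec]
  note c = b[THEN conjunct2, THEN bspec]
  show "f \<in> germs_at X x \<Longrightarrow> \<psi> f \<in> carrier E" by (rule b[THEN conjunct1])
  show "f \<in> germs_at X x \<Longrightarrow> g \<in> germs_at X x \<Longrightarrow> \<psi> (\<lambda>y. f y + g y) = \<psi> f \<oplus>\<^bsub>E\<^esub> \<psi> g"
    by (rule c[THEN conjunct1])
  show "f \<in> germs_at X x \<Longrightarrow> g \<in> germs_at X x \<Longrightarrow> \<psi> (\<lambda>y. f y * g y) = \<psi> f \<otimes>\<^bsub>E\<^esub> \<psi> g"
    by (rule c[THEN conjunct2, THEN conjunct1])
  show "f \<in> germs_at X x \<Longrightarrow> g \<in> germs_at X x \<Longrightarrow> germ X x f = germ X x g \<Longrightarrow> \<psi> f = \<psi> g"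
    by (rule c[THEN conjunct2, THEN conjunct2, THEN mp])
  show "\<psi> (\<lambda>y. 1) = \<one>\<^bsub>E\<^esub>" by (rule a[THEN conjunct2])
qed

text \<open>The map \<psi>1 \<otimes> \<psi>2 followed by multiplication in \<open>E\<close>,
  evaluated on a representative of a tensor.\<close>

definition tv :: "('e, 'y) ring_scheme \<Rightarrow> ('f \<Rightarrow> 'e) \<Rightarrow> ('g \<Rightarrow> 'e) \<Rightarrow> ('f \<times> 'g) list \<Rightarrow> 'e" where
  "tv E \<psi>1 \<psi>2 ts = foldr (\<lambda>(a, b) e. \<psi>1 a \<otimes>\<^bsub>E\<^esub> \<psi>2 b \<oplus>\<^bsub>E\<^esub> e) ts \<zero>\<^bsub>E\<^esub>"

lemma tv_simps [simp]:
  "tv E \<psi>1 \<psi>2 [] = \<zero>\<^bsub>E\<^esub>"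
  "tv E \<psi>1 \<psi>2 ((a, b) # ts) = \<psi>1 a \<otimes>\<^bsub>E\<^esub> \<psi>2 b \<oplus>\<^bsub>E\<^esub> tv E \<psi>1 \<psi>2 ts"
  by (simp_all add: tv_def)

text \<open>\<open>same_consts\<close> is what makes the induced map on tensors bilinear over the
  complex numbers: scalars may be moved from one factor to the other.\<close>

locale hom_pair = E: cring E
  for X :: "'a fspace" and x :: 'a and E :: "('e, 'y) ring_scheme" (structure)
    and \<psi>1 :: "('a \<Rightarrow> complex) \<Rightarrow> 'e" and \<psi>2 :: "('a \<Rightarrow> complex) \<Rightarrow> 'e" +
  assumes X: "sheaf_of_functions X" and x_point: "x \<in> points X"
    and h1: "germ_hom X x E \<psi>1" and h2: "germ_hom X x E \<psi>2"
    and same_consts: "\<psi>1 (\<lambda>y. c) = \<psi>2 (\<lambda>y. c)"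
begin

abbreviation "G \<equiv> germs_at X x"
abbreviation "T \<equiv> tv E \<psi>1 \<psi>2"

lemma alg: "fun_alg G" by (rule fun_alg_germs_at[OF X x_point])

lemmas psi1_closed [simp] = germ_hom_closed[OF h1]
lemmas psi2_closed [simp] = germ_hom_closed[OF h2]

lemma T_closed [simp]: "set ts \<subseteq> G \<times> G \<Longrightarrow> T ts \<in> carrier E"
  by (induction ts) auto

lemma T_append: "set ts \<subseteq> G \<times> G \<Longrightarrow> set us \<subseteq> G \<times> G \<Longrightarrow> T (ts @ us) = T ts \<oplus> T us"
  by (induction ts) (auto simp: E.a_ac)

lemma mul2_closed: "set ts \<subseteq> G \<times> G \<Longrightarrow> set us \<subseteq> G \<times> G \<Longrightarrow> set (mul2 ts us) \<subseteq> G \<times> G"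
  unfolding mul2_def using fun_alg_mult[OF alg] by (fastforce simp: case_prod_unfold)

lemma T_mul2_single:
  assumes "a \<in> G" "b \<in> G"
  shows "set us \<subseteq> G \<times> G \<Longrightarrow> T (map (\<lambda>(c, d). (\<lambda>x. a x * c x, \<lambda>y. b y * d y)) us) = \<psi>1 a \<otimes> \<psi>2 b \<otimes> T us"
proof (induction us)
  case Nil then show ?case using assms by simp
next
  case (Cons u us)
  obtain c d where u: "u = (c, d)" by (cases u)
  have cd: "c \<in> G" "d \<in> G" using Cons u by auto
  show ?case
    using Cons cd assms
    by (simp add: u germ_hom_mult[OF h1] germ_hom_mult[OF h2] E.r_distr E.m_ac)
qed

lemma T_mul2: "set ts \<subseteq> G \<times> G \<Longrightarrow> set us \<subseteq> G \<times> G \<Longrightarrow> T (mul2 ts us) = T ts \<otimes> T us"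
proof (induction ts)
  case Nil then show ?case by (simp add: mul2_def)
next
  case (Cons t ts)
  obtain a b where t: "t = (a, b)" by (cases t)
  have ab: "a \<in> G" "b \<in> G" using Cons t by auto
  have e: "mul2 (t # ts) us = map (\<lambda>(c, d). (\<lambda>x. a x * c x, \<lambda>y. b y * d y)) us @ mul2 ts us"
    by (simp add: mul2_def t)
  have "set (mul2 [t] us) \<subseteq> G \<times> G" by (rule mul2_closed) (use Cons in auto)
  then have m: "set (map (\<lambda>(c, d). (\<lambda>x. a x * c x, \<lambda>y. b y * d y)) us) \<subseteq> G \<times> G"
    by (simp add: mul2_def t)
  show ?case
    unfolding e using Cons T_append[OF m mul2_closed] T_mul2_single[OF ab, of us] ab
    by (simp add: t E.l_distr)
qed

lemma psi_zero: "\<psi>1 (\<lambda>y. 0) = \<zero>" "\<psi>2 (\<lambda>y. 0) = \<zero>"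
proof -
  have "\<psi>1 (\<lambda>y. 0) \<oplus> \<psi>1 (\<lambda>y. 0) = \<psi>1 (\<lambda>y. 0)"
    using germ_hom_add[OF h1, of "\<lambda>y. 0" "\<lambda>y. 0"] fun_alg_const[OF alg] by simp
  then show "\<psi>1 (\<lambda>y. 0) = \<zero>" using fun_alg_const[OF alg] by (simp add: E.add.l_cancel_one')
  then show "\<psi>2 (\<lambda>y. 0) = \<zero>" using same_consts[of 0] by simp
qed

text \<open>A step of elimination: from each second factor a multiple of \<open>b0\<close> is
  subtracted, and what was removed is collected in one tensor with second factor \<open>b0\<close>.
  For \<open>\<beta> = b0 y0\<close> the new second factors vanish at \<open>y0\<close>.\<close>

lemma T_shear:
  fixes \<beta> :: complex
  assumes b0: "b0 \<in> G"
  shows "set ts \<subseteq> G \<times> G \<Longrightarrow> (\<lambda>u. eval2 ts (u, y0) / \<beta>) \<in> G \<and>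
    T (map (\<lambda>(a, b). (a, \<lambda>v. b v - b y0 / \<beta> * b0 v)) ts) \<oplus>
      \<psi>1 (\<lambda>u. eval2 ts (u, y0) / \<beta>) \<otimes> \<psi>2 b0 = T ts"
proof (induction ts)
  case Nil then show ?case using b0 by (simp add: psi_zero fun_alg_const[OF alg])
next
  case (Cons t ts)
  obtain a b where t: "t = (a, b)" by (cases t)
  define c where "c = b y0 / \<beta>"
  let ?k = "\<lambda>y::'a. c" and ?b' = "\<lambda>v. b v - c * b0 v" and ?r = "\<lambda>u. eval2 ts (u, y0) / \<beta>"
  let ?m = "map (\<lambda>(a, b). (a, \<lambda>v. b v - b y0 / \<beta> * b0 v)) ts"
  have ab: "a \<in> G" "b \<in> G" and IH: "?r \<in> G" "T ?m \<oplus> \<psi>1 ?r \<otimes> \<psi>2 b0 = T ts" and ts: "set ts \<subseteq> G \<times> G"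
    using Cons t by auto
  have k: "?k \<in> G" by (rule fun_alg_const[OF alg])
  have kb: "(\<lambda>v. c * b0 v) \<in> G" by (rule fun_alg_scale[OF alg b0])
  have b': "?b' \<in> G" by (rule fun_alg_diff[OF alg ab(2) kb])
  have ka: "(\<lambda>u. c * a u) \<in> G" by (rule fun_alg_scale[OF alg ab(1)])
  have m: "set ?m \<subseteq> G \<times> G"
    using ts by (auto intro!: fun_alg_diff[OF alg] fun_alg_scale[OF alg b0]
        simp del: times_divide_eq_left times_divide_eq_right)
  have e: "(\<lambda>u. eval2 (t # ts) (u, y0) / \<beta>) = (\<lambda>u. c * a u + ?r u)"
    by (intro ext) (simp add: t c_def add_divide_distrib mult.commute)
  have "\<psi>2 b = \<psi>2 (\<lambda>v. ?b' v + c * b0 v)" by simp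
  also have "\<dots> = \<psi>2 ?b' \<oplus> \<psi>2 ?k \<otimes> \<psi>2 b0"
    by (subst germ_hom_add[OF h2 b' kb]) (simp add: germ_hom_mult[OF h2 k b0])
  finally have pb: "\<psi>2 b = \<psi>2 ?b' \<oplus> \<psi>2 ?k \<otimes> \<psi>2 b0" .
  have pe: "\<psi>1 (\<lambda>u. c * a u + ?r u) = \<psi>2 ?k \<otimes> \<psi>1 a \<oplus> \<psi>1 ?r"
    by (subst germ_hom_add[OF h1 ka IH(1)]) (simp add: germ_hom_mult[OF h1 k ab(1)] same_consts)
  have "T (map (\<lambda>(a, b). (a, \<lambda>v. b v - b y0 / \<beta> * b0 v)) (t # ts)) \<oplus>
      \<psi>1 (\<lambda>u. c * a u + ?r u) \<otimes> \<psi>2 b0 =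
      (\<psi>1 a \<otimes> \<psi>2 ?b' \<oplus> T ?m) \<oplus> (\<psi>2 ?k \<otimes> \<psi>1 a \<oplus> \<psi>1 ?r) \<otimes> \<psi>2 b0"
    by (simp only: t pe c_def[symmetric] list.map prod.case tv_simps)
  also have "\<dots> = \<psi>1 a \<otimes> (\<psi>2 ?b' \<oplus> \<psi>2 ?k \<otimes> \<psi>2 b0) \<oplus> (T ?m \<oplus> \<psi>1 ?r \<otimes> \<psi>2 b0)"
    using ab b' k m IH(1) b0 by (simp add: E.l_distr E.r_distr E.a_ac E.m_ac)
  also have "\<dots> = T (t # ts)" by (simp only: t IH(2) pb[symmetric] tv_simps)
  finally show ?case unfolding e using fun_alg_add[OF alg ka IH(1)] by simp
qed

text \<open>This stands in for the injectivity of the map from the tensor product of function algebras into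
  the functions on the product.\<close>

lemma T_zero:
  assumes U: "openX X U" "x \<in> U"
  shows "set ts \<subseteq> G \<times> G \<Longrightarrow> (\<And>u v. u \<in> U \<Longrightarrow> v \<in> U \<Longrightarrow> eval2 ts (u, v) = 0) \<Longrightarrow> T ts = \<zero>"
proof (induction "length ts" arbitrary: ts)
  case 0 then show ?case by simp
next
  case (Suc n)
  then obtain t ts' where ts: "ts = t # ts'" by (cases ts) auto
  obtain a0 b0 where t: "t = (a0, b0)" by (cases t)
  have ab: "a0 \<in> G" "b0 \<in> G" and ts': "set ts' \<subseteq> G \<times> G" using Suc.prems ts t by auto
  have z: "eval2 ts' (u, v) = - (a0 u * b0 v)" if "u \<in> U" "v \<in> U" for u v
    using Suc.prems(2)[OF that] by (simp add: ts t add_eq_0_iff)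
  show ?case
  proof (cases "\<forall>v\<in>U. b0 v = 0")
    case True
    have "germ X x b0 = germ X x (\<lambda>y. 0)" using True by (intro germ_eqI[OF U]) auto
    then have "\<psi>2 b0 = \<zero>"
      using germ_hom_cong[OF h2 ab(2) fun_alg_const[OF alg]] psi_zero by metis
    moreover have "T ts' = \<zero>" using Suc ts ts' z True by simp
    ultimately show ?thesis using ab by (simp add: ts t)
  next
    case False
    then obtain y0 where y0: "y0 \<in> U" "b0 y0 \<noteq> 0" by blast
    \<comment> \<open>At v = y0 the relation expresses \<open>a0\<close> through the tail. After the
      shear the tail alone represents zero, and it is shorter than \<open>ts\<close>, so the
      induction hypothesis applies to it.\<close>
    let ?us = "map (\<lambda>(a, b). (a, \<lambda>v. b v - b y0 / b0 y0 * b0 v)) ts'"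
    have us: "set ?us \<subseteq> G \<times> G"
      using ts' by (auto intro!: fun_alg_diff[OF alg] fun_alg_scale[OF alg ab(2)]
        simp del: times_divide_eq_left times_divide_eq_right)
    have "eval2 (map (\<lambda>(a, b). (a, \<lambda>v. b v - b y0 / b0 y0 * b0 v)) l) (u, v) =
        eval2 l (u, v) - eval2 l (u, y0) / b0 y0 * b0 v" for l :: "(('a \<Rightarrow> complex) \<times> ('a \<Rightarrow> complex)) list" and u v
      by (induction l) (auto simp: algebra_simps add_divide_distrib)
    then have "eval2 ?us (u, v) = 0" if "u \<in> U" "v \<in> U" for u v
      using z that y0 by simp
    then have Tus: "T ?us = \<zero>" using Suc(1)[of ?us] Suc(2) ts us by simp
    note sh = T_shear[OF ab(2) ts', of y0 "b0 y0"]
    have m: "(\<lambda>u. - a0 u) \<in> G" by (rule fun_alg_uminus[OF alg ab(1)])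
    have "germ X x (\<lambda>u. eval2 ts' (u, y0) / b0 y0) = germ X x (\<lambda>u. - a0 u)"
      using z y0 by (intro germ_eqI[OF U]) (auto simp: field_simps)
    then have "\<psi>1 (\<lambda>u. eval2 ts' (u, y0) / b0 y0) = \<psi>1 (\<lambda>u. - a0 u)"
      using germ_hom_cong[OF h1 sh[THEN conjunct1] m] by simp
    then have "T ts' = \<psi>1 (\<lambda>u. - a0 u) \<otimes> \<psi>2 b0" using sh Tus m ab by simp
    then have "T ts = (\<psi>1 a0 \<oplus> \<psi>1 (\<lambda>u. - a0 u)) \<otimes> \<psi>2 b0"
      using ab m by (simp add: ts t E.l_distr)
    also have "\<psi>1 a0 \<oplus> \<psi>1 (\<lambda>u. - a0 u) = \<zero>"
      using germ_hom_add[OF h1 ab(1) m] psi_zero by simp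
    finally show ?thesis using ab by simp
  qed
qed

lemma T_unique:
  assumes U: "openX X U" "x \<in> U" and ts: "set ts \<subseteq> G \<times> G" and us: "set us \<subseteq> G \<times> G"
    and eq: "\<And>u v. u \<in> U \<Longrightarrow> v \<in> U \<Longrightarrow> eval2 ts (u, v) = eval2 us (u, v)"
  shows "T ts = T us"
proof -
  \<comment> \<open>The tensor -1 \<otimes> 1, multiplication by which serves as negation. Both
    \<open>ts\<close> and \<open>us\<close> are compared with the same negative of
    \<open>us\<close>, so the value of \<open>T\<close> on it cancels.\<close>
  let ?k = "[(\<lambda>y::'a. -1::complex, \<lambda>y::'a. 1::complex)]"
  have k: "set ?k \<subseteq> G \<times> G" using fun_alg_const[OF alg] by simp
  have z: "T (ts @ mul2 ?k us) = \<zero>"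
    by (rule T_zero[OF U]) (use ts mul2_closed[OF k us] eq in \<open>auto simp: eval2_mul2\<close>)
  have z': "T (us @ mul2 ?k us) = \<zero>"
    by (rule T_zero[OF U]) (use us mul2_closed[OF k us] eq in \<open>auto simp: eval2_mul2\<close>)
  have "T ts \<oplus> T (mul2 ?k us) = T us \<oplus> T (mul2 ?k us)"
    using z z' T_append[OF ts mul2_closed[OF k us]] T_append[OF us mul2_closed[OF k us]] by simp
  then show ?thesis using ts us mul2_closed[OF k us] by (simp add: E.add.r_cancel)
qed

end

section \<open>Coordinates on affine open sets\<close>

lemma fun_alg_polyfun: "fun_alg (polyfun n)"
  unfolding fun_alg_def by (auto intro: polyfun.intros)

lemma chart_system_affine: "chart_system {(Z, polyfun n)}"
proof -
  have "polyfun n \<union> polyfun n \<subseteq> agreeing (Z \<inter> Z) (polyfun n)"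
    using agreeing_superset[of "polyfun n" "Z \<inter> Z"] by simp
  then show ?thesis
    unfolding chart_system_def by (auto simp: fun_alg_agreeing[OF fun_alg_polyfun])
qed

text \<open>The coordinate algebra of \<open>U\<close> is pulled back from polynomials. It is
  recorded through what it provides: denominators can be cleared by elements of \<open>A\<close>
  with identities valid on all of \<open>U\<close>, principal open sets form a basis, and points are
  separated.\<close>

lemma affine_open_coordinates:
  assumes X: "sheaf_of_functions X" and U: "affine_open X U"
  obtains A where "fun_alg A" "A \<subseteq> regs X U"
    "\<And>a. a \<in> A \<Longrightarrow> openX X {u \<in> U. a u \<noteq> 0}"
    "\<And>a. a \<in> A \<Longrightarrow> (\<lambda>u. 1 / a u) \<in> regs X {u \<in> U. a u \<noteq> 0}"
    "\<And>x f. x \<in> U \<Longrightarrow> f \<in> germs_at X x \<Longrightarrow> \<exists>s\<in>A. \<exists>a\<in>A. s x \<noteq> 0 \<and> (\<forall>u\<in>U. s u * f u = a u)"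
    "\<And>x W. x \<in> W \<Longrightarrow> x \<in> U \<Longrightarrow> openX X W \<Longrightarrow> \<exists>s\<in>A. s x \<noteq> 0 \<and> {u \<in> U. s u \<noteq> 0} \<subseteq> W"
    "\<And>x y. x \<in> U \<Longrightarrow> y \<in> U \<Longrightarrow> x \<noteq> y \<Longrightarrow> \<exists>a\<in>A. a x \<noteq> a y"
proof -
  obtain n Z \<phi> where oU: "openX X U" and Z: "algebraic_set n Z"
    and iso: "fspace_iso (open_subspace X U) (affine_variety n Z) \<phi>"
    using U unfolding affine_open_def by (elim conjE exE)
  let ?X = "open_subspace X U" and ?Y = "affine_variety n Z"
  note charts = chart_system_affine[of Z n]
  have Y: "?Y = fraction_space {(Z, polyfun n)}" by (simp add: affine_variety_def)
  have UX: "U \<subseteq> points X" using openin_subset[OF oU] .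
  have pX: "points ?X = U" using UX by (simp add: open_subspace_def inf.absorb2)
  have pY: "points ?Y = Z" unfolding Y by (simp add: points_fraction_space[OF charts])
  have opX: "openX ?X W \<longleftrightarrow> openX X W \<and> W \<subseteq> U" for W
    by (simp add: open_subspace_def openin_open_subtopology[OF oU])
  have FY: "function_space ?Y" unfolding Y by (rule function_space_fraction_space[OF charts])
  note SY = function_space_sheaf[OF FY]
  have homeo: "homeomorphic_map (zariski ?X) (zariski ?Y) \<phi>"
    and reg: "\<And>V f. openX ?Y V \<Longrightarrow> f \<in> extensional V \<Longrightarrow>
      f \<in> reg ?Y V \<longleftrightarrow> pullback \<phi> ?X V f \<in> reg ?X (preim \<phi> ?X V)"
    using iso unfolding fspace_iso_def by auto
  have inj: "inj_on \<phi> U" and im: "\<phi> ` U = Z"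
    using homeomorphic_imp_injective_map[OF homeo] homeomorphic_imp_surjective_map[OF homeo] pX pY by auto
  define \<psi> where "\<psi> = inv_into U \<phi>"
  have \<psi>: "\<psi> (\<phi> u) = u" if "u \<in> U" for u unfolding \<psi>_def using inj that by simp
  have pre: "preim \<phi> ?X V = {u \<in> U. \<phi> u \<in> V}" for V by (simp add: preim_def pX)
  have pre_open: "openX X {u \<in> U. \<phi> u \<in> V}" if "openX ?Y V" for V
  proof -
    have "openX ?X {u \<in> points ?X. \<phi> u \<in> V}"
      by (rule openin_continuous_map_preimage[OF homeomorphic_imp_continuous_map[OF homeo] that])
    then show ?thesis unfolding pX opX by simp
  qed
  have im_open: "openX ?Y (\<phi> ` W)" if "openX X W" "W \<subseteq> U" for W
    using homeomorphic_map_openness[OF homeo, of W] that pX opX by simp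
  have regX: "reg ?X = reg X" by (simp add: open_subspace_def)
  have reg1: "(\<lambda>u. g (\<phi> u)) \<in> regs X {u \<in> U. \<phi> u \<in> V}" if V: "openX ?Y V" and g: "g \<in> regs ?Y V" for g V
  proof -
    have "pullback \<phi> ?X V (restrict g V) \<in> reg ?X (preim \<phi> ?X V)"
      using reg[OF V, of "restrict g V"] g by (simp add: restrict_reg_iff)
    then show ?thesis unfolding pullback_restrict regX pre regs_def by simp
  qed
  have reg2: "(\<lambda>z. f (\<psi> z)) \<in> regs ?Y (\<phi> ` W)" if W: "openX X W" "W \<subseteq> U" and f: "f \<in> regs X W" for f W
  proof -
    have p: "preim \<phi> ?X (\<phi> ` W) = W" unfolding pre using W(2) inj by (auto simp: inj_on_def)
    have "restrict (\<lambda>u. f (\<psi> (\<phi> u))) W = restrict f W" using W(2) \<psi> by (intro restrict_ext) auto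
    then have "pullback \<phi> ?X (\<phi> ` W) (restrict (\<lambda>z. f (\<psi> z)) (\<phi> ` W)) \<in> reg ?X (preim \<phi> ?X (\<phi> ` W))"
      unfolding pullback_restrict p regX using f by (simp add: regs_def)
    then show ?thesis using reg[OF im_open[OF W], of "restrict (\<lambda>z. f (\<psi> z)) (\<phi> ` W)"]
      by (simp add: restrict_reg_iff)
  qed
  have poly: "p \<in> regs ?Y Z" if "p \<in> polyfun n" for p
    unfolding Y by (rule agreeing_regs[OF charts]) (use that agreeing_superset in auto)
  have oZ: "openX ?Y Z" using openin_topspace[of "zariski ?Y"] by (simp add: pY)
  have UZ: "{u \<in> U. \<phi> u \<in> Z} = U" using im by auto
  define A where "A = {\<lambda>u. p (\<phi> u) | p. p \<in> polyfun n}"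
  have UV: "{u \<in> U. \<phi> u \<in> {z \<in> Z. p z \<noteq> 0}} = {u \<in> U. p (\<phi> u) \<noteq> 0}" for p :: "_ \<Rightarrow> complex"
    using im by auto
  show ?thesis
  proof (rule that[of A])
    show "fun_alg A"
      unfolding fun_alg_def
    proof (intro conjI allI ballI)
      fix c show "(\<lambda>u. c) \<in> A" unfolding A_def using polyfun.const[of c n] by (intro CollectI exI[of _ "\<lambda>v. c"]) simp
    next
      fix f g assume "f \<in> A" "g \<in> A"
      then obtain p q where pq: "f = (\<lambda>u. p (\<phi> u))" "g = (\<lambda>u. q (\<phi> u))" "p \<in> polyfun n" "q \<in> polyfun n"
        unfolding A_def by blast
      show "(\<lambda>u. f u + g u) \<in> A" unfolding A_def
        by (intro CollectI exI[of _ "\<lambda>v. p v + q v"]) (simp add: pq polyfun.add)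
      show "(\<lambda>u. f u * g u) \<in> A" unfolding A_def
        by (intro CollectI exI[of _ "\<lambda>v. p v * q v"]) (simp add: pq polyfun.mult)
    qed
    show "A \<subseteq> regs X U"
    proof
      fix a assume "a \<in> A"
      then obtain p where p: "a = (\<lambda>u. p (\<phi> u))" "p \<in> polyfun n" unfolding A_def by blast
      show "a \<in> regs X U" using reg1[OF oZ poly[OF p(2)]] unfolding UZ p(1) .
    qed
    fix a assume "a \<in> A"
    then obtain p where p: "a = (\<lambda>u. p (\<phi> u))" "p \<in> polyfun n" unfolding A_def by blast
    note oV = function_space_open[OF FY oZ poly[OF p(2)]]
    show "openX X {u \<in> U. a u \<noteq> 0}" using pre_open[OF oV] unfolding UV p(1) .
    show "(\<lambda>u. 1 / a u) \<in> regs X {u \<in> U. a u \<noteq> 0}"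
      using reg1[OF oV function_space_inverse[OF FY oZ poly[OF p(2)]]] unfolding UV p(1) .
  next
    fix x f assume x: "x \<in> U" and "f \<in> germs_at X x"
    then obtain W where W: "openX X W" "x \<in> W" "f \<in> regs X W" unfolding germs_at_def by blast
    have o: "openX X (W \<inter> U)" using W oU by auto
    have f: "(\<lambda>z. f (\<psi> z)) \<in> regs ?Y (\<phi> ` (W \<inter> U))"
      by (rule reg2[OF o _ regs_subset[OF X W(1) o _ W(3)]]) auto
    have "\<phi> x \<in> \<phi> ` (W \<inter> U)" using W x by blast
    from f[unfolded Y, unfolded regs_fraction_space[OF charts], THEN bspec, OF this] obtain g h where gh: "g \<in> agreeing Z (polyfun n)" "h \<in> agreeing Z (polyfun n)" "h (\<phi> x) \<noteq> 0"
      "\<forall>y\<in>Z. h y \<noteq> 0 \<longrightarrow> y \<in> \<phi> ` (W \<inter> U) \<and> f (\<psi> y) = g y / h y"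
      by auto
    obtain g' h' where p: "g' \<in> polyfun n" "h' \<in> polyfun n" "\<forall>y\<in>Z. g y = g' y" "\<forall>y\<in>Z. h y = h' y"
      using gh(1,2) unfolding agreeing_def by auto
    \<comment> \<open>The extra factor h' makes the identity hold on all of \<open>U\<close>: where
      h' vanishes nothing is known of f, but both sides are zero.\<close>
    have "(\<lambda>u. h' (\<phi> u) * h' (\<phi> u)) \<in> A" "(\<lambda>u. h' (\<phi> u) * g' (\<phi> u)) \<in> A"
      unfolding A_def
      by (intro CollectI exI[of _ "\<lambda>v. h' v * h' v"] conjI refl polyfun.mult p)
         (intro CollectI exI[of _ "\<lambda>v. h' v * g' v"] conjI refl polyfun.mult p)
    moreover have "h' (\<phi> u) * h' (\<phi> u) * f u = h' (\<phi> u) * g' (\<phi> u)" if u: "u \<in> U" for u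
    proof (cases "h' (\<phi> u) = 0")
      case False
      have z: "\<phi> u \<in> Z" using u im by auto
      then have "f u = g' (\<phi> u) / h' (\<phi> u)" using False gh(4) p \<psi>[OF u] by auto
      then show ?thesis using False by simp
    qed simp
    moreover have "h' (\<phi> x) \<noteq> 0" using gh(3) p(4) x im by auto
    ultimately show "\<exists>s\<in>A. \<exists>a\<in>A. s x \<noteq> 0 \<and> (\<forall>u\<in>U. s u * f u = a u)"
      by (intro bexI[of _ "\<lambda>u. h' (\<phi> u) * h' (\<phi> u)"] bexI[of _ "\<lambda>u. h' (\<phi> u) * g' (\<phi> u)"]) auto
  next
    fix x W assume x: "x \<in> W" "x \<in> U" and W: "openX X W"
    have o: "openX ?Y (\<phi> ` (W \<inter> U))" by (rule im_open) (use W oU in auto)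
    have "\<phi> x \<in> \<phi> ` (W \<inter> U)" using x by blast
    from o[unfolded Y, unfolded openX_fraction_space[OF charts], THEN bspec, OF this] obtain k where k: "k \<in> agreeing Z (polyfun n)" "k (\<phi> x) \<noteq> 0" "{z \<in> Z. k z \<noteq> 0} \<subseteq> \<phi> ` (W \<inter> U)"
      by auto
    obtain k' where p: "k' \<in> polyfun n" "\<forall>y\<in>Z. k y = k' y"
      using k(1) unfolding agreeing_def by auto
    have "u \<in> W" if u: "u \<in> U" "k' (\<phi> u) \<noteq> 0" for u
    proof -
      have "\<phi> u \<in> \<phi> ` (W \<inter> U)" using k(3) p(2) u im by auto
      then show ?thesis using inj u(1) by (auto simp: inj_on_def)
    qed
    moreover have "(\<lambda>u. k' (\<phi> u)) \<in> A" unfolding A_def using p by blast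
    moreover have "k' (\<phi> x) \<noteq> 0" using k(2) p(2) x(2) im by auto
    ultimately show "\<exists>s\<in>A. s x \<noteq> 0 \<and> {u \<in> U. s u \<noteq> 0} \<subseteq> W"
      by (intro bexI[of _ "\<lambda>u. k' (\<phi> u)"]) auto
  next
    fix x y assume xy: "x \<in> U" "y \<in> U" "x \<noteq> y"
    have "Z \<subseteq> affine_space n" using Z unfolding algebraic_set_def by blast
    then have "\<phi> x \<in> affine_space n" "\<phi> y \<in> affine_space n" using xy im by auto
    moreover have "\<phi> x \<noteq> \<phi> y" using xy inj by (auto simp: inj_on_def)
    ultimately obtain i where "i < n" "\<phi> x i \<noteq> \<phi> y i"
      unfolding affine_space_def by (metis PiE_ext lessThan_iff)
    have "(\<lambda>u. \<phi> u i) \<in> A"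
      unfolding A_def by (intro CollectI exI[of _ "\<lambda>v. v i"] conjI refl polyfun.coord \<open>i < n\<close>)
    then show "\<exists>a\<in>A. a x \<noteq> a y"
      using \<open>\<phi> x i \<noteq> \<phi> y i\<close> by (intro bexI[of _ "\<lambda>u. \<phi> u i"])
  qed
qed

lemma function_space_variety:
  assumes "variety X"
  shows "function_space X"
proof -
  have X: "sheaf_of_functions X" using assms by (simp add: variety_def)
  have "openX X {x \<in> U. f x \<noteq> 0} \<and> (\<lambda>x. 1 / f x) \<in> regs X {x \<in> U. f x \<noteq> 0}"
    if U: "openX X U" and f: "f \<in> regs X U" for U f
  proof -
    have *: "\<exists>N. openX X N \<and> x \<in> N \<and> N \<subseteq> {x \<in> U. f x \<noteq> 0} \<and> (\<lambda>x. 1 / f x) \<in> regs X N"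
      if x: "x \<in> U" "f x \<noteq> 0" for x
    proof -
      have "x \<in> points X" using openin_subset[OF U] x by blast
      then obtain W where W: "affine_open X W" "x \<in> W"
        using assms unfolding variety_def by blast
      obtain A where A: "fun_alg A" "A \<subseteq> regs X W"
        "\<And>a. a \<in> A \<Longrightarrow> openX X {u \<in> W. a u \<noteq> 0}"
        "\<And>a. a \<in> A \<Longrightarrow> (\<lambda>u. 1 / a u) \<in> regs X {u \<in> W. a u \<noteq> 0}"
        "\<And>x f. x \<in> W \<Longrightarrow> f \<in> germs_at X x \<Longrightarrow> \<exists>s\<in>A. \<exists>a\<in>A. s x \<noteq> 0 \<and> (\<forall>u\<in>W. s u * f u = a u)"
        "\<And>x N. x \<in> N \<Longrightarrow> x \<in> W \<Longrightarrow> openX X N \<Longrightarrow> \<exists>s\<in>A. s x \<noteq> 0 \<and> {u \<in> W. s u \<noteq> 0} \<subseteq> N"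
        by (rule affine_open_coordinates[OF X W(1)], rule that) assumption+
      have oW: "openX X W" using W(1) by (simp add: affine_open_def)
      obtain s a where s: "s \<in> A" "a \<in> A" "s x \<noteq> 0" "\<forall>u\<in>W. s u * f u = a u"
        using A(5)[OF W(2) germs_atI[OF U x(1) f]] by blast
      obtain k where k: "k \<in> A" "k x \<noteq> 0" "{u \<in> W. k u \<noteq> 0} \<subseteq> U"
        using A(6)[OF x(1) W(2) U] by blast
      \<comment> \<open>Near x the inverse of f is s k / (k a). On \<open>W\<close> the function a =
        s f is non-zero exactly where s and f are, and k confines the locus to \<open>U\<close>,
        where f is regular.\<close>
      let ?q = "\<lambda>u. k u * a u"
      have q: "?q \<in> A" by (rule fun_alg_mult[OF A(1) k(1) s(2)])
      let ?N = "{u \<in> W. ?q u \<noteq> 0}"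
      have "x \<in> ?N" using W(2) k(2) s(3) x(2) s(4)[rule_format, OF W(2)] by auto
      moreover have "?N \<subseteq> {x \<in> U. f x \<noteq> 0}" using k(3) s(4)[rule_format] by fastforce
      moreover have "(\<lambda>x. 1 / f x) \<in> regs X ?N"
      proof -
        have "(\<lambda>u. s u * k u) \<in> regs X ?N"
          by (rule regs_subset[OF X oW A(3)[OF q]]) (use fun_alg_mult[OF A(1) s(1) k(1)] A(2) in auto)
        from fun_alg_mult[OF fun_alg_regs[OF X A(3)[OF q]] this A(4)[OF q]]
        show ?thesis
        proof (rule regs_cong)
          fix u assume u: "u \<in> ?N"
          then have e: "s u * f u = a u" "k u \<noteq> 0" "a u \<noteq> 0" using s(4) by auto
          then have "s u \<noteq> 0" "f u \<noteq> 0" by auto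
          then show "s u * k u * (1 / (k u * a u)) = 1 / f u"
            using e(2) by (simp add: e(1)[symmetric])
        qed
      qed
      ultimately show ?thesis using A(3)[OF q] by blast
    qed
    have o: "openX X {x \<in> U. f x \<noteq> 0}"
    proof (subst openin_subopen, intro ballI)
      fix x assume "x \<in> {x \<in> U. f x \<noteq> 0}"
      then show "\<exists>N. openX X N \<and> x \<in> N \<and> N \<subseteq> {x \<in> U. f x \<noteq> 0}" using * by blast
    qed
    moreover have "(\<lambda>x. 1 / f x) \<in> regs X {x \<in> U. f x \<noteq> 0}"
    proof (rule regs_local[OF X o])
      fix x assume "x \<in> {x \<in> U. f x \<noteq> 0}"
      then show "\<exists>N. openX X N \<and> x \<in> N \<and> (\<lambda>x. 1 / f x) \<in> regs X N" using *[of x] by auto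
    qed
    ultimately show ?thesis ..
  qed
  then show ?thesis using X by (auto simp: function_space_def)
qed

section \<open>The value of \<open>D\<close> at a point of the diagonal\<close>

definition phi1 :: "'a fspace \<Rightarrow> 'a \<Rightarrow> ('a \<Rightarrow> complex) \<Rightarrow> ('a \<Rightarrow> complex) set \<times> 'a cotangent" where
  "phi1 X x f = (germ X x f, \<ominus>\<^bsub>Omega_stalk X x\<^esub> dgerm X x f)"

definition phi2 :: "'a fspace \<Rightarrow> 'a \<Rightarrow> ('a \<Rightarrow> complex) \<Rightarrow> ('a \<Rightarrow> complex) set \<times> 'a cotangent" where
  "phi2 X x f = (germ X x f, dgerm X x f \<oplus>\<^bsub>Omega_stalk X x\<^esub> dgerm X x f)"

abbreviation stalk_ext :: "'a fspace \<Rightarrow> 'a \<Rightarrow> (('a \<Rightarrow> complex) set \<times> 'a cotangent) ring" where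
  "stalk_ext X x \<equiv> triv_ext (stalk X x) (Omega_stalk X x)"

text \<open>\<open>D\<close> on representatives, so that \<open>forms X x (dlist ts)\<close> is the
  germ at \<open>x\<close> of its value on the tensor \<open>ts\<close>.\<close>

definition dlist :: "(('a \<Rightarrow> complex) \<times> ('a \<Rightarrow> complex)) list \<Rightarrow> (('a \<Rightarrow> complex) \<times> ('a \<Rightarrow> complex)) list" where
  "dlist ts = concat (map (\<lambda>(a, b). [(\<lambda>y. 2 * a y, b), (\<lambda>y. - b y, a)]) ts)"

lemma dlist_simps [simp]:
  "dlist [] = []" "dlist ((a, b) # ts) = (\<lambda>y. 2 * a y, b) # (\<lambda>y. - b y, a) # dlist ts"
  by (simp_all add: dlist_def)

lemma dlist_closed: "fun_alg G \<Longrightarrow> set ts \<subseteq> G \<times> G \<Longrightarrow> set (dlist ts) \<subseteq> G \<times> G"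
  by (induction ts) (auto intro: fun_alg_scale fun_alg_uminus)

lemma eval2_diag: "fun_alg G \<Longrightarrow> set ts \<subseteq> G \<times> G \<Longrightarrow> (\<lambda>u. eval2 ts (u, u)) \<in> G"
  by (induction ts) (auto intro!: fun_alg_const fun_alg_add fun_alg_mult)

text \<open>The value at \<open>(x, x)\<close> of the ring homomorphism that sends a function \<open>t\<close> on \<open>X \<times> X\<close> to the pair
  of its restriction to the diagonal and of \<open>D t\<close>: it is determined by \<open>t\<close> being a fraction of
  tensors.\<close>

definition dval :: "'a fspace \<Rightarrow> 'a \<Rightarrow> ('a \<times> 'a \<Rightarrow> complex) \<Rightarrow> ('a \<Rightarrow> complex) set \<times> 'a cotangent \<Rightarrow> bool" where
  "dval X x t e \<longleftrightarrow> e \<in> carrier (stalk_ext X x) \<and>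
     (\<exists>U ts us. openX X U \<and> x \<in> U \<and> set ts \<subseteq> germs_at X x \<times> germs_at X x \<and>
        set us \<subseteq> germs_at X x \<times> germs_at X x \<and> eval2 us (x, x) \<noteq> 0 \<and>
        (\<forall>u\<in>U. \<forall>v\<in>U. eval2 us (u, v) * t (u, v) = eval2 ts (u, v)) \<and>
        tv (stalk_ext X x) (phi1 X x) (phi2 X x) us \<otimes>\<^bsub>stalk_ext X x\<^esub> e =
          tv (stalk_ext X x) (phi1 X x) (phi2 X x) ts)"

context
  fixes X :: "'a fspace" and x :: 'a
  assumes FX: "function_space X" and x: "x \<in> points X"
begin

lemmas sheaf_at = function_space_sheaf[OF FX]

interpretation M: module "stalk X x" "Omega_stalk X x"
  by (rule module_Omega_stalk[OF sheaf_at x])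

lemmas dc = dgerm_closed[OF sheaf_at x] and gc = germ_closed[OF sheaf_at x]
lemmas germs_alg = fun_alg_germs_at[OF sheaf_at x]

lemma dgerm_cong: "germ X x f = germ X x g \<Longrightarrow> dgerm X x f = dgerm X x g"
  by (simp add: dgerm_def)

lemma germ_hom_phi1: "germ_hom X x (stalk_ext X x) (phi1 X x)"
  unfolding germ_hom_def
proof (intro conjI ballI impI)
  fix f g assume fg: "f \<in> germs_at X x" "g \<in> germs_at X x"
  show "phi1 X x (\<lambda>y. f y + g y) = phi1 X x f \<oplus>\<^bsub>stalk_ext X x\<^esub> phi1 X x g"
    using fg by (simp add: phi1_def dgerm_add[OF sheaf_at x] stalk_simps[OF x] M.M.minus_add dc)
  show "phi1 X x (\<lambda>y. f y * g y) = phi1 X x f \<otimes>\<^bsub>stalk_ext X x\<^esub> phi1 X x g"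
    using fg by (simp add: phi1_def dgerm_mult[OF sheaf_at x] stalk_simps[OF x] M.M.minus_add M.smult_r_minus dc gc)
  show "germ X x f = germ X x g \<Longrightarrow> phi1 X x f = phi1 X x g"
    using dgerm_cong[of f g] by (simp add: phi1_def)
next
  show "phi1 X x (\<lambda>y. 1) = \<one>\<^bsub>stalk_ext X x\<^esub>"
    by (simp add: phi1_def dgerm_const[OF sheaf_at x] stalk_simps[OF x] M.M.minus_equality)
qed (auto simp: phi1_def dc gc)

lemma germ_hom_phi2: "germ_hom X x (stalk_ext X x) (phi2 X x)"
  unfolding germ_hom_def
proof (intro conjI ballI impI)
  fix f g assume fg: "f \<in> germs_at X x" "g \<in> germs_at X x"
  show "phi2 X x (\<lambda>y. f y + g y) = phi2 X x f \<oplus>\<^bsub>stalk_ext X x\<^esub> phi2 X x g"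
    using fg by (simp add: phi2_def dgerm_add[OF sheaf_at x] stalk_simps[OF x] M.M.a_ac dc)
  show "phi2 X x (\<lambda>y. f y * g y) = phi2 X x f \<otimes>\<^bsub>stalk_ext X x\<^esub> phi2 X x g"
    using fg by (simp add: phi2_def dgerm_mult[OF sheaf_at x] stalk_simps[OF x] M.M.a_ac M.smult_r_distr dc gc)
  show "germ X x f = germ X x g \<Longrightarrow> phi2 X x f = phi2 X x g"
    using dgerm_cong[of f g] by (simp add: phi2_def)
next
  show "phi2 X x (\<lambda>y. 1) = \<one>\<^bsub>stalk_ext X x\<^esub>"
    by (simp add: phi2_def dgerm_const[OF sheaf_at x] stalk_simps[OF x])
qed (auto simp: phi2_def dc gc)

lemma hom_pair_phi: "hom_pair X x (stalk_ext X x) (phi1 X x) (phi2 X x)"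
proof -
  interpret cring "stalk_ext X x" by (rule M.cring_triv_ext)
  show ?thesis
    by unfold_locales
       (simp_all add: sheaf_at x germ_hom_phi1 germ_hom_phi2 phi1_def phi2_def dgerm_const[OF sheaf_at x]
          M.M.minus_equality)
qed

interpretation P: hom_pair X x "stalk_ext X x" "phi1 X x" "phi2 X x"
  by (rule hom_pair_phi)

text \<open>In the extension (a, - da) (b, 2 db) = (ab, 2a db - b da). So \<open>D\<close> is the
  second component of a ring homomorphism whose first component is restriction to the
  diagonal.\<close>

lemma tv_eq:
  "set ts \<subseteq> P.G \<times> P.G \<Longrightarrow> P.T ts = (germ X x (\<lambda>u. eval2 ts (u, u)), forms X x (dlist ts))"
proof (induction ts)
  case Nil then show ?case by (simp add: stalk_simps[OF x])
next
  case (Cons t ts)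
  obtain a b where t: "t = (a, b)" by (cases t)
  have ab: "a \<in> P.G" "b \<in> P.G" and ts: "set ts \<subseteq> P.G \<times> P.G" using Cons t by auto
  have fc: "forms X x (dlist ts) \<in> carrier (Omega_stalk X x)"
    by (rule forms_closed[OF sheaf_at x dlist_closed[OF germs_alg ts]])
  have "germ X x (\<lambda>y. 2 * a y) = germ X x a \<oplus>\<^bsub>stalk X x\<^esub> germ X x a"
    by (simp add: stalk_simps[OF x])
  then have 1: "germ X x (\<lambda>y. 2 * a y) \<odot>\<^bsub>Omega_stalk X x\<^esub> dgerm X x b =
      germ X x a \<odot>\<^bsub>Omega_stalk X x\<^esub> (dgerm X x b \<oplus>\<^bsub>Omega_stalk X x\<^esub> dgerm X x b)"
    using ab by (simp only: M.smult_l_distr M.smult_r_distr dc gc)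
  have "germ X x (\<lambda>y. - b y) = \<ominus>\<^bsub>stalk X x\<^esub> germ X x b"
    by (rule M.R.minus_equality[symmetric])
       (auto simp: stalk_simps[OF x] gc ab fun_alg_uminus[OF germs_alg])
  then have 2: "germ X x (\<lambda>y. - b y) \<odot>\<^bsub>Omega_stalk X x\<^esub> dgerm X x a =
      germ X x b \<odot>\<^bsub>Omega_stalk X x\<^esub> (\<ominus>\<^bsub>Omega_stalk X x\<^esub> dgerm X x a)"
    using ab by (simp only: M.smult_l_minus M.smult_r_minus dc gc)
  have 3: "phi1 X x a \<otimes>\<^bsub>stalk_ext X x\<^esub> phi2 X x b = (germ X x (\<lambda>y. a y * b y),
      germ X x a \<odot>\<^bsub>Omega_stalk X x\<^esub> (dgerm X x b \<oplus>\<^bsub>Omega_stalk X x\<^esub> dgerm X x b) \<oplus>\<^bsub>Omega_stalk X x\<^esub>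
      germ X x b \<odot>\<^bsub>Omega_stalk X x\<^esub> (\<ominus>\<^bsub>Omega_stalk X x\<^esub> dgerm X x a))"
    by (simp add: phi1_def phi2_def stalk_simps[OF x])
  show ?case
    unfolding t tv_simps Cons.IH[OF ts] dlist_simps forms_simps form_germ_eq[OF sheaf_at x] 1 2 3
      eval2_simps
    using ab fc by (simp add: stalk_simps[OF x] dc gc M.M.a_assoc)
qed

lemma stalk_Units:
  assumes f: "f \<in> P.G" and nz: "f x \<noteq> 0"
  shows "germ X x f \<in> Units (stalk X x)" and "(\<lambda>y. 1 / f y) \<in> P.G"
    and "germ X x f \<otimes>\<^bsub>stalk X x\<^esub> germ X x (\<lambda>y. 1 / f y) = \<one>\<^bsub>stalk X x\<^esub>"
proof -
  obtain U where U: "openX X U" "x \<in> U" "f \<in> regs X U" using f unfolding germs_at_def by blast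
  let ?N = "{y \<in> U. f y \<noteq> 0}"
  have N: "openX X ?N" "x \<in> ?N" using function_space_open[OF FX U(1,3)] U nz by auto
  show i: "(\<lambda>y. 1 / f y) \<in> P.G"
    by (rule germs_atI[OF N function_space_inverse[OF FX U(1,3)]])
  show e: "germ X x f \<otimes>\<^bsub>stalk X x\<^esub> germ X x (\<lambda>y. 1 / f y) = \<one>\<^bsub>stalk X x\<^esub>"
    unfolding stalk_simps[OF x] by (rule germ_eqI[OF N]) auto
  then have "germ X x (\<lambda>y. 1 / f y) \<otimes>\<^bsub>stalk X x\<^esub> germ X x f = \<one>\<^bsub>stalk X x\<^esub>"
    using M.R.m_comm[OF gc[OF f] gc[OF i]] by simp
  then show "germ X x f \<in> Units (stalk X x)"
    using e gc[OF f] gc[OF i] unfolding Units_def by blast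
qed

text \<open>An element of a square-zero extension is a unit as soon as its first component is one,
  and here that component is a germ with non-zero value.\<close>

lemma tv_Units:
  assumes "set us \<subseteq> P.G \<times> P.G" "eval2 us (x, x) \<noteq> 0"
  shows "P.T us \<in> Units (stalk_ext X x)"
  unfolding tv_eq[OF assms(1)]
  by (rule M.triv_ext_Units[OF stalk_Units(1)[OF eval2_diag[OF germs_alg assms(1)] assms(2)]
        forms_closed[OF sheaf_at x dlist_closed[OF germs_alg assms(1)]]])

lemma dvalI:
  assumes "openX X U" "x \<in> U" "set ts \<subseteq> P.G \<times> P.G" "set us \<subseteq> P.G \<times> P.G" "eval2 us (x, x) \<noteq> 0"
    and "\<And>u v. u \<in> U \<Longrightarrow> v \<in> U \<Longrightarrow> eval2 us (u, v) * t (u, v) = eval2 ts (u, v)"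
    and "e \<in> carrier (stalk_ext X x)" "P.T us \<otimes>\<^bsub>stalk_ext X x\<^esub> e = P.T ts"
  shows "dval X x t e"
  unfolding dval_def using assms by (intro conjI exI[of _ U] exI[of _ ts] exI[of _ us] ballI) auto

lemma dvalE:
  assumes "dval X x t e"
  obtains U ts us where "openX X U" "x \<in> U" "set ts \<subseteq> P.G \<times> P.G" "set us \<subseteq> P.G \<times> P.G" "eval2 us (x, x) \<noteq> 0"
    "\<And>u v. u \<in> U \<Longrightarrow> v \<in> U \<Longrightarrow> eval2 us (u, v) * t (u, v) = eval2 ts (u, v)"
    "e \<in> carrier (stalk_ext X x)" "P.T us \<otimes>\<^bsub>stalk_ext X x\<^esub> e = P.T ts"
proof -
  from assms obtain U ts us where *: "openX X U" "x \<in> U" "set ts \<subseteq> P.G \<times> P.G" "set us \<subseteq> P.G \<times> P.G"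
    "eval2 us (x, x) \<noteq> 0" "\<forall>u\<in>U. \<forall>v\<in>U. eval2 us (u, v) * t (u, v) = eval2 ts (u, v)"
    "e \<in> carrier (stalk_ext X x)" "P.T us \<otimes>\<^bsub>stalk_ext X x\<^esub> e = P.T ts"
    unfolding dval_def by (elim conjE exE)
  show ?thesis by (rule that[OF *(1-5) _ *(7,8)]) (simp add: *(6))
qed

lemma dval_exists_fraction:
  assumes "openX X U" "x \<in> U" "set ts \<subseteq> P.G \<times> P.G" "set us \<subseteq> P.G \<times> P.G" "eval2 us (x, x) \<noteq> 0"
    and "\<And>u v. u \<in> U \<Longrightarrow> v \<in> U \<Longrightarrow> eval2 us (u, v) * t (u, v) = eval2 ts (u, v)"
  shows "\<exists>e. dval X x t e"
proof -
  let ?i = "inv\<^bsub>stalk_ext X x\<^esub> P.T us"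
  note u = tv_Units[OF assms(4,5)]
  have "P.T us \<otimes>\<^bsub>stalk_ext X x\<^esub> (?i \<otimes>\<^bsub>stalk_ext X x\<^esub> P.T ts) = P.T ts"
    using u P.T_closed[OF assms(3)] P.T_closed[OF assms(4)] P.E.Units_inv_closed[OF u]
    by (simp only: P.E.m_assoc[symmetric] P.E.Units_r_inv P.E.l_one)
  then have "dval X x t (?i \<otimes>\<^bsub>stalk_ext X x\<^esub> P.T ts)"
    using P.E.m_closed[OF P.E.Units_inv_closed[OF u] P.T_closed[OF assms(3)]]
    by (intro dvalI[OF assms])
  then show ?thesis ..
qed

text \<open>Cross-multiplication turns the two fractions into lists that represent the same function
  on a product neighbourhood, so \<open>T\<close> agrees on them; the denominators are units and
  cancel.\<close>

lemma dval_unique: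
  assumes t: "dval X x t e" and t': "dval X x t' e'"
    and N: "openX X N" "x \<in> N" "\<And>u v. u \<in> N \<Longrightarrow> v \<in> N \<Longrightarrow> t (u, v) = t' (u, v)"
  shows "e = e'"
proof -
  obtain U ts us where 1: "openX X U" "x \<in> U" "set ts \<subseteq> P.G \<times> P.G" "set us \<subseteq> P.G \<times> P.G" "eval2 us (x, x) \<noteq> 0"
    "\<And>u v. u \<in> U \<Longrightarrow> v \<in> U \<Longrightarrow> eval2 us (u, v) * t (u, v) = eval2 ts (u, v)"
    "e \<in> carrier (stalk_ext X x)" "P.T us \<otimes>\<^bsub>stalk_ext X x\<^esub> e = P.T ts"
    by (rule dvalE[OF t], rule that) assumption+
  obtain V ts' us' where 2: "openX X V" "x \<in> V" "set ts' \<subseteq> P.G \<times> P.G" "set us' \<subseteq> P.G \<times> P.G" "eval2 us' (x, x) \<noteq> 0"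
    "\<And>u v. u \<in> V \<Longrightarrow> v \<in> V \<Longrightarrow> eval2 us' (u, v) * t' (u, v) = eval2 ts' (u, v)"
    "e' \<in> carrier (stalk_ext X x)" "P.T us' \<otimes>\<^bsub>stalk_ext X x\<^esub> e' = P.T ts'"
    by (rule dvalE[OF t'], rule that) assumption+
  have o: "openX X (U \<inter> V \<inter> N)" "x \<in> U \<inter> V \<inter> N" using 1 2 N by auto
  have "P.T (mul2 us' ts) = P.T (mul2 us ts')"
  proof (rule P.T_unique[OF o P.mul2_closed[OF 2(4) 1(3)] P.mul2_closed[OF 1(4) 2(3)]])
    fix u v assume uv: "u \<in> U \<inter> V \<inter> N" "v \<in> U \<inter> V \<inter> N"
    have "eval2 ts (u, v) = eval2 us (u, v) * t' (u, v)" using 1(6)[of u v] N(3)[of u v] uv by auto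
    moreover have "eval2 ts' (u, v) = eval2 us' (u, v) * t' (u, v)" using 2(6)[of u v] uv by auto
    ultimately show "eval2 (mul2 us' ts) (u, v) = eval2 (mul2 us ts') (u, v)"
      by (simp add: eval2_mul2)
  qed
  then have eq: "P.T us' \<otimes>\<^bsub>stalk_ext X x\<^esub> (P.T us \<otimes>\<^bsub>stalk_ext X x\<^esub> e) =
     P.T us \<otimes>\<^bsub>stalk_ext X x\<^esub> (P.T us' \<otimes>\<^bsub>stalk_ext X x\<^esub> e')"
    using 1 2 by (simp add: P.T_mul2)
  note c = P.T_closed[OF 1(4)] P.T_closed[OF 2(4)]
  have "(P.T us' \<otimes>\<^bsub>stalk_ext X x\<^esub> P.T us) \<otimes>\<^bsub>stalk_ext X x\<^esub> e =
     (P.T us' \<otimes>\<^bsub>stalk_ext X x\<^esub> P.T us) \<otimes>\<^bsub>stalk_ext X x\<^esub> e'"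
    using eq c 1(7) 2(7) by (simp only: P.E.m_ac P.E.m_closed)
  moreover have "P.T us' \<otimes>\<^bsub>stalk_ext X x\<^esub> P.T us \<in> Units (stalk_ext X x)"
    by (rule P.E.Units_m_closed[OF tv_Units[OF 2(4,5)] tv_Units[OF 1(4,5)]])
  ultimately show ?thesis
    using P.E.Units_l_cancel 1(7) 2(7) by blast
qed

lemma dval_eval2:
  assumes "set ts \<subseteq> P.G \<times> P.G"
  shows "dval X x (eval2 ts) (P.T ts)"
proof (rule dvalI[OF openin_topspace x assms, of "[(\<lambda>y. 1, \<lambda>y. 1)]"])
  show "P.T [(\<lambda>y. 1, \<lambda>y. 1)] \<otimes>\<^bsub>stalk_ext X x\<^esub> P.T ts = P.T ts"
    using P.T_closed[OF assms]
    by (simp only: tv_simps germ_hom_one[OF germ_hom_phi1] germ_hom_one[OF germ_hom_phi2] P.E.r_one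
      P.E.one_closed P.E.r_zero P.E.l_one)
qed (use fun_alg_const[OF germs_alg] P.T_closed[OF assms] in auto)

lemma dval_add:
  assumes t: "dval X x t e" and t': "dval X x t' e'"
  shows "dval X x (\<lambda>p. t p + t' p) (e \<oplus>\<^bsub>stalk_ext X x\<^esub> e')"
proof -
  obtain U ts us where 1: "openX X U" "x \<in> U" "set ts \<subseteq> P.G \<times> P.G" "set us \<subseteq> P.G \<times> P.G" "eval2 us (x, x) \<noteq> 0"
    "\<And>u v. u \<in> U \<Longrightarrow> v \<in> U \<Longrightarrow> eval2 us (u, v) * t (u, v) = eval2 ts (u, v)"
    "e \<in> carrier (stalk_ext X x)" "P.T us \<otimes>\<^bsub>stalk_ext X x\<^esub> e = P.T ts"
    by (rule dvalE[OF t], rule that) assumption+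
  obtain V ts' us' where 2: "openX X V" "x \<in> V" "set ts' \<subseteq> P.G \<times> P.G" "set us' \<subseteq> P.G \<times> P.G" "eval2 us' (x, x) \<noteq> 0"
    "\<And>u v. u \<in> V \<Longrightarrow> v \<in> V \<Longrightarrow> eval2 us' (u, v) * t' (u, v) = eval2 ts' (u, v)"
    "e' \<in> carrier (stalk_ext X x)" "P.T us' \<otimes>\<^bsub>stalk_ext X x\<^esub> e' = P.T ts'"
    by (rule dvalE[OF t'], rule that) assumption+
  have o: "openX X (U \<inter> V)" "x \<in> U \<inter> V" using 1 2 by auto
  have c: "set (mul2 us' ts) \<subseteq> P.G \<times> P.G" "set (mul2 us ts') \<subseteq> P.G \<times> P.G" "set (mul2 us us') \<subseteq> P.G \<times> P.G"
    using P.mul2_closed 1 2 by blast+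
  note d = P.T_closed[OF 1(4)] P.T_closed[OF 2(4)]
  show ?thesis
  proof (rule dvalI[OF o, of "mul2 us' ts @ mul2 us ts'" "mul2 us us'"])
    fix u v assume uv: "u \<in> U \<inter> V" "v \<in> U \<inter> V"
    show "eval2 (mul2 us us') (u, v) * (t (u, v) + t' (u, v)) = eval2 (mul2 us' ts @ mul2 us ts') (u, v)"
      using 1(6)[of u v] 2(6)[of u v] uv by (simp add: eval2_mul2 algebra_simps)
  next
    have "P.T (mul2 us us') \<otimes>\<^bsub>stalk_ext X x\<^esub> (e \<oplus>\<^bsub>stalk_ext X x\<^esub> e') =
      P.T us' \<otimes>\<^bsub>stalk_ext X x\<^esub> (P.T us \<otimes>\<^bsub>stalk_ext X x\<^esub> e) \<oplus>\<^bsub>stalk_ext X x\<^esub>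
      P.T us \<otimes>\<^bsub>stalk_ext X x\<^esub> (P.T us' \<otimes>\<^bsub>stalk_ext X x\<^esub> e')"
      using d 1(7) 2(7) unfolding P.T_mul2[OF 1(4) 2(4)]
      by (simp only: P.E.r_distr P.E.m_ac P.E.m_closed)
    then show "P.T (mul2 us us') \<otimes>\<^bsub>stalk_ext X x\<^esub> (e \<oplus>\<^bsub>stalk_ext X x\<^esub> e') = P.T (mul2 us' ts @ mul2 us ts')"
      unfolding 1(8) 2(8) P.T_append[OF c(1,2)] P.T_mul2[OF 2(4) 1(3)] P.T_mul2[OF 1(4) 2(3)] .
  qed (use c 1 2 P.E.a_closed[OF 1(7) 2(7)] in \<open>auto simp: eval2_mul2 simp del: triv_ext_simps\<close>)
qed

lemma dval_mult:
  assumes t: "dval X x t e" and t': "dval X x t' e'"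
  shows "dval X x (\<lambda>p. t p * t' p) (e \<otimes>\<^bsub>stalk_ext X x\<^esub> e')"
proof -
  obtain U ts us where 1: "openX X U" "x \<in> U" "set ts \<subseteq> P.G \<times> P.G" "set us \<subseteq> P.G \<times> P.G" "eval2 us (x, x) \<noteq> 0"
    "\<And>u v. u \<in> U \<Longrightarrow> v \<in> U \<Longrightarrow> eval2 us (u, v) * t (u, v) = eval2 ts (u, v)"
    "e \<in> carrier (stalk_ext X x)" "P.T us \<otimes>\<^bsub>stalk_ext X x\<^esub> e = P.T ts"
    by (rule dvalE[OF t], rule that) assumption+
  obtain V ts' us' where 2: "openX X V" "x \<in> V" "set ts' \<subseteq> P.G \<times> P.G" "set us' \<subseteq> P.G \<times> P.G" "eval2 us' (x, x) \<noteq> 0"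
    "\<And>u v. u \<in> V \<Longrightarrow> v \<in> V \<Longrightarrow> eval2 us' (u, v) * t' (u, v) = eval2 ts' (u, v)"
    "e' \<in> carrier (stalk_ext X x)" "P.T us' \<otimes>\<^bsub>stalk_ext X x\<^esub> e' = P.T ts'"
    by (rule dvalE[OF t'], rule that) assumption+
  have o: "openX X (U \<inter> V)" "x \<in> U \<inter> V" using 1 2 by auto
  have c: "set (mul2 ts ts') \<subseteq> P.G \<times> P.G" "set (mul2 us us') \<subseteq> P.G \<times> P.G"
    using P.mul2_closed 1 2 by blast+
  note d = P.T_closed[OF 1(4)] P.T_closed[OF 2(4)]
  show ?thesis
  proof (rule dvalI[OF o, of "mul2 ts ts'" "mul2 us us'"])
    fix u v assume uv: "u \<in> U \<inter> V" "v \<in> U \<inter> V"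
    show "eval2 (mul2 us us') (u, v) * (t (u, v) * t' (u, v)) = eval2 (mul2 ts ts') (u, v)"
      unfolding eval2_mul2 using 1(6)[of u v, symmetric] 2(6)[of u v, symmetric] uv by simp
  next
    have "P.T (mul2 us us') \<otimes>\<^bsub>stalk_ext X x\<^esub> (e \<otimes>\<^bsub>stalk_ext X x\<^esub> e') =
      (P.T us \<otimes>\<^bsub>stalk_ext X x\<^esub> e) \<otimes>\<^bsub>stalk_ext X x\<^esub> (P.T us' \<otimes>\<^bsub>stalk_ext X x\<^esub> e')"
      using d 1(7) 2(7) unfolding P.T_mul2[OF 1(4) 2(4)]
      by (simp only: P.E.m_ac P.E.m_closed)
    then show "P.T (mul2 us us') \<otimes>\<^bsub>stalk_ext X x\<^esub> (e \<otimes>\<^bsub>stalk_ext X x\<^esub> e') = P.T (mul2 ts ts')"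
      unfolding 1(8) 2(8) P.T_mul2[OF 1(3) 2(3)] .
  qed (use c 1 2 P.E.m_closed[OF 1(7) 2(7)] in \<open>auto simp: eval2_mul2 simp del: triv_ext_simps\<close>)
qed

text \<open>In a neighbourhood of \<open>(x, x)\<close> in \<open>X \<times> X\<close>, which need not contain a product neighbourhood, there is
  still a basic open set.\<close>

lemma nhd_eval2:
  assumes N: "openX (X \<times>\<^sub>f X) N" "(x, x) \<in> N"
  obtains U ks where "openX X U" "x \<in> U" "set ks \<subseteq> regs X U \<times> regs X U" "eval2 ks (x, x) \<noteq> 0"
    "\<And>u v. u \<in> U \<Longrightarrow> v \<in> U \<Longrightarrow> eval2 ks (u, v) \<noteq> 0 \<Longrightarrow> (u, v) \<in> N"
proof -
  obtain U V k where k: "openX X U" "openX X V" "x \<in> U" "x \<in> V" "k \<in> ten2 (regs X U) (regs X V)"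
    "k (x, x) \<noteq> 0" "\<And>u v. u \<in> U \<Longrightarrow> v \<in> V \<Longrightarrow> k (u, v) \<noteq> 0 \<Longrightarrow> (u, v) \<in> N"
    by (rule openX_prod_nhd[OF sheaf_at sheaf_at N], rule that) assumption+
  have o: "openX X (U \<inter> V)" using k by auto
  have "ten2 (regs X U) (regs X V) \<subseteq> ten2 (regs X (U \<inter> V)) (regs X (U \<inter> V))"
    by (rule ten2_mono) (auto intro: regs_subset[OF sheaf_at k(1) o] regs_subset[OF sheaf_at k(2) o])
  then obtain ks where ks: "k = eval2 ks" "set ks \<subseteq> regs X (U \<inter> V) \<times> regs X (U \<inter> V)"
    using k(5) unfolding ten2_def by blast
  show ?thesis by (rule that[OF o _ ks(2)]) (use k ks in auto)
qed

lemma regs_germs: "openX X U \<Longrightarrow> x \<in> U \<Longrightarrow> set ks \<subseteq> regs X U \<times> regs X U \<Longrightarrow> set ks \<subseteq> P.G \<times> P.G"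
  using germs_atI[of X U x] by blast

text \<open>Agreement is known only on \<open>N\<close>, which need not contain a product. Numerator
  and denominator are multiplied by a tensor that is non-zero at (x, x) and vanishes wherever
  agreement might fail.\<close>

lemma dval_cong:
  assumes t: "dval X x t e" and N: "openX (X \<times>\<^sub>f X) N" "(x, x) \<in> N" "\<And>p. p \<in> N \<Longrightarrow> t p = t' p"
  shows "dval X x t' e"
proof -
  obtain U ts us where 1: "openX X U" "x \<in> U" "set ts \<subseteq> P.G \<times> P.G" "set us \<subseteq> P.G \<times> P.G" "eval2 us (x, x) \<noteq> 0"
    "\<And>u v. u \<in> U \<Longrightarrow> v \<in> U \<Longrightarrow> eval2 us (u, v) * t (u, v) = eval2 ts (u, v)"
    "e \<in> carrier (stalk_ext X x)" "P.T us \<otimes>\<^bsub>stalk_ext X x\<^esub> e = P.T ts"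
    by (rule dvalE[OF t], rule that) assumption+
  obtain V ks where 2: "openX X V" "x \<in> V" "set ks \<subseteq> regs X V \<times> regs X V" "eval2 ks (x, x) \<noteq> 0"
    "\<And>u v. u \<in> V \<Longrightarrow> v \<in> V \<Longrightarrow> eval2 ks (u, v) \<noteq> 0 \<Longrightarrow> (u, v) \<in> N"
    by (rule nhd_eval2[OF N(1,2)], rule that) assumption+
  note ks = regs_germs[OF 2(1-3)]
  show ?thesis
  proof (rule dvalI[of "U \<inter> V" "mul2 ks ts" "mul2 ks us"])
    fix u v assume uv: "u \<in> U \<inter> V" "v \<in> U \<inter> V"
    show "eval2 (mul2 ks us) (u, v) * t' (u, v) = eval2 (mul2 ks ts) (u, v)"
    proof (cases "eval2 ks (u, v) = 0")
      case False
      then have "t (u, v) = t' (u, v)" using N(3) 2(5) uv by auto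
      then show ?thesis using 1(6)[of u v] uv by (simp add: eval2_mul2)
    qed (simp add: eval2_mul2)
  next
    show "P.T (mul2 ks us) \<otimes>\<^bsub>stalk_ext X x\<^esub> e = P.T (mul2 ks ts)"
      unfolding P.T_mul2[OF ks 1(4)] P.T_mul2[OF ks 1(3)] 1(8)[symmetric]
      using P.T_closed[OF ks] P.T_closed[OF 1(4)] 1(7) by (simp only: P.E.m_assoc)
  qed (use 1 2 P.mul2_closed[OF ks 1(3)] P.mul2_closed[OF ks 1(4)] in \<open>auto simp: eval2_mul2 simp del: triv_ext_simps\<close>)
qed

lemma regs_fraction_lists:
  assumes t: "t \<in> regs (X \<times>\<^sub>f X) W" "(x, x) \<in> W"
  obtains U ts us where "openX X U" "x \<in> U" "set ts \<subseteq> regs X U \<times> regs X U" "set us \<subseteq> regs X U \<times> regs X U"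
    "eval2 us (x, x) \<noteq> 0" "\<And>u v. u \<in> U \<Longrightarrow> v \<in> U \<Longrightarrow> eval2 us (u, v) * t (u, v) = eval2 ts (u, v)"
    "\<And>u v. u \<in> U \<Longrightarrow> v \<in> U \<Longrightarrow> eval2 us (u, v) \<noteq> 0 \<Longrightarrow> (u, v) \<in> W"
proof -
  obtain U V g h where k: "openX X U" "openX X V" "x \<in> U" "x \<in> V" "g \<in> ten2 (regs X U) (regs X V)"
    "h \<in> ten2 (regs X U) (regs X V)" "h (x, x) \<noteq> 0"
    "\<And>u v. u \<in> U \<Longrightarrow> v \<in> V \<Longrightarrow> h (u, v) \<noteq> 0 \<Longrightarrow> (u, v) \<in> W \<and> t (u, v) = g (u, v) / h (u, v)"
    by (rule regs_prod_fraction[OF sheaf_at sheaf_at t], rule that) assumption+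
  have o: "openX X (U \<inter> V)" using k by auto
  let ?T = "ten2 (regs X (U \<inter> V)) (regs X (U \<inter> V))"
  have sub: "ten2 (regs X U) (regs X V) \<subseteq> ?T"
    by (rule ten2_mono) (auto intro: regs_subset[OF sheaf_at k(1) o] regs_subset[OF sheaf_at k(2) o])
  have A: "fun_alg ?T" by (rule ten2_fun_alg; rule fun_alg_regs[OF sheaf_at o])
  \<comment> \<open>Instead of g / h the fraction h g / (h h) is used: h h t = h g also holds where
    h vanishes and t is not controlled.\<close>
  have "(\<lambda>p. h p * g p) \<in> ?T" "(\<lambda>p. h p * h p) \<in> ?T"
    by (rule fun_alg_mult[OF A]; use k sub in blast)+
  then obtain ts us where l: "(\<lambda>p. h p * g p) = eval2 ts" "set ts \<subseteq> regs X (U \<inter> V) \<times> regs X (U \<inter> V)"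
    "(\<lambda>p. h p * h p) = eval2 us" "set us \<subseteq> regs X (U \<inter> V) \<times> regs X (U \<inter> V)"
    unfolding ten2_def by blast
  have e: "eval2 ts p = h p * g p" "eval2 us p = h p * h p" for p
    using l(1,3) by metis+
  show ?thesis
  proof (rule that[OF o _ l(2,4)])
    fix u v assume "u \<in> U \<inter> V" "v \<in> U \<inter> V"
    then show "eval2 us (u, v) * t (u, v) = eval2 ts (u, v)"
      using k(8)[of u v] by (cases "h (u, v) = 0") (auto simp: e)
  qed (use k in \<open>auto simp: e\<close>)
qed

lemma dval_exists:
  assumes t: "t \<in> regs (X \<times>\<^sub>f X) W" "(x, x) \<in> W"
  shows "\<exists>e. dval X x t e"
proof -
  obtain U ts us where k: "openX X U" "x \<in> U" "set ts \<subseteq> regs X U \<times> regs X U" "set us \<subseteq> regs X U \<times> regs X U"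
    "eval2 us (x, x) \<noteq> 0" "\<And>u v. u \<in> U \<Longrightarrow> v \<in> U \<Longrightarrow> eval2 us (u, v) * t (u, v) = eval2 ts (u, v)"
    by (rule regs_fraction_lists[OF t], rule that) assumption+
  show ?thesis
    by (rule dval_exists_fraction[OF k(1,2) regs_germs[OF k(1-3)] regs_germs[OF k(1,2,4)] k(5,6)])
qed

end

section \<open>Functions on the cube and the vanishing of \<open>D\<close> on restrictions\<close>

lemma cycle3_simps [simp]: "cycle3 (u, v, w) = {#u, v, w#}" by (simp add: cycle3_def)
lemma w2_simps [simp]: "w2 (u, v) = {#u, u, v#}" by (simp add: w2_def)

text \<open>With p = ab dc, q = ac db and r = bc da the summands are the values of \<open>D\<close>
  on ab \<otimes> c, ac \<otimes> b and bc \<otimes> a. This cancellation is the reason that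
  \<open>D\<close> vanishes on the image of r.\<close>

lemma (in abelian_group) triple_cancel:
  assumes "p \<in> carrier G" "q \<in> carrier G" "r \<in> carrier G"
  shows "((p \<oplus> p) \<ominus> (q \<oplus> r)) \<oplus> (((q \<oplus> q) \<ominus> (p \<oplus> r)) \<oplus> (((r \<oplus> r) \<ominus> (p \<oplus> q)) \<oplus> \<zero>)) = \<zero>"
proof -
  have *: "(a \<ominus> b) \<oplus> (c \<ominus> d) = (a \<oplus> c) \<ominus> (b \<oplus> d)"
    if "a \<in> carrier G" "b \<in> carrier G" "c \<in> carrier G" "d \<in> carrier G" for a b c d
    using that by (simp add: a_minus_def minus_add a_ac)
  have "((p \<oplus> p) \<ominus> (q \<oplus> r)) \<oplus> (((q \<oplus> q) \<ominus> (p \<oplus> r)) \<oplus> (((r \<oplus> r) \<ominus> (p \<oplus> q)) \<oplus> \<zero>)) =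
     (p \<oplus> p \<oplus> (q \<oplus> q \<oplus> (r \<oplus> r))) \<ominus> (q \<oplus> r \<oplus> (p \<oplus> r \<oplus> (p \<oplus> q)))"
    using assms by (simp add: *)
  also have "q \<oplus> r \<oplus> (p \<oplus> r \<oplus> (p \<oplus> q)) = p \<oplus> p \<oplus> (q \<oplus> q \<oplus> (r \<oplus> r))"
    using assms by (simp add: a_ac)
  finally show ?thesis using assms by (simp add: a_minus_def r_neg)
qed

abbreviation ten3 :: "('a \<Rightarrow> complex) set \<Rightarrow> ('a \<times> 'a \<times> 'a \<Rightarrow> complex) set" where
  "ten3 G \<equiv> ten2 G (ten2 G G)"

lemma ten3_fun_alg: "fun_alg G \<Longrightarrow> fun_alg (ten3 G)"
  by (intro ten2_fun_alg)

lemma ten3_coord: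
  assumes "fun_alg G" "a \<in> G"
  shows "(\<lambda>(u, v, w). a u) \<in> ten3 G" "(\<lambda>(u, v, w). a v) \<in> ten3 G" "(\<lambda>(u, v, w). a w) \<in> ten3 G"
  using ten2_fst[OF ten2_fun_alg[OF assms(1,1)] assms(2)]
    ten2_snd[OF assms(1) ten2_fst[OF assms]] ten2_snd[OF assms(1) ten2_snd[OF assms]]
  by (simp_all add: case_prod_unfold)

lemma ten3_induct [consumes 1, case_names zero add]:
  assumes F: "F \<in> ten3 G"
    and zero: "P (\<lambda>p. 0)"
    and add: "\<And>a b c F. a \<in> G \<Longrightarrow> b \<in> G \<Longrightarrow> c \<in> G \<Longrightarrow> P F \<Longrightarrow> P (\<lambda>(u, v, w). a u * b v * c w + F (u, v, w))"
  shows "P F"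
  using F
proof (induction rule: ten2_induct)
  case zero show ?case by (rule assms(2))
next
  case (add a g F)
  show ?case using add(2)
  proof (induction rule: ten2_induct)
    case zero
    have "(\<lambda>(x, y). a x * 0 + F (x, y)) = F" by auto
    then show ?case using add(4) by simp
  next
    case (add b c g)
    have "(\<lambda>(u, v, w). a u * b v * c w + (case (u, v, w) of (x, y) \<Rightarrow> a x * g y + F (x, y))) =
       (\<lambda>(x, y). a x * (case y of (v, w) \<Rightarrow> b v * c w + g (v, w)) + F (x, y))"
      by (auto simp: algebra_simps)
    then show ?case using assms(3)[OF \<open>a \<in> G\<close> add(1,2,4)] by simp
  qed
qed

lemma ten3_rotate:
  assumes G: "fun_alg G" and F: "F \<in> ten3 G"
  shows "(\<lambda>(u, v, w). F (v, w, u)) \<in> ten3 G"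
  using F
proof (induction rule: ten3_induct)
  case zero
  show ?case using fun_alg_const[OF ten3_fun_alg[OF G], of 0] by (simp add: case_prod_unfold)
next
  case (add a b c F)
  note m = fun_alg_mult[OF ten3_fun_alg[OF G]] and c = ten3_coord[OF G]
  from fun_alg_add[OF ten3_fun_alg[OF G] m[OF m[OF c(2)[OF add(1)] c(3)[OF add(2)]] c(1)[OF add(3)]] add(4)]
  show ?case by (simp add: case_prod_unfold)
qed

lemma function_space_cube: "sheaf_of_functions X \<Longrightarrow> function_space (cube X)"
  unfolding cube_def by (intro function_space_prod function_space_sheaf[OF function_space_prod])

text \<open>The cube is a nested product, so its regular functions are fractions of tensors whose
  second factors are themselves fractions on X \<times> X. This predicate flattens them into one
  fraction of triple tensors near (x, x, x).\<close>

definition frac3 :: "'a fspace \<Rightarrow> 'a \<Rightarrow> ('a \<times> 'a \<times> 'a \<Rightarrow> complex) \<Rightarrow> bool" where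
  "frac3 X x F \<longleftrightarrow> (\<exists>U K N. openX X U \<and> x \<in> U \<and> K \<in> ten3 (germs_at X x) \<and> N \<in> ten3 (germs_at X x) \<and>
     K (x, x, x) \<noteq> 0 \<and> (\<forall>u\<in>U. \<forall>v\<in>U. \<forall>w\<in>U. K (u, v, w) * F (u, v, w) = N (u, v, w)))"

lemma frac3I:
  assumes "openX X U" "x \<in> U" "K \<in> ten3 (germs_at X x)" "N \<in> ten3 (germs_at X x)" "K (x, x, x) \<noteq> 0"
    "\<And>u v w. u \<in> U \<Longrightarrow> v \<in> U \<Longrightarrow> w \<in> U \<Longrightarrow> K (u, v, w) * F (u, v, w) = N (u, v, w)"
  shows "frac3 X x F"
  unfolding frac3_def using assms by (intro exI[of _ U] exI[of _ K] exI[of _ N]) simp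

lemma frac3E:
  assumes "frac3 X x F"
  obtains U K N where "openX X U" "x \<in> U" "K \<in> ten3 (germs_at X x)" "N \<in> ten3 (germs_at X x)"
    "K (x, x, x) \<noteq> 0" "\<And>u v w. u \<in> U \<Longrightarrow> v \<in> U \<Longrightarrow> w \<in> U \<Longrightarrow> K (u, v, w) * F (u, v, w) = N (u, v, w)"
proof -
  from assms obtain U K N where *: "openX X U" "x \<in> U" "K \<in> ten3 (germs_at X x)" "N \<in> ten3 (germs_at X x)"
    "K (x, x, x) \<noteq> 0" "\<forall>u\<in>U. \<forall>v\<in>U. \<forall>w\<in>U. K (u, v, w) * F (u, v, w) = N (u, v, w)"
    unfolding frac3_def by (elim exE conjE)
  show ?thesis by (rule that[OF *(1-5)]) (simp add: *(6))
qed

context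
  fixes X :: "'a fspace" and x :: 'a
  assumes FX: "function_space X" and x: "x \<in> points X"
begin

interpretation M: module "stalk X x" "Omega_stalk X x"
  by (rule module_Omega_stalk[OF function_space_sheaf[OF FX] x])

interpretation P: hom_pair X x "stalk_ext X x" "phi1 X x" "phi2 X x"
  by (rule hom_pair_phi[OF FX x])

lemmas tm = fun_alg_mult[OF ten3_fun_alg[OF P.alg]] and ta = fun_alg_add[OF ten3_fun_alg[OF P.alg]]

lemma frac3_ten3: "F \<in> ten3 P.G \<Longrightarrow> frac3 X x F"
  by (rule frac3I[OF openin_topspace x fun_alg_const[OF ten3_fun_alg[OF P.alg], of 1]]) simp_all

lemma frac3_arith:
  assumes F: "frac3 X x F" and F': "frac3 X x F'"
  shows "frac3 X x (\<lambda>p. F p + F' p)" "frac3 X x (\<lambda>p. F p * F' p)"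
proof -
  obtain U K N where 1: "openX X U" "x \<in> U" "K \<in> ten3 P.G" "N \<in> ten3 P.G"
    "K (x, x, x) \<noteq> 0" "\<And>u v w. u \<in> U \<Longrightarrow> v \<in> U \<Longrightarrow> w \<in> U \<Longrightarrow> K (u, v, w) * F (u, v, w) = N (u, v, w)"
    by (rule frac3E[OF F], rule that) assumption+
  obtain U' K' N' where 2: "openX X U'" "x \<in> U'" "K' \<in> ten3 P.G" "N' \<in> ten3 P.G"
    "K' (x, x, x) \<noteq> 0" "\<And>u v w. u \<in> U' \<Longrightarrow> v \<in> U' \<Longrightarrow> w \<in> U' \<Longrightarrow> K' (u, v, w) * F' (u, v, w) = N' (u, v, w)"
    by (rule frac3E[OF F'], rule that) assumption+
  have o: "openX X (U \<inter> U')" "x \<in> U \<inter> U'" using 1 2 by auto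
  show "frac3 X x (\<lambda>p. F p + F' p)"
  proof (rule frac3I[OF o tm[OF 1(3) 2(3)] ta[OF tm[OF 2(3) 1(4)] tm[OF 1(3) 2(4)]]])
    fix u v w assume "u \<in> U \<inter> U'" "v \<in> U \<inter> U'" "w \<in> U \<inter> U'"
    then show "K (u, v, w) * K' (u, v, w) * (F (u, v, w) + F' (u, v, w)) =
       K' (u, v, w) * N (u, v, w) + K (u, v, w) * N' (u, v, w)"
      by (simp add: 1(6)[symmetric] 2(6)[symmetric] algebra_simps)
  qed (use 1 2 in simp)
  show "frac3 X x (\<lambda>p. F p * F' p)"
  proof (rule frac3I[OF o tm[OF 1(3) 2(3)] tm[OF 1(4) 2(4)]])
    fix u v w assume "u \<in> U \<inter> U'" "v \<in> U \<inter> U'" "w \<in> U \<inter> U'"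
    then show "K (u, v, w) * K' (u, v, w) * (F (u, v, w) * F' (u, v, w)) = N (u, v, w) * N' (u, v, w)"
      by (simp add: 1(6)[symmetric] 2(6)[symmetric] algebra_simps)
  qed (use 1 2 in simp)
qed

lemma frac3_ten2:
  assumes U: "openX X U" "x \<in> U" and V: "openX (X \<times>\<^sub>f X) V" "(x, x) \<in> V"
    and g: "g \<in> ten2 (regs X U) (regs (X \<times>\<^sub>f X) V)"
  shows "frac3 X x g"
  using g
proof (induction rule: ten2_induct)
  case zero
  show ?case by (rule frac3_ten3[OF fun_alg_const[OF ten3_fun_alg[OF P.alg]]])
next
  case (add a b g)
  have a: "frac3 X x (\<lambda>(u, p). a u)"
  proof -
    have "a \<in> P.G" by (rule germs_atI[OF U add(1)])
    from frac3_ten3[OF ten3_coord(1)[OF P.alg this]] show ?thesis by (simp add: case_prod_unfold)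
  qed
  have b: "frac3 X x (\<lambda>(u, p). b p)"
  proof -
    obtain W ts us where k: "openX X W" "x \<in> W" "set ts \<subseteq> regs X W \<times> regs X W" "set us \<subseteq> regs X W \<times> regs X W"
      "eval2 us (x, x) \<noteq> 0" "\<And>u v. u \<in> W \<Longrightarrow> v \<in> W \<Longrightarrow> eval2 us (u, v) * b (u, v) = eval2 ts (u, v)"
      by (rule regs_fraction_lists[OF FX x add(2) V(2)], rule that) assumption+
    have "eval2 ts \<in> ten2 P.G P.G" "eval2 us \<in> ten2 P.G P.G"
      using regs_germs[OF FX x k(1,2,3)] regs_germs[OF FX x k(1,2,4)] unfolding ten2_def by blast+
    then have T: "(\<lambda>(u, p). eval2 us p) \<in> ten3 P.G" "(\<lambda>(u, p). eval2 ts p) \<in> ten3 P.G"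
      by (simp_all add: ten2_snd[OF P.alg])
    show ?thesis by (rule frac3I[OF k(1,2) T]) (use k in auto)
  qed
  from frac3_arith(1)[OF frac3_arith(2)[OF a b] add(4)] show ?case by (simp add: case_prod_unfold)
qed

lemma regs_cube_frac3:
  assumes F: "F \<in> regs (cube X) W" "(x, x, x) \<in> W"
  shows "frac3 X x F"
proof -
  note sheaf_square = function_space_sheaf[OF function_space_prod[OF function_space_sheaf[OF FX] function_space_sheaf[OF FX]]]
  obtain U V g h where 1: "openX X U" "openX (X \<times>\<^sub>f X) V" "x \<in> U" "(x, x) \<in> V"
    "g \<in> ten2 (regs X U) (regs (X \<times>\<^sub>f X) V)" "h \<in> ten2 (regs X U) (regs (X \<times>\<^sub>f X) V)" "h (x, (x, x)) \<noteq> 0"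
    "\<And>u p. u \<in> U \<Longrightarrow> p \<in> V \<Longrightarrow> h (u, p) \<noteq> 0 \<Longrightarrow> (u, p) \<in> W \<and> F (u, p) = g (u, p) / h (u, p)"
    by (rule regs_prod_fraction[OF function_space_sheaf[OF FX] sheaf_square F[unfolded cube_def]], rule that) assumption+
  obtain U1 K N where 2: "openX X U1" "x \<in> U1" "K \<in> ten3 P.G" "N \<in> ten3 P.G"
    "K (x, x, x) \<noteq> 0" "\<And>u v w. u \<in> U1 \<Longrightarrow> v \<in> U1 \<Longrightarrow> w \<in> U1 \<Longrightarrow> K (u, v, w) * g (u, v, w) = N (u, v, w)"
    by (rule frac3E[OF frac3_ten2[OF 1(1,3,2,4,5)]], rule that) assumption+
  obtain U2 K' N' where 3: "openX X U2" "x \<in> U2" "K' \<in> ten3 P.G" "N' \<in> ten3 P.G"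
    "K' (x, x, x) \<noteq> 0" "\<And>u v w. u \<in> U2 \<Longrightarrow> v \<in> U2 \<Longrightarrow> w \<in> U2 \<Longrightarrow> K' (u, v, w) * h (u, v, w) = N' (u, v, w)"
    by (rule frac3E[OF frac3_ten2[OF 1(1,3,2,4,6)]], rule that) assumption+
  obtain U3 ks where 4: "openX X U3" "x \<in> U3" "set ks \<subseteq> regs X U3 \<times> regs X U3" "eval2 ks (x, x) \<noteq> 0"
    "\<And>u v. u \<in> U3 \<Longrightarrow> v \<in> U3 \<Longrightarrow> eval2 ks (u, v) \<noteq> 0 \<Longrightarrow> (u, v) \<in> V"
    by (rule nhd_eval2[OF FX x 1(2,4)], rule that) assumption+
  have "eval2 ks \<in> ten2 P.G P.G"
    using regs_germs[OF FX x 4(1-3)] unfolding ten2_def by blast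
  then have T: "(\<lambda>(u, p). eval2 ks p) \<in> ten3 P.G" by (simp add: ten2_snd[OF P.alg])
  have o: "openX X (U \<inter> U1 \<inter> U2 \<inter> U3)" "x \<in> U \<inter> U1 \<inter> U2 \<inter> U3" using 1 2 3 4 by auto
  show ?thesis
  \<comment> \<open>With K g = N and K' h = N' the fraction g / h equals K' N / (N' K). The
    additional factor N' vanishes where h does, and the tensor \<open>ks\<close> vanishes unless (v,
    w) lies in \<open>V\<close>.\<close>
  proof (rule frac3I[OF o tm[OF tm[OF tm[OF 3(4) 3(4)] 2(3)] T] tm[OF tm[OF tm[OF 3(4) 3(3)] 2(4)] T]])
    fix u v w assume uvw: "u \<in> U \<inter> U1 \<inter> U2 \<inter> U3" "v \<in> U \<inter> U1 \<inter> U2 \<inter> U3" "w \<in> U \<inter> U1 \<inter> U2 \<inter> U3"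
    note N = 2(6)[of u v w, symmetric] and N' = 3(6)[of u v w, symmetric]
    show "N' (u, v, w) * N' (u, v, w) * K (u, v, w) * (case (u, v, w) of (u, p) \<Rightarrow> eval2 ks p) * F (u, v, w) =
       N' (u, v, w) * K' (u, v, w) * N (u, v, w) * (case (u, v, w) of (u, p) \<Rightarrow> eval2 ks p)"
    proof (cases "eval2 ks (v, w) = 0 \<or> h (u, v, w) = 0")
      case True then show ?thesis using N' uvw by auto
    next
      case False
      then have "(v, w) \<in> V" using 4(5) uvw by auto
      then have "F (u, v, w) = g (u, v, w) / h (u, v, w)" using 1(8)[of u "(v, w)"] False uvw by auto
      then show ?thesis using N N' uvw False by (simp add: field_simps)
    qed
  qed (use 2 3(5) 3(6)[of x x x, symmetric] 3(2) 4 1 in auto)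
qed

text \<open>The three terms are the cyclic sum of F evaluated at (u, u, v). For an elementary tensor
  they are ab \<otimes> c, ac \<otimes> b and bc \<otimes> a, to which \<open>triple_cancel\<close>
  applies.\<close>

lemma diag3_list:
  assumes F: "F \<in> ten3 P.G"
  shows "\<exists>ts. set ts \<subseteq> P.G \<times> P.G \<and> (\<forall>u v. eval2 ts (u, v) = F (u, u, v) + F (u, v, u) + F (v, u, u)) \<and>
     P.T ts = (germ X x (\<lambda>u. 3 * F (u, u, u)), \<zero>\<^bsub>Omega_stalk X x\<^esub>)"
  using F
proof (induction rule: ten3_induct)
  case zero
  show ?case by (intro exI[of _ "[]"]) (simp add: stalk_simps[OF x])
next
  case (add a b c F)
  then obtain ts where ts: "set ts \<subseteq> P.G \<times> P.G" "\<And>u v. eval2 ts (u, v) = F (u, u, v) + F (u, v, u) + F (v, u, u)"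
     "P.T ts = (germ X x (\<lambda>u. 3 * F (u, u, u)), \<zero>\<^bsub>Omega_stalk X x\<^esub>)" by blast
  note abc = add(1-3)
  note m = fun_alg_mult[OF P.alg]
  note dc = dgerm_closed[OF function_space_sheaf[OF FX] x] and gc = germ_closed[OF function_space_sheaf[OF FX] x]
  have prod: "phi1 X x (\<lambda>y. a y * b y) \<otimes>\<^bsub>stalk_ext X x\<^esub> phi2 X x c =
     (germ X x (\<lambda>y. a y * b y * c y),
      (germ X x (\<lambda>y. a y * b y) \<odot>\<^bsub>Omega_stalk X x\<^esub> dgerm X x c \<oplus>\<^bsub>Omega_stalk X x\<^esub>
       germ X x (\<lambda>y. a y * b y) \<odot>\<^bsub>Omega_stalk X x\<^esub> dgerm X x c) \<ominus>\<^bsub>Omega_stalk X x\<^esub>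
      (germ X x (\<lambda>y. a y * c y) \<odot>\<^bsub>Omega_stalk X x\<^esub> dgerm X x b \<oplus>\<^bsub>Omega_stalk X x\<^esub>
       germ X x (\<lambda>y. b y * c y) \<odot>\<^bsub>Omega_stalk X x\<^esub> dgerm X x a))"
    if abc: "a \<in> P.G" "b \<in> P.G" "c \<in> P.G" for a b c
  proof -
    have e: "germ X x (\<lambda>y. a y * c y) = germ X x c \<otimes>\<^bsub>stalk X x\<^esub> germ X x a"
      "germ X x (\<lambda>y. b y * c y) = germ X x c \<otimes>\<^bsub>stalk X x\<^esub> germ X x b"
      by (simp_all add: stalk_simps[OF x] mult.commute)
    have "germ X x c \<odot>\<^bsub>Omega_stalk X x\<^esub> (\<ominus>\<^bsub>Omega_stalk X x\<^esub> dgerm X x (\<lambda>y. a y * b y)) =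
      \<ominus>\<^bsub>Omega_stalk X x\<^esub> (germ X x (\<lambda>y. a y * c y) \<odot>\<^bsub>Omega_stalk X x\<^esub> dgerm X x b \<oplus>\<^bsub>Omega_stalk X x\<^esub>
       germ X x (\<lambda>y. b y * c y) \<odot>\<^bsub>Omega_stalk X x\<^esub> dgerm X x a)"
      unfolding e dgerm_mult[OF function_space_sheaf[OF FX] x abc(1,2)]
      using abc by (simp add: M.smult_r_minus M.smult_r_distr M.smult_assoc1 dc gc)
    then show ?thesis
      unfolding phi1_def phi2_def using abc
      by (simp add: stalk_simps(1)[OF x] M.smult_r_distr a_minus_def dc gc m)
  qed
  let ?p = "germ X x (\<lambda>y. a y * b y) \<odot>\<^bsub>Omega_stalk X x\<^esub> dgerm X x c"
  let ?q = "germ X x (\<lambda>y. a y * c y) \<odot>\<^bsub>Omega_stalk X x\<^esub> dgerm X x b"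
  let ?r = "germ X x (\<lambda>y. b y * c y) \<odot>\<^bsub>Omega_stalk X x\<^esub> dgerm X x a"
  have pqr: "?p \<in> carrier (Omega_stalk X x)" "?q \<in> carrier (Omega_stalk X x)" "?r \<in> carrier (Omega_stalk X x)"
    using abc m by (auto intro!: M.smult_closed dc gc)
  let ?l = "[(\<lambda>y. a y * b y, c), (\<lambda>y. a y * c y, b), (\<lambda>y. b y * c y, a)]"
  have comm: "(\<lambda>y. c y * b y) = (\<lambda>y. b y * c y)" "(\<lambda>y. b y * a y) = (\<lambda>y. a y * b y)" "(\<lambda>y. c y * a y) = (\<lambda>y. a y * c y)"
    by (auto simp: mult.commute)
  have "P.T (?l @ ts) = (germ X x (\<lambda>u. 3 * (a u * b u * c u + F (u, u, u))), \<zero>\<^bsub>Omega_stalk X x\<^esub>)"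
    using M.M.triple_cancel[OF pqr] prod[OF abc(1,2,3)] prod[OF abc(1,3,2)] prod[OF abc(2,3,1)]
    by (simp add: ts(3) comm stalk_simps(2)[OF x] algebra_simps)
  moreover have "set (?l @ ts) \<subseteq> P.G \<times> P.G" using ts(1) abc m by auto
  moreover have "\<forall>u v. eval2 (?l @ ts) (u, v) = (case (u, u, v) of (u, v, w) \<Rightarrow> a u * b v * c w + F (u, v, w)) +
     (case (u, v, u) of (u, v, w) \<Rightarrow> a u * b v * c w + F (u, v, w)) +
     (case (v, u, u) of (u, v, w) \<Rightarrow> a u * b v * c w + F (u, v, w))"
    by (simp add: ts(2) algebra_simps)
  ultimately show ?case by (intro exI[of _ "?l @ ts"]) auto
qed

text \<open>f has the same value at the three orderings of 2u + v, so its restriction is a quotient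
  of two sums over these orderings. By \<open>diag3_list\<close> both sums have no differential
  part, hence neither has the quotient.\<close>

lemma dval_w2:
  assumes f: "(\<lambda>p. f (cycle3 p)) \<in> regs (cube X) W" "(x, x, x) \<in> W"
    and diag: "(\<lambda>u. f {#u, u, u#}) \<in> P.G"
  shows "dval X x (\<lambda>p. f (w2 p)) (germ X x (\<lambda>u. f {#u, u, u#}), \<zero>\<^bsub>Omega_stalk X x\<^esub>)"
proof -
  let ?F = "\<lambda>p. f (cycle3 p)"
  obtain U K N where 1: "openX X U" "x \<in> U" "K \<in> ten3 P.G" "N \<in> ten3 P.G"
    "K (x, x, x) \<noteq> 0" "\<And>u v w. u \<in> U \<Longrightarrow> v \<in> U \<Longrightarrow> w \<in> U \<Longrightarrow> K (u, v, w) * ?F (u, v, w) = N (u, v, w)"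
    by (rule frac3E[OF regs_cube_frac3[OF f]], rule that) assumption+
  let ?K1 = "\<lambda>(u, v, w). K (v, w, u)" and ?K2 = "\<lambda>(u, v, w). K (w, u, v)"
  note K1 = ten3_rotate[OF P.alg 1(3)]
  have K2: "?K2 \<in> ten3 P.G" using ten3_rotate[OF P.alg K1] by simp
  \<comment> \<open>The product with the two rotated copies is a denominator that is invariant under
    rotation; at (x, x, x) it is the cube of K.\<close>
  let ?L = "\<lambda>p. K p * ?K1 p * ?K2 p" and ?N = "\<lambda>p. N p * ?K1 p * ?K2 p"
  obtain ks where ks: "set ks \<subseteq> P.G \<times> P.G" "\<And>u v. eval2 ks (u, v) = ?L (u, u, v) + ?L (u, v, u) + ?L (v, u, u)"
     "P.T ks = (germ X x (\<lambda>u. 3 * ?L (u, u, u)), \<zero>\<^bsub>Omega_stalk X x\<^esub>)"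
    using diag3_list[OF tm[OF tm[OF 1(3) K1] K2]] by blast
  obtain ns where ns: "set ns \<subseteq> P.G \<times> P.G" "\<And>u v. eval2 ns (u, v) = ?N (u, u, v) + ?N (u, v, u) + ?N (v, u, u)"
     "P.T ns = (germ X x (\<lambda>u. 3 * ?N (u, u, u)), \<zero>\<^bsub>Omega_stalk X x\<^esub>)"
    using diag3_list[OF tm[OF tm[OF 1(4) K1] K2]] by blast
  have F: "{#u, v, u#} = {#u, u, v#}" "{#v, u, u#} = {#u, u, v#}" for u v :: 'a
    by (simp_all add: add_mset_commute)
  show ?thesis
  proof (rule dvalI[OF FX x 1(1,2) ns(1) ks(1)])
    show "eval2 ks (x, x) \<noteq> 0" using 1(5) by (simp add: ks(2))
  next
    fix u v assume uv: "u \<in> U" "v \<in> U"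
    have N: "N (u, u, v) = K (u, u, v) * f (w2 (u, v))" "N (u, v, u) = K (u, v, u) * f (w2 (u, v))"
      "N (v, u, u) = K (v, u, u) * f (w2 (u, v))"
      using 1(6)[of u u v] 1(6)[of u v u] 1(6)[of v u u] uv by (simp_all add: F(1)[of u v] F(2)[of v u])
    show "eval2 ks (u, v) * f (w2 (u, v)) = eval2 ns (u, v)"
      by (simp add: ks(2) ns(2) N algebra_simps del: w2_simps)
  next
    show "(germ X x (\<lambda>u. f {#u, u, u#}), \<zero>\<^bsub>Omega_stalk X x\<^esub>) \<in> carrier (stalk_ext X x)"
      using germ_closed[OF function_space_sheaf[OF FX] x diag] by simp
    have "germ X x (\<lambda>u. 3 * ?L (u, u, u) * f {#u, u, u#}) = germ X x (\<lambda>u. 3 * ?N (u, u, u))"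
    proof (rule germ_eqI[OF 1(1,2)])
      fix u assume "u \<in> U"
      then have "N (u, u, u) = K (u, u, u) * f {#u, u, u#}" using 1(6)[of u u u] by simp
      then show "3 * ?L (u, u, u) * f {#u, u, u#} = 3 * ?N (u, u, u)" by simp
    qed
    moreover have "germ X x (\<lambda>u. 3 * ?L (u, u, u)) \<in> carrier (stalk X x)"
      using P.T_closed[OF ks(1)] unfolding ks(3) by simp
    ultimately show "P.T ks \<otimes>\<^bsub>stalk_ext X x\<^esub> (germ X x (\<lambda>u. f {#u, u, u#}), \<zero>\<^bsub>Omega_stalk X x\<^esub>) = P.T ns"
      unfolding ks(3) ns(3) using germ_closed[OF function_space_sheaf[OF FX] x diag] by (simp add: stalk_simps(1)[OF x])
  qed
qed

end

section \<open>Functions on the symmetric cube and the map \<open>D\<close>\<close>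

text \<open>For t regular near (x, x) a pair e exists and is unique, by \<open>dval_exists\<close>
  and \<open>dval_unique\<close>, so \<open>THE\<close> picks the actual value.\<close>

definition canonical_D :: "'a fspace \<Rightarrow> 'a multiset set \<Rightarrow> ('a \<times> 'a \<Rightarrow> complex) \<Rightarrow> 'a \<Rightarrow> 'a cotangent" where
  "canonical_D X V t = (\<lambda>x\<in>preim w3 X V. snd (THE e. dval X x t e))"

context
  fixes X :: "'a fspace"
  assumes FX: "function_space X"
begin

lemma sheaf_base: "sheaf_of_functions X" by (rule function_space_sheaf[OF FX])

lemma function_space_square: "function_space (X \<times>\<^sub>f X)" by (rule function_space_prod[OF sheaf_base sheaf_base])

lemma sheaf_square: "sheaf_of_functions (X \<times>\<^sub>f X)" by (rule function_space_sheaf[OF function_space_square])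

lemma points_XX: "points (X \<times>\<^sub>f X) = points X \<times> points X" by (rule points_prod[OF sheaf_base sheaf_base])

lemma points_cube: "points (cube X) = points X \<times> points X \<times> points X"
  unfolding cube_def by (simp add: points_prod[OF sheaf_base sheaf_square] points_XX)

lemma function_space_cube_of_X: "function_space (cube X)" by (rule function_space_cube[OF sheaf_base])

lemma function_space_sym3: "function_space (sym3 X)"
  unfolding sym3_def by (rule function_space_quotient[OF function_space_cube_of_X])

lemma sheaf_sym3: "sheaf_of_functions (sym3 X)" by (rule function_space_sheaf[OF function_space_sym3])

lemma morphism_cycle3: "morphism (cube X) (sym3 X) cycle3"
  unfolding sym3_def by (rule morphism_quotient)

lemma morphism_triple:
  assumes "function_space Z" "morphism Z X f" "morphism Z X g" "morphism Z X h"
  shows "morphism Z (cube X) (\<lambda>z. (f z, g z, h z))"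
  unfolding cube_def
  by (intro morphism_Pair[OF sheaf_base sheaf_square] morphism_Pair[OF sheaf_base sheaf_base] assms)

lemma morphism_w2: "morphism (X \<times>\<^sub>f X) (sym3 X) w2"
proof -
  have w2: "w2 = (\<lambda>z. cycle3 (fst z, fst z, snd z))" by (auto simp: w2_def)
  show ?thesis unfolding w2
    by (intro morphism_comp[OF morphism_triple morphism_cycle3] function_space_square morphism_fst morphism_snd sheaf_base)
qed

lemma morphism_w3: "morphism X (sym3 X) w3"
proof -
  have w3: "w3 = (\<lambda>z. cycle3 (z, z, z))" by (auto simp: w3_def)
  show ?thesis unfolding w3
    by (intro morphism_comp[OF morphism_triple morphism_cycle3] FX morphism_id)
qed

lemma openX_sym3: "openX (sym3 X) V \<longleftrightarrow> V \<subseteq> cycle3 ` points (cube X) \<and> openX (cube X) (preim cycle3 (cube X) V)"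
  unfolding sym3_def by (rule openX_quotient_fspace)

lemma regs_sym3: "f \<in> regs (sym3 X) V \<longleftrightarrow> (\<lambda>p. f (cycle3 p)) \<in> regs (cube X) (preim cycle3 (cube X) V)"
  unfolding sym3_def by (rule regs_quotient)

lemma points_sym3: "points (sym3 X) = cycle3 ` points (cube X)"
  unfolding sym3_def by (rule points_quotient)

lemma openX_cube_Times:
  assumes "openX X U"
  shows "openX (cube X) (U \<times> U \<times> U)"
  unfolding cube_def by (intro openX_prod_Times sheaf_base sheaf_square assms)

lemma preim_sym3_set:
  assumes "U \<subseteq> points X"
  shows "preim cycle3 (cube X) (sym3_set U) = U \<times> U \<times> U"
    and "preim w2 (X \<times>\<^sub>f X) (sym3_set U) = U \<times> U" and "preim w3 X (sym3_set U) = U"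
  using assms by (auto simp: preim_def points_cube points_XX sym3_set_def w3_def)

lemma sym3_set_image: "sym3_set U = cycle3 ` (U \<times> U \<times> U)"
proof
  show "sym3_set U \<subseteq> cycle3 ` (U \<times> U \<times> U)"
  proof
    fix M assume M: "M \<in> sym3_set U"
    then have "size M = Suc (Suc (Suc 0))" by (simp add: sym3_set_def)
    then obtain a N where N: "M = add_mset a N" "size N = Suc (Suc 0)"
      using size_eq_Suc_imp_eq_union by fastforce
    then obtain b L where L: "N = add_mset b L" "size L = Suc 0"
      using size_eq_Suc_imp_eq_union by fastforce
    then obtain c where "L = {#c#}" using size_1_singleton_mset by fastforce
    then have "M = {#a, b, c#}" using N L by simp
    then show "M \<in> cycle3 ` (U \<times> U \<times> U)" using M by (force simp: sym3_set_def)
  qed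
qed (auto simp: sym3_set_def)

lemma openX_sym3_set:
  assumes "openX X U"
  shows "openX (sym3 X) (sym3_set U)"
  unfolding openX_sym3 preim_sym3_set[OF openin_subset[OF assms]]
  using openX_cube_Times[OF assms] openin_subset[OF assms]
  by (auto simp: sym3_set_image points_cube)

lemma w3_diag: "x \<in> preim w3 X V \<Longrightarrow> x \<in> points X \<and> (x, x) \<in> preim w2 (X \<times>\<^sub>f X) V \<and>
    (x, x, x) \<in> preim cycle3 (cube X) V"
  by (auto simp: preim_def points_XX points_cube w3_def)

lemma canonical_D_eq:
  assumes "x \<in> preim w3 X V" "dval X x t e"
  shows "canonical_D X V t x = snd e"
proof -
  have x: "x \<in> points X" using assms(1) by (simp add: preim_def)
  have "(THE e. dval X x t e) = e"
  proof (rule the_equality)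
    fix e' assume "dval X x t e'"
    then show "e' = e" by (rule dval_unique[OF FX x _ assms(2) openin_topspace x refl])
  qed (rule assms(2))
  then show ?thesis using assms(1) by (simp add: canonical_D_def)
qed

lemma germ_diag: "f \<in> regs (sym3 X) V \<Longrightarrow> openX (sym3 X) V \<Longrightarrow> x \<in> preim w3 X V \<Longrightarrow>
    (\<lambda>u. f {#u, u, u#}) \<in> germs_at X x"
  using germs_atI[OF morphism_open[OF morphism_w3] _ morphism_regs[OF morphism_w3]]
  by (simp add: w3_def)

lemma dval_w2':
  assumes V: "openX (sym3 X) V" and f: "f \<in> regs (sym3 X) V" and x: "x \<in> preim w3 X V"
  shows "dval X x (\<lambda>p. f (w2 p)) (germ X x (\<lambda>u. f {#u, u, u#}), \<zero>\<^bsub>Omega_stalk X x\<^esub>)"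
  by (rule dval_w2[OF FX _ f[unfolded regs_sym3] _ germ_diag[OF f V x]]) (use w3_diag[OF x] in auto)

text \<open>The quotient rule: if g and h are the restrictions of numerator and denominator to the
  diagonal, then D(ts / us) = (1 / h) D(ts) - (g / (h h)) D(us). One list of forms serves all nearby
  points, which makes D t a section of \<open>Omega\<close>.\<close>

lemma dval_forms:
  assumes t: "t \<in> regs (X \<times>\<^sub>f X) W" and x: "x \<in> points X" "(x, x) \<in> W"
  obtains N ls q where "openX X N" "x \<in> N" "set ls \<subseteq> regs X N \<times> regs X N"
    "\<And>y. y \<in> N \<Longrightarrow> dval X y t (germ X y q, forms X y ls)"
proof -
  obtain U ts us where 1: "openX X U" "x \<in> U" "set ts \<subseteq> regs X U \<times> regs X U" "set us \<subseteq> regs X U \<times> regs X U"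
    "eval2 us (x, x) \<noteq> 0" "\<And>u v. u \<in> U \<Longrightarrow> v \<in> U \<Longrightarrow> eval2 us (u, v) * t (u, v) = eval2 ts (u, v)"
    by (rule regs_fraction_lists[OF FX x(1) t x(2)], rule that) assumption+
  define h where "h u = eval2 us (u, u)" for u
  define g where "g u = eval2 ts (u, u)" for u
  note AU = fun_alg_regs[OF sheaf_base 1(1)]
  have hU: "h \<in> regs X U" and gU: "g \<in> regs X U"
    using eval2_diag[OF AU 1(4)] eval2_diag[OF AU 1(3)] by (simp_all add: h_def[abs_def] g_def[abs_def])
  define N where "N = {u \<in> U. h u \<noteq> 0}"
  have N: "openX X N" "x \<in> N" "N \<subseteq> U" using function_space_open[OF FX 1(1) hU] 1 by (auto simp: N_def h_def)
  note AN = fun_alg_regs[OF sheaf_base N(1)]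
  have sub: "regs X U \<subseteq> regs X N" using regs_subset[OF sheaf_base 1(1) N(1,3)] by blast
  have i: "(\<lambda>u. 1 / h u) \<in> regs X N" unfolding N_def by (rule function_space_inverse[OF FX 1(1) hU])
  let ?q = "\<lambda>u. g u * (1 / h u)" and ?r = "\<lambda>u. - (g u * (1 / h u) * (1 / h u))"
  have q: "?q \<in> regs X N" by (rule fun_alg_mult[OF AN _ i]) (use gU sub in blast)
  have r: "?r \<in> regs X N" by (rule fun_alg_uminus[OF AN fun_alg_mult[OF AN q i]])
  have tsN: "set ts \<subseteq> regs X N \<times> regs X N" and usN: "set us \<subseteq> regs X N \<times> regs X N" using 1(3,4) sub by blast+
  note dt = dlist_closed[OF AN tsN] and du = dlist_closed[OF AN usN]
  let ?sc = "\<lambda>f l. map (\<lambda>(a, b). (\<lambda>y. f y * a y :: complex, b :: 'a \<Rightarrow> complex)) l"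
  have scc: "set (?sc f l) \<subseteq> G \<times> G" if "fun_alg G" "f \<in> G" "set l \<subseteq> G \<times> G" for f l G
    using that fun_alg_mult[OF that(1,2)] by fastforce
  let ?ls = "?sc (\<lambda>u. 1 / h u) (dlist ts) @ ?sc ?r (dlist us)"
  have "dval X y t (germ X y ?q, forms X y ?ls)" if y: "y \<in> N" for y
  proof -
    have yp: "y \<in> points X" using openin_subset[OF N(1)] y by blast
    let ?G = "germs_at X y"
    have G: "regs X N \<subseteq> ?G" using germs_atI[OF N(1) y] by blast
    note A = fun_alg_germs_at[OF sheaf_base yp]
    interpret M: module "stalk X y" "Omega_stalk X y" by (rule module_Omega_stalk[OF sheaf_base yp])
    have l: "set ts \<subseteq> ?G \<times> ?G" "set us \<subseteq> ?G \<times> ?G" "set (dlist ts) \<subseteq> ?G \<times> ?G" "set (dlist us) \<subseteq> ?G \<times> ?G"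
      using tsN usN dt du G by blast+
    have iG: "(\<lambda>u. 1 / h u) \<in> ?G" "?r \<in> ?G" "?q \<in> ?G" "h \<in> ?G" using i r q hU sub G by blast+
    note gc = germ_closed[OF sheaf_base yp]
    note fc = forms_closed[OF sheaf_base yp l(3)] forms_closed[OF sheaf_base yp l(4)]
    note sc = scc[OF A iG(1) l(3)] scc[OF A iG(2) l(4)]
    have fls: "forms X y ?ls = germ X y (\<lambda>u. 1 / h u) \<odot>\<^bsub>Omega_stalk X y\<^esub> forms X y (dlist ts) \<oplus>\<^bsub>Omega_stalk X y\<^esub>
       germ X y ?r \<odot>\<^bsub>Omega_stalk X y\<^esub> forms X y (dlist us)"
      unfolding forms_append[OF sheaf_base yp sc] forms_smult[OF sheaf_base yp iG(1) l(3)] forms_smult[OF sheaf_base yp iG(2) l(4)] ..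
    \<comment> \<open>The differential part of us e is a combination of D(ts) and D(us); the
      coefficients computed here have to be 1 and 0.\<close>
    have e1: "germ X y h \<otimes>\<^bsub>stalk X y\<^esub> germ X y (\<lambda>u. 1 / h u) = \<one>\<^bsub>stalk X y\<^esub>"
      unfolding stalk_simps[OF yp] by (rule germ_eqI[OF N(1) y]) (simp add: N_def)
    have e2: "germ X y h \<otimes>\<^bsub>stalk X y\<^esub> germ X y ?r \<oplus>\<^bsub>stalk X y\<^esub> germ X y ?q = \<zero>\<^bsub>stalk X y\<^esub>"
      unfolding stalk_simps[OF yp] by (rule germ_eqI[OF N(1) y]) (simp add: N_def)
    have e3: "germ X y h \<otimes>\<^bsub>stalk X y\<^esub> germ X y ?q = germ X y g"
      unfolding stalk_simps[OF yp] by (rule germ_eqI[OF N(1) y]) (simp add: N_def)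
    have "germ X y h \<odot>\<^bsub>Omega_stalk X y\<^esub> forms X y ?ls \<oplus>\<^bsub>Omega_stalk X y\<^esub> germ X y ?q \<odot>\<^bsub>Omega_stalk X y\<^esub> forms X y (dlist us) =
       (germ X y h \<otimes>\<^bsub>stalk X y\<^esub> germ X y (\<lambda>u. 1 / h u)) \<odot>\<^bsub>Omega_stalk X y\<^esub> forms X y (dlist ts) \<oplus>\<^bsub>Omega_stalk X y\<^esub>
       (germ X y h \<otimes>\<^bsub>stalk X y\<^esub> germ X y ?r \<oplus>\<^bsub>stalk X y\<^esub> germ X y ?q) \<odot>\<^bsub>Omega_stalk X y\<^esub> forms X y (dlist us)"
      unfolding fls using gc[OF iG(1)] gc[OF iG(2)] gc[OF iG(3)] gc[OF iG(4)] fc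
      by (simp add: M.smult_assoc1 M.smult_l_distr M.smult_r_distr M.M.a_assoc)
    then have e4: "germ X y h \<odot>\<^bsub>Omega_stalk X y\<^esub> forms X y ?ls \<oplus>\<^bsub>Omega_stalk X y\<^esub>
       germ X y ?q \<odot>\<^bsub>Omega_stalk X y\<^esub> forms X y (dlist us) = forms X y (dlist ts)"
      unfolding e1 e2 using fc by simp
    have lsc: "forms X y ?ls \<in> carrier (Omega_stalk X y)"
      unfolding fls using gc[OF iG(1)] gc[OF iG(2)] fc by simp
    show ?thesis
    proof (rule dvalI[OF FX yp N(1) y l(1,2)])
      show "eval2 us (y, y) \<noteq> 0" using y by (simp add: N_def h_def)
      show "eval2 us (u, v) * t (u, v) = eval2 ts (u, v)" if "u \<in> N" "v \<in> N" for u v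
        using 1(6) that N(3) by blast
      show "(germ X y ?q, forms X y ?ls) \<in> carrier (stalk_ext X y)"
        using gc[OF iG(3)] lsc by simp
      show "tv (stalk_ext X y) (phi1 X y) (phi2 X y) us \<otimes>\<^bsub>stalk_ext X y\<^esub> (germ X y ?q, forms X y ?ls) =
         tv (stalk_ext X y) (phi1 X y) (phi2 X y) ts"
        unfolding tv_eq[OF FX yp l(1)] tv_eq[OF FX yp l(2)] triv_ext_simps
          h_def[symmetric] g_def[symmetric] using e3 e4 by simp
    qed
  qed
  moreover have "set ?ls \<subseteq> regs X N \<times> regs X N"
    using scc[OF AN i dt] scc[OF AN r du] by simp
  ultimately show ?thesis by (rule that[OF N(1,2), rotated])
qed

lemma canonical_D_closed:
  assumes V: "openX (sym3 X) V" and t: "t \<in> regs (X \<times>\<^sub>f X) (preim w2 (X \<times>\<^sub>f X) V)"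
  shows "canonical_D X V t \<in> carrier (sec (Omega X) (preim w3 X V))"
proof (rule Omega_secI[OF sheaf_base morphism_open[OF morphism_w3 V]])
  show "canonical_D X V t \<in> extensional (preim w3 X V)" by (simp add: canonical_D_def)
  fix x assume x: "x \<in> preim w3 X V"
  obtain N ls q where 1: "openX X N" "x \<in> N" "set ls \<subseteq> regs X N \<times> regs X N"
    "\<And>y. y \<in> N \<Longrightarrow> dval X y t (germ X y q, forms X y ls)"
    by (rule dval_forms[OF t, of x], use w3_diag[OF x] in simp, use w3_diag[OF x] in simp, rule that) assumption+
  let ?N = "N \<inter> preim w3 X V"
  have o: "openX X ?N" using 1(1) morphism_open[OF morphism_w3 V] by auto
  have "set ls \<subseteq> regs X ?N \<times> regs X ?N" using 1(3) regs_subset[OF sheaf_base 1(1) o] by blast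
  moreover have "canonical_D X V t y = forms X y ls" if "y \<in> ?N" for y
    using canonical_D_eq[OF _ 1(4)] that by simp
  ultimately show "\<exists>W ts. openX X W \<and> x \<in> W \<and> set ts \<subseteq> regs X W \<times> regs X W \<and>
      (\<forall>y\<in>W. canonical_D X V t y = forms X y ts)"
    using o 1(2) x by (intro exI[of _ ?N] exI[of _ ls]) auto
qed

lemma dval_section:
  assumes V: "openX (sym3 X) V" and t: "t \<in> regs (X \<times>\<^sub>f X) (preim w2 (X \<times>\<^sub>f X) V)" and x: "x \<in> preim w3 X V"
  obtains e where "dval X x t e"
  using dval_exists[OF FX _ t] w3_diag[OF x] by blast

lemma dval_carrier: "dval X x t e \<Longrightarrow> e \<in> carrier (stalk_ext X x)"
  by (simp add: dval_def)

text \<open>Linearity over the symmetric cube rests on \<open>dval_w2'\<close>: a symmetric function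
  restricts to an element without differential part, so multiplying by it only scales the
  differential part, by its pullback along \<open>w3\<close>.\<close>

lemma canonical_D_hom: "sheaf_hom (sym3 X) (w2_pushforward X) (w3_pushforward X) (canonical_D X)"
  unfolding sheaf_hom_def w2_pushforward_def w3_pushforward_def
proof (intro allI impI ballI conjI)
  fix V s assume V: "openX (sym3 X) V" and s: "s \<in> carrier (sec (pushforward w2 (X \<times>\<^sub>f X) (\<O> (X \<times>\<^sub>f X))) V)"
  let ?P = "preim w2 (X \<times>\<^sub>f X)"
  have oP: "openX (X \<times>\<^sub>f X) (?P V)" by (rule morphism_open[OF morphism_w2 V])
  have s': "s \<in> regs (X \<times>\<^sub>f X) (?P V)" using s reg_regs[OF sheaf_square oP] by simp
  show "canonical_D X V s \<in> carrier (sec (pushforward w3 X (Omega X)) V)"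
    using canonical_D_closed[OF V s'] by simp
  {
    fix t assume t: "t \<in> carrier (sec (pushforward w2 (X \<times>\<^sub>f X) (\<O> (X \<times>\<^sub>f X))) V)"
    have t': "t \<in> regs (X \<times>\<^sub>f X) (?P V)" using t reg_regs[OF sheaf_square oP] by simp
    show "canonical_D X V (s \<oplus>\<^bsub>sec (pushforward w2 (X \<times>\<^sub>f X) (\<O> (X \<times>\<^sub>f X))) V\<^esub> t) =
       canonical_D X V s \<oplus>\<^bsub>sec (pushforward w3 X (Omega X)) V\<^esub> canonical_D X V t"
      unfolding pushforward_simps sec_structure_sheaf sec_Omega
    proof (rule extensionalityI[of _ "preim w3 X V"])
      fix x assume x: "x \<in> preim w3 X V"
      have px: "x \<in> points X" "(x, x) \<in> ?P V" using w3_diag[OF x] by auto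
      obtain e where e: "dval X x s e" by (rule dval_section[OF V s' x])
      obtain f where f: "dval X x t f" by (rule dval_section[OF V t' x])
      have "dval X x (\<lambda>p\<in>?P V. s p + t p) (e \<oplus>\<^bsub>stalk_ext X x\<^esub> f)"
        by (rule dval_cong[OF FX px(1) dval_add[OF FX px(1) e f] oP px(2)]) simp
      from canonical_D_eq[OF x this] canonical_D_eq[OF x e] canonical_D_eq[OF x f] x
      show "canonical_D X V (\<lambda>p\<in>?P V. s p + t p) x =
         (\<lambda>x\<in>preim w3 X V. canonical_D X V s x \<oplus>\<^bsub>Omega_stalk X x\<^esub> canonical_D X V t x) x"
        by (cases e; cases f) simp
    qed (simp_all add: canonical_D_def)
  }
  {
    fix f assume f: "f \<in> reg (sym3 X) V"
    have f': "f \<in> regs (sym3 X) V" using f reg_regs[OF sheaf_sym3 V] by simp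
    show "canonical_D X V (f \<odot>\<^bsub>sec (pushforward w2 (X \<times>\<^sub>f X) (\<O> (X \<times>\<^sub>f X))) V\<^esub> s) =
       f \<odot>\<^bsub>sec (pushforward w3 X (Omega X)) V\<^esub> canonical_D X V s"
      unfolding pushforward_simps sec_structure_sheaf sec_Omega
    proof (rule extensionalityI[of _ "preim w3 X V"])
      fix x assume x: "x \<in> preim w3 X V"
      have px: "x \<in> points X" "(x, x) \<in> ?P V" using w3_diag[OF x] by auto
      interpret M: module "stalk X x" "Omega_stalk X x" by (rule module_Omega_stalk[OF sheaf_base px(1)])
      obtain e where e: "dval X x s e" by (rule dval_section[OF V s' x])
      have g: "germ X x (\<lambda>u. f {#u, u, u#}) = germ X x (pullback w3 X V f)"
        by (rule germ_eqI[OF morphism_open[OF morphism_w3 V] x]) (simp add: pullback_def w3_def)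
      have gcl: "germ X x (\<lambda>u. f {#u, u, u#}) \<in> carrier (stalk X x)"
        by (rule germ_closed[OF sheaf_base px(1) germ_diag[OF f' V x]])
      have "dval X x (\<lambda>p\<in>?P V. pullback w2 (X \<times>\<^sub>f X) V f p * s p)
         ((germ X x (\<lambda>u. f {#u, u, u#}), \<zero>\<^bsub>Omega_stalk X x\<^esub>) \<otimes>\<^bsub>stalk_ext X x\<^esub> e)"
        by (rule dval_cong[OF FX px(1) dval_mult[OF FX px(1) dval_w2'[OF V f' x] e] oP px(2)])
           (simp add: pullback_def)
      from canonical_D_eq[OF x this] canonical_D_eq[OF x e] x dval_carrier[OF e] gcl
      show "canonical_D X V (\<lambda>p\<in>?P V. pullback w2 (X \<times>\<^sub>f X) V f p * s p) x =
         (\<lambda>x\<in>preim w3 X V. germ X x (pullback w3 X V f) \<odot>\<^bsub>Omega_stalk X x\<^esub> canonical_D X V s x) x"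
        by (cases e) (simp add: g)
    qed (simp_all add: canonical_D_def)
  }
  {
    fix W assume W: "openX (sym3 X) W \<and> W \<subseteq> V"
    then have oW: "openX (X \<times>\<^sub>f X) (?P W)" using morphism_open[OF morphism_w2] by blast
    have pW: "preim w3 X W \<subseteq> preim w3 X V" using W by (intro preim_mono) simp
    show "canonical_D X W (restr (pushforward w2 (X \<times>\<^sub>f X) (\<O> (X \<times>\<^sub>f X))) W s) =
       restr (pushforward w3 X (Omega X)) W (canonical_D X V s)"
      unfolding pushforward_simps sec_structure_sheaf sec_Omega
    proof (rule extensionalityI[of _ "preim w3 X W"])
      fix x assume x: "x \<in> preim w3 X W"
      then have xV: "x \<in> preim w3 X V" using pW by blast
      have px: "x \<in> points X" "(x, x) \<in> ?P W" using w3_diag[OF x] by auto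
      obtain e where e: "dval X x s e" by (rule dval_section[OF V s' xV])
      have "dval X x (restrict s (?P W)) e"
        by (rule dval_cong[OF FX px(1) e oW px(2)]) simp
      from canonical_D_eq[OF x this] canonical_D_eq[OF xV e] x
      show "canonical_D X W (restrict s (?P W)) x = restrict (canonical_D X V s) (preim w3 X W) x" by simp
    qed (simp add: canonical_D_def, rule restrict_extensional)
  }
qed

lemma form_germ_uminus:
  assumes x: "x \<in> points X" and ab: "a \<in> germs_at X x" "b \<in> germs_at X x"
  shows "form_germ X (\<lambda>y. - a y) b x = \<ominus>\<^bsub>Omega_stalk X x\<^esub> form_germ X a b x"
proof -
  interpret M: module "stalk X x" "Omega_stalk X x" by (rule module_Omega_stalk[OF sheaf_base x])
  note gc = germ_closed[OF sheaf_base x] and dc = dgerm_closed[OF sheaf_base x]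
  have "germ X x (\<lambda>y. - a y) = \<ominus>\<^bsub>stalk X x\<^esub> germ X x a"
    by (rule M.R.minus_equality[symmetric])
       (auto simp: stalk_simps[OF x] gc ab fun_alg_uminus[OF fun_alg_germs_at[OF sheaf_base x]])
  then show ?thesis
    unfolding form_germ_eq[OF sheaf_base x] using ab by (simp only: M.smult_l_minus dc gc)
qed

lemma locally_given_canonical_D: "locally_given_D X (canonical_D X)"
  unfolding locally_given_D_def
proof (intro conjI canonical_D_hom allI impI ballI)
  fix U a b assume U: "affine_open X U" and a: "a \<in> reg X U" and b: "b \<in> reg X U"
  have oU: "openX X U" using U by (simp add: affine_open_def)
  note p = preim_sym3_set[OF openin_subset[OF oU]]
  have oUU: "openX (X \<times>\<^sub>f X) (U \<times> U)" by (rule openX_prod_Times[OF sheaf_base sheaf_base oU oU])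
  show "canonical_D X (sym3_set U) (\<lambda>(x, y)\<in>U \<times> U. a x * b y) =
    (\<lambda>x\<in>U. form_germ X (\<lambda>y. 2 * a y) b x \<ominus>\<^bsub>Omega_stalk X x\<^esub> form_germ X b a x)"
  proof (rule extensionalityI[of _ U])
    fix x assume x: "x \<in> U"
    have px: "x \<in> points X" using openin_subset[OF oU] x by blast
    interpret M: module "stalk X x" "Omega_stalk X x" by (rule module_Omega_stalk[OF sheaf_base px])
    have ab: "a \<in> germs_at X x" "b \<in> germs_at X x"
      using a b reg_regs[OF sheaf_base oU] germs_atI[OF oU x] by blast+
    then have l: "set [(a, b)] \<subseteq> germs_at X x \<times> germs_at X x" by simp
    have "dval X x (\<lambda>(x, y)\<in>U \<times> U. a x * b y) (tv (stalk_ext X x) (phi1 X x) (phi2 X x) [(a, b)])"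
      by (rule dval_cong[OF FX px dval_eval2[OF FX px l] oUU]) (use x in auto)
    then have "canonical_D X (sym3_set U) (\<lambda>(x, y)\<in>U \<times> U. a x * b y) x = forms X x (dlist [(a, b)])"
      using canonical_D_eq[of x "sym3_set U"] x by (simp only: p tv_eq[OF FX px l] snd_conv)
    also have "\<dots> = form_germ X (\<lambda>y. 2 * a y) b x \<ominus>\<^bsub>Omega_stalk X x\<^esub> form_germ X b a x"
      using ab fun_alg_scale[OF fun_alg_germs_at[OF sheaf_base px] ab(1), of 2]
      by (simp add: form_germ_uminus[OF px] a_minus_def form_germ_closed[OF sheaf_base px])
    finally show "canonical_D X (sym3_set U) (\<lambda>(x, y)\<in>U \<times> U. a x * b y) x =
       (\<lambda>x\<in>U. form_germ X (\<lambda>y. 2 * a y) b x \<ominus>\<^bsub>Omega_stalk X x\<^esub> form_germ X b a x) x"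
      using x by simp
  qed (simp_all add: canonical_D_def p)
qed

end

section \<open>Symmetric functions\<close>

text \<open>Descent along \<open>cycle3\<close>. The chosen ordering does not affect the value when
  F is symmetric.\<close>

definition sym_lift :: "('a \<times> 'a \<times> 'a \<Rightarrow> complex) \<Rightarrow> 'a multiset \<Rightarrow> complex" where
  "sym_lift F M = F (SOME p. cycle3 p = M)"

lemma sym_lift_cycle3:
  assumes "\<And>a b c. F (a, b, c) = F (b, a, c)" "\<And>a b c. F (a, b, c) = F (a, c, b)"
  shows "sym_lift F {#a, b, c#} = F (a, b, c)"
proof -
  let ?p = "SOME p. cycle3 p = {#a, b, c#}"
  have "cycle3 ?p = {#a, b, c#}" by (rule someI[of _ "(a, b, c)"]) simp
  moreover obtain u v w where p: "?p = (u, v, w)" by (cases ?p) auto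
  ultimately have "(u, v, w) \<in> {(a, b, c), (a, c, b), (b, a, c), (b, c, a), (c, a, b), (c, b, a)}"
    by (simp only: cycle3_simps perm3_iff)
  then have "F (u, v, w) = F (a, b, c)"
    using assms(1)[of a b c] assms(2)[of a b c] assms(2)[of b a c] assms(1)[of a c b] assms(2)[of c a b] by auto
  then show ?thesis by (simp add: sym_lift_def p)
qed

lemma ten2_swap:
  fixes A :: "('a \<Rightarrow> complex) set"
  assumes "F \<in> ten2 A A"
  shows "(\<lambda>(u, v). F (v, u)) \<in> ten2 A A"
proof -
  obtain ts where ts: "F = eval2 ts" "set ts \<subseteq> A \<times> A" using assms unfolding ten2_def by blast
  have "eval2 (map (\<lambda>(a, b). (b, a)) l) (u, v) = eval2 l (v, u)"
    for l :: "(('a \<Rightarrow> complex) \<times> ('a \<Rightarrow> complex)) list" and u v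
    by (induction l) (auto simp: mult.commute)
  then have "(\<lambda>(u, v). F (v, u)) = eval2 (map (\<lambda>(a, b). (b, a)) ts)" using ts(1) by auto
  moreover have "set (map (\<lambda>(a, b). (b, a)) ts) \<subseteq> A \<times> A" using ts(2) by auto
  ultimately show ?thesis unfolding ten2_def by blast
qed

lemma ten2_diag:
  assumes "fun_alg A" "F \<in> ten2 A A"
  shows "(\<lambda>u. F (u, u)) \<in> A"
  using assms eval2_diag unfolding ten2_def by blast

text \<open>Over an affine open set the fraction can be formed from the coordinate algebra, with an
  identity on all of \<open>U \<times> U\<close>, even outside \<open>W\<close>. Two points are
  allowed because the lemma is applied at (x, x) as well as at (x, y) with x \<noteq> y.\<close>

lemma affine_fraction:
  fixes A :: "('a \<Rightarrow> complex) set"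
  assumes sheaf_at: "sheaf_of_functions X" and A: "fun_alg A"
    and frac: "\<And>x f. x \<in> U \<Longrightarrow> f \<in> germs_at X x \<Longrightarrow> \<exists>s\<in>A. \<exists>a\<in>A. s x \<noteq> 0 \<and> (\<forall>u\<in>U. s u * f u = a u)"
    and nhd: "\<And>x W. x \<in> W \<Longrightarrow> x \<in> U \<Longrightarrow> openX X W \<Longrightarrow> \<exists>s\<in>A. s x \<noteq> 0 \<and> {u \<in> U. s u \<noteq> 0} \<subseteq> W"
    and t: "t \<in> regs (X \<times>\<^sub>f X) W" "(x, y) \<in> W" and xy: "x \<in> U" "y \<in> U"
  obtains h g where "h \<in> ten2 A A" "g \<in> ten2 A A" "h (x, y) \<noteq> 0"
    "\<And>u v. u \<in> U \<Longrightarrow> v \<in> U \<Longrightarrow> h (u, v) * t (u, v) = g (u, v)"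
proof -
  note AA = ten2_fun_alg[OF A A]
  note m = fun_alg_mult[OF AA] and ad = fun_alg_add[OF AA]
  \<comment> \<open>Having a fraction over \<open>A\<close> with global identity is stable under
    adding elementary tensors of germs, since denominators multiply; so it holds for numerator and
    denominator of t separately.\<close>
  define P where "P F \<longleftrightarrow> (\<exists>h\<in>ten2 A A. \<exists>g\<in>ten2 A A. h (x, y) \<noteq> 0 \<and>
     (\<forall>u\<in>U. \<forall>v\<in>U. h (u, v) * F (u, v) = g (u, v)))" for F
  have Pt: "P F" if "F \<in> ten2 (germs_at X x) (germs_at X y)" for F
    using that
  proof (induction rule: ten2_induct)
    case zero
    show ?case unfolding P_def
      by (rule bexI[OF _ fun_alg_const[OF AA, of 1]], rule bexI[OF _ fun_alg_const[OF AA, of 0]]) simp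
  next
    case (add a b F)
    obtain s a' where a: "s \<in> A" "a' \<in> A" "s x \<noteq> 0" "\<forall>u\<in>U. s u * a u = a' u" using frac[OF xy(1) add(1)] by blast
    obtain r b' where b: "r \<in> A" "b' \<in> A" "r y \<noteq> 0" "\<forall>u\<in>U. r u * b u = b' u" using frac[OF xy(2) add(2)] by blast
    obtain h g where F: "h \<in> ten2 A A" "g \<in> ten2 A A" "h (x, y) \<noteq> 0" "\<forall>u\<in>U. \<forall>v\<in>U. h (u, v) * F (u, v) = g (u, v)"
      using add(4) unfolding P_def by blast
    let ?s = "\<lambda>(u, v). s u * r v" and ?a = "\<lambda>(u, v). a' u * b' v"
    have sa: "?s \<in> ten2 A A" "?a \<in> ten2 A A" using a b by (auto intro: ten2_single)
    show ?case unfolding P_def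
    proof (rule bexI[OF _ m[OF sa(1) F(1)]], rule bexI[OF _ ad[OF m[OF F(1) sa(2)] m[OF sa(1) F(2)]]], intro conjI ballI)
      fix u v assume uv: "u \<in> U" "v \<in> U"
      have "a' u = s u * a u" "b' v = r v * b v" "g (u, v) = h (u, v) * F (u, v)" using a b F uv by auto
      then show "(case (u, v) of (u, v) \<Rightarrow> s u * r v) * h (u, v) * (case (u, v) of (x, y) \<Rightarrow> a x * b y + F (x, y)) =
        h (u, v) * (case (u, v) of (u, v) \<Rightarrow> a' u * b' v) + (case (u, v) of (u, v) \<Rightarrow> s u * r v) * g (u, v)"
        by (simp add: algebra_simps)
    qed (use a b F in simp)
  qed
  obtain U1 V1 g h where 1: "openX X U1" "openX X V1" "x \<in> U1" "y \<in> V1" "g \<in> ten2 (regs X U1) (regs X V1)"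
    "h \<in> ten2 (regs X U1) (regs X V1)" "h (x, y) \<noteq> 0"
    "\<And>u v. u \<in> U1 \<Longrightarrow> v \<in> V1 \<Longrightarrow> h (u, v) \<noteq> 0 \<Longrightarrow> (u, v) \<in> W \<and> t (u, v) = g (u, v) / h (u, v)"
    by (rule regs_prod_fraction[OF sheaf_at sheaf_at t], rule that) assumption+
  have "ten2 (regs X U1) (regs X V1) \<subseteq> ten2 (germs_at X x) (germs_at X y)"
    by (rule ten2_mono) (auto intro: germs_atI[OF 1(1,3)] germs_atI[OF 1(2,4)])
  then have gh: "P g" "P h" using Pt 1(5,6) by blast+
  obtain h1 g1 where 2: "h1 \<in> ten2 A A" "g1 \<in> ten2 A A" "h1 (x, y) \<noteq> 0" "\<forall>u\<in>U. \<forall>v\<in>U. h1 (u, v) * g (u, v) = g1 (u, v)"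
    using gh(1) unfolding P_def by blast
  obtain h2 g2 where 3: "h2 \<in> ten2 A A" "g2 \<in> ten2 A A" "h2 (x, y) \<noteq> 0" "\<forall>u\<in>U. \<forall>v\<in>U. h2 (u, v) * h (u, v) = g2 (u, v)"
    using gh(2) unfolding P_def by blast
  obtain s where s: "s \<in> A" "s x \<noteq> 0" "{u \<in> U. s u \<noteq> 0} \<subseteq> U1" using nhd[OF 1(3) xy(1) 1(1)] by blast
  obtain r where r: "r \<in> A" "r y \<noteq> 0" "{u \<in> U. r u \<noteq> 0} \<subseteq> V1" using nhd[OF 1(4) xy(2) 1(2)] by blast
  let ?k = "\<lambda>(u, v). s u * r v"
  have k: "?k \<in> ten2 A A" using s r by (auto intro: ten2_single)
  show ?thesis
  \<comment> \<open>From t = g / h, h1 g = g1 and h2 h = g2 one gets t = h2 g1 / (g2 h1). The factor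
    \<open>?k\<close> vanishes outside \<open>U1 \<times> V1\<close>, and the second g2 vanishes
    where h does, so the identity holds everywhere on \<open>U \<times> U\<close>.\<close>
  proof (rule that[OF m[OF m[OF m[OF k 3(2)] 3(2)] 2(1)] m[OF m[OF m[OF k 3(2)] 3(1)] 2(2)]])
    have "g2 (x, y) = h2 (x, y) * h (x, y)" using 3(4) xy by simp
    then show "(case (x, y) of (u, v) \<Rightarrow> s u * r v) * g2 (x, y) * g2 (x, y) * h1 (x, y) \<noteq> 0"
      using s r 3(3) 1(7) 2(3) by simp
  next
    fix u v assume uv: "u \<in> U" "v \<in> U"
    have e: "g2 (u, v) = h2 (u, v) * h (u, v)" "g1 (u, v) = h1 (u, v) * g (u, v)" using 2(4) 3(4) uv by auto
    show "(case (u, v) of (u, v) \<Rightarrow> s u * r v) * g2 (u, v) * g2 (u, v) * h1 (u, v) * t (u, v) =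
       (case (u, v) of (u, v) \<Rightarrow> s u * r v) * g2 (u, v) * h2 (u, v) * g1 (u, v)"
    proof (cases "s u = 0 \<or> r v = 0 \<or> h (u, v) = 0")
      case True then show ?thesis by (auto simp: e)
    next
      case False
      then have "u \<in> U1" "v \<in> V1" using s(3) r(3) uv by auto
      then have "t (u, v) = g (u, v) / h (u, v)" using 1(8) False by blast
      then show ?thesis using False by (simp add: e)
    qed
  qed
qed

context
  fixes X :: "'a fspace"
  assumes FX: "function_space X"
begin

lemmas SX2 = sheaf_base[OF FX]

lemma morphism_proj:
  shows "morphism (cube X) X fst" "morphism (cube X) X (\<lambda>p. fst (snd p))" "morphism (cube X) X (\<lambda>p. snd (snd p))"
  unfolding cube_def
  by (intro morphism_fst morphism_snd morphism_comp[OF morphism_snd[OF SX2 sheaf_square[OF FX]]] SX2 sheaf_square[OF FX])+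

lemma cube_regs_fun:
  assumes U: "openX X U" and a: "a \<in> regs X U"
  shows "(\<lambda>(u, v, w). a u) \<in> regs (cube X) (U \<times> U \<times> U)" "(\<lambda>(u, v, w). a v) \<in> regs (cube X) (U \<times> U \<times> U)"
    "(\<lambda>(u, v, w). a w) \<in> regs (cube X) (U \<times> U \<times> U)"
proof -
  note S = function_space_sheaf[OF function_space_cube_of_X[OF FX]] and o = openX_cube_Times[OF FX U]
  show "(\<lambda>(u, v, w). a u) \<in> regs (cube X) (U \<times> U \<times> U)"
    using morphism_regs_subset[OF S morphism_proj(1) U a o] by (auto simp: case_prod_unfold)
  show "(\<lambda>(u, v, w). a v) \<in> regs (cube X) (U \<times> U \<times> U)"
    using morphism_regs_subset[OF S morphism_proj(2) U a o] by (auto simp: case_prod_unfold)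
  show "(\<lambda>(u, v, w). a w) \<in> regs (cube X) (U \<times> U \<times> U)"
    using morphism_regs_subset[OF S morphism_proj(3) U a o] by (auto simp: case_prod_unfold)
qed

definition cube_alg :: "'a set \<Rightarrow> ('a \<times> 'a \<times> 'a \<Rightarrow> complex) set" where
  "cube_alg U = regs (cube X) (U \<times> U \<times> U)"

lemma fun_alg_cube_alg: "openX X U \<Longrightarrow> fun_alg (cube_alg U)"
  unfolding cube_alg_def
  by (rule fun_alg_regs[OF function_space_sheaf[OF function_space_cube_of_X[OF FX]] openX_cube_Times[OF FX]])

lemma cube_alg_pair:
  assumes U: "openX X U" and F: "F \<in> ten2 (regs X U) (regs X U)"
  shows "(\<lambda>(u, v, w). F (u, v)) \<in> cube_alg U" "(\<lambda>(u, v, w). F (u, w)) \<in> cube_alg U"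
    "(\<lambda>(u, v, w). F (v, w)) \<in> cube_alg U"
proof -
  note A = fun_alg_cube_alg[OF U]
  have "(\<lambda>(u, v, w). F (u, v)) \<in> cube_alg U \<and> (\<lambda>(u, v, w). F (u, w)) \<in> cube_alg U \<and>
    (\<lambda>(u, v, w). F (v, w)) \<in> cube_alg U"
    using F
  proof (induction rule: ten2_induct)
    case zero
    show ?case using fun_alg_const[OF A, of 0] by (simp add: case_prod_unfold)
  next
    case (add a b F)
    note c = cube_regs_fun[OF U add(1), folded cube_alg_def] cube_regs_fun[OF U add(2), folded cube_alg_def]
    note IH = add(4)[THEN conjunct1] add(4)[THEN conjunct2, THEN conjunct1] add(4)[THEN conjunct2, THEN conjunct2]
    from fun_alg_add[OF A fun_alg_mult[OF A c(1,5)] IH(1)] fun_alg_add[OF A fun_alg_mult[OF A c(1,6)] IH(2)]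
      fun_alg_add[OF A fun_alg_mult[OF A c(2,6)] IH(3)]
    show ?case by (simp add: case_prod_unfold)
  qed
  then show "(\<lambda>(u, v, w). F (u, v)) \<in> cube_alg U" "(\<lambda>(u, v, w). F (u, w)) \<in> cube_alg U"
    "(\<lambda>(u, v, w). F (v, w)) \<in> cube_alg U" by blast+
qed

lemma cube_alg_pairs:
  assumes U: "openX X U" and F: "F \<in> ten2 (regs X U) (regs X U)"
  shows "(\<lambda>(u, v, w). F (u, v)) \<in> cube_alg U" "(\<lambda>(u, v, w). F (u, w)) \<in> cube_alg U"
    "(\<lambda>(u, v, w). F (v, w)) \<in> cube_alg U" "(\<lambda>(u, v, w). F (v, u)) \<in> cube_alg U"
    "(\<lambda>(u, v, w). F (w, u)) \<in> cube_alg U" "(\<lambda>(u, v, w). F (w, v)) \<in> cube_alg U"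
  using cube_alg_pair[OF U F] cube_alg_pair[OF U ten2_swap[OF F]] by simp_all

lemma sym_lift_regs:
  assumes U: "openX X U" and F: "F \<in> cube_alg U"
    and sym: "\<And>a b c. F (a, b, c) = F (b, a, c)" "\<And>a b c. F (a, b, c) = F (a, c, b)"
  shows "sym_lift F \<in> regs (sym3 X) (sym3_set U)"
proof -
  have "(\<lambda>p. sym_lift F (cycle3 p)) = F"
    using sym_lift_cycle3[of F, OF sym] by auto
  then show ?thesis
    using F unfolding regs_sym3[OF FX] preim_sym3_set(1)[OF FX openin_subset[OF U]] cube_alg_def by simp
qed

text \<open>If \<open>h\<close> does not vanish at \<open>(x, x)\<close>, its norm is a symmetric function that does not vanish at \<open>3x\<close>,
  and the restriction of the norm along \<open>w2\<close> is a multiple of \<open>h\<close>: so fractions on \<open>X \<times> X\<close> can be given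
  symmetric denominators.\<close>

definition norm3 :: "('a \<times> 'a \<Rightarrow> complex) \<Rightarrow> 'a multiset \<Rightarrow> complex" where
  "norm3 h = sym_lift (\<lambda>(u, v, w). h (u, v) * h (v, u) * (h (u, w) * h (w, u)) * (h (v, w) * h (w, v)))"

lemma norm3_w2: "norm3 h {#u, u, v#} = h (u, u) * h (u, u) * (h (u, v) * h (v, u)) * (h (u, v) * h (v, u))"
  unfolding norm3_def by (subst sym_lift_cycle3) auto

lemma norm3_regs:
  assumes U: "openX X U" and h: "h \<in> ten2 (regs X U) (regs X U)"
  shows "norm3 h \<in> regs (sym3 X) (sym3_set U)"
  unfolding norm3_def
proof (rule sym_lift_regs[OF U])
  note m = fun_alg_mult[OF fun_alg_cube_alg[OF U]] and c = cube_alg_pairs[OF U h]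
  from m[OF m[OF m[OF c(1,4)] m[OF c(2,5)]] m[OF c(3,6)]]
  show "(\<lambda>(u, v, w). h (u, v) * h (v, u) * (h (u, w) * h (w, u)) * (h (v, w) * h (w, v))) \<in> cube_alg U"
    by (simp add: case_prod_unfold)
qed auto

text \<open>For h t = g this is, by \<open>norm3_w2\<close>, the restriction of
  \<open>norm3 h\<close> times t: one of the two factors h(u, v) has been absorbed into g.\<close>

lemma norm3_numerator:
  assumes A: "fun_alg A" and h: "h \<in> ten2 A A" and g: "g \<in> ten2 A A"
  shows "(\<lambda>(u, v). h (u, u) * h (u, u) * (h (v, u) * h (v, u)) * h (u, v) * g (u, v)) \<in> ten2 A A"
proof -
  note m = fun_alg_mult[OF ten2_fun_alg[OF A A]]
  note d = ten2_fst[OF A ten2_diag[OF A h]] and s = ten2_swap[OF h]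
  from m[OF m[OF m[OF m[OF d d] m[OF s s]] h] g]
  show ?thesis by (simp add: case_prod_unfold)
qed

section \<open>Uniqueness of \<open>D\<close>\<close>

lemma locally_given_D_hom:
  assumes D: "locally_given_D X D" and V: "openX (sym3 X) V" and t: "t \<in> reg (X \<times>\<^sub>f X) (preim w2 (X \<times>\<^sub>f X) V)"
  shows "D V t \<in> carrier (sec (Omega X) (preim w3 X V))"
    and "s \<in> reg (X \<times>\<^sub>f X) (preim w2 (X \<times>\<^sub>f X) V) \<Longrightarrow>
      D V (\<lambda>p\<in>preim w2 (X \<times>\<^sub>f X) V. t p + s p) = (\<lambda>x\<in>preim w3 X V. D V t x \<oplus>\<^bsub>Omega_stalk X x\<^esub> D V s x)"
    and "f \<in> reg (sym3 X) V \<Longrightarrow> D V (\<lambda>p\<in>preim w2 (X \<times>\<^sub>f X) V. pullback w2 (X \<times>\<^sub>f X) V f p * t p) =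
      (\<lambda>x\<in>preim w3 X V. germ X x (pullback w3 X V f) \<odot>\<^bsub>Omega_stalk X x\<^esub> D V t x)"
    and "openX (sym3 X) W \<Longrightarrow> W \<subseteq> V \<Longrightarrow>
      D W (restrict t (preim w2 (X \<times>\<^sub>f X) W)) = restrict (D V t) (preim w3 X W)"
proof -
  note h = D[unfolded locally_given_D_def, THEN conjunct1, unfolded sheaf_hom_def w2_pushforward_def w3_pushforward_def
        pushforward_simps sec_structure_sheaf sec_Omega, THEN spec, THEN mp, OF V, THEN bspec, OF t]
  note h2 = h[THEN conjunct2] and h3 = h[THEN conjunct2, THEN conjunct2]
  show "D V t \<in> carrier (sec (Omega X) (preim w3 X V))" by (rule h[THEN conjunct1])
  show "s \<in> reg (X \<times>\<^sub>f X) (preim w2 (X \<times>\<^sub>f X) V) \<Longrightarrow>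
      D V (\<lambda>p\<in>preim w2 (X \<times>\<^sub>f X) V. t p + s p) = (\<lambda>x\<in>preim w3 X V. D V t x \<oplus>\<^bsub>Omega_stalk X x\<^esub> D V s x)"
    by (rule h2[THEN conjunct1, THEN bspec])
  show "f \<in> reg (sym3 X) V \<Longrightarrow> D V (\<lambda>p\<in>preim w2 (X \<times>\<^sub>f X) V. pullback w2 (X \<times>\<^sub>f X) V f p * t p) =
      (\<lambda>x\<in>preim w3 X V. germ X x (pullback w3 X V f) \<odot>\<^bsub>Omega_stalk X x\<^esub> D V t x)"
    by (rule h3[THEN conjunct1, THEN bspec])
  show "openX (sym3 X) W \<Longrightarrow> W \<subseteq> V \<Longrightarrow>
      D W (restrict t (preim w2 (X \<times>\<^sub>f X) W)) = restrict (D V t) (preim w3 X W)"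
    by (rule h3[THEN conjunct2, THEN spec, THEN mp, OF conjI])
qed

text \<open>Multiplication by the symmetric function \<open>norm3 h\<close> commutes with
  \<open>D\<close> and turns t into a tensor over \<open>A\<close>. There additivity and the
  prescribed values on elementary tensors leave no freedom, and the norm is invertible near
  3x.\<close>

lemma D_unique_at:
  assumes D: "locally_given_D X D" and D': "locally_given_D X D'"
    and V: "openX (sym3 X) V" and t: "t \<in> reg (X \<times>\<^sub>f X) (preim w2 (X \<times>\<^sub>f X) V)" and x: "x \<in> preim w3 X V"
    and U: "affine_open X U" "x \<in> U"
  shows "D V t x = D' V t x"
proof -
  let ?P = "preim w2 (X \<times>\<^sub>f X)"
  have oU: "openX X U" using U by (simp add: affine_open_def)
  have px: "x \<in> points X" using openin_subset[OF oU] U(2) by blast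
  note p = preim_sym3_set[OF FX openin_subset[OF oU]] and oS = openX_sym3_set[OF FX oU]
  have oUU: "openX (X \<times>\<^sub>f X) (U \<times> U)" by (rule openX_prod_Times[OF SX2 SX2 oU oU])
  have oP: "openX (X \<times>\<^sub>f X) (?P V)" by (rule morphism_open[OF morphism_w2[OF FX] V])
  have t': "t \<in> regs (X \<times>\<^sub>f X) (?P V)" using t reg_regs[OF sheaf_square[OF FX] oP] by blast
  obtain A where A: "fun_alg A" "A \<subseteq> regs X U"
    "\<And>x f. x \<in> U \<Longrightarrow> f \<in> germs_at X x \<Longrightarrow> \<exists>s\<in>A. \<exists>a\<in>A. s x \<noteq> 0 \<and> (\<forall>u\<in>U. s u * f u = a u)"
    "\<And>x W. x \<in> W \<Longrightarrow> x \<in> U \<Longrightarrow> openX X W \<Longrightarrow> \<exists>s\<in>A. s x \<noteq> 0 \<and> {u \<in> U. s u \<noteq> 0} \<subseteq> W"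
    by (rule affine_open_coordinates[OF SX2 U(1)], rule that) assumption+
  have xx: "(x, x) \<in> ?P V" using w3_diag[OF FX x] by blast
  obtain h g where hg: "h \<in> ten2 A A" "g \<in> ten2 A A" "h (x, x) \<noteq> 0"
    "\<And>u v. u \<in> U \<Longrightarrow> v \<in> U \<Longrightarrow> h (u, v) * t (u, v) = g (u, v)"
    by (rule affine_fraction[OF SX2 A(1,3,4) t' xx U(2,2)], assumption+, rule that) assumption+
  have sub: "ten2 A A \<subseteq> ten2 (regs X U) (regs X U)" by (rule ten2_mono[OF A(2) A(2)])
  have \<kappa>: "norm3 h \<in> regs (sym3 X) (sym3_set U)" by (rule norm3_regs[OF oU]) (use hg(1) sub in blast)
  let ?Q = "\<lambda>(u, v). h (u, u) * h (u, u) * (h (v, u) * h (v, u)) * h (u, v) * g (u, v)"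
  have Q: "?Q \<in> ten2 A A" by (rule norm3_numerator[OF A(1) hg(1,2)])
  \<comment> \<open>The norm is invertible here, and 3x belongs to this set because
    \<open>norm3 h\<close> takes a power of h(x, x) there.\<close>
  define W where "W = {M \<in> sym3_set U. norm3 h M \<noteq> 0} \<inter> V"
  have W: "openX (sym3 X) W" "W \<subseteq> sym3_set U" "W \<subseteq> V"
    using function_space_open[OF function_space_sym3[OF FX] oS \<kappa>] V by (auto simp: W_def)
  have xW: "x \<in> preim w3 X W"
    using x hg(3) U(2) px by (auto simp: preim_def W_def w3_def norm3_w2 sym3_set_def)
  have oPW: "openX (X \<times>\<^sub>f X) (?P W)" by (rule morphism_open[OF morphism_w2[OF FX] W(1)])
  have \<kappa>W: "norm3 h \<in> regs (sym3 X) W" by (rule regs_subset[OF sheaf_sym3[OF FX] oS W(1,2) \<kappa>])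
  let ?k = "restrict (norm3 h) W"
  have kr: "?k \<in> reg (sym3 X) W" using \<kappa>W by (simp add: regs_def)
  have tW: "restrict t (?P W) \<in> reg (X \<times>\<^sub>f X) (?P W)"
    by (rule reg_restrict[OF sheaf_square[OF FX] oP t oPW preim_mono[OF W(3)]])
  have QU: "restrict q (U \<times> U) \<in> reg (X \<times>\<^sub>f X) (U \<times> U)" if "q \<in> ten2 A A" for q
    using ten2_regs[OF SX2 SX2 oU oU] that sub unfolding restrict_reg_iff by blast
  have PW: "?P W \<subseteq> U \<times> U" using preim_mono[OF W(2), of w2 "X \<times>\<^sub>f X"] unfolding p(2) .
  have eq: "(\<lambda>q\<in>?P W. pullback w2 (X \<times>\<^sub>f X) W ?k q * restrict t (?P W) q) = restrict (restrict ?Q (U \<times> U)) (?P W)"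
  proof (rule ext)
    fix q :: "'a \<times> 'a"
    obtain u v where q: "q = (u, v)" by (cases q)
    show "(\<lambda>q\<in>?P W. pullback w2 (X \<times>\<^sub>f X) W ?k q * restrict t (?P W) q) q = restrict (restrict ?Q (U \<times> U)) (?P W) q"
    proof (cases "q \<in> ?P W")
      case True
      then have uv: "u \<in> U" "v \<in> U" "{#u, u, v#} \<in> W" using PW q by (auto simp: preim_def)
      then show ?thesis using True q hg(4)[of u v, symmetric] by (simp add: pullback_def norm3_w2)
    qed (simp add: restrict_def)
  qed
  have key: "D V t x = germ X x (\<lambda>y. 1 / norm3 h {#y, y, y#}) \<odot>\<^bsub>Omega_stalk X x\<^esub> D (sym3_set U) (restrict ?Q (U \<times> U)) x"
    if D: "locally_given_D X D" for D
  proof -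
    interpret M: module "stalk X x" "Omega_stalk X x" by (rule module_Omega_stalk[OF SX2 px])
    note hom = locally_given_D_hom[OF D]
    have cl: "D V t \<in> carrier (sec (Omega X) (preim w3 X V))" by (rule hom(1)[OF V t])
    have c: "D V t x \<in> carrier (Omega_stalk X x)"
      by (rule Omega_secD(2)[OF SX2 morphism_open[OF morphism_w3[OF FX] V] cl x])
    have r1: "D W (restrict t (?P W)) = restrict (D V t) (preim w3 X W)"
      by (rule hom(4)[OF V t W(1,3)])
    have r2: "D W (restrict (restrict ?Q (U \<times> U)) (?P W)) = restrict (D (sym3_set U) (restrict ?Q (U \<times> U))) (preim w3 X W)"
      by (rule hom(4)[OF oS, unfolded p, OF QU[OF Q] W(1,2)])
    have r3: "D W (\<lambda>q\<in>?P W. pullback w2 (X \<times>\<^sub>f X) W ?k q * restrict t (?P W) q) =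
       (\<lambda>x\<in>preim w3 X W. germ X x (pullback w3 X W ?k) \<odot>\<^bsub>Omega_stalk X x\<^esub> D W (restrict t (?P W)) x)"
      by (rule hom(3)[OF W(1) tW kr])
    have gk: "germ X x (pullback w3 X W ?k) = germ X x (\<lambda>y. norm3 h {#y, y, y#})"
      by (rule germ_eqI[OF morphism_open[OF morphism_w3[OF FX] W(1)] xW]) (simp add: pullback_def preim_def w3_def)
    have kg: "(\<lambda>y. norm3 h {#y, y, y#}) \<in> germs_at X x" by (rule germ_diag[OF FX \<kappa>W W(1) xW])
    have nz: "norm3 h {#x, x, x#} \<noteq> 0" using hg(3) by (simp add: norm3_w2)
    note un = stalk_Units[OF FX px kg nz]
    have "D (sym3_set U) (restrict ?Q (U \<times> U)) x = germ X x (\<lambda>y. norm3 h {#y, y, y#}) \<odot>\<^bsub>Omega_stalk X x\<^esub> D V t x"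
      using fun_cong[OF r2, of x] fun_cong[OF r3, of x] xW unfolding eq r1 by (simp add: gk)
    then have "germ X x (\<lambda>y. 1 / norm3 h {#y, y, y#}) \<odot>\<^bsub>Omega_stalk X x\<^esub> D (sym3_set U) (restrict ?Q (U \<times> U)) x =
       (germ X x (\<lambda>y. 1 / norm3 h {#y, y, y#}) \<otimes>\<^bsub>stalk X x\<^esub> germ X x (\<lambda>y. norm3 h {#y, y, y#})) \<odot>\<^bsub>Omega_stalk X x\<^esub> D V t x"
      using c germ_closed[OF SX2 px un(2)] germ_closed[OF SX2 px kg] by (simp add: M.smult_assoc1)
    also have "\<dots> = D V t x"
      using un(3) c M.R.m_comm[OF germ_closed[OF SX2 px un(2)] germ_closed[OF SX2 px kg]] by simp
    finally show ?thesis ..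
  qed
  have same: "D (sym3_set U) (restrict q (U \<times> U)) = D' (sym3_set U) (restrict q (U \<times> U))" if "q \<in> ten2 A A" for q
    using that
  proof (induction rule: ten2_induct)
    case zero
    \<comment> \<open>The value at zero has to be derived from additivity: D 0 + D 0 = D 0.\<close>
    have z: "D (sym3_set U) (restrict (\<lambda>p. 0) (U \<times> U)) = (\<lambda>x\<in>U. \<zero>\<^bsub>Omega_stalk X x\<^esub>)" if D: "locally_given_D X D" for D
    proof -
      let ?o = "restrict (\<lambda>p. 0 :: complex) (U \<times> U)"
      note hom = locally_given_D_hom[OF D oS, unfolded p]
      have o: "?o \<in> reg (X \<times>\<^sub>f X) (U \<times> U)" by (rule QU[OF fun_alg_const[OF ten2_fun_alg[OF A(1) A(1)]]])
      interpret N: module "sec (\<O> X) U" "sec (Omega X) U" by (rule module_Omega_sec[OF SX2 oU])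
      have c: "D (sym3_set U) ?o \<in> carrier (sec (Omega X) U)" by (rule hom(1)[OF o])
      have "(\<lambda>p\<in>U \<times> U. ?o p + ?o p) = ?o" by (intro ext) (simp add: restrict_def)
      then have "D (sym3_set U) ?o \<oplus>\<^bsub>sec (Omega X) U\<^esub> D (sym3_set U) ?o = D (sym3_set U) ?o"
        using hom(2)[OF o o] unfolding sec_Omega by simp
      then have "D (sym3_set U) ?o = \<zero>\<^bsub>sec (Omega X) U\<^esub>" using N.M.add.l_cancel_one[OF c c] by (simp only:)
      then show ?thesis by simp
    qed
    show ?case unfolding z[OF D] z[OF D'] ..
  next
    case (add a b q)
    have ab: "restrict a U \<in> reg X U" "restrict b U \<in> reg X U" using add(1,2) A(2) by (auto simp: restrict_reg_iff)
    have s: "D (sym3_set U) (restrict (\<lambda>(x, y). a x * b y + q (x, y)) (U \<times> U)) =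
       (\<lambda>x\<in>U. (\<lambda>x\<in>U. form_germ X (\<lambda>y. 2 * restrict a U y) (restrict b U) x \<ominus>\<^bsub>Omega_stalk X x\<^esub>
          form_germ X (restrict b U) (restrict a U) x) x \<oplus>\<^bsub>Omega_stalk X x\<^esub> D (sym3_set U) (restrict q (U \<times> U)) x)"
      if D: "locally_given_D X D" for D
    proof -
      note hom = locally_given_D_hom[OF D oS, unfolded p]
      let ?s = "\<lambda>(x, y)\<in>U \<times> U. restrict a U x * restrict b U y"
      have r: "?s \<in> reg (X \<times>\<^sub>f X) (U \<times> U)"
      proof -
        have "?s = restrict (\<lambda>(x, y). a x * b y) (U \<times> U)" by (intro ext) (auto simp: restrict_def)
        then show ?thesis using QU[OF ten2_single[OF add(1,2)]] by simp
      qed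
      have "restrict (\<lambda>(x, y). a x * b y + q (x, y)) (U \<times> U) = (\<lambda>p\<in>U \<times> U. ?s p + restrict q (U \<times> U) p)"
        by (intro ext) (auto simp: restrict_def)
      moreover have "D (sym3_set U) (\<lambda>p\<in>U \<times> U. ?s p + restrict q (U \<times> U) p) =
        (\<lambda>x\<in>U. D (sym3_set U) ?s x \<oplus>\<^bsub>Omega_stalk X x\<^esub> D (sym3_set U) (restrict q (U \<times> U)) x)"
        by (rule hom(2)[OF r QU[OF add(3)]])
      moreover have "D (sym3_set U) ?s = (\<lambda>x\<in>U. form_germ X (\<lambda>y. 2 * restrict a U y) (restrict b U) x \<ominus>\<^bsub>Omega_stalk X x\<^esub>
          form_germ X (restrict b U) (restrict a U) x)"
        using D[unfolded locally_given_D_def, THEN conjunct2, rule_format, OF U(1) ab] .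
      ultimately show ?thesis by (simp only:)
    qed
    show ?case unfolding s[OF D] s[OF D'] add(4) ..
  qed
  show ?thesis unfolding key[OF D] key[OF D'] same[OF Q] ..
qed

lemma D_unique:
  assumes D: "locally_given_D X D"
    and aff: "\<And>x. x \<in> points X \<Longrightarrow> \<exists>U. affine_open X U \<and> x \<in> U"
    and V: "openX (sym3 X) V" and t: "t \<in> carrier (sec (w2_pushforward X) V)"
  shows "D V t = canonical_D X V t"
proof (rule extensionalityI[of _ "preim w3 X V"])
  have "D V t \<in> carrier (sec (w3_pushforward X) V)"
    using D[unfolded locally_given_D_def, THEN conjunct1, unfolded sheaf_hom_def, rule_format, OF V t] by blast
  then show "D V t \<in> extensional (preim w3 X V)"
    using Omega_secD(1)[OF SX2 morphism_open[OF morphism_w3[OF FX] V]] by (simp add: w3_pushforward_def)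
  show "canonical_D X V t \<in> extensional (preim w3 X V)" by (simp add: canonical_D_def)
  fix x assume x: "x \<in> preim w3 X V"
  then obtain U where U: "affine_open X U" "x \<in> U" using aff by (auto simp: preim_def)
  show "D V t x = canonical_D X V t x"
    by (rule D_unique_at[OF D locally_given_canonical_D[OF FX] V _ x U]) (use t in \<open>simp add: w2_pushforward_def\<close>)
qed

end

text \<open>The functions that near (x, x) are restrictions along \<open>w2\<close> of functions on
  some \<open>sym3_set U\<close>. It will be the subgroup \<open>Z\<close> in
  \<open>kaehler_sum_zero\<close>; as it is tested on tensors, product neighbourhoods are
  enough.\<close>

definition sym_germs :: "'a fspace \<Rightarrow> 'a \<Rightarrow> ('a \<times> 'a \<Rightarrow> complex) set" where
  "sym_germs X x = {H. \<exists>U \<nu>. openX X U \<and> x \<in> U \<and> \<nu> \<in> regs (sym3 X) (sym3_set U) \<and>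
     (\<forall>u\<in>U. \<forall>v\<in>U. H (u, v) = \<nu> (w2 (u, v)))}"

lemma sym_germsI:
  assumes "openX X U" "x \<in> U" "\<nu> \<in> regs (sym3 X) (sym3_set U)" "\<And>u v. u \<in> U \<Longrightarrow> v \<in> U \<Longrightarrow> H (u, v) = \<nu> (w2 (u, v))"
  shows "H \<in> sym_germs X x"
  unfolding sym_germs_def using assms by (intro CollectI exI[of _ U] exI[of _ \<nu>]) simp

lemma sym_germsE:
  assumes "H \<in> sym_germs X x"
  obtains U \<nu> where "openX X U" "x \<in> U" "\<nu> \<in> regs (sym3 X) (sym3_set U)" "\<And>u v. u \<in> U \<Longrightarrow> v \<in> U \<Longrightarrow> H (u, v) = \<nu> (w2 (u, v))"
proof -
  from assms obtain U \<nu> where *: "openX X U" "x \<in> U" "\<nu> \<in> regs (sym3 X) (sym3_set U)" "\<forall>u\<in>U. \<forall>v\<in>U. H (u, v) = \<nu> (w2 (u, v))"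
    unfolding sym_germs_def mem_Collect_eq by (elim exE conjE)
  show ?thesis by (rule that[OF *(1-3)]) (simp add: *(4) del: w2_simps)
qed

lemma sym3_set_mono: "U \<subseteq> V \<Longrightarrow> sym3_set U \<subseteq> sym3_set V"
  by (auto simp: sym3_set_def)

context
  fixes X :: "'a fspace" and x :: 'a
  assumes FX: "function_space X" and x: "x \<in> points X"
begin

lemma regs_sym3_subset:
  assumes "openX X U" "openX X V" "V \<subseteq> U" "\<nu> \<in> regs (sym3 X) (sym3_set U)"
  shows "\<nu> \<in> regs (sym3 X) (sym3_set V)"
  by (rule regs_subset[OF sheaf_sym3[OF FX] openX_sym3_set[OF FX assms(1)] openX_sym3_set[OF FX assms(2)]
        sym3_set_mono[OF assms(3)] assms(4)])

lemma sym_germs_zero: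
  assumes "openX X U" "x \<in> U" "\<And>u v. u \<in> U \<Longrightarrow> v \<in> U \<Longrightarrow> H (u, v) = 0"
  shows "H \<in> sym_germs X x"
  by (rule sym_germsI[OF assms(1,2) fun_alg_const[OF fun_alg_regs[OF sheaf_sym3[OF FX] openX_sym3_set[OF FX assms(1)]], of 0]])
     (rule assms(3))

lemma sym_germs_combine:
  assumes H: "H \<in> sym_germs X x" and H': "H' \<in> sym_germs X x"
    and N: "openX X N" "x \<in> N" "\<And>u v. u \<in> N \<Longrightarrow> v \<in> N \<Longrightarrow> K (u, v) = c * H (u, v) + c' * H' (u, v)"
  shows "K \<in> sym_germs X x"
proof -
  obtain U \<nu> where 1: "openX X U" "x \<in> U" "\<nu> \<in> regs (sym3 X) (sym3_set U)" "\<And>u v. u \<in> U \<Longrightarrow> v \<in> U \<Longrightarrow> H (u, v) = \<nu> (w2 (u, v))"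
    by (rule sym_germsE[OF H], rule that) assumption+
  obtain V \<mu> where 2: "openX X V" "x \<in> V" "\<mu> \<in> regs (sym3 X) (sym3_set V)" "\<And>u v. u \<in> V \<Longrightarrow> v \<in> V \<Longrightarrow> H' (u, v) = \<mu> (w2 (u, v))"
    by (rule sym_germsE[OF H'], rule that) assumption+
  let ?U = "U \<inter> V \<inter> N"
  have o: "openX X ?U" using 1 2 N by auto
  note A = fun_alg_regs[OF sheaf_sym3[OF FX] openX_sym3_set[OF FX o]]
  have r: "\<nu> \<in> regs (sym3 X) (sym3_set ?U)" "\<mu> \<in> regs (sym3 X) (sym3_set ?U)"
    using regs_sym3_subset[OF 1(1) o _ 1(3)] regs_sym3_subset[OF 2(1) o _ 2(3)] by auto
  show ?thesis
    by (rule sym_germsI[OF o _ fun_alg_add[OF A fun_alg_scale[OF A r(1), of c] fun_alg_scale[OF A r(2), of c']]])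
       (use 1 2 N in auto)
qed

text \<open>At (u, u, v) the sum over the six orderings of a \<otimes> b \<otimes> c contains each
  of these three terms twice, hence the factor one half.\<close>

lemma sym_germs_elementary:
  assumes abc: "a \<in> germs_at X x" "b \<in> germs_at X x" "c \<in> germs_at X x"
  shows "(\<lambda>(u, v). a u * b u * c v + a u * c u * b v + b u * c u * a v) \<in> sym_germs X x"
proof -
  obtain Ua Ub Uc where U: "openX X Ua" "x \<in> Ua" "a \<in> regs X Ua" "openX X Ub" "x \<in> Ub" "b \<in> regs X Ub"
      "openX X Uc" "x \<in> Uc" "c \<in> regs X Uc"
    using abc unfolding germs_at_def by blast
  let ?U = "Ua \<inter> Ub \<inter> Uc"
  have o: "openX X ?U" using U by auto
  have r: "a \<in> regs X ?U" "b \<in> regs X ?U" "c \<in> regs X ?U"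
    using regs_subset[OF SX2[OF FX] U(1) o _ U(3)] regs_subset[OF SX2[OF FX] U(4) o _ U(6)]
      regs_subset[OF SX2[OF FX] U(7) o _ U(9)] by auto
  note A = fun_alg_cube_alg[OF FX o]
  note m = fun_alg_mult[OF A] and ad = fun_alg_add[OF A]
  note ca = cube_regs_fun[OF FX o r(1), folded cube_alg_def[OF FX]] and cb = cube_regs_fun[OF FX o r(2), folded cube_alg_def[OF FX]]
    and cc = cube_regs_fun[OF FX o r(3), folded cube_alg_def[OF FX]]
  let ?F = "\<lambda>(u, v, w). a u * b v * c w + a u * b w * c v + (a v * b u * c w + a v * b w * c u) + (a w * b u * c v + a w * b v * c u)"
  from ad[OF ad[OF ad[OF m[OF m[OF ca(1) cb(2)] cc(3)] m[OF m[OF ca(1) cb(3)] cc(2)]]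
     ad[OF m[OF m[OF ca(2) cb(1)] cc(3)] m[OF m[OF ca(2) cb(3)] cc(1)]]]
     ad[OF m[OF m[OF ca(3) cb(1)] cc(2)] m[OF m[OF ca(3) cb(2)] cc(1)]]]
  have F: "?F \<in> cube_alg X ?U" by (simp add: case_prod_unfold)
  have l: "sym_lift ?F {#u, v, w#} = ?F (u, v, w)" for u v w
    by (rule sym_lift_cycle3) (auto simp: algebra_simps)
  have "sym_lift ?F \<in> regs (sym3 X) (sym3_set ?U)"
    by (rule sym_lift_regs[OF FX o F]) (auto simp: algebra_simps)
  from fun_alg_scale[OF fun_alg_regs[OF sheaf_sym3[OF FX] openX_sym3_set[OF FX o]] this, of "1 / 2"]
  have s: "(\<lambda>M. 1 / 2 * sym_lift ?F M) \<in> regs (sym3 X) (sym3_set ?U)" .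
  have "(\<lambda>(u, v). a u * b u * c v + a u * c u * b v + b u * c u * a v) (u, v) = 1 / 2 * sym_lift ?F (w2 (u, v))" for u v
    unfolding w2_simps l by (simp add: algebra_simps)
  then show ?thesis by (intro sym_germsI[OF o _ s]) (use U in auto)
qed

text \<open>Under \<open>D\<close> a tensor is mapped to zero iff it is symmetric modulo the image of \<open>r\<close>; the inverse
  isomorphism of \<open>\<Omega>\<^sup>1\<close> with the cokernel of \<open>r\<close> sends \<open>a db\<close> to a third of
  \<open>a \<otimes> b - ab \<otimes> 1\<close>.\<close>

lemma dlist_forms_zero:
  assumes qs: "set qs \<subseteq> germs_at X x \<times> germs_at X x" and zero: "forms X x (dlist qs) = \<zero>\<^bsub>Omega_stalk X x\<^esub>"
  shows "eval2 qs \<in> sym_germs X x"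
proof -
  let ?G = "germs_at X x"
  note sheaf_at = SX2[OF FX]
  note alg = fun_alg_germs_at[OF sheaf_at x]
  interpret D: differentials "stalk X x" "const_germs X x" by (rule differentials_stalk[OF sheaf_at x])
  \<comment> \<open>The universal property wants a map on germs, whereas \<open>sym_germs\<close>
    consists of functions. Representatives are chosen; they agree with the given functions only near
    x, which is why the steps below shrink neighbourhoods.\<close>
  define \<rho> where "\<rho> A = (SOME f. f \<in> ?G \<and> germ X x f = A)" for A
  have \<rho>: "\<rho> (germ X x f) \<in> ?G" "germ X x (\<rho> (germ X x f)) = germ X x f" if "f \<in> ?G" for f
    using someI[of "\<lambda>g. g \<in> ?G \<and> germ X x g = germ X x f" f] that unfolding \<rho>_def by auto
  have near: "\<exists>N. openX X N \<and> x \<in> N \<and> (\<forall>y\<in>N. \<rho> (germ X x f) y = f y)" if "f \<in> ?G" for f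
    by (rule germ_eqD[OF x \<rho>(2)[OF that]]) (intro exI conjI, assumption, assumption, simp)
  \<comment> \<open>The function a \<otimes> b - ab \<otimes> 1, which \<open>D\<close> maps to 3a
    db.\<close>
  define \<phi> where "\<phi> A B = (\<lambda>(u, v). \<rho> A u * (\<rho> B v - \<rho> B u))" for A B :: "('a \<Rightarrow> complex) set"
  let ?Z = "sym_germs X x"
  have cong: "K \<in> ?Z" if "H \<in> ?Z" "openX X N" "x \<in> N" "\<And>u v. u \<in> N \<Longrightarrow> v \<in> N \<Longrightarrow> K (u, v) = H (u, v)" for H K N
    by (rule sym_germs_combine[OF that(1,1,2,3), of _ 1 0]) (simp add: that(4))
  have Z0: "0 \<in> ?Z" by (rule sym_germs_zero[OF openin_topspace x]) simp
  have Zdiff: "H - K \<in> ?Z" if "H \<in> ?Z" "K \<in> ?Z" for H K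
    by (rule sym_germs_combine[OF that openin_topspace x, of _ 1 "-1"]) simp
  have st: "carrier (stalk X x) = germ X x ` ?G" by (rule carrier_stalk[OF sheaf_at])
  note ss = stalk_simps[OF x]
  have addl: "\<phi> (A \<oplus>\<^bsub>stalk X x\<^esub> A') B - (\<phi> A B + \<phi> A' B) \<in> ?Z"
    if "A \<in> carrier (stalk X x)" "A' \<in> carrier (stalk X x)" "B \<in> carrier (stalk X x)" for A A' B
  proof -
    obtain a a' b where f: "a \<in> ?G" "A = germ X x a" "a' \<in> ?G" "A' = germ X x a'" "b \<in> ?G" "B = germ X x b"
      using \<open>A \<in> _\<close> \<open>A' \<in> _\<close> \<open>B \<in> _\<close> unfolding st by blast
    obtain N1 where 1: "openX X N1" "x \<in> N1" "\<forall>y\<in>N1. \<rho> A y = a y" using near[OF f(1)] f(2) by blast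
    obtain N2 where 2: "openX X N2" "x \<in> N2" "\<forall>y\<in>N2. \<rho> A' y = a' y" using near[OF f(3)] f(4) by blast
    obtain N3 where 3: "openX X N3" "x \<in> N3" "\<forall>y\<in>N3. \<rho> (A \<oplus>\<^bsub>stalk X x\<^esub> A') y = a y + a' y"
      using near[OF fun_alg_add[OF alg f(1,3)]] unfolding f(2,4) ss by blast
    show ?thesis
      by (rule sym_germs_zero[of "N1 \<inter> N2 \<inter> N3"]) (use 1 2 3 in \<open>auto simp: \<phi>_def algebra_simps\<close>)
  qed
  have addr: "\<phi> A (B \<oplus>\<^bsub>stalk X x\<^esub> B') - (\<phi> A B + \<phi> A B') \<in> ?Z"
    if "A \<in> carrier (stalk X x)" "B \<in> carrier (stalk X x)" "B' \<in> carrier (stalk X x)" for A B B'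
  proof -
    obtain b b' where f: "b \<in> ?G" "B = germ X x b" "b' \<in> ?G" "B' = germ X x b'"
      using \<open>B \<in> _\<close> \<open>B' \<in> _\<close> unfolding st by blast
    obtain N1 where 1: "openX X N1" "x \<in> N1" "\<forall>y\<in>N1. \<rho> B y = b y" using near[OF f(1)] f(2) by blast
    obtain N2 where 2: "openX X N2" "x \<in> N2" "\<forall>y\<in>N2. \<rho> B' y = b' y" using near[OF f(3)] f(4) by blast
    obtain N3 where 3: "openX X N3" "x \<in> N3" "\<forall>y\<in>N3. \<rho> (B \<oplus>\<^bsub>stalk X x\<^esub> B') y = b y + b' y"
      using near[OF fun_alg_add[OF alg f(1,3)]] unfolding f(2,4) ss by blast
    show ?thesis
      by (rule sym_germs_zero[of "N1 \<inter> N2 \<inter> N3"]) (use 1 2 3 in \<open>auto simp: \<phi>_def algebra_simps\<close>)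
  qed
  have leib: "\<phi> A (B \<otimes>\<^bsub>stalk X x\<^esub> C) - (\<phi> (A \<otimes>\<^bsub>stalk X x\<^esub> B) C + \<phi> (A \<otimes>\<^bsub>stalk X x\<^esub> C) B) \<in> ?Z"
    if "A \<in> carrier (stalk X x)" "B \<in> carrier (stalk X x)" "C \<in> carrier (stalk X x)" for A B C
  proof -
    obtain a b c where f: "a \<in> ?G" "A = germ X x a" "b \<in> ?G" "B = germ X x b" "c \<in> ?G" "C = germ X x c"
      using \<open>A \<in> _\<close> \<open>B \<in> _\<close> \<open>C \<in> _\<close> unfolding st by blast
    note m = fun_alg_mult[OF alg]
    obtain N1 where 1: "openX X N1" "x \<in> N1" "\<forall>y\<in>N1. \<rho> A y = a y" using near[OF f(1)] f(2) by blast
    obtain N2 where 2: "openX X N2" "x \<in> N2" "\<forall>y\<in>N2. \<rho> B y = b y" using near[OF f(3)] f(4) by blast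
    obtain N3 where 3: "openX X N3" "x \<in> N3" "\<forall>y\<in>N3. \<rho> C y = c y" using near[OF f(5)] f(6) by blast
    obtain N4 where 4: "openX X N4" "x \<in> N4" "\<forall>y\<in>N4. \<rho> (B \<otimes>\<^bsub>stalk X x\<^esub> C) y = b y * c y"
      using near[OF m[OF f(3,5)]] unfolding f(4,6) ss by blast
    obtain N5 where 5: "openX X N5" "x \<in> N5" "\<forall>y\<in>N5. \<rho> (A \<otimes>\<^bsub>stalk X x\<^esub> B) y = a y * b y"
      using near[OF m[OF f(1,3)]] unfolding f(2,4) ss by blast
    obtain N6 where 6: "openX X N6" "x \<in> N6" "\<forall>y\<in>N6. \<rho> (A \<otimes>\<^bsub>stalk X x\<^esub> C) y = a y * c y"
      using near[OF m[OF f(1,5)]] unfolding f(2,6) ss by blast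
    let ?N = "N1 \<inter> N2 \<inter> N3 \<inter> N4 \<inter> N5 \<inter> N6"
    have o: "openX X ?N" by (intro openin_Int 1(1) 2(1) 3(1) 4(1) 5(1) 6(1))
    have o': "x \<in> ?N" using 1(2) 2(2) 3(2) 4(2) 5(2) 6(2) by simp
    show ?thesis
    \<comment> \<open>The Leibniz defect a \<otimes> bc + abc \<otimes> 1 - ab \<otimes> c - ac
      \<otimes> b is the symmetric expression of (a, bc, 1) minus that of (a, b, c); the two terms
      bc \<otimes> a cancel.\<close>
    proof (rule sym_germs_combine[OF sym_germs_elementary[OF f(1) m[OF f(3,5)] fun_alg_const[OF alg, of 1]]
          sym_germs_elementary[OF f(1,3,5)] o o', of _ 1 "-1"])
      fix u v assume "u \<in> ?N" "v \<in> ?N"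
      then show "(\<phi> A (B \<otimes>\<^bsub>stalk X x\<^esub> C) - (\<phi> (A \<otimes>\<^bsub>stalk X x\<^esub> B) C + \<phi> (A \<otimes>\<^bsub>stalk X x\<^esub> C) B)) (u, v) =
         1 * (case (u, v) of (u, v) \<Rightarrow> a u * (b u * c u) * 1 + a u * 1 * (b v * c v) + b u * c u * 1 * a v) +
         - 1 * (case (u, v) of (u, v) \<Rightarrow> a u * b u * c v + a u * c u * b v + b u * c u * a v)"
        using 1(3) 2(3) 3(3) 4(3) 5(3) 6(3) by (simp add: \<phi>_def algebra_simps)
    qed
  qed
  have const: "\<phi> A K \<in> ?Z" if "A \<in> carrier (stalk X x)" "K \<in> const_germs X x" for A K
  proof -
    obtain k where k: "K = germ X x (\<lambda>y. k)" using \<open>K \<in> _\<close> unfolding const_germs_def by blast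
    obtain N where "openX X N" "x \<in> N" "\<forall>y\<in>N. \<rho> K y = k" using near[OF fun_alg_const[OF alg, of k]] k by blast
    then show ?thesis by (intro sym_germs_zero[of N]) (auto simp: \<phi>_def)
  qed
  let ?ts = "map (\<lambda>(a, b). (germ X x a, germ X x b)) (dlist qs)"
  have dl: "set (dlist qs) \<subseteq> ?G \<times> ?G" by (rule dlist_closed[OF alg qs])
  have ts: "set ?ts \<subseteq> carrier (stalk X x) \<times> carrier (stalk X x)" unfolding st using dl by auto
  have "foldr (\<lambda>(a, b) \<omega>. a \<odot>\<^bsub>kaehler (stalk X x) (const_germs X x)\<^esub> univ_deriv (stalk X x) (const_germs X x) b
      \<oplus>\<^bsub>kaehler (stalk X x) (const_germs X x)\<^esub> \<omega>)
     (map (\<lambda>(a, b). (germ X x a, germ X x b)) l) \<zero>\<^bsub>kaehler (stalk X x) (const_germs X x)\<^esub> = forms X x l" for l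
    by (induction l) (auto simp: form_germ_def Omega_stalk_def)
  then have "(\<Sum>(a, b)\<leftarrow>?ts. \<phi> a b) \<in> ?Z"
    using zero by (intro D.kaehler_sum_zero[OF Z0 Zdiff addl addr leib const ts]) (simp_all add: Omega_stalk_def)
  then have main: "(\<Sum>(a, b)\<leftarrow>dlist qs. \<phi> (germ X x a) (germ X x b)) \<in> ?Z"
    by (simp add: comp_def case_prod_unfold)
  have sum: "\<exists>N. openX X N \<and> x \<in> N \<and> (\<forall>u\<in>N. \<forall>v\<in>N.
      (\<Sum>(a, b)\<leftarrow>l. \<phi> (germ X x a) (germ X x b)) (u, v) = (\<Sum>(a, b)\<leftarrow>l. a u * (b v - b u)))"
    if "set l \<subseteq> ?G \<times> ?G" for l
    using that
  proof (induction l)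
    case Nil show ?case using x by (intro exI[of _ "points X"]) auto
  next
    case (Cons t l)
    obtain a b where t: "t = (a, b)" by (cases t)
    have ab: "a \<in> ?G" "b \<in> ?G" using Cons t by auto
    obtain N where N: "openX X N" "x \<in> N" "\<forall>u\<in>N. \<forall>v\<in>N.
      (\<Sum>(a, b)\<leftarrow>l. \<phi> (germ X x a) (germ X x b)) (u, v) = (\<Sum>(a, b)\<leftarrow>l. a u * (b v - b u))" using Cons by auto
    obtain N1 where 1: "openX X N1" "x \<in> N1" "\<forall>y\<in>N1. \<rho> (germ X x a) y = a y" using near[OF ab(1)] by blast
    obtain N2 where 2: "openX X N2" "x \<in> N2" "\<forall>y\<in>N2. \<rho> (germ X x b) y = b y" using near[OF ab(2)] by blast
    show ?case
      using N 1 2 by (intro exI[of _ "N \<inter> N1 \<inter> N2"]) (auto simp: t \<phi>_def)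
  qed
  obtain N where N: "openX X N" "x \<in> N" "\<forall>u\<in>N. \<forall>v\<in>N.
      (\<Sum>(a, b)\<leftarrow>dlist qs. \<phi> (germ X x a) (germ X x b)) (u, v) = (\<Sum>(a, b)\<leftarrow>dlist qs. a u * (b v - b u))"
    using sum[OF dl] by blast
  \<comment> \<open>For a \<otimes> b the left side is 2(a \<otimes> b - ab \<otimes> 1) - (b
    \<otimes> a - ab \<otimes> 1) = 3 a \<otimes> b - (ab \<otimes> 1 + a \<otimes> b + b \<otimes>
    a), and the last bracket is the symmetric expression of (a, b, 1).\<close>
  have "\<exists>E\<in>?Z. \<forall>u v. (\<Sum>(a, b)\<leftarrow>dlist l. a u * (b v - b u)) = 3 * eval2 l (u, v) - E (u, v)"
    if "set l \<subseteq> ?G \<times> ?G" for l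
    using that
  proof (induction l)
    case Nil show ?case using Z0 by (intro bexI[of _ 0]) auto
  next
    case (Cons t l)
    obtain a b where t: "t = (a, b)" by (cases t)
    have ab: "a \<in> ?G" "b \<in> ?G" using Cons t by auto
    obtain E where E: "E \<in> ?Z" "\<forall>u v. (\<Sum>(a, b)\<leftarrow>dlist l. a u * (b v - b u)) = 3 * eval2 l (u, v) - E (u, v)"
      using Cons by auto
    let ?E = "\<lambda>(u, v). a u * b u * 1 + a u * 1 * b v + b u * 1 * a v :: complex"
    have e: "?E \<in> ?Z" using sym_germs_elementary[OF ab fun_alg_const[OF alg, of 1]] by simp
    have "(\<lambda>p. ?E p + E p) \<in> ?Z"
      by (rule sym_germs_combine[OF e E(1) openin_topspace x, of _ 1 1]) simp
    then show ?case
      by (rule rev_bexI) (use E(2) in \<open>auto simp: t algebra_simps\<close>)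
  qed
  then obtain E where E: "E \<in> ?Z" "\<forall>u v. (\<Sum>(a, b)\<leftarrow>dlist qs. a u * (b v - b u)) = 3 * eval2 qs (u, v) - E (u, v)"
    using qs by blast
  show ?thesis
    by (rule sym_germs_combine[OF main E(1) N(1,2), of _ "1 / 3" "1 / 3"]) (use N(3) E(2) in \<open>simp add: field_simps\<close>)
qed

end

section \<open>Exactness\<close>

context
  fixes X :: "'a fspace"
  assumes FX: "function_space X"
begin

lemmas SX3 = SX2[OF FX] and SS = sheaf_sym3[OF FX] and S22 = sheaf_square[OF FX]

lemma invariant_ideal_eq:
  "invariant_ideal X = \<lparr>sec = (\<lambda>V. (sec (\<O> (sym3 X)) V)\<lparr>carrier :=
     {f \<in> reg (sym3 X) V. pullback cycle3 (cube X) V f \<in> big_diagonal_ideal X (preim cycle3 (cube X) V)}\<rparr>),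
     restr = restr (\<O> (sym3 X))\<rparr>"
  by (simp add: invariant_ideal_def)

text \<open>Every point of a pairwise diagonal is an ordering of some 2u + v, and a function of the
  cycle does not see the ordering; so the three vanishing conditions collapse to one.\<close>

lemma invariant_section:
  assumes V: "openX (sym3 X) V" and f: "f \<in> reg (sym3 X) V"
  shows "pullback cycle3 (cube X) V f \<in> big_diagonal_ideal X (preim cycle3 (cube X) V) \<longleftrightarrow>
     (\<forall>u v. {#u, u, v#} \<in> V \<longrightarrow> f {#u, u, v#} = 0)" (is "?L \<longleftrightarrow> ?R")
proof
  have sub: "V \<subseteq> cycle3 ` points (cube X)" using V unfolding openX_sym3[OF FX] by blast
  have perm: "{#u, v, u#} = {#u, u, v#}" "{#v, u, u#} = {#u, u, v#}" for u v :: 'a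
    by (simp_all add: add_mset_commute)
  have pc: "points (cube X) = points X \<times> points X \<times> points X" by (rule points_cube[OF FX])
  {
    assume L: ?L
    show ?R
    proof (intro allI impI)
      fix u v assume uv: "{#u, u, v#} \<in> V"
      then obtain a b c where abc: "{#u, u, v#} = {#a, b, c#}" "(a, b, c) \<in> points (cube X)"
        using sub by auto
      then have "(u, u, v) \<in> {(a, b, c), (a, c, b), (b, a, c), (b, c, a), (c, a, b), (c, b, a)}"
        by (simp only: perm3_iff)
      then have "u \<in> points X" "v \<in> points X" using abc(2) unfolding pc by auto
      then have p: "(u, u, v) \<in> preim cycle3 (cube X) V" using uv by (simp add: preim_def pc)
      then have "pullback cycle3 (cube X) V f (u, u, v) = 0"
        using L unfolding big_diagonal_ideal_def vanishing_ideal_def by auto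
      then show "f {#u, u, v#} = 0" using p by (simp add: pullback_def)
    qed
  }
  assume R: ?R
  have r: "pullback cycle3 (cube X) V f \<in> reg (cube X) (preim cycle3 (cube X) V)"
    by (rule pullback_reg[OF SS morphism_cycle3[OF FX] V f])
  have "pullback cycle3 (cube X) V f (u, v, w) = 0"
    if p: "(u, v, w) \<in> preim cycle3 (cube X) V" and eq: "u = v \<or> u = w \<or> v = w" for u v w
  proof -
    have m: "{#u, v, w#} \<in> V" using p by (simp add: preim_def)
    from eq have "f {#u, v, w#} = 0"
    proof (elim disjE)
      assume "u = v" then show ?thesis using R m by simp
    next
      assume e: "u = w" show ?thesis
        using R[rule_format, of u v] m unfolding e[symmetric] perm(1)[of u v] by simp
    next
      assume e: "v = w" show ?thesis
        using R[rule_format, of v u] m unfolding e[symmetric] perm(2)[of u v] by simp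
    qed
    then show ?thesis using p by (simp add: pullback_def)
  qed
  then show ?L unfolding big_diagonal_ideal_def vanishing_ideal_def using r by auto
qed

lemma carrier_invariant_ideal:
  assumes V: "openX (sym3 X) V"
  shows "carrier (sec (invariant_ideal X) V) =
    {f \<in> reg (sym3 X) V. \<forall>u v. {#u, u, v#} \<in> V \<longrightarrow> f {#u, u, v#} = 0}"
  unfolding invariant_ideal_def using invariant_section[OF V] by (simp cong: conj_cong)

lemma module_sheaf_invariant_ideal: "module_sheaf (sym3 X) (invariant_ideal X)"
  unfolding invariant_ideal_eq
proof (rule module_sheaf_functions[OF SS])
  let ?C = "\<lambda>V. {f \<in> reg (sym3 X) V. pullback cycle3 (cube X) V f \<in> big_diagonal_ideal X (preim cycle3 (cube X) V)}"
  have C: "f \<in> ?C V \<longleftrightarrow> f \<in> reg (sym3 X) V \<and> (\<forall>u v. {#u, u, v#} \<in> V \<longrightarrow> f {#u, u, v#} = 0)"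
    if "openX (sym3 X) V" for f V
    using invariant_section[OF that] by blast
  fix V assume V: "openX (sym3 X) V"
  show "?C V \<subseteq> reg (sym3 X) V" by blast
  show "(\<lambda>x\<in>V. 0) \<in> ?C V" unfolding C[OF V] using reg_const[OF SS V] by simp
  show "(\<lambda>x\<in>V. f x + g x) \<in> ?C V" if "f \<in> ?C V" "g \<in> ?C V" for f g
    using that reg_add[OF SS V] unfolding C[OF V] by simp
  show "(\<lambda>x\<in>V. f x * g x) \<in> ?C V" if "f \<in> reg (sym3 X) V" "g \<in> ?C V" for f g
    using that reg_mult[OF SS V] unfolding C[OF V] by simp
  show "restrict f W \<in> ?C W" if W: "openX (sym3 X) W" "W \<subseteq> V" and "f \<in> ?C V" for f W
    using that reg_restrict[OF SS V _ W] unfolding C[OF V] C[OF W(1)] by auto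
  show "f \<in> ?C V" if f: "f \<in> reg (sym3 X) V"
    and l: "\<And>x. x \<in> V \<Longrightarrow> \<exists>W. openX (sym3 X) W \<and> x \<in> W \<and> W \<subseteq> V \<and> restrict f W \<in> ?C W" for f
    unfolding C[OF V]
  proof (intro conjI allI impI f)
    fix u v assume "{#u, u, v#} \<in> V"
    from l[OF this] obtain W where W: "openX (sym3 X) W" "{#u, u, v#} \<in> W" "restrict f W \<in> ?C W" by blast
    then have "restrict f W {#u, u, v#} = 0" using C[OF W(1)] by blast
    then show "f {#u, u, v#} = 0" using W(2) by simp
  qed
qed

lemma restriction_map_eq: "restriction_map X = pullback w2 (X \<times>\<^sub>f X)"
  by (intro ext) (simp add: restriction_map_def)

text \<open>Both sides say that the function vanishes at all cycles 2u + v in \<open>V\<close>;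
  being pointwise, this can be checked locally.\<close>

lemma exact_at_structure_sheaf:
  "sheaf_exact (sym3 X) (invariant_ideal X) (\<O> (sym3 X)) (w2_pushforward X) (\<lambda>V f. f) (restriction_map X)"
  unfolding sheaf_exact_def
proof (intro allI impI ballI)
  fix V t assume V: "openX (sym3 X) V" and "t \<in> carrier (sec (\<O> (sym3 X)) V)"
  then have t: "t \<in> reg (sym3 X) V" by simp
  let ?P = "preim w2 (X \<times>\<^sub>f X)"
  have sub: "V \<subseteq> points (sym3 X)" using openin_subset[OF V] .
  have pt: "(u, v) \<in> ?P V \<longleftrightarrow> {#u, u, v#} \<in> V" for u v
  proof
    assume uv: "{#u, u, v#} \<in> V"
    then obtain a b c where abc: "{#u, u, v#} = {#a, b, c#}" "(a, b, c) \<in> points (cube X)"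
      using sub unfolding points_sym3[OF FX] by auto
    then have "(u, u, v) \<in> {(a, b, c), (a, c, b), (b, a, c), (b, c, a), (c, a, b), (c, b, a)}"
      by (simp only: perm3_iff)
    then have "u \<in> points X" "v \<in> points X" using abc(2) unfolding points_cube[OF FX] by auto
    then show "(u, v) \<in> ?P V" using uv by (simp add: preim_def points_XX[OF FX])
  qed (simp add: preim_def)
  have r: "restriction_map X V t = \<zero>\<^bsub>sec (w2_pushforward X) V\<^esub> \<longleftrightarrow> (\<forall>u v. {#u, u, v#} \<in> V \<longrightarrow> t {#u, u, v#} = 0)"
  proof
    assume "restriction_map X V t = \<zero>\<^bsub>sec (w2_pushforward X) V\<^esub>"
    then have e: "pullback w2 (X \<times>\<^sub>f X) V t = (\<lambda>p\<in>?P V. 0)"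
      by (simp add: restriction_map_eq w2_pushforward_def)
    show "\<forall>u v. {#u, u, v#} \<in> V \<longrightarrow> t {#u, u, v#} = 0"
    proof (intro allI impI)
      fix u v assume "{#u, u, v#} \<in> V"
      then show "t {#u, u, v#} = 0" using fun_cong[OF e, of "(u, v)"] pt[of u v] by (simp add: pullback_def)
    qed
  next
    assume z: "\<forall>u v. {#u, u, v#} \<in> V \<longrightarrow> t {#u, u, v#} = 0"
    have "pullback w2 (X \<times>\<^sub>f X) V t = (\<lambda>p\<in>?P V. 0)"
      unfolding pullback_def
    proof (rule restrict_ext)
      fix p assume p: "p \<in> ?P V"
      obtain u v where "p = (u, v)" by (cases p)
      then show "t (w2 p) = 0" using z p pt by simp
    qed
    then show "restriction_map X V t = \<zero>\<^bsub>sec (w2_pushforward X) V\<^esub>"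
      by (simp add: restriction_map_eq w2_pushforward_def)
  qed
  show "restriction_map X V t = \<zero>\<^bsub>sec (w2_pushforward X) V\<^esub> \<longleftrightarrow>
     in_image (sym3 X) (invariant_ideal X) (\<O> (sym3 X)) (\<lambda>V f. f) V t"
    unfolding r in_image_def sec_structure_sheaf
  proof
    assume z: "\<forall>u v. {#u, u, v#} \<in> V \<longrightarrow> t {#u, u, v#} = 0"
    then have "t \<in> carrier (sec (invariant_ideal X) V)" using t unfolding carrier_invariant_ideal[OF V] by blast
    moreover have "restrict t V = t" by (rule extensional_restrict[OF reg_extensional[OF SS V t]])
    ultimately show "\<forall>p\<in>V. \<exists>W. openX (sym3 X) W \<and> p \<in> W \<and> W \<subseteq> V \<and> (\<exists>s\<in>carrier (sec (invariant_ideal X) W). s = restrict t W)"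
      using V by (intro ballI exI[of _ V]) auto
  next
    assume l: "\<forall>p\<in>V. \<exists>W. openX (sym3 X) W \<and> p \<in> W \<and> W \<subseteq> V \<and> (\<exists>s\<in>carrier (sec (invariant_ideal X) W). s = restrict t W)"
    show "\<forall>u v. {#u, u, v#} \<in> V \<longrightarrow> t {#u, u, v#} = 0"
    proof (intro allI impI)
      fix u v assume "{#u, u, v#} \<in> V"
      then obtain W where W: "openX (sym3 X) W" "{#u, u, v#} \<in> W" "restrict t W \<in> carrier (sec (invariant_ideal X) W)"
        using l by blast
      then have "restrict t W {#u, u, v#} = 0" unfolding carrier_invariant_ideal[OF W(1)] by blast
      then show "t {#u, u, v#} = 0" using W(2) by simp
    qed
  qed
qed

text \<open>Solving r s = t near p is reduced to finding symmetric functions with \<kappa> t = \<nu>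
  along \<open>w2\<close> and \<kappa> non-zero at p; the lift is then \<nu> / \<kappa>.\<close>

lemma lift_fraction:
  assumes W: "openX (sym3 X) W" "p \<in> W" and \<kappa>: "\<kappa> \<in> regs (sym3 X) W" "\<kappa> p \<noteq> 0" and \<nu>: "\<nu> \<in> regs (sym3 X) W"
    and eq: "\<And>u v. (u, v) \<in> preim w2 (X \<times>\<^sub>f X) W \<Longrightarrow> \<kappa> {#u, u, v#} * t (u, v) = \<nu> {#u, u, v#}"
  shows "\<exists>W'. openX (sym3 X) W' \<and> p \<in> W' \<and> W' \<subseteq> W \<and>
    (\<exists>s\<in>reg (sym3 X) W'. pullback w2 (X \<times>\<^sub>f X) W' s = restrict t (preim w2 (X \<times>\<^sub>f X) W'))"
proof -
  let ?W = "{M \<in> W. \<kappa> M \<noteq> 0}"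
  have o: "openX (sym3 X) ?W" by (rule function_space_open[OF function_space_sym3[OF FX] W(1) \<kappa>(1)])
  have "(\<lambda>M. \<nu> M / \<kappa> M) \<in> regs (sym3 X) ?W"
    by (rule regs_divide[OF function_space_sym3[OF FX] W(1) \<nu> \<kappa>(1) o]) auto
  then have s: "restrict (\<lambda>M. \<nu> M / \<kappa> M) ?W \<in> reg (sym3 X) ?W" by (simp add: regs_def)
  have "pullback w2 (X \<times>\<^sub>f X) ?W (restrict (\<lambda>M. \<nu> M / \<kappa> M) ?W) = restrict t (preim w2 (X \<times>\<^sub>f X) ?W)"
    unfolding pullback_restrict
  proof (rule restrict_ext)
    fix q assume q: "q \<in> preim w2 (X \<times>\<^sub>f X) ?W"
    obtain u v where uv: "q = (u, v)" by (cases q)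
    then have "(u, v) \<in> preim w2 (X \<times>\<^sub>f X) W" "\<kappa> {#u, u, v#} \<noteq> 0" using q by (auto simp: preim_def)
    then show "\<nu> (w2 q) / \<kappa> (w2 q) = t q" using eq[of u v] by (simp add: uv field_simps)
  qed
  then show ?thesis using o s W(2) \<kappa>(2) by (intro exI[of _ ?W]) auto
qed

text \<open>The determinant of three functions evaluated at three points is alternating, so its
  square is symmetric and vanishes when two points coincide. The functions are chosen such that the
  matrix is diagonal at (a, b, c).\<close>

lemma separating_function_distinct:
  assumes U: "openX X U" and A: "fun_alg A" "A \<subseteq> regs X U"
    and sep: "\<And>x y. x \<in> U \<Longrightarrow> y \<in> U \<Longrightarrow> x \<noteq> y \<Longrightarrow> \<exists>a\<in>A. a x \<noteq> a y"
    and abc: "a \<in> U" "b \<in> U" "c \<in> U" "a \<noteq> b" "a \<noteq> c" "b \<noteq> c"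
  obtains \<kappa> where "\<kappa> \<in> regs (sym3 X) (sym3_set U)" "\<kappa> {#a, b, c#} \<noteq> 0" "\<And>u v. \<kappa> {#u, u, v#} = 0"
proof -
  obtain f where f: "f \<in> A" "f a \<noteq> f b" using sep abc by blast
  obtain g where g: "g \<in> A" "g a \<noteq> g c" using sep abc by blast
  obtain h where h: "h \<in> A" "h b \<noteq> h c" using sep abc by blast
  \<comment> \<open>p vanishes at b and c but not at a; similarly q is supported at b and r at c
    among the three points.\<close>
  define p where "p u = (f u - f b) * (g u - g c)" for u
  define q where "q u = (f u - f a) * (h u - h c)" for u
  define r where "r u = (g u - g a) * (h u - h b)" for u
  have A': "(\<lambda>u. k u - d) \<in> A" if "k \<in> A" for k and d :: complex
    using fun_alg_diff[OF A(1) that fun_alg_const[OF A(1), of d]] .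
  have "p \<in> A" "q \<in> A" "r \<in> A"
    unfolding p_def[abs_def] q_def[abs_def] r_def[abs_def] by (intro fun_alg_mult[OF A(1)] A' f g h)+
  then have pqr: "p \<in> regs X U" "q \<in> regs X U" "r \<in> regs X U" using A(2) by blast+
  note B = fun_alg_cube_alg[OF FX U]
  note m = fun_alg_mult[OF B] and ad = fun_alg_add[OF B] and di = fun_alg_diff[OF B]
  note cp = cube_regs_fun[OF FX U pqr(1), folded cube_alg_def[OF FX]] and cq = cube_regs_fun[OF FX U pqr(2), folded cube_alg_def[OF FX]]
    and cr = cube_regs_fun[OF FX U pqr(3), folded cube_alg_def[OF FX]]
  define d where "d = (\<lambda>(u, v, w). p u * (q v * r w - q w * r v) - p v * (q u * r w - q w * r u) +
    p w * (q u * r v - q v * r u))"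
  have "d \<in> cube_alg X U"
    using ad[OF di[OF m[OF cp(1) di[OF m[OF cq(2) cr(3)] m[OF cq(3) cr(2)]]] m[OF cp(2) di[OF m[OF cq(1) cr(3)] m[OF cq(3) cr(1)]]]]
      m[OF cp(3) di[OF m[OF cq(1) cr(2)] m[OF cq(2) cr(1)]]]] by (simp add: d_def case_prod_unfold)
  then have F: "(\<lambda>t. d t * d t) \<in> cube_alg X U" by (rule m) fact
  have s1: "d (u, v, w) * d (u, v, w) = d (v, u, w) * d (v, u, w)" for u v w
  proof -
    have "d (v, u, w) = - d (u, v, w)" by (simp add: d_def algebra_simps)
    then show ?thesis by simp
  qed
  have s2: "d (u, v, w) * d (u, v, w) = d (u, w, v) * d (u, w, v)" for u v w
  proof -
    have "d (u, w, v) = - d (u, v, w)" by (simp add: d_def algebra_simps)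
    then show ?thesis by simp
  qed
  note l = sym_lift_cycle3[of "\<lambda>t. d t * d t", OF s1 s2]
  show ?thesis
  proof (rule that[of "sym_lift (\<lambda>t. d t * d t)"])
    show "sym_lift (\<lambda>t. d t * d t) \<in> regs (sym3 X) (sym3_set U)" by (rule sym_lift_regs[OF FX U F s1 s2])
    have "d (a, b, c) = p a * q b * r c" by (simp add: d_def p_def q_def r_def)
    also have "\<dots> \<noteq> 0" using f g h abc by (simp add: p_def q_def r_def)
    finally show "sym_lift (\<lambda>t. d t * d t) {#a, b, c#} \<noteq> 0" unfolding l by simp
    show "sym_lift (\<lambda>t. d t * d t) {#u, u, v#} = 0" for u v
      unfolding l by (simp add: d_def algebra_simps)
  qed
qed

text \<open>For \<open>x \<noteq> y\<close> every function on \<open>X \<times> X\<close>, after multiplication with \<open>(a(u) - a(v))\<^sup>2\<close>, is a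
  restriction along \<open>w2\<close>.\<close>

definition avg3 :: "('a \<Rightarrow> complex) \<Rightarrow> ('a \<times> 'a \<Rightarrow> complex) \<Rightarrow> 'a multiset \<Rightarrow> complex" where
  "avg3 a G = sym_lift (\<lambda>(u, v, w).
     (G (u, w) + G (v, w)) * ((a u - a w) * (a v - a w)) +
     (G (u, v) + G (w, v)) * ((a u - a v) * (a w - a v)) +
     (G (v, u) + G (w, u)) * ((a v - a u) * (a w - a u)))"

lemma avg3_w2: "avg3 a G {#u, u, v#} = 2 * G (u, v) * ((a u - a v) * (a u - a v))"
  unfolding avg3_def by (subst sym_lift_cycle3) (auto simp: algebra_simps)

lemma avg3_regs:
  assumes U: "openX X U" and a: "a \<in> regs X U" and G: "G \<in> ten2 (regs X U) (regs X U)"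
  shows "avg3 a G \<in> regs (sym3 X) (sym3_set U)"
  unfolding avg3_def
proof (rule sym_lift_regs[OF FX U])
  note B = fun_alg_cube_alg[OF FX U]
  note m = fun_alg_mult[OF B] and ad = fun_alg_add[OF B] and di = fun_alg_diff[OF B]
  note c = cube_regs_fun[OF FX U a, folded cube_alg_def[OF FX]] and g = cube_alg_pairs[OF FX U G]
  from ad[OF ad[OF m[OF ad[OF g(2,3)] m[OF di[OF c(1,3)] di[OF c(2,3)]]]
     m[OF ad[OF g(1,6)] m[OF di[OF c(1,2)] di[OF c(3,2)]]]]
     m[OF ad[OF g(4,5)] m[OF di[OF c(2,1)] di[OF c(3,1)]]]]
  show "(\<lambda>(u, v, w).
     (G (u, w) + G (v, w)) * ((a u - a w) * (a v - a w)) +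
     (G (u, v) + G (w, v)) * ((a u - a v) * (a w - a v)) +
     (G (v, u) + G (w, u)) * ((a v - a u) * (a w - a u))) \<in> cube_alg X U"
    by (simp add: case_prod_unfold)
qed (auto simp: algebra_simps)

text \<open>The denominator that goes with \<open>avg3\<close>. Each summand singles out one of the
  three points and compares it with the other two; at 2u + v the summands singling out a copy of u
  contain the factor a(u) - a(u).\<close>

definition dsq3 :: "('a \<Rightarrow> complex) \<Rightarrow> ('a \<times> 'a \<Rightarrow> complex) \<Rightarrow> 'a multiset \<Rightarrow> complex" where
  "dsq3 a h = sym_lift (\<lambda>(u, v, w).
     (h (u, w) * (a u - a w)) * (h (v, w) * (a v - a w)) +
     (h (u, v) * (a u - a v)) * (h (w, v) * (a w - a v)) +
     (h (v, u) * (a v - a u)) * (h (w, u) * (a w - a u)))"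

lemma dsq3_w2: "dsq3 a h {#u, u, v#} = h (u, v) * h (u, v) * ((a u - a v) * (a u - a v))"
  unfolding dsq3_def by (subst sym_lift_cycle3) (auto simp: algebra_simps)

lemma dsq3_regs:
  assumes U: "openX X U" and a: "a \<in> regs X U" and h: "h \<in> ten2 (regs X U) (regs X U)"
  shows "dsq3 a h \<in> regs (sym3 X) (sym3_set U)"
  unfolding dsq3_def
proof (rule sym_lift_regs[OF FX U])
  note B = fun_alg_cube_alg[OF FX U]
  note m = fun_alg_mult[OF B] and ad = fun_alg_add[OF B] and di = fun_alg_diff[OF B]
  note c = cube_regs_fun[OF FX U a, folded cube_alg_def[OF FX]] and g = cube_alg_pairs[OF FX U h]
  from ad[OF ad[OF m[OF m[OF g(2) di[OF c(1,3)]] m[OF g(3) di[OF c(2,3)]]]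
     m[OF m[OF g(1) di[OF c(1,2)]] m[OF g(6) di[OF c(3,2)]]]]
     m[OF m[OF g(4) di[OF c(2,1)]] m[OF g(5) di[OF c(3,1)]]]]
  show "(\<lambda>(u, v, w).
     (h (u, w) * (a u - a w)) * (h (v, w) * (a v - a w)) +
     (h (u, v) * (a u - a v)) * (h (w, v) * (a w - a v)) +
     (h (v, u) * (a v - a u)) * (h (w, u) * (a w - a u))) \<in> cube_alg X U"
    by (simp add: case_prod_unfold)
qed (auto simp: algebra_simps)

lemma sym3_cases:
  fixes U :: "'a set"
  assumes "p \<in> sym3_set U"
  obtains (distinct) a b c where "p = {#a, b, c#}" "a \<in> U" "b \<in> U" "c \<in> U" "a \<noteq> b" "a \<noteq> c" "b \<noteq> c"
  | (double) x y where "p = {#x, x, y#}" "x \<in> U" "y \<in> U" "x \<noteq> y"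
  | (triple) x where "p = {#x, x, x#}" "x \<in> U"
proof -
  obtain a b c where p: "p = {#a, b, c#}" "a \<in> U" "b \<in> U" "c \<in> U"
    using assms unfolding sym3_set_image[OF FX] by auto
  have perm: "{#u, v, u#} = {#u, u, v#}" "{#v, u, u#} = {#u, u, v#}" for u v :: 'a
    by (simp_all add: add_mset_commute)
  show ?thesis
  proof (cases "a = b")
    case True
    then show ?thesis using p double[of a c] triple[of a] by (cases "a = c") auto
  next
    case ab: False
    show ?thesis
    proof (cases "a = c")
      case True then show ?thesis using p double[of a b] ab perm(1)[of a b] by auto
    next
      case ac: False
      show ?thesis
      proof (cases "b = c")
        case True then show ?thesis using p double[of b a] ab perm(2)[of a b] by auto
      next
        case False then show ?thesis using p distinct[of a b c] ab ac by blast
      qed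
    qed
  qed
qed

context
  assumes aff: "points (sym3 X) \<subseteq> \<Union>{sym3_set U | U. affine_open X U}"
begin

text \<open>Lifts are built near each kind of cycle. Near three distinct points \<open>w2\<close>
  has empty preimage and zero lifts; near 2x + y every function lifts; near 3x the vanishing of D t
  enters. The converse direction is \<open>dval_w2'\<close>.\<close>

lemma exact_at_w2:
  "sheaf_exact (sym3 X) (\<O> (sym3 X)) (w2_pushforward X) (w3_pushforward X) (restriction_map X) (canonical_D X)"
  unfolding sheaf_exact_def
proof (intro allI impI ballI)
  fix V t assume V: "openX (sym3 X) V" and tc: "t \<in> carrier (sec (w2_pushforward X) V)"
  let ?P = "preim w2 (X \<times>\<^sub>f X)"
  have oP: "openX (X \<times>\<^sub>f X) (?P V)" by (rule morphism_open[OF morphism_w2[OF FX] V])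
  have tr: "t \<in> regs (X \<times>\<^sub>f X) (?P V)" using tc reg_regs[OF S22 oP] by (simp add: w2_pushforward_def)
  have im: "in_image (sym3 X) (\<O> (sym3 X)) (w2_pushforward X) (restriction_map X) V t \<longleftrightarrow>
    (\<forall>p\<in>V. \<exists>W. openX (sym3 X) W \<and> p \<in> W \<and> W \<subseteq> V \<and>
      (\<exists>s\<in>reg (sym3 X) W. pullback w2 (X \<times>\<^sub>f X) W s = restrict t (?P W)))"
    by (simp add: in_image_def restriction_map_eq w2_pushforward_def)
  have ze: "\<zero>\<^bsub>sec (w3_pushforward X) V\<^esub> = (\<lambda>x\<in>preim w3 X V. \<zero>\<^bsub>Omega_stalk X x\<^esub>)"
    by (simp add: w3_pushforward_def)
  show "canonical_D X V t = \<zero>\<^bsub>sec (w3_pushforward X) V\<^esub> \<longleftrightarrow>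
    in_image (sym3 X) (\<O> (sym3 X)) (w2_pushforward X) (restriction_map X) V t"
    unfolding im ze
  proof
    assume l: "\<forall>p\<in>V. \<exists>W. openX (sym3 X) W \<and> p \<in> W \<and> W \<subseteq> V \<and>
      (\<exists>s\<in>reg (sym3 X) W. pullback w2 (X \<times>\<^sub>f X) W s = restrict t (?P W))"
    show "canonical_D X V t = (\<lambda>x\<in>preim w3 X V. \<zero>\<^bsub>Omega_stalk X x\<^esub>)"
    proof (rule extensionalityI[of _ "preim w3 X V"])
      fix x assume x: "x \<in> preim w3 X V"
      then have "w3 x \<in> V" "x \<in> points X" by (auto simp: preim_def)
      then obtain W s where W: "openX (sym3 X) W" "w3 x \<in> W" "W \<subseteq> V" "s \<in> reg (sym3 X) W"
        "pullback w2 (X \<times>\<^sub>f X) W s = restrict t (?P W)" using l by blast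
      have xW: "x \<in> preim w3 X W" using W(2) x by (simp add: preim_def)
      have s: "s \<in> regs (sym3 X) W" using W(4) reg_regs[OF SS W(1)] by blast
      have "s (w2 p) = t p" if "p \<in> ?P W" for p
        using fun_cong[OF W(5), of p] that by (simp add: pullback_def)
      then have "dval X x t (germ X x (\<lambda>u. s {#u, u, u#}), \<zero>\<^bsub>Omega_stalk X x\<^esub>)"
        using w3_diag[OF FX xW] morphism_open[OF morphism_w2[OF FX] W(1)]
        by (intro dval_cong[OF FX _ dval_w2'[OF FX W(1) s xW], of "?P W"]) auto
      from canonical_D_eq[OF FX x this] x
      show "canonical_D X V t x = (\<lambda>x\<in>preim w3 X V. \<zero>\<^bsub>Omega_stalk X x\<^esub>) x" by simp
    qed (simp_all add: canonical_D_def)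
  next
    assume D0: "canonical_D X V t = (\<lambda>x\<in>preim w3 X V. \<zero>\<^bsub>Omega_stalk X x\<^esub>)"
    show "\<forall>p\<in>V. \<exists>W. openX (sym3 X) W \<and> p \<in> W \<and> W \<subseteq> V \<and>
      (\<exists>s\<in>reg (sym3 X) W. pullback w2 (X \<times>\<^sub>f X) W s = restrict t (?P W))"
    proof
      fix p assume p: "p \<in> V"
      then obtain U where U: "affine_open X U" "p \<in> sym3_set U"
        using aff openin_subset[OF V] by blast
      have oU: "openX X U" using U by (simp add: affine_open_def)
      note pre = preim_sym3_set[OF FX openin_subset[OF oU]] and oS = openX_sym3_set[OF FX oU]
      obtain A where A: "fun_alg A" "A \<subseteq> regs X U"
        "\<And>x f. x \<in> U \<Longrightarrow> f \<in> germs_at X x \<Longrightarrow> \<exists>s\<in>A. \<exists>a\<in>A. s x \<noteq> 0 \<and> (\<forall>u\<in>U. s u * f u = a u)"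
        "\<And>x W. x \<in> W \<Longrightarrow> x \<in> U \<Longrightarrow> openX X W \<Longrightarrow> \<exists>s\<in>A. s x \<noteq> 0 \<and> {u \<in> U. s u \<noteq> 0} \<subseteq> W"
        "\<And>x y. x \<in> U \<Longrightarrow> y \<in> U \<Longrightarrow> x \<noteq> y \<Longrightarrow> \<exists>a\<in>A. a x \<noteq> a y"
        by (rule affine_open_coordinates[OF SX3 U(1)], rule that) assumption+
      have sub: "ten2 A A \<subseteq> ten2 (regs X U) (regs X U)" by (rule ten2_mono[OF A(2) A(2)])
      let ?W = "sym3_set U \<inter> V"
      have W: "openX (sym3 X) ?W" "p \<in> ?W" using oS V U(2) p by auto
      have rW: "f \<in> regs (sym3 X) ?W" if "f \<in> regs (sym3 X) (sym3_set U)" for f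
        by (rule regs_subset[OF SS oS W(1) _ that]) simp
      have PW: "u \<in> U \<and> v \<in> U" if "(u, v) \<in> ?P ?W" for u v
        using that unfolding preim_Int pre by auto
      from U(2) have "\<exists>W. openX (sym3 X) W \<and> p \<in> W \<and> W \<subseteq> ?W \<and>
        (\<exists>s\<in>reg (sym3 X) W. pullback w2 (X \<times>\<^sub>f X) W s = restrict t (?P W))"
      proof (cases rule: sym3_cases)
        case (distinct a b c)
        obtain \<kappa> where k: "\<kappa> \<in> regs (sym3 X) (sym3_set U)" "\<kappa> {#a, b, c#} \<noteq> 0" "\<And>u v. \<kappa> {#u, u, v#} = 0"
          by (rule separating_function_distinct[OF oU A(1,2,5) distinct(2-7)], assumption+, rule that) assumption+
        show ?thesis
          by (rule lift_fraction[OF W rW[OF k(1)] _ fun_alg_const[OF fun_alg_regs[OF SS W(1)], of 0]])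
             (use k distinct in auto)
      next
        case (double x y)
        have xy: "(x, y) \<in> ?P V"
          using p double openin_subset[OF oU] by (auto simp: preim_def points_XX[OF FX])
        obtain h g where hg: "h \<in> ten2 A A" "g \<in> ten2 A A" "h (x, y) \<noteq> 0"
          "\<And>u v. u \<in> U \<Longrightarrow> v \<in> U \<Longrightarrow> h (u, v) * t (u, v) = g (u, v)"
          by (rule affine_fraction[OF SX3 A(1,3,4) tr xy double(2,3)], assumption+, rule that) assumption+
        obtain a where a: "a \<in> A" "a x \<noteq> a y" using A(5) double by blast
        have ar: "a \<in> regs X U" using a A(2) by blast
        \<comment> \<open>The half compensates the 2 in \<open>avg3_w2\<close>, and h g = h h t
          matches the square of h in \<open>dsq3_w2\<close>.\<close>
        have G: "(\<lambda>q. 1 / 2 * (h q * g q)) \<in> ten2 A A"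
          by (rule fun_alg_scale[OF ten2_fun_alg[OF A(1) A(1)] fun_alg_mult[OF ten2_fun_alg[OF A(1) A(1)] hg(1,2)]])
        have k: "dsq3 a h \<in> regs (sym3 X) (sym3_set U)" by (rule dsq3_regs[OF oU ar]) (use hg(1) sub in blast)
        have n: "avg3 a (\<lambda>q. 1 / 2 * (h q * g q)) \<in> regs (sym3 X) (sym3_set U)"
          by (rule avg3_regs[OF oU ar]) (use G sub in blast)
        show ?thesis
        proof (rule lift_fraction[OF W rW[OF k] _ rW[OF n]])
          show "dsq3 a h p \<noteq> 0" using hg(3) a(2) by (simp add: double(1) dsq3_w2)
          fix u v assume "(u, v) \<in> ?P ?W"
          then have "g (u, v) = h (u, v) * t (u, v)" using hg(4)[of u v] PW by auto
          then show "dsq3 a h {#u, u, v#} * t (u, v) = avg3 a (\<lambda>q. 1 / 2 * (h q * g q)) {#u, u, v#}"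
            by (simp add: dsq3_w2 avg3_w2)
        qed
      next
        case (triple x)
        have px: "x \<in> points X" using triple openin_subset[OF oU] by blast
        have xV: "x \<in> preim w3 X V" using p triple px by (simp add: preim_def w3_def)
        have xx: "(x, x) \<in> ?P V" using w3_diag[OF FX xV] by blast
        obtain h g where hg: "h \<in> ten2 A A" "g \<in> ten2 A A" "h (x, x) \<noteq> 0"
          "\<And>u v. u \<in> U \<Longrightarrow> v \<in> U \<Longrightarrow> h (u, v) * t (u, v) = g (u, v)"
          by (rule affine_fraction[OF SX3 A(1,3,4) tr xx triple(2,2)], assumption+, rule that) assumption+
        have \<kappa>: "norm3 h \<in> regs (sym3 X) (sym3_set U)" by (rule norm3_regs[OF FX oU]) (use hg(1) sub in blast)
        let ?Q = "\<lambda>(u, v). h (u, u) * h (u, u) * (h (v, u) * h (v, u)) * h (u, v) * g (u, v)"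
        have "?Q \<in> ten2 A A" by (rule norm3_numerator[OF FX A(1) hg(1,2)])
        then obtain qs where qs: "?Q = eval2 qs" "set qs \<subseteq> A \<times> A" unfolding ten2_def by blast
        have kQ: "norm3 h {#u, u, v#} * t (u, v) = eval2 qs (u, v)" if "u \<in> U" "v \<in> U" for u v
          using hg(4)[OF that, symmetric] unfolding qs(1)[symmetric] by (simp add: norm3_w2[OF FX])
        have AG: "A \<subseteq> germs_at X x" using A(2) germs_atI[OF oU triple(2)] by blast
        have qG: "set qs \<subseteq> germs_at X x \<times> germs_at X x" using qs(2) AG by blast
        interpret M: module "stalk X x" "Omega_stalk X x" by (rule module_Omega_stalk[OF SX3 px])
        obtain e where e: "dval X x t e" by (rule dval_section[OF FX V tr xV])
        have e0: "snd e = \<zero>\<^bsub>Omega_stalk X x\<^esub>"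
          using canonical_D_eq[OF FX xV e] fun_cong[OF D0, of x] xV by simp
        have xS: "x \<in> preim w3 X (sym3_set U)" using triple(2) by (simp add: pre)
        have kd: "germ X x (\<lambda>u. norm3 h {#u, u, u#}) \<in> carrier (stalk X x)"
          by (rule germ_closed[OF SX3 px germ_diag[OF FX \<kappa> oS xS]])
        \<comment> \<open>The norm has no differential part, so \<open>D\<close> of the tensor
          \<open>?Q\<close> is a multiple of D t and vanishes; \<open>dlist_forms_zero\<close> then
          turns \<open>?Q\<close> into the restriction of a symmetric function, the numerator of the
          lift.\<close>
        note d1 = dval_mult[OF FX px dval_w2'[OF FX oS \<kappa> xS] e]
        have "(germ X x (\<lambda>u. norm3 h {#u, u, u#}), \<zero>\<^bsub>Omega_stalk X x\<^esub>) \<otimes>\<^bsub>stalk_ext X x\<^esub> e =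
            tv (stalk_ext X x) (phi1 X x) (phi2 X x) qs"
          by (rule dval_unique[OF FX px d1 dval_eval2[OF FX px qG] oU triple(2)])
             (simp add: kQ)
        then have "forms X x (dlist qs) = snd ((germ X x (\<lambda>u. norm3 h {#u, u, u#}), \<zero>\<^bsub>Omega_stalk X x\<^esub>) \<otimes>\<^bsub>stalk_ext X x\<^esub> e)"
          by (simp add: tv_eq[OF FX px qG])
        also have "\<dots> = \<zero>\<^bsub>Omega_stalk X x\<^esub>"
          using e0 dval_carrier[OF FX e] kd by (cases e) simp
        finally have "eval2 qs \<in> sym_germs X x" by (rule dlist_forms_zero[OF FX px qG])
        then obtain U1 \<nu> where n: "openX X U1" "x \<in> U1" "\<nu> \<in> regs (sym3 X) (sym3_set U1)"
          "\<And>u v. u \<in> U1 \<Longrightarrow> v \<in> U1 \<Longrightarrow> eval2 qs (u, v) = \<nu> (w2 (u, v))"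
          by (rule sym_germsE, rule_tac that) assumption+
        let ?W1 = "?W \<inter> sym3_set U1"
        have o1: "openX (sym3 X) ?W1" using W(1) openX_sym3_set[OF FX n(1)] by auto
        have p1: "p \<in> ?W1" using W(2) n(2) by (simp add: triple(1) sym3_set_def)
        have "\<exists>W'. openX (sym3 X) W' \<and> p \<in> W' \<and> W' \<subseteq> ?W1 \<and>
          (\<exists>s\<in>reg (sym3 X) W'. pullback w2 (X \<times>\<^sub>f X) W' s = restrict t (?P W'))"
        proof (rule lift_fraction[OF o1 p1])
          show "norm3 h \<in> regs (sym3 X) ?W1" by (rule regs_subset[OF SS oS o1 _ \<kappa>]) auto
          show "\<nu> \<in> regs (sym3 X) ?W1" by (rule regs_subset[OF SS openX_sym3_set[OF FX n(1)] o1 _ n(3)]) auto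
          show "norm3 h p \<noteq> 0" using hg(3) by (simp add: triple(1) norm3_w2[OF FX])
          fix u v assume uv: "(u, v) \<in> ?P ?W1"
          then have "u \<in> U" "v \<in> U" "u \<in> U1" "v \<in> U1"
            unfolding preim_Int pre preim_sym3_set[OF FX openin_subset[OF n(1)]] by auto
          then show "norm3 h {#u, u, v#} * t (u, v) = \<nu> {#u, u, v#}" using kQ[of u v] n(4)[of u v] by simp
        qed
        then show ?thesis by blast
      qed
      then show "\<exists>W. openX (sym3 X) W \<and> p \<in> W \<and> W \<subseteq> V \<and>
        (\<exists>s\<in>reg (sym3 X) W. pullback w2 (X \<times>\<^sub>f X) W s = restrict t (?P W))" by blast
    qed
  qed
qed

text \<open>D(a \<otimes> b - ab \<otimes> 1) = 2a db - b da + d(ab), because \<open>D\<close> of ab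
  \<otimes> 1 is - d(ab); the terms b da cancel and 3a db remains.\<close>

lemma forms_lift:
  assumes px: "y \<in> points X" and ab: "a \<in> germs_at X y" "b \<in> germs_at X y"
  shows "forms X y (dlist [(a, b), (\<lambda>u. - (a u * b u), \<lambda>u. 1)]) = form_germ X (\<lambda>u. 3 * a u) b y"
proof -
  interpret M: module "stalk X y" "Omega_stalk X y" by (rule module_Omega_stalk[OF SX3 px])
  note alg = fun_alg_germs_at[OF SX3 px]
  note gc = germ_closed[OF SX3 px] and dc = dgerm_closed[OF SX3 px]
  note fge = form_germ_eq[OF SX3 px] and ss = stalk_simps[OF px]
  have m: "(\<lambda>u. a u * b u) \<in> germs_at X y" and k: "(\<lambda>u. c) \<in> germs_at X y" for c
    by (rule fun_alg_mult[OF alg ab], rule fun_alg_const[OF alg])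
  have mm: "(\<lambda>u. - (a u * b u)) \<in> germs_at X y" by (rule fun_alg_uminus[OF alg m])
  have "dgerm X y (\<lambda>u. (-1) * (a u * b u)) = germ X y (\<lambda>u. -1) \<odot>\<^bsub>Omega_stalk X y\<^esub> dgerm X y (\<lambda>u. a u * b u)"
    using dgerm_mult[OF SX3 px k[of "-1"] m] m by (simp add: dgerm_const[OF SX3 px] gc dc k)
  then have dm: "dgerm X y (\<lambda>u. - (a u * b u)) = germ X y (\<lambda>u. -1) \<odot>\<^bsub>Omega_stalk X y\<^esub> dgerm X y (\<lambda>u. a u * b u)"
    by simp
  have "form_germ X (\<lambda>u. - 1) (\<lambda>u. - (a u * b u)) y =
      (germ X y (\<lambda>u. -1) \<otimes>\<^bsub>stalk X y\<^esub> germ X y (\<lambda>u. -1)) \<odot>\<^bsub>Omega_stalk X y\<^esub> dgerm X y (\<lambda>u. a u * b u)"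
    unfolding fge dm by (rule M.smult_assoc1[symmetric]) (auto intro: gc dc m k)
  also have "germ X y (\<lambda>u. -1) \<otimes>\<^bsub>stalk X y\<^esub> germ X y (\<lambda>u. -1) = \<one>\<^bsub>stalk X y\<^esub>" by (simp add: ss)
  finally have 1: "form_germ X (\<lambda>u. - 1) (\<lambda>u. - (a u * b u)) y =
      form_germ X a b y \<oplus>\<^bsub>Omega_stalk X y\<^esub> form_germ X b a y"
    unfolding fge using dgerm_mult[OF SX3 px ab] dc[OF m] by simp
  have 2: "form_germ X (\<lambda>u. 2 * - (a u * b u)) (\<lambda>u. 1) y = \<zero>\<^bsub>Omega_stalk X y\<^esub>"
    unfolding fge dgerm_const[OF SX3 px]
    by (rule M.smult_r_null[OF gc[OF fun_alg_scale[OF alg mm]]])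
  have 3: "form_germ X (\<lambda>u. - b u) a y = \<ominus>\<^bsub>Omega_stalk X y\<^esub> form_germ X b a y"
    by (rule form_germ_uminus[OF FX px ab(2,1)])
  note fc = form_germ_closed[OF SX3 px]
  have a2: "(\<lambda>u. 2 * a u) \<in> germs_at X y" by (rule fun_alg_scale[OF alg ab(1)])
  have "form_germ X (\<lambda>u. 2 * a u) b y \<oplus>\<^bsub>Omega_stalk X y\<^esub> form_germ X a b y =
     (germ X y (\<lambda>u. 2 * a u) \<oplus>\<^bsub>stalk X y\<^esub> germ X y a) \<odot>\<^bsub>Omega_stalk X y\<^esub> dgerm X y b"
    unfolding fge by (rule M.smult_l_distr[symmetric]) (auto intro: gc dc a2 ab)
  also have "germ X y (\<lambda>u. 2 * a u) \<oplus>\<^bsub>stalk X y\<^esub> germ X y a = germ X y (\<lambda>u. 3 * a u)"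
    unfolding ss by (simp add: algebra_simps)
  finally have 4: "form_germ X (\<lambda>u. 2 * a u) b y \<oplus>\<^bsub>Omega_stalk X y\<^esub> form_germ X a b y = form_germ X (\<lambda>u. 3 * a u) b y"
    unfolding fge .
  have "forms X y (dlist [(a, b), (\<lambda>u. - (a u * b u), \<lambda>u. 1)]) =
     form_germ X (\<lambda>u. 2 * a u) b y \<oplus>\<^bsub>Omega_stalk X y\<^esub> (\<ominus>\<^bsub>Omega_stalk X y\<^esub> form_germ X b a y \<oplus>\<^bsub>Omega_stalk X y\<^esub>
       (\<zero>\<^bsub>Omega_stalk X y\<^esub> \<oplus>\<^bsub>Omega_stalk X y\<^esub> ((form_germ X a b y \<oplus>\<^bsub>Omega_stalk X y\<^esub> form_germ X b a y) \<oplus>\<^bsub>Omega_stalk X y\<^esub> \<zero>\<^bsub>Omega_stalk X y\<^esub>)))"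
    unfolding dlist_simps forms_simps 1 2 3 ..
  also have "\<dots> = form_germ X (\<lambda>u. 2 * a u) b y \<oplus>\<^bsub>Omega_stalk X y\<^esub> (form_germ X a b y \<oplus>\<^bsub>Omega_stalk X y\<^esub>
       (\<ominus>\<^bsub>Omega_stalk X y\<^esub> form_germ X b a y \<oplus>\<^bsub>Omega_stalk X y\<^esub> form_germ X b a y))"
    using fc[OF ab] fc[OF ab(2,1)] fc[OF a2 ab(2)] by (simp add: M.M.a_ac)
  also have "\<dots> = form_germ X (\<lambda>u. 2 * a u) b y \<oplus>\<^bsub>Omega_stalk X y\<^esub> form_germ X a b y"
    using fc[OF ab] fc[OF ab(2,1)] by (simp add: M.M.l_neg)
  finally show ?thesis unfolding 4 .
qed

text \<open>Near x a section of \<Omega> is a finite sum of terms a db, and each is lifted by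
  \<open>forms_lift\<close>. Near any other cycle an open set can be chosen whose preimage under
  \<open>w3\<close> is empty.\<close>

lemma surjective_at_w3: "sheaf_surjective (sym3 X) (w2_pushforward X) (w3_pushforward X) (canonical_D X)"
  unfolding sheaf_surjective_def in_image_def
proof (intro allI impI ballI)
  fix V \<omega> p assume V: "openX (sym3 X) V" and "\<omega> \<in> carrier (sec (w3_pushforward X) V)" and p: "p \<in> V"
  then have \<omega>: "\<omega> \<in> carrier (sec (Omega X) (preim w3 X V))" by (simp add: w3_pushforward_def)
  let ?P = "preim w2 (X \<times>\<^sub>f X)"
  obtain U where U: "affine_open X U" "p \<in> sym3_set U"
    using aff openin_subset[OF V] p by blast
  have oU: "openX X U" using U by (simp add: affine_open_def)
  note oS = openX_sym3_set[OF FX oU] and oV3 = morphism_open[OF morphism_w3[OF FX] V]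
  obtain A where A: "fun_alg A" "A \<subseteq> regs X U"
    "\<And>x y. x \<in> U \<Longrightarrow> y \<in> U \<Longrightarrow> x \<noteq> y \<Longrightarrow> \<exists>a\<in>A. a x \<noteq> a y"
    by (rule affine_open_coordinates[OF SX3 U(1)], rule that) assumption+
  \<comment> \<open>If \<kappa> vanishes at all 3u, its non-vanishing locus has empty preimage under
    \<open>w3\<close>; equality of sections over it is trivial and zero is a lift.\<close>
  have goal: "\<exists>W. openX (sym3 X) W \<and> p \<in> W \<and> W \<subseteq> V \<and>
      (\<exists>s\<in>carrier (sec (w2_pushforward X) W). canonical_D X W s = restr (w3_pushforward X) W \<omega>)"
    if \<kappa>: "\<kappa> \<in> regs (sym3 X) (sym3_set U)" "\<kappa> p \<noteq> 0" "\<And>u. \<kappa> {#u, u, u#} = 0" for \<kappa>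
  proof -
    let ?W = "{M \<in> sym3_set U. \<kappa> M \<noteq> 0} \<inter> V"
    have o: "openX (sym3 X) ?W" using function_space_open[OF function_space_sym3[OF FX] oS \<kappa>(1)] V by auto
    have e: "preim w3 X ?W = {}" using \<kappa>(3) by (auto simp: preim_def w3_def)
    have "restrict (\<lambda>p. 0) (?P ?W) \<in> carrier (sec (w2_pushforward X) ?W)"
      using reg_const[OF S22 morphism_open[OF morphism_w2[OF FX] o]] by (simp add: w2_pushforward_def)
    moreover have "canonical_D X ?W s = restr (w3_pushforward X) ?W \<omega>" for s
      by (simp add: canonical_D_def w3_pushforward_def e) (simp add: restrict_def)
    ultimately show ?thesis using o p U(2) \<kappa>(2) by (intro exI[of _ ?W]) auto
  qed
  from U(2) show "\<exists>W. openX (sym3 X) W \<and> p \<in> W \<and> W \<subseteq> V \<and>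
      (\<exists>s\<in>carrier (sec (w2_pushforward X) W). canonical_D X W s = restr (w3_pushforward X) W \<omega>)"
  proof (cases rule: sym3_cases)
    case (distinct a b c)
    obtain \<kappa> where k: "\<kappa> \<in> regs (sym3 X) (sym3_set U)" "\<kappa> {#a, b, c#} \<noteq> 0" "\<And>u v. \<kappa> {#u, u, v#} = 0"
      by (rule separating_function_distinct[OF oU A(1,2,3) distinct(2-7)], assumption+, rule that) assumption+
    show ?thesis by (rule goal[OF k(1)]) (use k distinct in auto)
  next
    case (double x y)
    obtain a where a: "a \<in> A" "a x \<noteq> a y" using A(3) double by blast
    \<comment> \<open>Along \<open>w2\<close> this function is the square of a(u) - a(v), so it
      vanishes at 3u but not at 2x + y.\<close>
    have k: "dsq3 a (\<lambda>q. 1) \<in> regs (sym3 X) (sym3_set U)"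
      by (rule dsq3_regs[OF oU _ fun_alg_const[OF ten2_fun_alg[OF fun_alg_regs[OF SX3 oU] fun_alg_regs[OF SX3 oU]]]])
         (use a A(2) in blast)
    show ?thesis by (rule goal[OF k]) (use a double in \<open>auto simp: dsq3_w2\<close>)
  next
    case (triple x)
    have px: "x \<in> points X" using triple openin_subset[OF oU] by blast
    have xV: "x \<in> preim w3 X V" using p triple px by (simp add: preim_def w3_def)
    obtain N ls where N: "openX X N" "x \<in> N" "N \<subseteq> preim w3 X V" "set ls \<subseteq> regs X N \<times> regs X N" "\<forall>y\<in>N. \<omega> y = forms X y ls"
      using Omega_secD(3)[OF SX3 oV3 \<omega> xV] by (elim exE conjE)
    \<comment> \<open>One third of the tensor in \<open>forms_lift\<close>, so that \<open>D\<close>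
      returns exactly a db.\<close>
    let ?t = "\<lambda>a b. [(\<lambda>u. 1 / 3 * a u, b), (\<lambda>u. - (1 / 3 * a u * b u), \<lambda>u. 1)] :: (('a \<Rightarrow> complex) \<times> ('a \<Rightarrow> complex)) list"
    define ss where "ss = concat (map (\<lambda>(a, b). ?t a b) ls)"
    have tc: "set (concat (map (\<lambda>(a, b). ?t a b) l)) \<subseteq> G \<times> G"
      if G: "fun_alg G" and "set l \<subseteq> G \<times> G" for l G
      using that(2)
    proof (induction l)
      case (Cons t l)
      obtain a b where t: "t = (a, b)" by (cases t)
      have ab: "a \<in> G" "b \<in> G" using Cons t by auto
      have 1: "(\<lambda>u. 1 / 3 * a u) \<in> G" by (rule fun_alg_scale[OF G ab(1)])
      have 2: "(\<lambda>u. - (1 / 3 * a u * b u)) \<in> G" by (rule fun_alg_uminus[OF G fun_alg_mult[OF G 1 ab(2)]])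
      have "set (?t a b) \<subseteq> G \<times> G" using 1 2 ab fun_alg_const[OF G, of 1] by simp
      moreover have "set (concat (map (\<lambda>(a, b). ?t a b) l)) \<subseteq> G \<times> G" using Cons by simp
      ultimately show ?case unfolding t list.map prod.case concat.simps set_append by (rule Un_least)
    qed simp
    have ssN: "set ss \<subseteq> regs X N \<times> regs X N"
      unfolding ss_def by (rule tc[OF fun_alg_regs[OF SX3 N(1)] N(4)])
    have fss: "forms X y (dlist ss) = \<omega> y" if y: "y \<in> N" for y
    proof -
      have py: "y \<in> points X" using openin_subset[OF N(1)] y by blast
      let ?G = "germs_at X y"
      note alg = fun_alg_germs_at[OF SX3 py]
      have "forms X y (dlist (concat (map (\<lambda>(a, b). ?t a b) l))) = forms X y l" if "set l \<subseteq> ?G \<times> ?G" for l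
        using that
      proof (induction l)
        case (Cons t l)
        obtain a b where t: "t = (a, b)" by (cases t)
        have ab: "a \<in> ?G" "b \<in> ?G" and l: "set l \<subseteq> ?G \<times> ?G" using Cons t by auto
        have a3: "(\<lambda>u. 1 / 3 * a u) \<in> ?G" by (rule fun_alg_scale[OF alg ab(1)])
        have t1: "set (?t a b) \<subseteq> ?G \<times> ?G" using tc[OF alg, of "[(a, b)]"] ab by (simp only: list.map prod.case concat.simps) simp
        have dapp: "dlist (?t a b @ m) = dlist (?t a b) @ dlist m" for m by (simp add: dlist_def)
        have "forms X y (dlist (?t a b @ concat (map (\<lambda>(a, b). ?t a b) l))) =
          forms X y (dlist (?t a b)) \<oplus>\<^bsub>Omega_stalk X y\<^esub> forms X y (dlist (concat (map (\<lambda>(a, b). ?t a b) l)))"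
          unfolding dapp by (rule forms_append[OF SX3 py dlist_closed[OF alg t1] dlist_closed[OF alg tc[OF alg l]]])
        also have "forms X y (dlist (?t a b)) = form_germ X (\<lambda>u. 3 * (1 / 3 * a u)) b y"
          by (rule forms_lift[OF py a3 ab(2)])
        also have "(\<lambda>u. 3 * (1 / 3 * a u)) = a" by simp
        finally show ?case unfolding t list.map prod.case concat.simps Cons.IH[OF l] forms_simps .
      qed simp
      moreover have "set ls \<subseteq> ?G \<times> ?G" using N(4) germs_atI[OF N(1) y] by blast
      ultimately show ?thesis using N(5) y by (simp add: ss_def)
    qed
    let ?W = "sym3_set N \<inter> V"
    have oN: "openX (sym3 X) (sym3_set N)" by (rule openX_sym3_set[OF FX N(1)])
    note pre = preim_sym3_set[OF FX openin_subset[OF N(1)]]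
    have W: "openX (sym3 X) ?W" "p \<in> ?W" using oN V p N(2) triple(1) by (auto simp: sym3_set_def)
    have oPW: "openX (X \<times>\<^sub>f X) (?P ?W)" by (rule morphism_open[OF morphism_w2[OF FX] W(1)])
    have oNN: "openX (X \<times>\<^sub>f X) (N \<times> N)" by (rule openX_prod_Times[OF SX3 SX3 N(1) N(1)])
    have "eval2 ss \<in> ten2 (regs X N) (regs X N)" using ssN unfolding ten2_def by blast
    then have "eval2 ss \<in> regs (X \<times>\<^sub>f X) (N \<times> N)" by (rule ten2_regs[OF SX3 SX3 N(1) N(1)])
    then have sr: "eval2 ss \<in> regs (X \<times>\<^sub>f X) (?P ?W)"
      by (rule regs_subset[OF S22 oNN oPW, rotated]) (auto simp: preim_Int pre)
    let ?s = "restrict (eval2 ss) (?P ?W)"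
    have "?s \<in> carrier (sec (w2_pushforward X) ?W)"
      using sr by (simp add: w2_pushforward_def restrict_reg_iff del: restrict_apply)
    moreover have "canonical_D X ?W ?s = restr (w3_pushforward X) ?W \<omega>"
      unfolding w3_pushforward_def pushforward_simps sec_Omega
    proof (rule extensionalityI[of _ "preim w3 X ?W"])
      fix y assume y: "y \<in> preim w3 X ?W"
      then have yN: "y \<in> N" unfolding preim_Int pre by blast
      have py: "y \<in> points X" using openin_subset[OF N(1)] yN by blast
      have sG: "set ss \<subseteq> germs_at X y \<times> germs_at X y" using ssN germs_atI[OF N(1) yN] by blast
      have "dval X y ?s (tv (stalk_ext X y) (phi1 X y) (phi2 X y) ss)"
        by (rule dval_cong[OF FX py dval_eval2[OF FX py sG] oPW]) (use w3_diag[OF FX y] in auto)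
      from canonical_D_eq[OF FX y this] fss[OF yN] y
      show "canonical_D X ?W ?s y = restrict \<omega> (preim w3 X ?W) y" by (simp add: tv_eq[OF FX py sG])
    qed (simp add: canonical_D_def, rule restrict_extensional)
    ultimately show ?thesis using W by (intro exI[of _ ?W]) auto
  qed
qed

end

end

section \<open>Transfer of exactness from \<open>canonical_D\<close> to an arbitrary
  \<open>D\<close>\<close>

lemma in_image_carrier_cong:
  assumes "\<And>W s. openX S W \<Longrightarrow> s \<in> carrier (sec F W) \<Longrightarrow> \<phi> W s = \<psi> W s"
  shows "in_image S F G \<phi> V t \<longleftrightarrow> in_image S F G \<psi> V t"
  unfolding in_image_def using assms by (metis (no_types, lifting))

theorem theorem3p14:
  fixes X :: "'a fspace"
  assumes "smooth_variety X"
    and "points (sym3 X) \<subseteq> \<Union>{sym3_set U | U. affine_open X U}"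
  shows "(\<exists>D. locally_given_D X D) \<and>
         (\<forall>D. locally_given_D X D \<longrightarrow>
            exact_sequence (sym3 X)
              (invariant_ideal X) (\<O> (sym3 X)) (w2_pushforward X) (w3_pushforward X)
              (\<lambda>V f. f) (restriction_map X) D)"
proof (intro conjI allI impI)
  have var: "variety X" using assms(1) by (simp add: smooth_variety_def)
  have FX: "function_space X" by (rule function_space_variety[OF var])
  show "\<exists>D. locally_given_D X D" using locally_given_canonical_D[OF FX] by blast
  fix D assume D: "locally_given_D X D"
  have aff: "\<exists>U. affine_open X U \<and> x \<in> U" if "x \<in> points X" for x
    using var that unfolding variety_def by blast
  \<comment> \<open>A locally given \<open>D\<close> is arbitrary on arguments that are not
    sections, so it agrees with \<open>canonical_D\<close> on sections only; exactness and
    surjectivity involve nothing else.\<close>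
  note eq = D_unique[OF FX D aff]
  show "exact_sequence (sym3 X) (invariant_ideal X) (\<O> (sym3 X)) (w2_pushforward X) (w3_pushforward X)
          (\<lambda>V f. f) (restriction_map X) D"
    unfolding exact_sequence_def
  proof (intro conjI)
    show "module_sheaf (sym3 X) (invariant_ideal X)" by (rule module_sheaf_invariant_ideal[OF FX])
    show "module_sheaf (sym3 X) (\<O> (sym3 X))" by (rule module_sheaf_structure[OF sheaf_sym3[OF FX]])
    show "module_sheaf (sym3 X) (w2_pushforward X)"
      unfolding w2_pushforward_def
      by (rule module_sheaf_pushforward[OF sheaf_sym3[OF FX] morphism_w2[OF FX] module_sheaf_structure[OF sheaf_square[OF FX]]])
    show "module_sheaf (sym3 X) (w3_pushforward X)"
      unfolding w3_pushforward_def
      by (rule module_sheaf_pushforward[OF sheaf_sym3[OF FX] morphism_w3[OF FX] module_sheaf_Omega[OF sheaf_base[OF FX]]])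
    show "sheaf_hom (sym3 X) (invariant_ideal X) (\<O> (sym3 X)) (\<lambda>V f. f)"
      unfolding sheaf_hom_def by (simp add: invariant_ideal_def)
    show "sheaf_hom (sym3 X) (\<O> (sym3 X)) (w2_pushforward X) (restriction_map X)"
      unfolding w2_pushforward_def restriction_map_eq[OF FX]
      by (rule sheaf_hom_pullback[OF sheaf_sym3[OF FX] morphism_w2[OF FX]])
    show "sheaf_hom (sym3 X) (w2_pushforward X) (w3_pushforward X) D"
      using D by (simp add: locally_given_D_def)
    show "sheaf_injective (sym3 X) (invariant_ideal X) (\<lambda>V f. f)"
      by (simp add: sheaf_injective_def)
    show "sheaf_exact (sym3 X) (invariant_ideal X) (\<O> (sym3 X)) (w2_pushforward X) (\<lambda>V f. f) (restriction_map X)"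
      by (rule exact_at_structure_sheaf[OF FX])
    show "sheaf_exact (sym3 X) (\<O> (sym3 X)) (w2_pushforward X) (w3_pushforward X) (restriction_map X) D"
      using exact_at_w2[OF FX assms(2)] eq unfolding sheaf_exact_def by simp
    show "sheaf_surjective (sym3 X) (w2_pushforward X) (w3_pushforward X) D"
      using surjective_at_w3[OF FX assms(2)] in_image_carrier_cong[of "sym3 X" "w2_pushforward X" D "canonical_D X", OF eq]
      unfolding sheaf_surjective_def by simp
  qed
qed

end
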